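(* For every integer $m\ge1$ (and every $p\ge2$), the vertex operator algebra $\mathcal W(p)^{A_m}$ is $C_2$-cofinite, i.e. $\mathcal W(p)^{A_m}/C_2(\mathcal W(p)^{A_m})$ is finite-dimensional.
   Context: Fix an integer $p\ge 2$. Let $L=\mathbb Z\alpha$ with $\langle\alpha,\alpha\rangle=2p$, $M(1)$ the Heisenberg vertex algebra, $V_L=M(1)\otimes\mathbb C[L]$ the lattice vertex algebra with conformal vector $\omega=\frac{1}{4p}\alpha(-1)^2\mathbf 1+\frac{p-1}{2p}\alpha(-2)\mathbf 1$, $Y(a,z)=\sum_n a_nz^{-n-1}$, and $Q=e^{\alpha}_0$ the screening operator. The triplet vertex algebra $\mathcal W(p)$ is the Virasoro submodule of $V_L$ generated by the singular vectors $Q^ie^{-n\alpha}$ ($n\ge0$, $0\le i\le 2n$); it is a vertex subalgebra. For $m\ge1$ let $\sigma=\exp(\pi i\,\alpha(0)/(pm))$ (acting on $M(1)\otimes e^{n\alpha}$ by $e^{2\pi in/m}$) and $\mathcal W(p)^{A_m}=\mathcal W(p)\cap V_L^\sigma$. For a vertex algebra $V$, $C_2(V)=\mathrm{span}\{a_{-2}b: a,b\in V\}$. *)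

theory Defs
  imports Complex_Main "HOL-Library.Multiset"
begin

section \<open>The rank-one lattice vertex algebra V_L, L = Z alpha, <alpha,alpha> = 2p\<close>

text \<open>Basis of V_L = M(1) (x) C[L]: a pair (lam, n) stands for the monomial
  alpha(-(x_1+1)) ... alpha(-(x_r+1)) (x) e^{n alpha}, where lam = {#x_1,...,x_r#}.
  Vectors are finitely supported coefficient functions on this basis.\<close>

type_synonym bas = "nat multiset \<times> int"
type_synonym vec = "bas \<Rightarrow> complex"

definition supp :: "vec \<Rightarrow> bas set" where
  "supp v = {b. v b \<noteq> 0}"

definition VL :: "vec set" where
  "VL = {v. finite (supp v)}"

definition bvec :: "bas \<Rightarrow> vec" where
  "bvec b = (\<lambda>b'. if b' = b then 1 else 0)"

definition smult :: "complex \<Rightarrow> vec \<Rightarrow> vec" where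
  "smult c v = (\<lambda>b. c * v b)"

definition vzero :: vec where "vzero = (\<lambda>b. 0)"

definition vadd :: "vec \<Rightarrow> vec \<Rightarrow> vec" where
  "vadd v w = (\<lambda>b. v b + w b)"

definition vsub :: "vec \<Rightarrow> vec \<Rightarrow> vec" where
  "vsub v w = (\<lambda>b. v b - w b)"

definition extend :: "(bas \<Rightarrow> vec) \<Rightarrow> vec \<Rightarrow> vec" where
  "extend f v = (\<lambda>b'. \<Sum>b\<in>supp v. v b * f b b')"

text \<open>Degree (M(1)-weight) of a monomial and the (nonnegative) weight
  deg + p n^2 with respect to the standard conformal vector (1/4p) alpha(-1)^2.\<close>
definition deg :: "nat multiset \<Rightarrow> nat" where
  "deg lam = sum_mset lam + size lam"

definition wt :: "nat \<Rightarrow> bas \<Rightarrow> int" where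
  "wt p b = int (deg (fst b)) + int p * (snd b)^2"

definition wtmax :: "nat \<Rightarrow> vec \<Rightarrow> int" where
  "wtmax p w = Max (insert 0 (wt p ` supp w))"

definition degmax :: "vec \<Rightarrow> nat" where
  "degmax w = Max (insert 0 ((deg \<circ> fst) ` supp w))"

definition hmode_b :: "nat \<Rightarrow> int \<Rightarrow> bas \<Rightarrow> vec" where
  "hmode_b p j b = (case b of (lam, n) \<Rightarrow>
     if j < 0 then bvec (lam + {# nat (- j) - 1 #}, n)
     else if j = 0 then smult (of_int (2 * int p * n)) (bvec (lam, n))
     else smult (of_int (2 * int p * j * int (count lam (nat j - 1))))
                (bvec (lam - {# nat j - 1 #}, n)))"

definition hmode :: "nat \<Rightarrow> int \<Rightarrow> vec \<Rightarrow> vec" where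
  "hmode p j = extend (hmode_b p j)"

text \<open>Coefficients of exp(sum_{n>0} beta(-n) z^n / n) = sum_m Sop m z^m and
  exp(- sum_{n>0} beta(n) z^(-n) / n) = sum_m Top m z^(-m), for beta = k alpha,
  via m S_m = sum_{i=1..m} beta(-i) S_{m-i} and m T_m = - sum_{i=1..m} beta(i) T_{m-i}.\<close>

fun Sop :: "nat \<Rightarrow> int \<Rightarrow> nat \<Rightarrow> vec \<Rightarrow> vec" where
  "Sop p k m v = (if m = 0 then v else
     (\<lambda>b. (1 / of_nat m) * (\<Sum>i\<in>{1..m}. of_int k * hmode p (- int i) (Sop p k (m - i) v) b)))"

fun Top :: "nat \<Rightarrow> int \<Rightarrow> nat \<Rightarrow> vec \<Rightarrow> vec" where
  "Top p k m v = (if m = 0 then v else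
     (\<lambda>b. (- 1 / of_nat m) * (\<Sum>i\<in>{1..m}. of_int k * hmode p (int i) (Top p k (m - i) v) b)))"

text \<open>Y(e^{k alpha}, z) = E^-(-k alpha, z) E^+(-k alpha, z) e_{k alpha} z^{k alpha(0)}
  with the trivial 2-cocycle (admissible since L has rank one and is even).
  The mode (e^{k alpha})_j is the coefficient of z^{-j-1}.\<close>

definition latmode_b :: "nat \<Rightarrow> int \<Rightarrow> int \<Rightarrow> bas \<Rightarrow> vec" where
  "latmode_b p k j b = (case b of (lam, n) \<Rightarrow>
     (\<lambda>b'. \<Sum>c\<in>{0..deg lam}.
        (let a = int c - 2 * int p * k * n - j - 1 in
          if a \<ge> 0 then Sop p k (nat a) (Top p k c (bvec (lam, n + k))) b' else 0)))"

definition latmode :: "nat \<Rightarrow> int \<Rightarrow> int \<Rightarrow> vec \<Rightarrow> vec" where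
  "latmode p k j = extend (latmode_b p k j)"

text \<open>Using u = alpha(-1)1 (so u_i = alpha(i)) and the iterate formula
  (u_{-n} v)_j = sum_{i>=0} (-1)^i binom(-n,i) (u_{-n-i} v_{j+i} - (-1)^n v_{-n+j-i} u_i);
  the sums are truncated at a bound beyond which all terms vanish.\<close>

function ymode :: "nat \<Rightarrow> nat multiset \<Rightarrow> int \<Rightarrow> int \<Rightarrow> vec \<Rightarrow> vec" where
  "ymode p lam k j w =
    (if lam = {#} then latmode p k j w
     else (let x = Max (set_mset lam); mu = lam - {#x#}; n = x + 1;
               N = nat (wt p (mu, k) + wtmax p w + \<bar>j\<bar>) + degmax w + 1 in
       (\<lambda>b. \<Sum>i\<in>{0..N}.
          ((- 1) ^ i * ((- of_nat n :: complex) gchoose i)) *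
          (hmode p (- int n - int i) (ymode p mu k (j + int i) w) b
           - (- 1) ^ n * ymode p mu k (- int n + j - int i) (hmode p (int i) w) b))))"
  by pat_completeness auto
termination
proof (relation "measure (\<lambda>(p, lam, k, j, w). size lam)", goal_cases)
  case 1 then show ?case by simp
next
  case (2 p lam k j w)
  then show ?case by (simp add: size_Diff1_less)
next
  case (3 p lam k j w)
  then show ?case by (simp add: size_Diff1_less)
qed

text \<open>Modes a_j of an arbitrary vector a of V_L: Y(a,z) = sum_j a_j z^{-j-1}.\<close>
definition mode :: "nat \<Rightarrow> vec \<Rightarrow> int \<Rightarrow> vec \<Rightarrow> vec" where
  "mode p a j w = (\<lambda>b'. \<Sum>b\<in>supp a. a b * ymode p (fst b) (snd b) j w b')"

definition omega :: "nat \<Rightarrow> vec" where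
  "omega p = (\<lambda>b. if b = ({#0, 0#}, 0) then 1 / (4 * of_nat p)
                  else if b = ({#1#}, 0) then (of_nat p - 1) / (2 * of_nat p) else 0)"

definition Lvir :: "nat \<Rightarrow> int \<Rightarrow> vec \<Rightarrow> vec" where
  "Lvir p n = mode p (omega p) (n + 1)"

definition Q :: "nat \<Rightarrow> vec \<Rightarrow> vec" where
  "Q p = mode p (bvec ({#}, 1)) 0"

inductive_set Wp :: "nat \<Rightarrow> vec set" for p :: nat where
  gen: "i \<le> 2 * n \<Longrightarrow> (Q p ^^ i) (bvec ({#}, - int n)) \<in> Wp p"
| zero: "vzero \<in> Wp p"
| add: "v \<in> Wp p \<Longrightarrow> w \<in> Wp p \<Longrightarrow> vadd v w \<in> Wp p"
| scal: "v \<in> Wp p \<Longrightarrow> smult c v \<in> Wp p"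
| vir: "v \<in> Wp p \<Longrightarrow> Lvir p n v \<in> Wp p"

text \<open>V_L^sigma: sigma acts on M(1) (x) e^{n alpha} by e^{2 pi i n / m}, so the fixed
  points are exactly the vectors supported on n divisible by m.\<close>
definition VL_fixed :: "nat \<Rightarrow> vec set" where
  "VL_fixed m = {v \<in> VL. \<forall>b. v b \<noteq> 0 \<longrightarrow> int m dvd snd b}"

definition WAm :: "nat \<Rightarrow> nat \<Rightarrow> vec set" where
  "WAm p m = Wp p \<inter> VL_fixed m"

inductive_set C2 :: "nat \<Rightarrow> vec set \<Rightarrow> vec set" for p :: nat and U :: "vec set" where
  gen: "a \<in> U \<Longrightarrow> b \<in> U \<Longrightarrow> mode p a (-2) b \<in> C2 p U"
| zero: "vzero \<in> C2 p U"
| add: "v \<in> C2 p U \<Longrightarrow> w \<in> C2 p U \<Longrightarrow> vadd v w \<in> C2 p U"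
| scal: "v \<in> C2 p U \<Longrightarrow> smult c v \<in> C2 p U"

definition C2_cofinite :: "nat \<Rightarrow> vec set \<Rightarrow> bool" where
  "C2_cofinite p U \<longleftrightarrow> (\<exists>S. finite S \<and> S \<subseteq> U \<and>
     (\<forall>u\<in>U. \<exists>c :: vec \<Rightarrow> complex.
        vsub u (\<lambda>b. \<Sum>s\<in>S. c s * s b) \<in> C2 p U))"

end

theory Submission
  imports Defs "HOL-Library.Poly_Mapping" "HOL-Library.Product_Plus"
begin

text \<open>
  Finitely supported vectors form a commutative ring on which the given modes become a vertex algebra,
  by Dong's lemma and Goddard's uniqueness theorem. Put \<open>F n = e\<^sup>-\<^sup>n\<^sup>\<alpha>\<close>, of conformal weight
  \<open>h\<^sub>n\<close>. Two structure constants are nonzero because they are constant terms of \<open>f(z) f(1/z)\<close> for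
  a Laurent polynomial \<open>f\<close>: the \<open>\<kappa>\<^sub>n\<close> with \<open>(F n)\<^sub>2\<^sub>h\<^sub>-\<^sub>1 Q\<^sup>2\<^sup>n (F n) = \<kappa>\<^sub>n 1\<close>, and the one that
  exhibits \<open>e\<^sup>(\<^sup>n\<^sup>+\<^sup>1\<^sup>)\<^sup>\<alpha>\<close> as a value of \<open>Q\<^sup>2\<^sup>n\<^sup>+\<^sup>1\<close> on charge \<open>- n\<close>. The second makes \<open>Q\<close> surjective
  from charge 0 to charge 1; counting monomials, its kernel on charge 0 is the Virasoro module generated by
  the vacuum. The first then shows that the kernel of \<open>Q\<^sup>2\<^sup>n\<^sup>+\<^sup>1\<close> on charge \<open>- n\<close> is the Virasoro module
  generated by \<open>F n\<close>. Decomposing products of two \<open>Q\<close>-strings as for \<open>sl\<^sub>2\<close>, it follows that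
  \<open>W(p)\<close> is closed under all modes, and that modulo \<open>C\<^sub>2\<close> the fixed point algebra is spanned by the
  \<open>L(-2)\<^sup>b g\<close> with \<open>g\<close> one of \<open>1\<close>, \<open>Q (F 1)\<close>, \<open>F m\<close>, \<open>Q\<^sup>2\<^sup>m (F m)\<close>.
  Finally, for \<open>j \<le> - 2\<close> the vector \<open>(F m)\<^sub>j Q\<^sup>2\<^sup>m (F m)\<close> lies in \<open>C\<^sub>2\<close> and has charge 0. In even degree
  \<open>D\<close> it is congruent to a multiple of \<open>L(-2)\<^sup>D\<^sup>/\<^sup>2 1\<close> already modulo the \<open>C\<^sub>2\<close>-space of the charge 0 part,
  where the coefficient of \<open>\<alpha>(-1)\<^sup>D\<close> vanishes. That coefficient of the vector itself is, up to a
  nonzero factor, a polynomial in \<open>D\<close> with nonzero constant term \<open>\<kappa>\<^sub>m (- m)\<^sup>2\<^sup>(\<^sup>p\<^sup>-\<^sup>1\<^sup>)\<^sup>m\<close>, so some power of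
  \<open>L(-2)\<close> maps the fixed point algebra into \<open>C\<^sub>2\<close>.
\<close>

section \<open>Finitely supported vectors\<close>

text \<open>Both structure constants are of Selberg type, but only their nonvanishing matters: the
  constant term of \<open>f(z) f(1/z)\<close> with integer coefficients is a sum of squares, so
  symmetrizing the integrand takes the place of evaluating it. For the constants attached to
  \<open>F n\<close> the integrand lacks factors \<open>(1 + z) ^ (2 p - 2)\<close>; conjugating
  \<open>Q\<close> with the exponential of the raising operator \<open>L_1\<close> of the conformal
  vector \<open>\<alpha>(-1) ^ 2 / (4 p)\<close> supplies them. Only \<open>Q\<close>, one half of
  the expected \<open>sl_2\<close>, is at hand. Highest weight vectors in a product of two strings
  are therefore written down explicitly, and "highest weight" means annihilated by the appropriate
  power of \<open>Q\<close>; this is why the kernels of these powers must be known. The last step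
  rests on a discrepancy: the coefficient of \<open>\<alpha>(-1) ^ D\<close> vanishes on products
  inside the charge 0 part, whereas \<open>F m\<close> and \<open>Q ^ (2 m) (F m)\<close> have
  opposite nonzero charges and escape this rule. The degree is taken even because
  \<open>Q (F 1)\<close> has the odd degree \<open>2 p - 1\<close>, so that no
  \<open>L (- 2) ^ b (Q (F 1))\<close> can interfere.\<close>

type_synonym V = "bas \<Rightarrow>\<^sub>0 complex"

definition scl :: "complex \<Rightarrow> V \<Rightarrow> V" (infixr \<open>*\<^sub>V\<close> 75) where
  "c *\<^sub>V x = Poly_Mapping.single 0 c * x"

lemma lookup_scl [simp]: "Poly_Mapping.lookup (c *\<^sub>V x) b = c * Poly_Mapping.lookup x b"
  unfolding scl_def mult_map_scale_conv_mult[symmetric]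
  by (simp add: Poly_Mapping.map.rep_eq when_def)

lemma scl_add_right: "c *\<^sub>V (x + y) = c *\<^sub>V x + c *\<^sub>V y"
  and scl_add_left: "(c + d) *\<^sub>V x = c *\<^sub>V x + d *\<^sub>V x"
  and scl_diff_right: "c *\<^sub>V (x - y) = c *\<^sub>V x - c *\<^sub>V y"
  and scl_diff_left: "(c - d) *\<^sub>V x = c *\<^sub>V x - d *\<^sub>V x"
  and scl_scl [simp]: "c *\<^sub>V d *\<^sub>V x = (c * d) *\<^sub>V x"
  and scl_one [simp]: "1 *\<^sub>V x = x"
  and scl_zero_left [simp]: "0 *\<^sub>V x = 0"
  and scl_zero_right [simp]: "c *\<^sub>V 0 = (0 :: V)"
  and scl_minus_right [simp]: "c *\<^sub>V (- x) = - (c *\<^sub>V x)"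
  and scl_minus_left [simp]: "(- c) *\<^sub>V x = - (c *\<^sub>V x)"
  and scl_mult_left: "(c *\<^sub>V x) * y = c *\<^sub>V (x * y)"
  and scl_mult_right: "x * (c *\<^sub>V y) = c *\<^sub>V (x * y)"
  by (auto simp: scl_def algebra_simps single_add single_diff mult_single
      single_uminus simp flip: mult.assoc)

lemma scl_sum_right: "c *\<^sub>V sum f S = (\<Sum>i\<in>S. c *\<^sub>V f i)"
  by (simp add: scl_def sum_distrib_left)

lemma scl_sum_left: "sum f S *\<^sub>V x = (\<Sum>i\<in>S. f i *\<^sub>V x)"
  by (induction S rule: infinite_finite_induct) (simp_all add: scl_add_left)

lemma scl_of_nat: "of_nat n *\<^sub>V x = of_nat n * x"
  by (simp add: scl_def)

interpretation V: vector_space scl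
  by standard (simp_all add: scl_add_right scl_add_left)

lemma scl_eq_0 [simp]: "c *\<^sub>V x = 0 \<longleftrightarrow> c = 0 \<or> x = 0"
  by (rule V.scale_eq_0_iff)

definition bv :: "bas \<Rightarrow> V" where
  "bv b = Poly_Mapping.single b 1"

lemma bv_mult: "bv b * bv b' = bv (b + b')"
  by (simp add: bv_def mult_single)

lemma bv_0 [simp]: "bv ({#}, 0) = 1"
  by (metis bv_def single_one zero_multiset_def zero_prod_def)

lemma lookup_bv: "Poly_Mapping.lookup (bv b) b' = (if b = b' then 1 else 0)"
  by (simp add: bv_def lookup_single when_def)

lemma keys_bv [simp]: "Poly_Mapping.keys (bv b) = {b}"
  by (simp add: bv_def)

lemma V_expand: "x = (\<Sum>b\<in>Poly_Mapping.keys x. Poly_Mapping.lookup x b *\<^sub>V bv b)"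
  by (rule poly_mapping_eqI)
     (simp add: lookup_sum lookup_bv if_distrib[of "\<lambda>u. _ * u"] sum.delta in_keys_iff cong: if_cong)

definition lin :: "(V \<Rightarrow> V) \<Rightarrow> bool" where
  "lin f \<longleftrightarrow> (\<forall>x y. f (x + y) = f x + f y) \<and> (\<forall>c x. f (c *\<^sub>V x) = c *\<^sub>V f x)"

lemma linI: "(\<And>x y. f (x + y) = f x + f y) \<Longrightarrow> (\<And>c x. f (c *\<^sub>V x) = c *\<^sub>V f x) \<Longrightarrow> lin f"
  by (simp add: lin_def)

lemma lin_add: "lin f \<Longrightarrow> f (x + y) = f x + f y"
  and lin_scl: "lin f \<Longrightarrow> f (c *\<^sub>V x) = c *\<^sub>V f x"
  by (simp_all add: lin_def)

lemma lin_0: "lin f \<Longrightarrow> f 0 = 0"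
  using lin_scl[of f 0 0] by simp

lemma lin_minus: "lin f \<Longrightarrow> f (- x) = - f x"
  using lin_scl[of f "-1" x] by simp

lemma lin_diff: "lin f \<Longrightarrow> f (x - y) = f x - f y"
  using lin_add[of f x "- y"] by (simp add: lin_minus)

lemma lin_sum: "lin f \<Longrightarrow> f (sum g S) = (\<Sum>i\<in>S. f (g i))"
  by (induction S rule: infinite_finite_induct) (simp_all add: lin_0 lin_add)

lemma lin_compose: "lin f \<Longrightarrow> lin g \<Longrightarrow> lin (\<lambda>x. f (g x))"
  by (simp add: lin_def)

lemma lin_funpow: "lin f \<Longrightarrow> lin (f ^^ n)"
  by (induction n) (simp_all add: lin_def)

lemma lin_id: "lin (\<lambda>x. x)"
  and lin_zero: "lin (\<lambda>x. 0)"
  and lin_mult: "lin ((*) y)"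
  and lin_scale: "lin (\<lambda>x. c *\<^sub>V x)"
  by (auto simp: lin_def algebra_simps scl_mult_right scl_add_right)

lemma lin_plus: "lin f \<Longrightarrow> lin g \<Longrightarrow> lin (\<lambda>x. f x + g x)"
  and lin_minus_fun: "lin f \<Longrightarrow> lin g \<Longrightarrow> lin (\<lambda>x. f x - g x)"
  and lin_scale_fun: "lin f \<Longrightarrow> lin (\<lambda>x. c *\<^sub>V f x)"
  by (auto simp: lin_def algebra_simps scl_add_right scl_diff_right)

lemma lin_sum_fun: "(\<And>i. i \<in> S \<Longrightarrow> lin (f i)) \<Longrightarrow> lin (\<lambda>x. \<Sum>i\<in>S. f i x)"
  by (induction S rule: infinite_finite_induct) (auto simp: lin_zero intro: lin_plus)

lemma lin_eqI:
  assumes "lin f" "lin g" "\<And>b. f (bv b) = g (bv b)"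
  shows "f x = g x"
proof -
  have "f x = (\<Sum>b\<in>Poly_Mapping.keys x. Poly_Mapping.lookup x b *\<^sub>V f (bv b))"
    by (subst (1) V_expand[of x]) (simp add: lin_sum lin_scl assms)
  also have "\<dots> = g x"
    by (subst (2) V_expand[of x]) (simp add: lin_sum lin_scl assms)
  finally show ?thesis .
qed

definition linext :: "(bas \<Rightarrow> V) \<Rightarrow> V \<Rightarrow> V" where
  "linext f x = (\<Sum>b\<in>Poly_Mapping.keys x. Poly_Mapping.lookup x b *\<^sub>V f b)"

lemma linext_superset:
  assumes "finite S" "Poly_Mapping.keys x \<subseteq> S"
  shows "linext f x = (\<Sum>b\<in>S. Poly_Mapping.lookup x b *\<^sub>V f b)"
  unfolding linext_def using assms
  by (intro sum.mono_neutral_left) (auto simp: in_keys_iff)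

lemma lin_linext: "lin (linext f)"
proof (rule linI)
  fix x y :: V
  let ?S = "Poly_Mapping.keys x \<union> Poly_Mapping.keys y"
  have "linext f (x + y) = (\<Sum>b\<in>?S. Poly_Mapping.lookup (x + y) b *\<^sub>V f b)"
    by (rule linext_superset) (auto dest: subsetD[OF Poly_Mapping.keys_add])
  also have "\<dots> = linext f x + linext f y"
    by (simp add: linext_superset[of ?S x] linext_superset[of ?S y] lookup_add scl_add_left sum.distrib)
  finally show "linext f (x + y) = linext f x + linext f y" .
next
  fix c and x :: V
  have "linext f (c *\<^sub>V x) = (\<Sum>b\<in>Poly_Mapping.keys x. Poly_Mapping.lookup (c *\<^sub>V x) b *\<^sub>V f b)"
    by (rule linext_superset) (auto simp: in_keys_iff)
  then show "linext f (c *\<^sub>V x) = c *\<^sub>V linext f x"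
    by (simp add: linext_def scl_sum_right)
qed

lemma linext_bv [simp]: "linext f (bv b) = f b"
  by (simp add: linext_def lookup_bv)

lemma lin_span:
  assumes "lin f" "x \<in> V.span S" "\<And>y. y \<in> S \<Longrightarrow> f y \<in> V.span R"
  shows "f x \<in> V.span R"
  using assms(2)
proof (induction rule: V.span_induct_alt)
  case base
  then show ?case by (simp add: lin_0 assms V.span_zero)
next
  case (step c x y)
  then show ?case by (simp add: lin_add lin_scl assms V.span_add V.span_scale)
qed

section \<open>Fields and their products\<close>

text \<open>Stands for a series with finitely many nonzero terms, so that products of fields can be
  defined without a truncation bound; \<open>fsum_eq\<close> supplies one afterwards. For infinitely
  many nonzero terms the value is the default 0.\<close>

definition fsum :: "(nat \<Rightarrow> V) \<Rightarrow> V" where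
  "fsum f = (\<Sum>i\<in>{i. f i \<noteq> 0}. f i)"

lemma fsum_eq: "(\<And>i. i \<ge> N \<Longrightarrow> f i = 0) \<Longrightarrow> fsum f = (\<Sum>i<N. f i)"
  unfolding fsum_def by (intro sum.mono_neutral_left) (auto intro: leI)

lemma fsum_delta: "fsum (\<lambda>i. if int i = c then f i else 0) = (if c \<ge> 0 then f (nat c) else 0)"
proof -
  have "fsum (\<lambda>i. if int i = c then f i else 0) = (\<Sum>i<Suc (nat c). if int i = c then f i else 0)"
    by (rule fsum_eq) auto
  also have "\<dots> = (\<Sum>i<Suc (nat c). if i = nat c then if c \<ge> 0 then f i else 0 else 0)"
    by (rule sum.cong) auto
  also have "\<dots> = (if c \<ge> 0 then f (nat c) else 0)"
    by (subst sum.delta) auto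
  finally show ?thesis .
qed

lemma fsum_mem: "V.subspace S \<Longrightarrow> (\<And>i. f i \<in> S) \<Longrightarrow> fsum f \<in> S"
  unfolding fsum_def by (intro V.subspace_sum) auto

text \<open>Coefficients of \<open>(1 - t) ^ n\<close> for an integer exponent \<open>n\<close>.\<close>
definition bc :: "int \<Rightarrow> nat \<Rightarrow> complex" where
  "bc n i = (- 1) ^ i * (of_int n gchoose i)"

lemma bc_0 [simp]: "bc n 0 = 1"
  by (simp add: bc_def)

lemma bc_Suc: "bc (n + 1) (Suc i) = bc n (Suc i) - bc n i"
proof -
  have "(of_int (n + 1) gchoose Suc i) = (of_int n gchoose i) + (of_int n gchoose Suc i :: complex)"
    by (simp add: gbinomial_Suc_Suc)
  then show ?thesis by (simp only: bc_def) (simp add: algebra_simps)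
qed

lemma bc_zero_Suc [simp]: "bc 0 (Suc i) = 0"
  by (simp add: bc_def)

lemma bc_absorb: "of_nat (Suc i) * bc n (Suc i) = - (of_int n - of_nat i) * bc n i"
proof -
  have "of_nat (Suc i) * (of_int n gchoose Suc i) = (of_int n - of_nat i) * (of_int n gchoose i :: complex)"
    using gbinomial_mult_1[of "of_int n :: complex" i] by (simp add: algebra_simps)
  then have "(- 1) ^ Suc i * (of_nat (Suc i) * (of_int n gchoose Suc i))
      = (- 1) ^ Suc i * ((of_int n - of_nat i) * (of_int n gchoose i :: complex))"
    by simp
  also have "(- 1) ^ Suc i * ((of_int n - of_nat i) * (of_int n gchoose i :: complex)) = - (of_int n - of_nat i) * bc n i"
    by (simp add: bc_def algebra_simps)
  finally show ?thesis by (simp only: bc_def mult.left_commute)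
qed

text \<open>The bound on the second index is uniform in the first, so one bound truncates all the
  shifted terms occurring in \<open>iexp\<close>.\<close>

definition bdd :: "(int \<Rightarrow> int \<Rightarrow> V) \<Rightarrow> bool" where
  "bdd X \<longleftrightarrow> (\<exists>K. \<forall>m k. k \<ge> K \<longrightarrow> X m k = 0)"

text \<open>Coefficients of \<open>(z - w) ^ n X(z, w)\<close>, expanded in the region \<open>|z| > |w|\<close>.\<close>
definition iexp :: "int \<Rightarrow> (int \<Rightarrow> int \<Rightarrow> V) \<Rightarrow> int \<Rightarrow> int \<Rightarrow> V" where
  "iexp n X m k = fsum (\<lambda>i. bc n i *\<^sub>V X (m + n - int i) (k + int i))"

lemma bdd_iexp:
  assumes "bdd X"
  obtains K where "\<And>n m k N. k + int N \<ge> K \<Longrightarrow>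
    iexp n X m k = (\<Sum>i<N. bc n i *\<^sub>V X (m + n - int i) (k + int i))"
proof -
  obtain K where K: "\<And>m k. k \<ge> K \<Longrightarrow> X m k = 0"
    using assms by (auto simp: bdd_def)
  show ?thesis
    by (rule that[of K]) (auto simp: iexp_def K intro!: fsum_eq)
qed

lemma iexp_0: "iexp 0 X m k = X m k"
proof -
  have "iexp 0 X m k = (\<Sum>i<1. bc 0 i *\<^sub>V X (m + 0 - int i) (k + int i))"
    unfolding iexp_def
  proof (rule fsum_eq)
    fix i :: nat assume "1 \<le> i"
    then show "bc 0 i *\<^sub>V X (m + 0 - int i) (k + int i) = 0" by (cases i) auto
  qed
  then show ?thesis by simp
qed

lemma iexp_Suc:
  assumes "bdd X"
  shows "iexp (n + 1) X m k = iexp n X (m + 1) k - iexp n X m (k + 1)"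
proof -
  obtain K where K: "\<And>n m k N. k + int N \<ge> K \<Longrightarrow>
    iexp n X m k = (\<Sum>i<N. bc n i *\<^sub>V X (m + n - int i) (k + int i))"
    using bdd_iexp[OF assms] by blast
  define N where "N = nat (K - k)"
  have "iexp (n + 1) X m k = (\<Sum>i<Suc N. bc (n + 1) i *\<^sub>V X (m + (n + 1) - int i) (k + int i))"
    by (rule K) (simp add: N_def)
  also have "\<dots> = X (m + (n + 1)) k
      + (\<Sum>i<N. bc n (Suc i) *\<^sub>V X (m + n - int i) (k + 1 + int i))
      - (\<Sum>i<N. bc n i *\<^sub>V X (m + n - int i) (k + 1 + int i))"
    unfolding sum.lessThan_Suc_shift bc_Suc scl_diff_left sum_subtractf
    by (simp add: algebra_simps)
  also have "(\<Sum>i<N. bc n i *\<^sub>V X (m + n - int i) (k + 1 + int i)) = iexp n X m (k + 1)"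
    by (rule K[symmetric]) (simp add: N_def)
  also have "X (m + (n + 1)) k + (\<Sum>i<N. bc n (Suc i) *\<^sub>V X (m + n - int i) (k + 1 + int i))
     = (\<Sum>i<Suc N. bc n i *\<^sub>V X (m + 1 + n - int i) (k + int i))"
    unfolding sum.lessThan_Suc_shift by (simp add: algebra_simps)
  also have "\<dots> = iexp n X (m + 1) k"
    by (rule K[symmetric]) (simp add: N_def)
  finally show ?thesis .
qed

lemma bdd_common:
  assumes "bdd X" "bdd Y"
  obtains K where "\<And>m k. k \<ge> K \<Longrightarrow> X m k = 0" "\<And>m k. k \<ge> K \<Longrightarrow> Y m k = 0"
proof -
  obtain K1 K2 where "\<And>m k. k \<ge> K1 \<Longrightarrow> X m k = 0" "\<And>m k. k \<ge> K2 \<Longrightarrow> Y m k = 0"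
    using assms by (auto simp: bdd_def)
  then show ?thesis by (intro that[of "max K1 K2"]) auto
qed

lemma iexp_diff:
  assumes "bdd X" "bdd Y"
  shows "iexp n (\<lambda>m k. X m k - Y m k) m k = iexp n X m k - iexp n Y m k"
proof -
  obtain K where K: "\<And>m k. k \<ge> K \<Longrightarrow> X m k = 0" "\<And>m k. k \<ge> K \<Longrightarrow> Y m k = 0"
    using bdd_common[OF assms] by blast
  have *: "iexp n Z m k = (\<Sum>i<nat (K - k). bc n i *\<^sub>V Z (m + n - int i) (k + int i))"
    if "\<And>m k. k \<ge> K \<Longrightarrow> Z m k = 0" for Z
    unfolding iexp_def by (rule fsum_eq) (simp add: that)
  show ?thesis
    by (simp add: * K scl_diff_right sum_subtractf)
qed

lemma iexp_lin:
  assumes "bdd X" "lin f"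
  shows "f (iexp n X m k) = iexp n (\<lambda>m k. f (X m k)) m k"
proof -
  obtain K where K: "\<And>m k. k \<ge> K \<Longrightarrow> X m k = 0"
    using assms by (auto simp: bdd_def)
  have *: "iexp n Z m k = (\<Sum>i<nat (K - k). bc n i *\<^sub>V Z (m + n - int i) (k + int i))"
    if "\<And>m k. k \<ge> K \<Longrightarrow> Z m k = 0" for Z
    unfolding iexp_def by (rule fsum_eq) (simp add: that)
  show ?thesis
    by (simp add: * K lin_0 lin_sum lin_scl assms)
qed

lemma iexp_shift: "iexp n (\<lambda>m k. X (m + a) (k + b)) m k = iexp n X (m + a) (k + b)"
  unfolding iexp_def by (simp add: algebra_simps)

lemma iexp_mem:
  assumes "V.subspace S" "\<And>i. X (m + n - int i) (k + int i) \<in> S"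
  shows "iexp n X m k \<in> S"
  unfolding iexp_def by (intro fsum_mem V.subspace_scale assms)

text \<open>Up to sign, the combination on the left is the action of \<open>d/dz + d/dw\<close> on
  coefficients, and this operator annihilates \<open>z - w\<close>, hence commutes with
  multiplication by its powers.\<close>

lemma iexp_euler:
  assumes "bdd X"
  shows "iexp n (\<lambda>m k. of_int m *\<^sub>V X (m - 1) k + of_int k *\<^sub>V X m (k - 1)) m k
    = of_int m *\<^sub>V iexp n X (m - 1) k + of_int k *\<^sub>V iexp n X m (k - 1)" (is "iexp n ?Z m k = _")
proof -
  obtain K where K: "\<And>m k. k \<ge> K \<Longrightarrow> X m k = 0"
    using assms by (auto simp: bdd_def)
  define N where "N = nat (K + 1 - k)"
  have *: "iexp n Z m' k' = (\<Sum>i<M. bc n i *\<^sub>V Z (m' + n - int i) (k' + int i))"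
    if "\<And>m k. k \<ge> K + 1 \<Longrightarrow> Z m k = 0" "k' + int M \<ge> K + 1" for Z m' k' M
    unfolding iexp_def by (rule fsum_eq) (use that in auto)
  let ?a = "\<lambda>i. X (m - 1 + n - int i) (k + int i)" and ?b = "\<lambda>i. X (m + n - int i) (k - 1 + int i)"
  have idx: "m + n - int (Suc i) = m - 1 + n - int i" "k - 1 + int (Suc i) = k + int i" for i
    by auto
  have absorb: "bc n (Suc i) * of_nat (Suc i) = - (bc n i * (of_int n - of_nat i))" for i
    using bc_absorb[of i n] by (simp only: mult.commute[of "bc n i"] mult.commute[of "bc n (Suc i)"] minus_mult_left)
  have "iexp n ?Z m k = (\<Sum>i<Suc N. bc n i *\<^sub>V ?Z (m + n - int i) (k + int i))"
    by (rule *) (auto simp: K N_def)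
  also have "\<dots> = (\<Sum>i<Suc N. of_int m *\<^sub>V bc n i *\<^sub>V ?a i + of_int k *\<^sub>V bc n i *\<^sub>V ?b i)
      + ((\<Sum>i<Suc N. (bc n i * (of_int n - of_nat i)) *\<^sub>V ?a i)
      + (\<Sum>i<Suc N. (bc n i * of_nat i) *\<^sub>V ?b i))"
    by (simp only: sum.distrib[symmetric])
       (intro sum.cong refl, simp add: algebra_simps scl_add_left scl_diff_left scl_add_right)
  also have "(\<Sum>i<Suc N. (bc n i * of_nat i) *\<^sub>V ?b i) = (\<Sum>i<N. (bc n (Suc i) * of_nat (Suc i)) *\<^sub>V ?a i)"
    unfolding sum.lessThan_Suc_shift by (simp only: idx) simp
  also have "\<dots> = (\<Sum>i<N. - ((bc n i * (of_int n - of_nat i)) *\<^sub>V ?a i))"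
    by (simp only: absorb scl_minus_left)
  also have "(\<Sum>i<Suc N. (bc n i * (of_int n - of_nat i)) *\<^sub>V ?a i)
     = (\<Sum>i<N. (bc n i * (of_int n - of_nat i)) *\<^sub>V ?a i)"
    by (simp add: K N_def)
  also have "\<dots> + (\<Sum>i<N. - ((bc n i * (of_int n - of_nat i)) *\<^sub>V ?a i)) = 0"
    by (simp add: sum_negf)
  also have "(\<Sum>i<Suc N. of_int m *\<^sub>V bc n i *\<^sub>V ?a i + of_int k *\<^sub>V bc n i *\<^sub>V ?b i) + 0 =
      of_int m *\<^sub>V (\<Sum>i<Suc N. bc n i *\<^sub>V ?a i) + of_int k *\<^sub>V (\<Sum>i<Suc N. bc n i *\<^sub>V ?b i)"
    by (simp only: sum.distrib scl_sum_right add_0_right)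
  also have "(\<Sum>i<Suc N. bc n i *\<^sub>V ?a i) = iexp n X (m - 1) k"
    by (rule *[symmetric]) (auto simp: K N_def)
  also have "(\<Sum>i<Suc N. bc n i *\<^sub>V ?b i) = iexp n X m (k - 1)"
    by (rule *[symmetric]) (auto simp: K N_def)
  finally show ?thesis .
qed

definition sg :: "int \<Rightarrow> complex" where
  "sg n = (if even n then 1 else - 1)"

lemma sg_Suc: "sg (n + 1) = - sg n"
  by (simp add: sg_def)

definition fld :: "(int \<Rightarrow> V \<Rightarrow> V) \<Rightarrow> bool" where
  "fld A \<longleftrightarrow> (\<forall>k. lin (A k)) \<and> (\<forall>v. \<exists>K. \<forall>k\<ge>K. A k v = 0)"

lemma fld_lin: "fld A \<Longrightarrow> lin (A k)"
  by (simp add: fld_def)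

lemma fld_bdd: "fld B \<Longrightarrow> (\<And>m. lin (A m)) \<Longrightarrow> bdd (\<lambda>m k. A m (B k v))"
  unfolding fld_def bdd_def by (metis lin_0)

text \<open>The residue of \<open>(z - w)\<^sup>n\<close> times the product \<open>A(z) B(w)\<close>, minus the oppositely ordered
  product expanded in the opposite region; for \<open>m = 0\<close> these are the modes of
  the \<open>n\<close>-th product of \<open>A\<close> and \<open>B\<close>.\<close>
definition J :: "int \<Rightarrow> (int \<Rightarrow> V \<Rightarrow> V) \<Rightarrow> (int \<Rightarrow> V \<Rightarrow> V) \<Rightarrow> int \<Rightarrow> int \<Rightarrow> V \<Rightarrow> V" where
  "J n A B m k v = iexp n (\<lambda>m k. A m (B k v)) m k - sg n *\<^sub>V iexp n (\<lambda>k m. B k (A m v)) k m"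

lemma J_0: "J 0 A B m k v = A m (B k v) - B k (A m v)"
  by (simp add: J_def iexp_0 sg_def)

lemma J_Suc:
  assumes "fld A" "fld B"
  shows "J (n + 1) A B m k v = J n A B (m + 1) k v - J n A B m (k + 1) v"
  unfolding J_def sg_Suc iexp_Suc[OF fld_bdd[OF assms(2) fld_lin[OF assms(1)]]]
    iexp_Suc[OF fld_bdd[OF assms(1) fld_lin[OF assms(2)]]]
  by (simp add: scl_diff_right algebra_simps)

lemma J_mem:
  assumes "V.subspace S"
    and "\<And>i. A (m + n - int i) (B (k + int i) v) \<in> S"
    and "\<And>i. B (k + n - int i) (A (m + int i) v) \<in> S"
  shows "J n A B m k v \<in> S"
  unfolding J_def by (intro V.subspace_diff V.subspace_scale iexp_mem assms)

lemma J_lin: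
  assumes "fld A" "fld B"
  shows "lin (J n A B m k)"
proof -
  have 1: "lin (\<lambda>v. iexp n (\<lambda>m k. A m (B k v)) m k)" if "fld A" "fld B" for A B m k
  proof -
    have trunc: "\<exists>K. \<forall>k\<ge>K. B k v = 0" for v using that by (simp add: fld_def)
    have l: "lin (\<lambda>v. A m (B k v))" for m k
      by (rule lin_compose) (use that in \<open>auto simp: fld_def\<close>)
    show ?thesis
    proof (rule linI)
      fix x y
      obtain K1 K2 where K: "\<And>k. k \<ge> K1 \<Longrightarrow> B k x = 0" "\<And>k. k \<ge> K2 \<Longrightarrow> B k y = 0"
        using trunc by meson
      define M where "M = nat (max K1 K2 - k)"
      have E: "iexp n (\<lambda>m k. A m (B k v)) m k = (\<Sum>i<M. bc n i *\<^sub>V A (m + n - int i) (B (k + int i) v))"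
        if "\<And>k. k \<ge> max K1 K2 \<Longrightarrow> B k v = 0" for v
        unfolding iexp_def
      proof (rule fsum_eq)
        fix i assume "M \<le> i"
        then have "B (k + int i) v = 0" by (intro that) (auto simp: M_def)
        then show "bc n i *\<^sub>V A (m + n - int i) (B (k + int i) v) = 0"
          using \<open>fld A\<close> by (simp add: lin_0 fld_lin)
      qed
      have z: "B k (x + y) = 0" if "k \<ge> max K1 K2" for k
        using that K \<open>fld B\<close> by (simp add: lin_add fld_lin)
      show "iexp n (\<lambda>m k. A m (B k (x + y))) m k = iexp n (\<lambda>m k. A m (B k x)) m k + iexp n (\<lambda>m k. A m (B k y)) m k"
      proof -
        have zx: "B k x = 0" "B k y = 0" if "k \<ge> max K1 K2" for k
          using that K by auto
        show ?thesis
          using E[of "x + y"] E[of x] E[of y] z zx by (simp add: lin_add[OF l] scl_add_right sum.distrib)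
      qed
    next
      fix c x
      have "bdd (\<lambda>m k. A m (B k x))" using that by (simp add: fld_bdd fld_lin)
      from iexp_lin[OF this lin_scale, of c]
      show "iexp n (\<lambda>m k. A m (B k (c *\<^sub>V x))) m k = c *\<^sub>V iexp n (\<lambda>m k. A m (B k x)) m k"
        by (simp add: lin_scl[OF l])
    qed
  qed
  show ?thesis
    unfolding J_def by (intro lin_minus_fun lin_scale_fun 1 assms)
qed

text \<open>In the second half of \<open>J\<close> only finitely many \<open>A (m + i) v\<close> are
  nonzero, and each of them has its own bound for \<open>B\<close>; the maximum of these, corrected
  by the shift of the mode, is the bound.\<close>

lemma J_fld:
  assumes "fld A" "fld B"
  shows "fld (J n A B m)"
  unfolding fld_def
proof (intro conjI allI J_lin assms)
  fix v
  obtain K1 where K1: "\<And>k. k \<ge> K1 \<Longrightarrow> B k v = 0" using assms(2) by (meson fld_def)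
  obtain K2 where K2: "\<And>k. k \<ge> K2 \<Longrightarrow> A k v = 0" using assms(1) by (meson fld_def)
  have "\<forall>i. \<exists>K. \<forall>k\<ge>K. B k (A (m + int i) v) = 0" using assms(2) by (auto simp: fld_def)
  then obtain L where L: "\<And>i k. k \<ge> L i \<Longrightarrow> B k (A (m + int i) v) = 0" by metis
  define M where "M = nat (K2 - m)"
  define K where "K = max K1 (Max (insert 0 (L ` {..<M})) - n + int M)"
  have "J n A B m k v = 0" if "k \<ge> K" for k
  proof -
    have "A (m + n - int i) (B (k + int i) v) \<in> {0}" for i
      using that assms(1) by (simp add: K1 K_def lin_0 fld_lin)
    moreover have "B (k + n - int i) (A (m + int i) v) \<in> {0}" for i
    proof (cases "i < M")
      case True
      then have "L i \<le> Max (insert 0 (L ` {..<M}))" by (intro Max_ge) auto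
      then have "L i \<le> k + n - int i" using that True unfolding K_def by linarith
      then show ?thesis by (simp add: L)
    next
      case False
      then have "A (m + int i) v = 0" by (intro K2) (simp add: M_def)
      then show ?thesis using assms(2) by (simp add: lin_0 fld_lin)
    qed
    ultimately have "J n A B m k v \<in> {0}"
      by (intro J_mem) (simp_all add: V.subspace_single_0)
    then show ?thesis by simp
  qed
  then show "\<exists>K. \<forall>k\<ge>K. J n A B m k v = 0" by blast
qed

text \<open>Multiplication by \<open>z - w\<close> on coefficients, where the index \<open>m\<close>
  belongs to \<open>z ^ (- m - 1)\<close> and \<open>k\<close> to
  \<open>w ^ (- k - 1)\<close>.\<close>

definition dif :: "(int \<Rightarrow> int \<Rightarrow> V) \<Rightarrow> int \<Rightarrow> int \<Rightarrow> V" where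
  "dif f m k = f (m + 1) k - f m (k + 1)"

definition loc :: "(int \<Rightarrow> V \<Rightarrow> V) \<Rightarrow> (int \<Rightarrow> V \<Rightarrow> V) \<Rightarrow> bool" where
  "loc A B \<longleftrightarrow> (\<exists>N. \<forall>v m k. (dif ^^ N) (\<lambda>m k. A m (B k v) - B k (A m v)) m k = 0)"

lemma dif_zero: "(dif ^^ N) (\<lambda>m k. 0) = (\<lambda>m k. 0)"
  by (induction N) (auto simp: dif_def fun_eq_iff)

lemma dif_swap: "(dif ^^ N) (\<lambda>m k. f k m) m k = (- 1) ^ N *\<^sub>V (dif ^^ N) f k m"
  by (induction N arbitrary: m k) (auto simp: dif_def scl_diff_right scl_minus_left)

lemma dif_add: "(dif ^^ N) (\<lambda>m k. f m k + g m k) m k = (dif ^^ N) f m k + (dif ^^ N) g m k"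
  by (induction N arbitrary: m k) (simp_all add: dif_def)

lemma dif_scl: "(dif ^^ N) (\<lambda>m k. c *\<^sub>V f m k) m k = c *\<^sub>V (dif ^^ N) f m k"
  by (induction N arbitrary: m k) (simp_all add: dif_def scl_diff_right)

lemma dif_uminus: "(dif ^^ N) (\<lambda>m k. - f m k) m k = - (dif ^^ N) f m k"
  by (induction N arbitrary: m k) (auto simp: dif_def)

lemma loc_sym: assumes "loc A B" shows "loc B A"
proof -
  obtain N where N: "\<And>v m k. (dif ^^ N) (\<lambda>m k. A m (B k v) - B k (A m v)) m k = 0"
    using assms by (auto simp: loc_def)
  have "(dif ^^ N) (\<lambda>m k. B m (A k v) - A k (B m v)) m k = 0" for v m k
  proof -
    have "(dif ^^ N) (\<lambda>m k. B m (A k v) - A k (B m v)) m k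
        = (dif ^^ N) (\<lambda>m k. - (A k (B m v) - B m (A k v))) m k" by simp
    also have "\<dots> = - ((- 1) ^ N *\<^sub>V (dif ^^ N) (\<lambda>m k. A m (B k v) - B k (A m v)) k m)"
      by (simp only: dif_uminus dif_swap[of N "\<lambda>m k. A m (B k v) - B k (A m v)"])
    finally show ?thesis by (simp add: N)
  qed
  then show ?thesis unfolding loc_def by blast
qed

lemma dif_pow_mono:
  assumes "\<And>m k. (dif ^^ N) f m k = 0" "N \<le> M"
  shows "(dif ^^ M) f m k = 0"
proof -
  have "(dif ^^ M) f = (dif ^^ (M - N)) ((dif ^^ N) f)"
    using assms(2) by (simp add: funpow_add[symmetric, THEN fun_cong, unfolded o_def])
  also have "(dif ^^ N) f = (\<lambda>m k. 0)" using assms(1) by (simp add: fun_eq_iff)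
  finally show ?thesis by (simp add: dif_zero)
qed

lemma J_dif:
  assumes "fld A" "fld B"
  shows "(dif ^^ r) (\<lambda>m k. J n A B m k v) = (\<lambda>m k. J (n + int r) A B m k v)"
proof (induction r)
  case (Suc r)
  have "(dif ^^ Suc r) (\<lambda>m k. J n A B m k v) = dif (\<lambda>m k. J (n + int r) A B m k v)"
    using Suc by simp
  also have "\<dots> = (\<lambda>m k. J (n + int r + 1) A B m k v)"
    unfolding dif_def J_Suc[OF assms] by simp
  finally show ?case by (simp add: algebra_simps)
qed simp

text \<open>\<open>J 0\<close> is the commutator and each step up in \<open>n\<close> multiplies by
  \<open>z - w\<close>, so locality is the vanishing of \<open>J n\<close> for all large
  \<open>n\<close>.\<close>

lemma loc_J:
  assumes "fld A" "fld B" "loc A B"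
  obtains N where "\<And>n m k v. n \<ge> int N \<Longrightarrow> J n A B m k v = 0"
proof -
  obtain N where N: "\<And>v m k. (dif ^^ N) (\<lambda>m k. A m (B k v) - B k (A m v)) m k = 0"
    using assms by (auto simp: loc_def)
  show ?thesis
  proof (rule that[of N])
    fix n m k v assume n: "n \<ge> int N"
    have "J n A B m k v = (dif ^^ nat n) (\<lambda>m k. J 0 A B m k v) m k"
      using n by (simp add: J_dif assms)
    also have "\<dots> = 0"
      unfolding J_0 by (rule dif_pow_mono[OF N]) (use n in simp)
    finally show "J n A B m k v = 0" .
  qed
qed

subsection \<open>Dong's lemma\<close>

text \<open>The three operators multiply coefficients in variables \<open>z\<close>,
  \<open>w\<close>, \<open>u\<close> by \<open>z - u\<close>, \<open>w - u\<close> and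
  \<open>z - w\<close>.\<close>

definition dzu :: "(int \<Rightarrow> int \<Rightarrow> int \<Rightarrow> V) \<Rightarrow> int \<Rightarrow> int \<Rightarrow> int \<Rightarrow> V" where
  "dzu f m k l = f (m + 1) k l - f m k (l + 1)"

definition dwu :: "(int \<Rightarrow> int \<Rightarrow> int \<Rightarrow> V) \<Rightarrow> int \<Rightarrow> int \<Rightarrow> int \<Rightarrow> V" where
  "dwu f m k l = f m (k + 1) l - f m k (l + 1)"

definition dzw :: "(int \<Rightarrow> int \<Rightarrow> int \<Rightarrow> V) \<Rightarrow> int \<Rightarrow> int \<Rightarrow> int \<Rightarrow> V" where
  "dzw f m k l = f (m + 1) k l - f m (k + 1) l"

lemma dzu_dwu: "(dzu ^^ a) ((dwu ^^ b) f) = (dwu ^^ b) ((dzu ^^ a) f)"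
proof -
  have 1: "dzu (dwu f) = dwu (dzu f)" for f by (auto simp: dzu_def dwu_def fun_eq_iff)
  have 2: "dzu ((dwu ^^ b) f) = (dwu ^^ b) (dzu f)" for f by (induction b arbitrary: f) (simp_all add: 1)
  show ?thesis by (induction a) (simp_all add: 2)
qed

lemma dzw_dwu: "(dzw ^^ a) ((dwu ^^ b) f) = (dwu ^^ b) ((dzw ^^ a) f)"
proof -
  have 1: "dzw (dwu f) = dwu (dzw f)" for f by (auto simp: dzw_def dwu_def fun_eq_iff)
  have 2: "dzw ((dwu ^^ b) f) = (dwu ^^ b) (dzw f)" for f by (induction b arbitrary: f) (simp_all add: 1)
  show ?thesis by (induction a) (simp_all add: 2)
qed

lemma dzu_dzw: "dzu ((dzw ^^ b) f) = (dzw ^^ b) (dzu f)"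
proof -
  have 1: "dzu (dzw f) = dzw (dzu f)" for f by (auto simp: dzu_def dzw_def fun_eq_iff)
  show ?thesis by (induction b arbitrary: f) (simp_all add: 1)
qed

lemma dzw_dzu: "dzw ((dzu ^^ b) f) = (dzu ^^ b) (dzw f)"
proof -
  have 1: "dzw (dzu f) = dzu (dzw f)" for f by (auto simp: dzu_def dzw_def fun_eq_iff)
  show ?thesis by (induction b arbitrary: f) (simp_all add: 1)
qed

lemma dwu_zero: "(dwu ^^ N) (\<lambda>m k l. 0) = (\<lambda>m k l. 0)"
  by (induction N) (auto simp: dwu_def fun_eq_iff)

lemma dwu_diff: "(dwu ^^ N) (\<lambda>m k l. f m k l - g m k l) = (\<lambda>m k l. (dwu ^^ N) f m k l - (dwu ^^ N) g m k l)"
  by (induction N) (auto simp: dwu_def fun_eq_iff)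

lemma dzu_diff: "(dzu ^^ N) (\<lambda>m k l. f m k l - g m k l) = (\<lambda>m k l. (dzu ^^ N) f m k l - (dzu ^^ N) g m k l)"
  by (induction N) (auto simp: dzu_def fun_eq_iff)

lemma dzu_zero: "(dzu ^^ N) (\<lambda>m k l. 0) = (\<lambda>m k l. 0)"
  by (induction N) (auto simp: dzu_def fun_eq_iff)

text \<open>Since \<open>w - u = (z - u) - (z - w)\<close>.\<close>
lemma dwu_nilpotent:
  "(dzu ^^ a) f = (\<lambda>_ _ _. 0) \<Longrightarrow> (dzw ^^ b) f = (\<lambda>_ _ _. 0) \<Longrightarrow> (dwu ^^ (a + b)) f = (\<lambda>_ _ _. 0)"
proof (induction "a + b" arbitrary: a b f)
  case 0
  then show ?case by simp
next
  case (Suc n)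
  show ?case
  proof (cases "a = 0 \<or> b = 0")
    case True
    then have "f = (\<lambda>_ _ _. 0)" using Suc.prems by auto
    then show ?thesis by (simp add: dwu_zero)
  next
    case False
    then obtain a' b' where ab: "a = Suc a'" "b = Suc b'" by (metis not0_implies_Suc)
    have "(dwu ^^ (a' + b)) (dzu f) = (\<lambda>_ _ _. 0)"
    proof (rule Suc.hyps(1))
      show "(dzu ^^ a') (dzu f) = (\<lambda>_ _ _. 0)"
        using Suc.prems(1) by (simp add: ab funpow_swap1)
      show "(dzw ^^ b) (dzu f) = (\<lambda>_ _ _. 0)"
        using Suc.prems(2) by (simp add: dzu_dzw[symmetric]) (simp add: dzu_def fun_eq_iff)
    qed (use Suc.hyps ab in simp)
    moreover have "(dwu ^^ (a + b')) (dzw f) = (\<lambda>_ _ _. 0)"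
    proof (rule Suc.hyps(1))
      show "(dzw ^^ b') (dzw f) = (\<lambda>_ _ _. 0)"
        using Suc.prems(2) by (simp add: ab funpow_swap1)
      show "(dzu ^^ a) (dzw f) = (\<lambda>_ _ _. 0)"
        using Suc.prems(1) by (simp add: dzw_dzu[symmetric]) (simp add: dzw_def fun_eq_iff)
    qed (use Suc.hyps ab in simp)
    moreover have "dwu f = (\<lambda>m k l. dzu f m k l - dzw f m k l)"
      by (auto simp: dwu_def dzu_def dzw_def fun_eq_iff)
    moreover have "a' + b = n" "a + b' = n" using Suc.hyps(2) ab by simp_all
    ultimately have "(dwu ^^ n) (dwu f) = (\<lambda>_ _ _. 0)"
      by (simp only: dwu_diff) simp
    then show ?thesis using Suc.hyps(2)[symmetric] by (simp add: funpow_swap1)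
  qed
qed

definition iexp3 :: "int \<Rightarrow> (int \<Rightarrow> int \<Rightarrow> int \<Rightarrow> V) \<Rightarrow> int \<Rightarrow> int \<Rightarrow> int \<Rightarrow> V" where
  "iexp3 n g m k l = iexp n (\<lambda>m k. g m k l) m k"

definition bdd3 :: "(int \<Rightarrow> int \<Rightarrow> int \<Rightarrow> V) \<Rightarrow> bool" where
  "bdd3 g \<longleftrightarrow> (\<forall>l. bdd (\<lambda>m k. g m k l))"

lemma bdd_diff: "bdd X \<Longrightarrow> bdd Y \<Longrightarrow> bdd (\<lambda>m k. X m k - Y m k)"
  by (erule (1) bdd_common) (unfold bdd_def, metis diff_zero)

lemma bdd_shift: assumes "bdd X" shows "bdd (\<lambda>m k. X (m + a) (k + b))"
proof -
  obtain K where "\<And>m k. k \<ge> K \<Longrightarrow> X m k = 0"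
    using assms by (auto simp: bdd_def)
  then have "\<And>m k. k \<ge> K - b \<Longrightarrow> X (m + a) (k + b) = 0" by simp
  then show ?thesis unfolding bdd_def by blast
qed

lemma bdd3_shift:
  assumes "bdd3 g"
  shows "bdd (\<lambda>m k. g m k l)" "bdd (\<lambda>m k. g (m + 1) k l)" "bdd (\<lambda>m k. g m (k + 1) l)"
  using assms bdd_shift[of "\<lambda>m k. g m k l" 1 0] bdd_shift[of "\<lambda>m k. g m k l" 0 1]
  by (simp_all add: bdd3_def)

lemma dwu_iexp3:
  assumes "bdd3 g"
  shows "bdd3 (dwu g) \<and> dwu (iexp3 n g) = iexp3 n (dwu g)"
proof
  show "bdd3 (dwu g)"
    unfolding bdd3_def dwu_def by (intro allI bdd_diff bdd3_shift assms)
  have "dwu (iexp3 n g) m k l = iexp3 n (dwu g) m k l" for m k l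
    unfolding iexp3_def dwu_def
    using iexp_shift[of n "\<lambda>m k. g m k l" 0 1 m k]
    by (subst iexp_diff) (auto intro: bdd3_shift assms)
  then show "dwu (iexp3 n g) = iexp3 n (dwu g)" by (simp add: fun_eq_iff)
qed

lemma dzu_iexp3:
  assumes "bdd3 g"
  shows "bdd3 (dzu g) \<and> dzu (iexp3 n g) = iexp3 n (dzu g)"
proof
  show "bdd3 (dzu g)"
    unfolding bdd3_def dzu_def by (intro allI bdd_diff bdd3_shift assms)
  have "dzu (iexp3 n g) m k l = iexp3 n (dzu g) m k l" for m k l
    unfolding iexp3_def dzu_def
    using iexp_shift[of n "\<lambda>m k. g m k l" 1 0 m k]
    by (subst iexp_diff) (auto intro: bdd3_shift assms)
  then show "dzu (iexp3 n g) = iexp3 n (dzu g)" by (simp add: fun_eq_iff)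
qed

lemma iexp_dzu_dwu:
  assumes "bdd3 g"
  shows "(dzu ^^ a) ((dwu ^^ b) (iexp3 n g)) = iexp3 n ((dzu ^^ a) ((dwu ^^ b) g))"
proof -
  have W: "bdd3 ((dwu ^^ b) g) \<and> (dwu ^^ b) (iexp3 n g) = iexp3 n ((dwu ^^ b) g)" for b
    by (induction b) (use assms dwu_iexp3 in auto)
  have "bdd3 ((dzu ^^ a) ((dwu ^^ b) g)) \<and>
     (dzu ^^ a) ((dwu ^^ b) (iexp3 n g)) = iexp3 n ((dzu ^^ a) ((dwu ^^ b) g))"
    by (induction a) (use W dzu_iexp3 in auto)
  then show ?thesis by blast
qed

text \<open>\<open>A B C - C A B\<close> splits into \<open>A [B, C]\<close>, killed by a power of
  \<open>w - u\<close>, and \<open>[A, C] B\<close>, killed by a power of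
  \<open>z - u\<close>.\<close>

lemma loc_triple:
  assumes "fld A" "fld B" "fld C"
    and NA: "\<And>v m k. (dif ^^ N) (\<lambda>m k. A m (C k v) - C k (A m v)) m k = 0"
    and NB: "\<And>v m k. (dif ^^ N) (\<lambda>m k. B m (C k v) - C k (B m v)) m k = 0"
  shows "(dzu ^^ N) ((dwu ^^ N) (\<lambda>m k l. A m (B k (C l v)) - C l (A m (B k v)))) = (\<lambda>_ _ _. 0)"
proof -
  let ?G1 = "\<lambda>m k l. A m (B k (C l v) - C l (B k v))"
  let ?G2 = "\<lambda>m k l. C l (A m (B k v)) - A m (C l (B k v))"
  have "(dwu ^^ N) ?G1 m k l = A m ((dif ^^ N) (\<lambda>k l. B k (C l v) - C l (B k v)) k l)" for m k l N
    by (induction N arbitrary: k l) (simp_all add: dwu_def dif_def lin_diff assms fld_lin)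
  then have G1: "(dwu ^^ N) ?G1 = (\<lambda>_ _ _. 0)"
    by (simp add: NB fun_eq_iff lin_0 assms fld_lin)
  have "(dzu ^^ N) ?G2 m k l = (dif ^^ N) (\<lambda>m l. - (A m (C l (B k v)) - C l (A m (B k v)))) m l" for m k l N
    by (induction N arbitrary: m l) (simp_all add: dzu_def dif_def)
  then have G2: "(dzu ^^ N) ?G2 = (\<lambda>_ _ _. 0)"
    by (simp only: dif_uminus NA fun_eq_iff minus_zero) simp
  have "(\<lambda>m k l. A m (B k (C l v)) - C l (A m (B k v))) = (\<lambda>m k l. ?G1 m k l - ?G2 m k l)"
    by (simp add: lin_diff assms fld_lin)
  moreover have "(dzu ^^ N) ((dwu ^^ N) (\<lambda>m k l. ?G1 m k l - ?G2 m k l)) = (\<lambda>_ _ _. 0)"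
    unfolding dwu_diff[of N ?G1 ?G2] dzu_diff[of N "(dwu ^^ N) ?G1" "(dwu ^^ N) ?G2"]
    unfolding dzu_dwu[of N N ?G2] G1 G2 dwu_zero dzu_zero by simp
  ultimately show ?thesis by simp
qed

text \<open>The commutator of the product \<open>J n A B\<close> with \<open>C\<close>, multiplied
  by \<open>(w - u) ^ N\<close>, is killed by \<open>(z - u) ^ N\<close> because of the locality
  with \<open>C\<close>, and by \<open>(z - w) ^ r\<close> because \<open>J\<close> vanishes for
  large \<open>n\<close>. Hence a further power \<open>N + r\<close> of \<open>w - u\<close> kills
  it.\<close>

lemma dong:
  assumes "fld A" "fld B" "fld C" "loc A B" "loc A C" "loc B C"
  shows "loc (J n A B 0) C"
proof -
  obtain NA where NA: "\<And>v m k. (dif ^^ NA) (\<lambda>m k. A m (C k v) - C k (A m v)) m k = 0"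
    using assms by (auto simp: loc_def)
  obtain NB where NB: "\<And>v m k. (dif ^^ NB) (\<lambda>m k. B m (C k v) - C k (B m v)) m k = 0"
    using assms by (auto simp: loc_def)
  define N where "N = max NA NB"
  have NA': "(dif ^^ N) (\<lambda>m k. A m (C k v) - C k (A m v)) m k = 0" for v m k
    by (rule dif_pow_mono[OF NA]) (simp add: N_def)
  have NB': "(dif ^^ N) (\<lambda>m k. B m (C k v) - C k (B m v)) m k = 0" for v m k
    by (rule dif_pow_mono[OF NB]) (simp add: N_def)
  obtain M where M: "\<And>n m k v. n \<ge> int M \<Longrightarrow> J n A B m k v = 0"
    using loc_J[OF assms(1,2,4)] by blast
  define r where "r = nat (int M - n)"
  have "(dwu ^^ (N + r + N)) (\<lambda>m k l. J n A B m k (C l v) - C l (J n A B m k v)) = (\<lambda>_ _ _. 0)" for v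
  proof -
    let ?K = "\<lambda>n m k l. J n A B m k (C l v) - C l (J n A B m k v)"
    have "(dzw ^^ s) (?K n) = ?K (n + int s)" for s
    proof (induction s)
      case (Suc s)
      then have "(dzw ^^ Suc s) (?K n) = dzw (?K (n + int s))" by simp
      also have "\<dots> = ?K (n + int s + 1)"
        by (simp add: dzw_def J_Suc assms fun_eq_iff lin_diff fld_lin)
      finally show ?case by (simp add: algebra_simps)
    qed simp
    then have zw: "(dzw ^^ r) (?K n) = (\<lambda>_ _ _. 0)"
      by (simp add: M r_def fun_eq_iff lin_0 assms fld_lin)
    let ?G = "\<lambda>m k l. A m (B k (C l v)) - C l (A m (B k v))"
    let ?G' = "\<lambda>k m l. B k (A m (C l v)) - C l (B k (A m v))"
    have b: "bdd (\<lambda>m k. A m (B k v))" "bdd (\<lambda>k m. B k (A m v))" for v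
      using assms by (simp_all add: fld_bdd fld_lin)
    have bC: "bdd (\<lambda>m k. C l (X m k))" if "bdd X" for X l
      using that assms(3) unfolding bdd_def by (metis lin_0 fld_lin)
    have K: "?K n = (\<lambda>m k l. iexp n (\<lambda>m k. ?G m k l) m k - sg n *\<^sub>V iexp n (\<lambda>k m. ?G' k m l) k m)"
      by (simp add: J_def fun_eq_iff iexp_diff b bC iexp_lin[OF b(1)] iexp_lin[OF b(2)]
           lin_diff lin_scl assms fld_lin scl_diff_right)
    have 1: "(dzu ^^ N) ((dwu ^^ N) (\<lambda>m k l. iexp n (\<lambda>m k. ?G m k l) m k)) = (\<lambda>_ _ _. 0)"
      using iexp_dzu_dwu[of ?G N N n]
      by (simp add: loc_triple[OF assms(1-3) NA' NB'] iexp3_def[abs_def] iexp_def fsum_def bdd3_def bdd_diff b bC)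
    have 2: "(dzu ^^ N) ((dwu ^^ N) (\<lambda>k m l. iexp n (\<lambda>k m. ?G' k m l) k m)) = (\<lambda>_ _ _. 0)"
      using iexp_dzu_dwu[of ?G' N N n]
      by (simp add: loc_triple[OF assms(2,1,3) NB' NA'] iexp3_def[abs_def] iexp_def fsum_def bdd3_def bdd_diff b bC)
    have sw1: "(dwu ^^ a) (\<lambda>m k l. c *\<^sub>V f k m l) = (\<lambda>m k l. c *\<^sub>V (dzu ^^ a) f k m l)" for a f c
      by (induction a) (auto simp: dwu_def dzu_def fun_eq_iff scl_diff_right)
    have sw2: "(dzu ^^ a) (\<lambda>m k l. c *\<^sub>V f k m l) = (\<lambda>m k l. c *\<^sub>V (dwu ^^ a) f k m l)" for a f c
      by (induction a) (auto simp: dwu_def dzu_def fun_eq_iff scl_diff_right)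
    have "(dzu ^^ N) ((dwu ^^ N) (?K n)) = (\<lambda>_ _ _. 0)"
      unfolding K by (simp only: dwu_diff dzu_diff 1 sw1 sw2) (simp only: dzu_dwu[symmetric] 2, simp)
    moreover have "(dzw ^^ r) ((dwu ^^ N) (?K n)) = (\<lambda>_ _ _. 0)"
      by (simp only: dzw_dwu zw dwu_zero)
    ultimately have "(dwu ^^ (N + r)) ((dwu ^^ N) (?K n)) = (\<lambda>_ _ _. 0)"
      by (rule dwu_nilpotent)
    then show ?thesis by (simp add: funpow_add)
  qed
  \<comment> \<open>Multiplication by \<open>w - u\<close> leaves the index of \<open>z\<close>
    alone, so that index can be frozen at 0, where \<open>J\<close> gives the modes of the
    product.\<close>
  then have Z: "(dwu ^^ (N + r + N)) (\<lambda>m k l. J n A B m k (C l v) - C l (J n A B m k v)) 0 k l = 0" for v k l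
    by simp
  have W: "(dwu ^^ s) f m k l = (dif ^^ s) (f m) k l" for s f m k l
    by (induction s arbitrary: k l) (simp_all add: dwu_def dif_def)
  have "(dif ^^ (N + r + N)) (\<lambda>k l. J n A B 0 k (C l v) - C l (J n A B 0 k v)) k l = 0" for v k l
    using Z[of v k l] unfolding W .
  then show ?thesis unfolding loc_def by blast
qed

subsection \<open>Vertex algebras\<close>

lemma J_translation:
  assumes "fld A" "fld B" "lin T"
    and A: "\<And>k v. T (A k v) = A k (T v) - of_int k *\<^sub>V A (k - 1) v"
    and B: "\<And>k v. T (B k v) = B k (T v) - of_int k *\<^sub>V B (k - 1) v"
  shows "T (J n A B m k v) = J n A B m k (T v) - of_int m *\<^sub>V J n A B (m - 1) k v - of_int k *\<^sub>V J n A B m (k - 1) v"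
proof -
  have *: "T (iexp n (\<lambda>m k. A m (B k v)) m k) = iexp n (\<lambda>m k. A m (B k (T v))) m k
      - (of_int m *\<^sub>V iexp n (\<lambda>m k. A m (B k v)) (m - 1) k + of_int k *\<^sub>V iexp n (\<lambda>m k. A m (B k v)) m (k - 1))"
    if f: "fld A" "fld B" and A: "\<And>k v. T (A k v) = A k (T v) - of_int k *\<^sub>V A (k - 1) v"
    and B: "\<And>k v. T (B k v) = B k (T v) - of_int k *\<^sub>V B (k - 1) v" for A B m k
  proof -
    have b: "bdd (\<lambda>m k. A m (B k v))" for v
      using f by (simp add: fld_bdd fld_lin)
    obtain K where K: "\<And>m k. k \<ge> K \<Longrightarrow> A m (B k v) = 0"
      using b[of v] unfolding bdd_def by auto
    have b': "bdd (\<lambda>m k. of_int m *\<^sub>V A (m - 1) (B k v) + of_int k *\<^sub>V A m (B (k - 1) v))"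
      unfolding bdd_def by (intro exI[of _ "K + 1"]) (auto simp: K)
    have "T (iexp n (\<lambda>m k. A m (B k v)) m k) = iexp n (\<lambda>m k. T (A m (B k v))) m k"
      by (rule iexp_lin[OF b assms(3)])
    also have "(\<lambda>m k. T (A m (B k v))) = (\<lambda>m k. A m (B k (T v))
        - (of_int m *\<^sub>V A (m - 1) (B k v) + of_int k *\<^sub>V A m (B (k - 1) v)))"
      by (simp add: A B lin_diff lin_scl fld_lin[OF f(1)] fun_eq_iff)
    finally show ?thesis
      by (simp only: iexp_diff[OF b b'] iexp_euler[OF b])
  qed
  show ?thesis
    unfolding J_def lin_diff[OF assms(3)] lin_scl[OF assms(3)] *[OF assms(1,2) A B] *[OF assms(2,1) B A]
    by (simp add: scl_diff_right scl_add_right mult.commute)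
qed

locale vertex_algebra =
  fixes Y :: "V \<Rightarrow> int \<Rightarrow> V \<Rightarrow> V" and vac :: V and T :: "V \<Rightarrow> V"
  assumes Y_fld: "fld (Y a)"
    and Y_lin: "lin (\<lambda>a. Y a k v)"
    and Y_loc: "loc (Y a) (Y b)"
    and Y_vac: "k \<ge> 0 \<Longrightarrow> Y a k vac = 0"
    and Y_create: "Y a (- 1) vac = a"
    and T_lin: "lin T"
    and T_vac: "T vac = 0"
    and T_Y: "T (Y a k v) = Y a k (T v) - of_int k *\<^sub>V Y a (k - 1) v"
begin

lemma Y_lin2: "lin (Y a k)"
  by (rule fld_lin[OF Y_fld])

text \<open>Applied to the vacuum, \<open>D(z) Y(v, w)\<close> vanishes after multiplication by
  \<open>(z - w) ^ N\<close>. As \<open>Y(v, w)\<close> creates no negative powers of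
  \<open>w\<close> from the vacuum, the constant term in \<open>w\<close> only sees
  \<open>z ^ N\<close> and returns every mode of \<open>D\<close> on \<open>v\<close>.\<close>

lemma goddard:
  assumes "fld D" "\<And>c. loc D (Y c)" "\<And>k. D k vac = 0"
  shows "D k v = 0"
proof -
  obtain N where N: "\<And>w m k. (dif ^^ N) (\<lambda>m k. D m (Y v k w) - Y v k (D m w)) m k = 0"
    using assms(2)[of v] by (auto simp: loc_def)
  let ?f = "\<lambda>m l. D m (Y v l vac)"
  have "(\<forall>m l. l \<ge> 0 \<longrightarrow> (dif ^^ n) ?f m l = 0) \<and> (\<forall>m. (dif ^^ n) ?f m (- 1) = ?f (m + int n) (- 1))" for n
    by (induction n) (auto simp: dif_def Y_vac lin_0 fld_lin assms(1) algebra_simps)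
  then have "(dif ^^ N) ?f (k - int N) (- 1) = D k v"
    by (simp add: Y_create)
  moreover have "(dif ^^ N) ?f (k - int N) (- 1) = 0"
    using N[of vac "k - int N" "- 1"] by (simp add: assms(3) lin_0[OF Y_lin2])
  ultimately show ?thesis by simp
qed

lemma dif_diff: "(dif ^^ N) (\<lambda>m k. f m k - g m k) m k = (dif ^^ N) f m k - (dif ^^ N) g m k"
  by (induction N arbitrary: m k) (simp_all add: dif_def)

lemma loc_diff:
  assumes "loc A C" "loc B C" "fld C"
  shows "loc (\<lambda>k v. A k v - B k v) C"
proof -
  obtain N1 where N1: "\<And>v m k. (dif ^^ N1) (\<lambda>m k. A m (C k v) - C k (A m v)) m k = 0"
    using assms by (auto simp: loc_def)
  obtain N2 where N2: "\<And>v m k. (dif ^^ N2) (\<lambda>m k. B m (C k v) - C k (B m v)) m k = 0"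
    using assms by (auto simp: loc_def)
  have "(dif ^^ (max N1 N2)) (\<lambda>m k. (A m (C k v) - B m (C k v)) - C k (A m v - B m v)) m k = 0" for v m k
  proof -
    have "(\<lambda>m k. (A m (C k v) - B m (C k v)) - C k (A m v - B m v)) =
        (\<lambda>m k. (A m (C k v) - C k (A m v)) - (B m (C k v) - C k (B m v)))"
      by (simp add: lin_diff fld_lin assms fun_eq_iff)
    then show ?thesis
      using dif_diff[of "max N1 N2" "\<lambda>m k. A m (C k v) - C k (A m v)" "\<lambda>m k. B m (C k v) - C k (B m v)" m k]
        dif_pow_mono[OF N1 max.cobounded1, of N2 v m k] dif_pow_mono[OF N2 max.cobounded2, of N1 v m k]
      by simp
  qed
  then show ?thesis unfolding loc_def by blast
qed

text \<open>Translation covariance determines all negative modes on the vacuum from the mode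
  \<open>- 1\<close>, because \<open>T\<close> kills the vacuum; the difference of the two fields
  then kills the vacuum and \<open>goddard\<close> applies.\<close>

theorem Y_unique:
  assumes B: "fld B" "\<And>c. loc B (Y c)" "\<And>k. k \<ge> 0 \<Longrightarrow> B k vac = 0"
    and T_B: "\<And>k v. T (B k v) = B k (T v) - of_int k *\<^sub>V B (k - 1) v"
  shows "B k v = Y (B (- 1) vac) k v"
proof -
  let ?b = "B (- 1) vac"
  let ?D = "\<lambda>k v. B k v - Y ?b k v"
  have fD: "fld ?D"
    unfolding fld_def
  proof (intro conjI allI)
    show "lin (?D k)" for k
      by (rule lin_minus_fun[OF fld_lin[OF B(1)] Y_lin2])
    fix v
    obtain K1 K2 where "\<And>k. k \<ge> K1 \<Longrightarrow> B k v = 0" "\<And>k. k \<ge> K2 \<Longrightarrow> Y ?b k v = 0"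
      using B(1) Y_fld unfolding fld_def by meson
    then show "\<exists>K. \<forall>k\<ge>K. ?D k v = 0"
      by (intro exI[of _ "max K1 K2"]) auto
  qed
  have TD: "T (?D k v) = ?D k (T v) - of_int k *\<^sub>V ?D (k - 1) v" for k v
    by (simp add: lin_diff T_lin T_Y T_B scl_diff_right)
  have neg: "?D (- 1 - int j) vac = 0" for j
  proof (induction j)
    case 0
    then show ?case by (simp add: Y_create)
  next
    case (Suc j)
    have "T (?D (- 1 - int j) vac) = ?D (- 1 - int j) (T vac) - of_int (- 1 - int j) *\<^sub>V ?D (- 1 - int j - 1) vac"
      by (rule TD)
    then have "of_int (- 1 - int j) *\<^sub>V ?D (- 1 - int j - 1) vac = 0"
      by (simp only: Suc T_vac lin_0[OF T_lin] lin_0[OF fld_lin[OF fD]]) simp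
    moreover have "of_int (- 1 - int j) \<noteq> (0 :: complex)"
      unfolding of_int_eq_0_iff by simp
    ultimately have "?D (- 1 - int j - 1) vac = 0" by simp
    moreover have "- 1 - int (Suc j) = - 1 - int j - 1" by simp
    ultimately show ?case by (simp only:)
  qed
  have vacD: "?D k vac = 0" for k
  proof (cases "k \<ge> 0")
    case True
    then show ?thesis by (simp add: B(3) Y_vac)
  next
    case False
    then have "k = - 1 - int (nat (- 1 - k))" by simp
    then show ?thesis using neg by metis
  qed
  have locD: "loc ?D (Y c)" for c
    by (rule loc_diff[OF B(2) Y_loc Y_fld])
  have "?D k v = 0"
    by (rule goddard[OF fD locD vacD])
  then show ?thesis by simp
qed

text \<open>The right side is local with every field by \<open>dong\<close>, is covariant under
  translation and creates \<open>Y a n b\<close> from the vacuum; uniqueness does the rest.\<close>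

theorem iterate: "Y (Y a n b) k v = J n (Y a) (Y b) 0 k v"
proof -
  have J0: "J n (Y a) (Y b) 0 k vac = (if k = - 1 then Y a n b else 0)" if "k \<ge> - 1" for k
  proof -
    have 1: "iexp n (\<lambda>m k. Y a m (Y b k vac)) 0 k = (if k = - 1 then Y a n b else 0)"
    proof -
      have "iexp n (\<lambda>m k. Y a m (Y b k vac)) 0 k = (\<Sum>i<1. bc n i *\<^sub>V Y a (0 + n - int i) (Y b (k + int i) vac))"
        unfolding iexp_def by (rule fsum_eq) (use that in \<open>simp add: Y_vac lin_0[OF Y_lin2]\<close>)
      then show ?thesis
        using that by (auto simp: Y_create Y_vac lin_0[OF Y_lin2])
    qed
    have 2: "iexp n (\<lambda>k m. Y b k (Y a m vac)) k 0 = 0"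
      unfolding iexp_def fsum_def by (simp add: Y_vac lin_0[OF Y_lin2])
    show ?thesis unfolding J_def by (simp add: 1 2)
  qed
  have "J n (Y a) (Y b) 0 k v = Y (J n (Y a) (Y b) 0 (- 1) vac) k v"
  proof (rule Y_unique)
    show "T (J n (Y a) (Y b) 0 k v) = J n (Y a) (Y b) 0 k (T v) - of_int k *\<^sub>V J n (Y a) (Y b) 0 (k - 1) v" for k v
      by (simp add: J_translation[OF Y_fld Y_fld T_lin T_Y T_Y])
  qed (simp_all add: J_fld Y_fld dong[OF Y_fld Y_fld Y_fld Y_loc Y_loc Y_loc] J0)
  then show ?thesis by (simp add: J0)
qed

text \<open>A qualitative Borcherds identity: only the spanning vectors are recorded, not the
  binomial coefficients. Induction goes downwards in \<open>n\<close> from the order of locality; at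
  fixed \<open>n\<close>, \<open>J_Suc\<close> moves the first index away from 0, where
  \<open>iterate\<close> gives the value.\<close>

lemma J_span: "J n (Y a) (Y b) m k v \<in> V.span (range (\<lambda>i. Y (Y a (n + int i) b) (m + k - int i) v))"
proof -
  obtain N where N: "\<And>n m k v. n \<ge> int N \<Longrightarrow> J n (Y a) (Y b) m k v = 0"
    using loc_J[OF Y_fld Y_fld Y_loc] by blast
  let ?S = "\<lambda>n s. range (\<lambda>i. Y (Y a (n + int i) b) (s - int i) v)"
  have "J n (Y a) (Y b) m k v \<in> V.span (?S n (m + k))"
    if "n \<ge> int N - int r" for n m k r
    using that
  proof (induction r arbitrary: n m k)
    case 0
    then show ?case by (simp add: N V.span_zero)
  next
    case (Suc r)
    have sub: "?S (n + 1) (s - 1) \<subseteq> ?S n s" for s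
    proof
      fix x assume "x \<in> ?S (n + 1) (s - 1)"
      then obtain i where "x = Y (Y a (n + 1 + int i) b) (s - 1 - int i) v" by blast
      then have "x = Y (Y a (n + int (Suc i)) b) (s - int (Suc i)) v"
        by (simp add: algebra_simps)
      then show "x \<in> ?S n s" by (rule range_eqI)
    qed
    have IH: "J (n + 1) (Y a) (Y b) m k v \<in> V.span (?S n (m + k + 1))" for m k
      using Suc.IH[of "n + 1" m k] Suc.prems V.span_mono[OF sub[of "m + k + 1"]] by auto
    have 0: "J n (Y a) (Y b) 0 k v \<in> V.span (?S n k)" for k
      by (rule V.span_base) (auto simp: iterate[symmetric] intro: range_eqI[of _ _ 0])
    have pos: "J n (Y a) (Y b) (int j) k v \<in> V.span (?S n (int j + k))" for j k
    proof (induction j arbitrary: k)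
      case (Suc j)
      have "J n (Y a) (Y b) (int j + 1) k v = J (n + 1) (Y a) (Y b) (int j) k v + J n (Y a) (Y b) (int j) (k + 1) v"
        by (simp add: J_Suc[OF Y_fld Y_fld])
      also have "\<dots> \<in> V.span (?S n (int j + k + 1))"
        using Suc[of "k + 1"] by (intro V.span_add IH) (simp add: algebra_simps)
      finally show ?case by (simp add: algebra_simps)
    qed (simp add: 0)
    have neg: "J n (Y a) (Y b) (- int j) k v \<in> V.span (?S n (k - int j))" for j k
    proof (induction j arbitrary: k)
      case (Suc j)
      have "J n (Y a) (Y b) (- 1 - int j) k v = J n (Y a) (Y b) (- int j) (k - 1) v - J (n + 1) (Y a) (Y b) (- 1 - int j) (k - 1) v"
        using J_Suc[OF Y_fld Y_fld, of n a b "- 1 - int j" "k - 1" v] by simp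
      also have "\<dots> \<in> V.span (?S n (k - 1 - int j))"
        using Suc[of "k - 1"] IH[of "- 1 - int j" "k - 1"] by (intro V.span_diff) (simp_all add: algebra_simps)
      finally show ?case by (simp add: algebra_simps)
    qed (simp add: 0)
    show ?case
    proof (cases "m \<ge> 0")
      case True
      then show ?thesis using pos[of "nat m" k] by simp
    next
      case False
      then show ?thesis using neg[of "nat (- m)" k] by (simp add: algebra_simps)
    qed
  qed
  from this[of "nat (int N - n)" n m k] show ?thesis by simp
qed

lemma commutator_span:
  "Y a m (Y b k v) - Y b k (Y a m v) \<in> V.span (range (\<lambda>i. Y (Y a (int i) b) (m + k - int i) v))"
  using J_span[of 0 a b m k v] by (simp add: J_0)

lemma zero_mode_derivation: "Y a 0 (Y b k v) = Y (Y a 0 b) k v + Y b k (Y a 0 v)"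
  by (simp add: iterate J_0)

lemma J_eq_0:
  assumes "\<And>i. Y a (n + int i) b = 0"
  shows "J n (Y a) (Y b) m k v = 0"
  using J_span[of n a b m k v] by (simp add: assms lin_0[OF Y_lin])

text \<open>When \<open>n\<close> is the last index with \<open>Y a n b\<close> possibly nonzero,
  \<open>J (n + 1)\<close> vanishes, so \<open>J n\<close> depends only on \<open>m + k\<close> and
  is known at \<open>m = 0\<close>.\<close>

lemma J_top:
  assumes "\<And>i. Y a (n + 1 + int i) b = 0"
  shows "J n (Y a) (Y b) m k v = Y (Y a n b) (m + k) v"
proof -
  have S: "J n (Y a) (Y b) (m + 1) k v = J n (Y a) (Y b) m (k + 1) v" for m k
    using J_Suc[OF Y_fld Y_fld, of n a b m k v] J_eq_0[of a "n + 1" b m k v] assms by simp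
  have "J n (Y a) (Y b) (int j) k v = J n (Y a) (Y b) 0 (int j + k) v" for j k
  proof (induction j arbitrary: k)
    case (Suc j)
    then show ?case using S[of "int j" k] by (simp add: algebra_simps)
  qed simp
  moreover have "J n (Y a) (Y b) (- int j) k v = J n (Y a) (Y b) 0 (k - int j) v" for j k
  proof (induction j arbitrary: k)
    case (Suc j)
    then show ?case using S[of "- 1 - int j" "k - 1"] by (simp add: algebra_simps)
  qed simp
  ultimately have "J n (Y a) (Y b) m k v = J n (Y a) (Y b) 0 (m + k) v"
  proof (cases "m \<ge> 0")
    case True
    then show ?thesis using \<open>\<And>j k. J n (Y a) (Y b) (int j) k v = _ j k\<close>[of "nat m" k] by simp
  next
    case False
    then show ?thesis using \<open>\<And>j k. J n (Y a) (Y b) (- int j) k v = _ j k\<close>[of "nat (- m)" k]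
      by (simp add: algebra_simps)
  qed
  then show ?thesis by (simp add: iterate)
qed

text \<open>The commutator formula when only the zeroth and first products survive. By
  \<open>J_top\<close> the increments of \<open>J 0\<close> in \<open>m\<close> are constant along
  \<open>m + k\<close>, so summing them produces the factor \<open>m\<close>.\<close>

lemma commutator_primary:
  assumes "\<And>i. Y a (2 + int i) b = 0"
  shows "Y a m (Y b k v) = Y b k (Y a m v) + Y (Y a 0 b) (m + k) v + of_int m *\<^sub>V Y (Y a 1 b) (m + k - 1) v"
proof -
  have 1: "J 1 (Y a) (Y b) m k v = Y (Y a 1 b) (m + k) v" for m k
    by (rule J_top) (simp add: assms)
  have S: "J 0 (Y a) (Y b) (m + 1) k v = Y (Y a 1 b) (m + k) v + J 0 (Y a) (Y b) m (k + 1) v" for m k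
    using J_Suc[OF Y_fld Y_fld, of 0 a b m k v] 1[of m k] by simp
  have "J 0 (Y a) (Y b) (int j) k v = J 0 (Y a) (Y b) 0 (int j + k) v + of_int (int j) *\<^sub>V Y (Y a 1 b) (int j + k - 1) v" for j k
  proof (induction j arbitrary: k)
    case (Suc j)
    show ?case
      using S[of "int j" k] Suc[of "k + 1"] by (simp add: algebra_simps scl_add_left)
  qed simp
  moreover have "J 0 (Y a) (Y b) (- int j) k v = J 0 (Y a) (Y b) 0 (k - int j) v + of_int (- int j) *\<^sub>V Y (Y a 1 b) (k - 1 - int j) v" for j k
  proof (induction j arbitrary: k)
    case (Suc j)
    show ?case
      using S[of "- 1 - int j" "k - 1"] Suc[of "k - 1"] by (simp add: algebra_simps scl_add_left scl_diff_left)
  qed simp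
  ultimately have "J 0 (Y a) (Y b) m k v = J 0 (Y a) (Y b) 0 (m + k) v + of_int m *\<^sub>V Y (Y a 1 b) (m + k - 1) v"
  proof (cases "m \<ge> 0")
    case True
    then show ?thesis using \<open>\<And>j k. J 0 (Y a) (Y b) (int j) k v = _ j k\<close>[of "nat m" k] by simp
  next
    case False
    then show ?thesis using \<open>\<And>j k. J 0 (Y a) (Y b) (- int j) k v = _ j k\<close>[of "nat (- m)" k]
      by (simp add: algebra_simps)
  qed
  then show ?thesis by (simp add: iterate[of a 0 b, symmetric]) (simp add: J_0 algebra_simps)
qed

lemma Y_vac_left: "Y vac k v = (if k = - 1 then v else 0)"
proof -
  let ?I = "\<lambda>(k::int) (v::V). if k = - 1 then v else 0"
  have "?I k v = Y (?I (- 1) vac) k v"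
  proof (rule Y_unique)
    show "fld ?I"
      unfolding fld_def by (intro conjI allI linI exI[of _ 0]) (auto simp: scl_add_right)
    show "loc ?I (Y c)" for c
      unfolding loc_def by (rule exI[of _ 0]) (simp add: lin_0[OF Y_lin2])
  qed (auto simp: lin_0[OF T_lin])
  then show ?thesis by simp
qed

text \<open>\<open>T a\<close> is the product of index \<open>- 2\<close> of \<open>a\<close> with
  the vacuum. Since the vacuum field is the identity, each half of the iterate formula has at most
  one term: the first contributes for negative \<open>k\<close>, the second for positive
  \<open>k\<close>.\<close>

lemma Y_T: "Y (T a) k v = - of_int k *\<^sub>V Y a (k - 1) v"
proof -
  have "Y a (- 2) vac = T a"
    using T_Y[of a "- 1" vac] by (simp add: Y_create T_vac lin_0[OF Y_lin2])
    have bc2: "bc (- 2) i = of_nat (Suc i)" for i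
    proof (induction i)
      case (Suc i)
      have "of_nat (Suc i) * bc (- 2) (Suc i) = of_nat (Suc i) * of_nat (Suc (Suc i))"
        unfolding bc_absorb Suc by (simp add: algebra_simps)
      then show ?case by (simp only: mult_cancel_left of_nat_eq_0_iff) simp
    qed simp
    have "bc (- 2) i *\<^sub>V Y a (0 + - 2 - int i) (Y vac (k + int i) v) =
        (if int i = - 1 - k then bc (- 2) i *\<^sub>V Y a (k - 1) v else 0)" for i
    proof (cases "int i = - 1 - k")
      case True
      then have "0 + - 2 - int i = k - 1" "k + int i = - 1" by simp_all
      then show ?thesis using True by (simp only: Y_vac_left) simp
    qed (auto simp: Y_vac_left lin_0[OF Y_lin2])
    then have 1: "iexp (- 2) (\<lambda>m k. Y a m (Y vac k v)) 0 k =
        (if - 1 - k \<ge> 0 then bc (- 2) (nat (- 1 - k)) *\<^sub>V Y a (k - 1) v else 0)"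
      unfolding iexp_def by (simp only: fsum_delta)
    have "bc (- 2) i *\<^sub>V Y vac (k + - 2 - int i) (Y a (0 + int i) v) =
        (if int i = k - 1 then bc (- 2) i *\<^sub>V Y a (k - 1) v else 0)" for i
      by (auto simp: Y_vac_left)
    then have 2: "iexp (- 2) (\<lambda>k m. Y vac k (Y a m v)) k 0 =
        (if k - 1 \<ge> 0 then bc (- 2) (nat (k - 1)) *\<^sub>V Y a (k - 1) v else 0)"
      unfolding iexp_def by (subst fsum_delta[symmetric]) (intro arg_cong[of _ _ fsum] ext)
    have "J (- 2) (Y a) (Y vac) 0 k v = - of_int k *\<^sub>V Y a (k - 1) v"
    proof -
      consider "k \<le> - 1" | "k = 0" | "k \<ge> 1" by linarith
      then show ?thesis
        unfolding J_def 1 2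
      proof cases
        case 1
        then have "bc (- 2) (nat (- 1 - k)) = - of_int k" by (simp add: bc2)
        with 1 show "(if - 1 - k \<ge> 0 then bc (- 2) (nat (- 1 - k)) *\<^sub>V Y a (k - 1) v else 0) - sg (- 2) *\<^sub>V
          (if k - 1 \<ge> 0 then bc (- 2) (nat (k - 1)) *\<^sub>V Y a (k - 1) v else 0) = - of_int k *\<^sub>V Y a (k - 1) v"
          by simp
      next
        case 3
        then have "bc (- 2) (nat (k - 1)) = of_int k" by (simp add: bc2)
        with 3 show "(if - 1 - k \<ge> 0 then bc (- 2) (nat (- 1 - k)) *\<^sub>V Y a (k - 1) v else 0) - sg (- 2) *\<^sub>V
          (if k - 1 \<ge> 0 then bc (- 2) (nat (k - 1)) *\<^sub>V Y a (k - 1) v else 0) = - of_int k *\<^sub>V Y a (k - 1) v"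
          by (simp add: sg_def)
      qed simp
    qed
    then show ?thesis by (simp add: iterate[symmetric] \<open>Y a (- 2) vac = T a\<close>)
qed

end

section \<open>The lattice vertex algebra\<close>

subsection \<open>Derivations and gradings\<close>

definition A :: "nat \<Rightarrow> V" where "A i = bv ({#i#}, 0)"
definition ex :: "int \<Rightarrow> V" where "ex n = bv ({#}, n)"

lemma bv_add_mset: "bv (add_mset i lam, n) = A i * bv (lam, n)"
  by (simp add: A_def bv_mult)

lemma ex_0 [simp]: "ex 0 = 1"
  by (simp add: ex_def)

lemma ex_mult: "ex m * ex n = ex (m + n)"
  by (simp add: ex_def bv_mult)

lemma ex_bv: "ex k * bv (lam, n) = bv (lam, n + k)"
  by (simp add: ex_def bv_mult add.commute)

lemma V_induct [case_names add scl mono]: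
  assumes "\<And>x y. P x \<Longrightarrow> P y \<Longrightarrow> P (x + y)" "\<And>c x. P x \<Longrightarrow> P (c *\<^sub>V x)" "\<And>lam n. P (bv (lam, n))"
  shows "P x"
proof -
  have "P 0" using assms(2)[OF assms(3), of 0] by simp
  have Pb: "P (bv b)" for b by (cases b) (simp add: assms(3))
  have "P (\<Sum>b\<in>S. f b *\<^sub>V bv b)" if "finite S" for S f
    using that by (induction S rule: finite_induct) (simp_all add: assms(1,2) \<open>P 0\<close> Pb)
  then show ?thesis by (subst V_expand) simp
qed

definition deriv :: "(V \<Rightarrow> V) \<Rightarrow> bool" where
  "deriv f \<longleftrightarrow> lin f \<and> (\<forall>x y. f (x * y) = f x * y + x * f y)"

lemma deriv_lin: "deriv f \<Longrightarrow> lin f"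
  and deriv_mult: "deriv f \<Longrightarrow> f (x * y) = f x * y + x * f y"
  by (simp_all add: deriv_def)

lemma deriv_1: "deriv f \<Longrightarrow> f 1 = 0"
  using deriv_mult[of f 1 1] by simp

lemma deriv_comm: "deriv f \<Longrightarrow> deriv g \<Longrightarrow> deriv (\<lambda>x. f (g x) - g (f x))"
proof -
  assume f: "deriv f" and g: "deriv g"
  show ?thesis
    unfolding deriv_def
  proof (intro conjI allI)
    show "lin (\<lambda>x. f (g x) - g (f x))"
      by (rule lin_minus_fun[OF lin_compose[OF deriv_lin[OF f] deriv_lin[OF g]] lin_compose[OF deriv_lin[OF g] deriv_lin[OF f]]])
    show "f (g (x * y)) - g (f (x * y)) = (f (g x) - g (f x)) * y + x * (f (g y) - g (f y))" for x y
      by (simp add: deriv_mult[OF f] deriv_mult[OF g] lin_add[OF deriv_lin[OF f]] lin_add[OF deriv_lin[OF g]] algebra_simps)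
  qed
qed

lemma deriv_zero: "deriv (\<lambda>x. 0)"
  by (simp add: deriv_def lin_zero)

lemma deriv_scale: "deriv f \<Longrightarrow> deriv (\<lambda>x. c *\<^sub>V f x)"
  unfolding deriv_def by (auto intro!: lin_scale_fun simp: scl_add_right scl_mult_left scl_mult_right)

lemma deriv_eqI:
  assumes "deriv f" "deriv g" "\<And>i. f (A i) = g (A i)" "\<And>n. f (ex n) = g (ex n)"
  shows "f x = g x"
proof (rule lin_eqI[of f g])
  fix b :: bas
  obtain lam n where b: "b = (lam, n)" by fastforce
  have "f (bv (lam, n)) = g (bv (lam, n))"
    by (induction lam) (simp_all add: bv_add_mset deriv_mult assms flip: ex_def)
  then show "f (bv b) = g (bv b)" by (simp add: b)
qed (use assms in \<open>auto simp: deriv_def\<close>)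

text \<open>The derivation with \<open>A i \<mapsto> d i\<close> and \<open>ex n \<mapsto> n u ex n\<close>.\<close>
definition der :: "(nat \<Rightarrow> V) \<Rightarrow> V \<Rightarrow> V \<Rightarrow> V" where
  "der d u = linext (\<lambda>(lam, n). (\<Sum>x\<in>#lam. d x * bv (lam - {#x#}, n)) + of_int n *\<^sub>V (u * bv (lam, n)))"

lemma der_bv: "der d u (bv (lam, n)) = (\<Sum>x\<in>#lam. d x * bv (lam - {#x#}, n)) + of_int n *\<^sub>V (u * bv (lam, n))"
  by (simp add: der_def)

lemma lin_der: "lin (der d u)"
  unfolding der_def by (rule lin_linext)

lemma der_bv_mult: "der d u (bv b * bv b') = der d u (bv b) * bv b' + bv b * der d u (bv b')"
proof -
  obtain lam n mu k where b: "b = (lam, n)" "b' = (mu, k)" by fastforce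
  have 1: "(\<Sum>x\<in>#lam. d x * bv (lam + mu - {#x#}, n + k)) = (\<Sum>x\<in>#lam. d x * bv (lam - {#x#}, n)) * bv (mu, k)"
    for lam mu n k
  proof -
    have "(\<Sum>x\<in>#lam. d x * bv (lam + mu - {#x#}, n + k)) = (\<Sum>x\<in>#lam. (d x * bv (lam - {#x#}, n)) * bv (mu, k))"
    proof (rule arg_cong[of _ _ sum_mset], rule image_mset_cong)
      fix x assume "x \<in># lam"
      then have "lam + mu - {#x#} = lam - {#x#} + mu" by (simp add: multiset_eq_iff)
      then show "d x * bv (lam + mu - {#x#}, n + k) = (d x * bv (lam - {#x#}, n)) * bv (mu, k)"
        by (simp add: mult.assoc bv_mult)
    qed
    then show ?thesis by (simp add: sum_mset_distrib_right)
  qed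
  have 2: "(\<Sum>x\<in>#mu. d x * bv (lam + mu - {#x#}, n + k)) = bv (lam, n) * (\<Sum>x\<in>#mu. d x * bv (mu - {#x#}, k))"
    using 1[of mu lam k n] by (simp add: ac_simps)
  have "bv b * bv b' = bv (lam + mu, n + k)" by (simp add: b bv_mult)
  then have "der d u (bv b * bv b') = (\<Sum>x\<in>#lam. d x * bv (lam + mu - {#x#}, n + k))
      + (\<Sum>x\<in>#mu. d x * bv (lam + mu - {#x#}, n + k)) + of_int (n + k) *\<^sub>V (u * (bv b * bv b'))"
    by (simp add: der_bv)
  also have "\<dots> = der d u (bv b) * bv b' + bv b * der d u (bv b')"
    unfolding 1 2 b der_bv by (simp add: scl_add_left scl_mult_left scl_mult_right algebra_simps)
  finally show ?thesis .
qed

lemma deriv_der: "deriv (der d u)"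
  unfolding deriv_def
proof (intro conjI lin_der allI)
  fix x y
  have 1: "der d u (bv b * y) = der d u (bv b) * y + bv b * der d u y" for b y
    by (rule lin_eqI[OF lin_compose[OF lin_der lin_mult] lin_plus[OF lin_mult lin_compose[OF lin_mult lin_der]]])
      (rule der_bv_mult)
  have "der d u (y * x) = y * der d u x + der d u y * x"
    by (rule lin_eqI[OF lin_compose[OF lin_der lin_mult] lin_plus[OF lin_compose[OF lin_mult lin_der] lin_mult]])
      (simp add: 1 mult.commute[of y] mult.commute[of "der d u y"])
  then show "der d u (x * y) = der d u x * y + x * der d u y"
    by (simp add: mult.commute add.commute)
qed

lemma der_A [simp]: "der d u (A i) = d i"
  by (simp add: A_def der_bv)

lemma der_ex [simp]: "der d u (ex n) = of_int n *\<^sub>V (u * ex n)"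
  by (simp add: ex_def der_bv)

text \<open>Charge \<open>c\<close> and \<open>M(1)\<close>-degree \<open>d\<close>. The degree is
  an integer, so that modes shift it freely; a negative degree forces the vector to be 0 by
  \<open>hom_neg\<close>, which is the standard way to see that a mode vanishes.\<close>

definition hom :: "int \<Rightarrow> int \<Rightarrow> V set" where
  "hom c d = {x. \<forall>b\<in>Poly_Mapping.keys x. snd b = c \<and> int (deg (fst b)) = d}"

lemma hom_subspace: "V.subspace (hom c d)"
  unfolding V.subspace_def hom_def
proof (intro conjI ballI CollectI)
  fix x y :: V and b
  assume "x \<in> {x. \<forall>b\<in>Poly_Mapping.keys x. snd b = c \<and> int (deg (fst b)) = d}"
    "y \<in> {x. \<forall>b\<in>Poly_Mapping.keys x. snd b = c \<and> int (deg (fst b)) = d}" "b \<in> Poly_Mapping.keys (x + y)"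
  then show "snd b = c" "int (deg (fst b)) = d"
    using Poly_Mapping.keys_add[of x y] by auto
qed (auto simp: in_keys_iff)

lemmas hom_0 [simp] = V.subspace_0[OF hom_subspace]
lemmas hom_add = V.subspace_add[OF hom_subspace]
lemmas hom_scl = V.subspace_scale[OF hom_subspace]
lemmas hom_sum = V.subspace_sum[OF hom_subspace]

lemma deg_empty [simp]: "deg {#} = 0"
  and deg_add_mset [simp]: "deg (add_mset i lam) = Suc i + deg lam"
  and deg_plus: "deg (lam + mu) = deg lam + deg mu"
  by (simp_all add: deg_def)

lemma bv_hom: "bv (lam, n) \<in> hom n (int (deg lam))"
  by (simp add: hom_def)

lemma hom_neg: "x \<in> hom c d \<Longrightarrow> d < 0 \<Longrightarrow> x = 0"
  unfolding hom_def using keys_eq_empty by fastforce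

lemma hom_mult:
  assumes "x \<in> hom c d" "y \<in> hom c' d'"
  shows "x * y \<in> hom (c + c') (d + d')"
  unfolding hom_def
proof (intro CollectI ballI)
  fix b assume "b \<in> Poly_Mapping.keys (x * y)"
  then obtain b1 b2 where "b = b1 + b2" "b1 \<in> Poly_Mapping.keys x" "b2 \<in> Poly_Mapping.keys y"
    using Poly_Mapping.keys_mult by blast
  then show "snd b = c + c' \<and> int (deg (fst b)) = d + d'"
    using assms by (auto simp: hom_def deg_plus)
qed

lemma A_hom: "A i \<in> hom 0 (int i + 1)"
  and ex_hom: "ex n \<in> hom n 0"
  and one_hom: "1 \<in> hom 0 0"
  using bv_hom[of "{#i#}" 0] bv_hom[of "{#}" n] bv_hom[of "{#}" 0] by (simp_all add: A_def ex_def add.commute)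

lemma der_hom:
  assumes "\<And>i. d i \<in> hom 0 (int i + 1 + s)" "u \<in> hom 0 s" "x \<in> hom c e"
  shows "der d u x \<in> hom c (e + s)"
proof -
  have "der d u (bv b) \<in> hom c (e + s)" if "b \<in> Poly_Mapping.keys x" for b
  proof -
    have "snd b = c" "int (deg (fst b)) = e"
      using assms(3) that by (auto simp: hom_def)
    then obtain lam where b: "b = (lam, c)" and e: "e = int (deg lam)"
      by (cases b) auto
    have "der d u (bv (lam, c)) \<in> hom c (int (deg lam) + s)" for lam
    proof (induction lam)
      case empty
      have "u * ex c \<in> hom (0 + c) (s + 0)" by (intro hom_mult assms ex_hom)
      then show ?case by (simp flip: ex_def add: hom_scl)
    next
      case (add i lam)
      have "d i * bv (lam, c) \<in> hom (0 + c) (int i + 1 + s + int (deg lam))"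
        by (intro hom_mult assms bv_hom)
      moreover have "A i * der d u (bv (lam, c)) \<in> hom (0 + c) (int i + 1 + (int (deg lam) + s))"
        by (intro hom_mult A_hom add)
      ultimately show ?case
        by (auto simp: bv_add_mset deriv_mult[OF deriv_der] algebra_simps intro!: hom_add)
    qed
    then show ?thesis by (simp add: b e)
  qed
  then show ?thesis
    by (subst V_expand) (simp add: lin_sum[OF lin_der] lin_scl[OF lin_der] hom_sum hom_scl)
qed

subsection \<open>Heisenberg modes and the exponential operators\<close>

locale lattice =
  fixes p :: nat
  assumes p2: "p \<ge> 2"
begin

abbreviation cp :: complex where "cp \<equiv> of_nat p"

lemma p_nz [simp]: "p \<noteq> 0"
  using p2 by simp

text \<open>The Heisenberg mode \<alpha>(j) on a polynomial ring: a multiplication for negative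
  \<open>j\<close>, otherwise a derivation. Commutation relations of derivations then need checking
  only on the generators, by \<open>deriv_eqI\<close>.\<close>

definition h :: "int \<Rightarrow> V \<Rightarrow> V" where
  "h j = (if j < 0 then (*) (A (nat (- j) - 1))
          else if j = 0 then der (\<lambda>_. 0) ((2 * cp) *\<^sub>V 1)
          else der (\<lambda>x. if int x + 1 = j then (2 * cp * of_int j) *\<^sub>V 1 else 0) 0)"

text \<open>The translation operator, later identified with \<open>L (- 1)\<close>.\<close>

definition Td :: "V \<Rightarrow> V" where
  "Td = der (\<lambda>x. of_nat (Suc x) *\<^sub>V A (Suc x)) (A 0)"

lemma h_neg: "i > 0 \<Longrightarrow> h (- int i) x = A (i - 1) * x"
  by (simp add: h_def)

lemma h_neg1: "h (- int i - 1) x = A i * x"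
proof -
  have "- int i - 1 = - int (Suc i)" by simp
  then show ?thesis using h_neg[of "Suc i" x] by (simp only:) simp
qed

lemma deriv_h: "j \<ge> 0 \<Longrightarrow> deriv (h j)"
  by (simp add: h_def deriv_der)

lemma lin_h: "lin (h j)"
  by (cases "j \<ge> 0") (rule deriv_lin[OF deriv_h], assumption, simp add: h_def lin_mult)

lemma deriv_Td: "deriv Td"
  by (simp add: Td_def deriv_der)

lemma lin_Td: "lin Td"
  by (rule deriv_lin[OF deriv_Td])

lemma h_A: "j > 0 \<Longrightarrow> h j (A i) = (if int i + 1 = j then (2 * cp * of_int j) *\<^sub>V 1 else 0)"
  and h_ex: "j > 0 \<Longrightarrow> h j (ex n) = 0"
  and h0_A [simp]: "h 0 (A i) = 0"
  by (simp_all add: h_def)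

lemma h0_ex [simp]: "h 0 (ex n) = (2 * cp * of_int n) *\<^sub>V ex n"
  by (simp add: h_def scl_mult_left)

lemma Td_A: "Td (A i) = of_nat (Suc i) *\<^sub>V A (Suc i)"
  and Td_ex: "Td (ex n) = of_int n *\<^sub>V (A 0 * ex n)"
  by (simp_all add: Td_def)

lemma h0_hom: "x \<in> hom c d \<Longrightarrow> h 0 x = (2 * cp * of_int c) *\<^sub>V x"
proof -
  assume x: "x \<in> hom c d"
  have 1: "h 0 (bv (lam, n)) = (2 * cp * of_int n) *\<^sub>V bv (lam, n)" for lam n
    by (induction lam) (simp_all add: bv_add_mset deriv_mult[OF deriv_h] scl_mult_right flip: ex_def)
  have "h 0 (bv b) = (2 * cp * of_int c) *\<^sub>V bv b" if "b \<in> Poly_Mapping.keys x" for b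
    using x that 1[of "fst b" "snd b"] by (auto simp: hom_def)
  then show ?thesis
    by (subst (1 2) V_expand) (simp add: lin_sum[OF lin_h] lin_scl[OF lin_h] scl_sum_right mult.commute)
qed

lemma h_hom: "x \<in> hom c d \<Longrightarrow> h j x \<in> hom c (d - j)"
proof -
  assume x: "x \<in> hom c d"
  consider "j < 0" | "j = 0" | "j > 0" by linarith
  then show ?thesis
  proof cases
    case 1
    have "A (nat (- j) - 1) * x \<in> hom (0 + c) (int (nat (- j) - 1) + 1 + d)" by (intro hom_mult A_hom x)
    moreover have "int (nat (- j) - 1) + 1 + d = d - j" using 1 by simp
    ultimately show ?thesis using 1 by (simp add: h_def)
  next
    case 2
    then show ?thesis using x by (simp add: h0_hom hom_scl)
  next
    case 3
    have "der (\<lambda>x. if int x + 1 = j then (2 * cp * of_int j) *\<^sub>V 1 else 0) 0 x \<in> hom c (d + - j)"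
      by (rule der_hom) (auto simp: hom_scl one_hom x)
    then show ?thesis using 3 by (simp add: h_def)
  qed
qed

lemma Td_hom: "x \<in> hom c d \<Longrightarrow> Td x \<in> hom c (d + 1)"
proof -
  have "A (Suc i) \<in> hom 0 (int i + 1 + 1)" for i
    using A_hom[of "Suc i"] by (simp add: add.commute)
  then show "x \<in> hom c d \<Longrightarrow> Td x \<in> hom c (d + 1)"
    unfolding Td_def using A_hom[of 0] by (intro der_hom hom_scl) auto
qed

lemma h_comm: "h i (h j x) - h j (h i x) = (if i + j = 0 then (2 * cp * of_int i) *\<^sub>V x else 0)"
proof -
  have D: "h i (h j x) = h j (h i x)" if "i \<ge> 0" "j \<ge> 0" for i j
  proof -
    have "h i (h j x) - h j (h i x) = (\<lambda>x. 0) x"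
      by (rule deriv_eqI[of "\<lambda>x. h i (h j x) - h j (h i x)"])
        (use that in \<open>auto intro!: deriv_comm deriv_h deriv_zero simp: h_A h_ex deriv_1[OF deriv_h] lin_0[OF lin_h] lin_scl[OF lin_h]
          le_less\<close>)
    then show ?thesis by simp
  qed
  have M: "h i (h (- int j - 1) x) - h (- int j - 1) (h i x) = (if i = int j + 1 then (2 * cp * of_int i) *\<^sub>V x else 0)"
    if "i \<ge> 0" for i j
    using that by (auto simp: h_neg1 deriv_mult[OF deriv_h] h_A le_less scl_mult_left)
  consider "i \<ge> 0" "j \<ge> 0" | "i \<ge> 0" "j < 0" | "i < 0" "j \<ge> 0" | "i < 0" "j < 0" by linarith
  then show ?thesis
  proof cases
    case 1
    then show ?thesis using D by auto
  next
    case 2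
    then show ?thesis using M[of i "nat (- j - 1)"] by auto
  next
    case 3
    have "h j (h i x) - h i (h j x) = (if j = - i then (2 * cp * of_int j) *\<^sub>V x else 0)"
      using M[of j "nat (- i - 1)"] 3 by simp
    moreover have "h i (h j x) - h j (h i x) = - (h j (h i x) - h i (h j x))" by simp
    ultimately have "h i (h j x) - h j (h i x) = - (if j = - i then (2 * cp * of_int j) *\<^sub>V x else 0)"
      by (simp only:)
    then show ?thesis by (auto simp: add_eq_0_iff2)
  next
    case 4
    then show ?thesis by (simp add: h_def mult.left_commute)
  qed
qed

lemma h_commute: "i > 0 \<Longrightarrow> j \<ge> 0 \<Longrightarrow> h i (h j x) = h j (h i x)"
  using h_comm[of i j x] by auto

lemma Td_h: "Td (h j x) = h j (Td x) - of_int j *\<^sub>V h (j - 1) x"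
proof -
  consider "j < 0" | "j = 0" | "j > 0" by linarith
  then show ?thesis
  proof cases
    case 1
    define i where "i = nat (- j - 1)"
    have j: "j = - int i - 1" "j - 1 = - int (Suc i) - 1" using 1 by (simp_all add: i_def)
    have "of_int j = (- of_nat (Suc i) :: complex)" by (simp add: j(1))
    then show ?thesis
      unfolding j(2) h_neg1 unfolding j(1) h_neg1
      by (simp only: deriv_mult[OF deriv_Td] Td_A scl_mult_left)
        (simp add: scl_minus_left[symmetric] add.commute del: scl_minus_left)
  next
    case 2
    have "Td (h 0 x) - h 0 (Td x) = (\<lambda>x. 0) x"
      by (rule deriv_eqI[of "\<lambda>x. Td (h 0 x) - h 0 (Td x)"])
        (auto intro!: deriv_comm deriv_h deriv_Td deriv_zero simp: Td_A Td_ex lin_0[OF lin_Td] lin_scl[OF lin_Td] lin_scl[OF lin_h]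
          deriv_mult[OF deriv_h] scl_mult_right mult.commute)
    then show ?thesis using 2 by simp
  next
    case 3
    have h1: "h (j - 1) (A i) = (if int i + 1 = j - 1 then (2 * cp * of_int (j - 1)) *\<^sub>V 1 else 0)" for i
      using 3 by (cases "j = 1") (auto simp: h_A)
    have "Td (h j x) - h j (Td x) = (\<lambda>x. (- of_int j) *\<^sub>V h (j - 1) x) x"
    proof (rule deriv_eqI[OF deriv_comm[OF deriv_Td deriv_h] deriv_scale[OF deriv_h]])
      fix i
      show "Td (h j (A i)) - h j (Td (A i)) = (- of_int j) *\<^sub>V h (j - 1) (A i)"
        unfolding h1 Td_A lin_scl[OF lin_h] h_A[OF 3]
        by (auto simp: lin_0[OF lin_Td] lin_scl[OF lin_Td] deriv_1[OF deriv_Td])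
    next
      fix n
      show "Td (h j (ex n)) - h j (Td (ex n)) = (- of_int j) *\<^sub>V h (j - 1) (ex n)"
        using 3 by (cases "j = 1") (auto simp: h_A h_ex Td_ex lin_0[OF lin_Td] lin_scl[OF lin_h] deriv_mult[OF deriv_h] scl_mult_left)
    qed (use 3 in simp_all)
    then show ?thesis by (simp add: algebra_simps)
  qed
qed

section \<open>The coefficients of the creation and annihilation exponentials\<close>

fun Sn :: "complex \<Rightarrow> nat \<Rightarrow> V" where
  "Sn k m = (if m = 0 then 1 else
     (1 / of_nat m) *\<^sub>V (\<Sum>i\<in>{1..m}. k *\<^sub>V (A (i - 1) * Sn k (m - i))))"

fun Tn :: "int \<Rightarrow> nat \<Rightarrow> V \<Rightarrow> V" where
  "Tn k m x = (if m = 0 then x else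
     (- 1 / of_nat m) *\<^sub>V (\<Sum>i\<in>{1..m}. of_int k *\<^sub>V h (int i) (Tn k (m - i) x)))"

declare Sn.simps [simp del] Tn.simps [simp del]

text \<open>The integer index, with value 0 below zero, lets sums be shifted without case
  distinctions. The parameter is complex because \<open>1 / (2 p)\<close> occurs in
  \<open>ex_in_image\<close>.\<close>

definition S :: "complex \<Rightarrow> int \<Rightarrow> V" where
  "S k a = (if a < 0 then 0 else Sn k (nat a))"

definition T :: "int \<Rightarrow> int \<Rightarrow> V \<Rightarrow> V" where
  "T k a x = (if a < 0 then 0 else Tn k (nat a) x)"

lemma S_neg [simp]: "a < 0 \<Longrightarrow> S k a = 0"
  and S_0 [simp]: "S k 0 = 1"
  and T_neg [simp]: "a < 0 \<Longrightarrow> T l a x = 0"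
  and T_0 [simp]: "T l 0 x = x"
  by (simp_all add: S_def T_def Sn.simps Tn.simps)

lemma S_rec:
  assumes "int N \<ge> a"
  shows "of_int a *\<^sub>V S k a = k *\<^sub>V (\<Sum>i\<in>{1..N}. A (i - 1) * S k (a - int i))"
proof (cases "a > 0")
  case True
  have "of_int a *\<^sub>V S k a = k *\<^sub>V (\<Sum>i\<in>{1..nat a}. A (i - 1) * Sn k (nat a - i))"
    using True by (simp add: S_def Sn.simps[of k "nat a"] scl_sum_right del: scl_scl)
  also have "(\<Sum>i\<in>{1..nat a}. A (i - 1) * Sn k (nat a - i)) = (\<Sum>i\<in>{1..nat a}. A (i - 1) * S k (a - int i))"
    by (rule sum.cong) (auto simp: S_def nat_diff_distrib)
  also have "\<dots> = (\<Sum>i\<in>{1..N}. A (i - 1) * S k (a - int i))"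
    using assms by (intro sum.mono_neutral_left) auto
  finally show ?thesis .
next
  case False
  then have "S k (a - int i) = 0" if "i \<ge> 1" for i using that by (intro S_neg) linarith
  then have "(\<Sum>i\<in>{1..N}. A (i - 1) * S k (a - int i)) = 0" by (intro sum.neutral) auto
  then show ?thesis using False by (cases "a = 0") auto
qed

lemma lin_T: "lin (T k a)"
proof -
  have "lin (Tn k m)" for m
  proof (induction m rule: less_induct)
    case (less m)
    show ?case
    proof (cases "m = 0")
      case True
      then show ?thesis by (simp add: Tn.simps[abs_def] lin_def)
    next
      case False
      have "lin (\<lambda>x. (- 1 / of_nat m) *\<^sub>V (\<Sum>i\<in>{1..m}. of_int k *\<^sub>V h (int i) (Tn k (m - i) x)))"
        by (intro lin_scale_fun lin_sum_fun lin_compose[OF lin_h] less) auto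
      then show ?thesis using False by (simp add: Tn.simps[abs_def])
    qed
  qed
  then show ?thesis unfolding T_def[abs_def] by (cases "a < 0") (simp_all add: lin_zero)
qed

lemma T_rec:
  assumes "int N \<ge> a"
  shows "of_int a *\<^sub>V T k a x = - of_int k *\<^sub>V (\<Sum>i\<in>{1..N}. h (int i) (T k (a - int i) x))"
proof (cases "a > 0")
  case True
  have "of_int a *\<^sub>V T k a x = (of_int a * (- 1 / of_nat (nat a))) *\<^sub>V (\<Sum>i\<in>{1..nat a}. of_int k *\<^sub>V h (int i) (Tn k (nat a - i) x))"
    using True by (simp add: T_def Tn.simps[of k "nat a"])
  also have "of_int a * (- 1 / of_nat (nat a)) = (- 1 :: complex)"
    using True by simp
  also have "(\<Sum>i\<in>{1..nat a}. of_int k *\<^sub>V h (int i) (Tn k (nat a - i) x)) = of_int k *\<^sub>V (\<Sum>i\<in>{1..nat a}. h (int i) (T k (a - int i) x))"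
    unfolding scl_sum_right by (rule sum.cong) (auto simp: T_def nat_diff_distrib)
  also have "(\<Sum>i\<in>{1..nat a}. h (int i) (T k (a - int i) x)) = (\<Sum>i\<in>{1..N}. h (int i) (T k (a - int i) x))"
    using assms by (intro sum.mono_neutral_left) (auto simp: lin_0[OF lin_h])
  finally show ?thesis by simp
next
  case False
  then have "T k (a - int i) x = 0" if "i \<ge> 1" for i using that by (intro T_neg) linarith
  then have "(\<Sum>i\<in>{1..N}. h (int i) (T k (a - int i) x)) = 0" by (intro sum.neutral) (auto simp: lin_0[OF lin_h])
  then show ?thesis using False by (cases "a = 0") auto
qed

lemma int_strong_induct [case_names neg zero pos]:
  fixes a :: int
  assumes "\<And>a. a < 0 \<Longrightarrow> P a" "P 0" "\<And>a. a > 0 \<Longrightarrow> (\<And>b. b < a \<Longrightarrow> P b) \<Longrightarrow> P a"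
  shows "P a"
proof (induction "nat a" arbitrary: a rule: less_induct)
  case less
  then show ?case
    using assms by (metis linorder_neqE_linordered_idom nat_mono_iff)
qed

lemma S_hom: "S k a \<in> hom 0 a"
proof (induction a rule: int_strong_induct)
  case (pos a)
  have "of_int a *\<^sub>V S k a = k *\<^sub>V (\<Sum>i\<in>{1..nat a}. A (i - 1) * S k (a - int i))"
    by (rule S_rec) simp
  moreover have "A (i - 1) * S k (a - int i) \<in> hom 0 a" if "i \<in> {1..nat a}" for i
    using hom_mult[OF A_hom[of "i - 1"] pos(2)[of "a - int i"]] that by (simp add: of_nat_diff)
  ultimately have "of_int a *\<^sub>V S k a \<in> hom 0 a" by (simp only: hom_scl hom_sum)
  then have "(1 / of_int a) *\<^sub>V of_int a *\<^sub>V S k a \<in> hom 0 a" by (rule hom_scl)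
  then show ?case using pos by simp
qed (simp_all add: one_hom)

lemma T_hom: "x \<in> hom c d \<Longrightarrow> T k a x \<in> hom c (d - a)"
proof (induction a rule: int_strong_induct)
  case (pos a)
  have "of_int a *\<^sub>V T k a x = - of_int k *\<^sub>V (\<Sum>i\<in>{1..nat a}. h (int i) (T k (a - int i) x))"
    by (rule T_rec) simp
  moreover have "h (int i) (T k (a - int i) x) \<in> hom c (d - a)" if "i \<in> {1..nat a}" for i
    using h_hom[OF pos(2)[of "a - int i", OF _ pos(3)], of "int i"] that by simp
  ultimately have "of_int a *\<^sub>V T k a x \<in> hom c (d - a)" by (simp only: hom_scl hom_sum)
  then have "(1 / of_int a) *\<^sub>V of_int a *\<^sub>V T k a x \<in> hom c (d - a)" by (rule hom_scl)
  then show ?case using pos by simp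
qed simp_all

end

lemma sum_shift_int:
  fixes f :: "int \<Rightarrow> V"
  assumes "\<And>c. c < 0 \<Longrightarrow> f c = 0" "\<And>c. c \<ge> int N \<Longrightarrow> f c = 0" "M \<ge> N + i"
  shows "(\<Sum>c<M. f (int c - int i)) = (\<Sum>c<N. f (int c))"
proof -
  have "(\<Sum>c<M. f (int c - int i)) = (\<Sum>c\<in>{i..<i + N}. f (int c - int i))"
    using assms by (intro sum.mono_neutral_right) (auto simp: not_less)
  also have "\<dots> = (\<Sum>c<N. f (int c))"
    by (rule sum.reindex_bij_witness[of _ "\<lambda>c. c + i" "\<lambda>c. c - i"]) (auto simp: of_nat_diff)
  finally show ?thesis .
qed

lemma double_sum_diag:
  fixes g :: "nat \<Rightarrow> V" and f :: "nat \<Rightarrow> complex"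
  assumes "\<And>r. r \<ge> N \<Longrightarrow> g r = 0"
  shows "(\<Sum>j\<in>{1..N}. \<Sum>i<N. f i *\<^sub>V g (i + j)) = (\<Sum>r<N. (\<Sum>i<r. f i) *\<^sub>V g r)"
proof -
  have "(\<Sum>j\<in>{1..N}. \<Sum>i<N. f i *\<^sub>V g (i + j)) = (\<Sum>i<N. \<Sum>j\<in>{1..N}. f i *\<^sub>V g (i + j))"
    by (rule sum.swap)
  also have "\<dots> = (\<Sum>i<N. \<Sum>r<N. if i < r then f i *\<^sub>V g r else 0)"
  proof (rule sum.cong[OF refl])
    fix i
    have "(\<Sum>j\<in>{1..N}. f i *\<^sub>V g (i + j)) = (\<Sum>r\<in>{i+1..i+N}. f i *\<^sub>V g r)"
      by (rule sum.reindex_bij_witness[of _ "\<lambda>r. r - i" "\<lambda>j. i + j"]) auto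
    also have "\<dots> = (\<Sum>r\<in>{i+1..<N}. f i *\<^sub>V g r)"
      using assms by (intro sum.mono_neutral_right) auto
    also have "\<dots> = (\<Sum>r\<in>{..<N}. if i < r then f i *\<^sub>V g r else 0)"
      by (intro sum.mono_neutral_cong_left) auto
    finally show "(\<Sum>j\<in>{1..N}. f i *\<^sub>V g (i + j)) = (\<Sum>r<N. if i < r then f i *\<^sub>V g r else 0)" .
  qed
  also have "\<dots> = (\<Sum>r<N. \<Sum>i<N. if i < r then f i *\<^sub>V g r else 0)"
    by (rule sum.swap)
  also have "\<dots> = (\<Sum>r<N. (\<Sum>i<r. f i) *\<^sub>V g r)"
  proof (rule sum.cong[OF refl])
    fix r assume "r \<in> {..<N}"
    have "(\<Sum>i<N. if i < r then f i *\<^sub>V g r else 0) = (\<Sum>i<r. f i *\<^sub>V g r)"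
      using \<open>r \<in> {..<N}\<close> by (intro sum.mono_neutral_cong_right) auto
    then show "(\<Sum>i<N. if i < r then f i *\<^sub>V g r else 0) = (\<Sum>i<r. f i) *\<^sub>V g r"
      by (simp add: scl_sum_left)
  qed
  finally show ?thesis .
qed

text \<open>The coefficient form of \<open>t f'(t) = - M t / (1 - t) f(t)\<close> for
  \<open>f(t) = (1 - t) ^ M\<close>.\<close>

lemma bc_partial_sum: "of_nat r * bc M r = - of_int M * (\<Sum>i<r. bc M i)"
proof (induction r)
  case (Suc r)
  have "of_nat (Suc r) * bc M (Suc r) = - of_int M * bc M r + of_nat r * bc M r"
    unfolding bc_absorb by (simp add: algebra_simps)
  then show ?case by (simp only: Suc) (simp add: algebra_simps)
qed simp

lemma scl_cancel: "c \<noteq> 0 \<Longrightarrow> c *\<^sub>V x = c *\<^sub>V y \<Longrightarrow> x = y"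
  by (simp add: V.scale_left_imp_eq)

context lattice
begin

text \<open>\<open>S k\<close> lists the coefficients of the exponential of \<open>k\<close> times
  the sum of \<open>A (n - 1) z ^ n / n\<close>, and \<open>h i\<close> is \<open>2 p i\<close>
  times the partial derivative by \<open>A (i - 1)\<close>; it brings down
  \<open>2 p k z ^ i\<close>.\<close>

lemma S_h:
  assumes "i > 0"
  shows "h i (S k a) = (2 * cp * k) *\<^sub>V S k (a - i)"
proof (induction a rule: int_strong_induct)
  case (neg a)
  then show ?case using assms by (simp add: lin_0[OF lin_h])
next
  case zero
  then show ?case using assms by (simp add: deriv_1[OF deriv_h])
next
  case (pos a)
  define N where "N = nat (a + i)"
  have N: "int N \<ge> a" "int N \<ge> a - i" "nat i \<in> {1..N}" using assms pos by (auto simp: N_def)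
  have "of_int a *\<^sub>V h i (S k a) = h i (of_int a *\<^sub>V S k a)"
    by (simp only: lin_scl[OF lin_h])
  also have "\<dots> = k *\<^sub>V (\<Sum>j\<in>{1..N}. h i (A (j - 1)) * S k (a - int j) + A (j - 1) * h i (S k (a - int j)))"
    unfolding S_rec[OF N(1)] lin_scl[OF lin_h] lin_sum[OF lin_h] using assms
    by (simp add: deriv_mult[OF deriv_h])
  also have "(\<Sum>j\<in>{1..N}. h i (A (j - 1)) * S k (a - int j) + A (j - 1) * h i (S k (a - int j))) =
    (\<Sum>j\<in>{1..N}. if j = nat i then (2 * cp * of_int i) *\<^sub>V S k (a - i) else 0) +
    (2 * cp * k) *\<^sub>V (\<Sum>j\<in>{1..N}. A (j - 1) * S k (a - i - int j))"
    unfolding scl_sum_right sum.distrib[symmetric]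
  proof (rule sum.cong[OF refl])
    fix j assume j: "j \<in> {1..N}"
    have "h i (S k (a - int j)) = (2 * cp * k) *\<^sub>V S k (a - i - int j)"
      using pos(2)[of "a - int j"] j by (simp add: algebra_simps)
    moreover have "h i (A (j - 1)) = (if j = nat i then (2 * cp * of_int i) *\<^sub>V 1 else 0)"
      using assms j by (auto simp: h_A of_nat_diff)
    ultimately show "h i (A (j - 1)) * S k (a - int j) + A (j - 1) * h i (S k (a - int j)) =
       (if j = nat i then (2 * cp * of_int i) *\<^sub>V S k (a - i) else 0) + (2 * cp * k) *\<^sub>V (A (j - 1) * S k (a - i - int j))"
      using assms by (simp add: scl_mult_left scl_mult_right)
  qed
  also have "(\<Sum>j\<in>{1..N}. if j = nat i then (2 * cp * of_int i) *\<^sub>V S k (a - i) else 0) = (2 * cp * of_int i) *\<^sub>V S k (a - i)"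
    using N(3) by (simp add: sum.delta)
  also have "k *\<^sub>V ((2 * cp * of_int i) *\<^sub>V S k (a - i) + (2 * cp * k) *\<^sub>V (\<Sum>j\<in>{1..N}. A (j - 1) * S k (a - i - int j)))
      = (2 * cp * k) *\<^sub>V (of_int i *\<^sub>V S k (a - i) + k *\<^sub>V (\<Sum>j\<in>{1..N}. A (j - 1) * S k (a - i - int j)))"
    by (simp add: scl_add_right mult_ac)
  also have "k *\<^sub>V (\<Sum>j\<in>{1..N}. A (j - 1) * S k (a - i - int j)) = of_int (a - i) *\<^sub>V S k (a - i)"
    by (rule S_rec[symmetric]) (rule N)
  also have "of_int i *\<^sub>V S k (a - i) + of_int (a - i) *\<^sub>V S k (a - i) = of_int a *\<^sub>V S k (a - i)"
    by (simp add: scl_add_left[symmetric])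
  finally have "of_int a *\<^sub>V h i (S k a) = of_int a *\<^sub>V (2 * cp * k) *\<^sub>V S k (a - i)"
    by (simp add: mult_ac)
  then show ?case using pos by (elim scl_cancel[rotated]) simp
qed

text \<open>On the exponent, \<open>Td\<close> acts as \<open>d/dz\<close> except that the lowest
  term \<open>k A 0\<close> is missing.\<close>

lemma S_Td: "Td (S k a) = of_int (a + 1) *\<^sub>V S k (a + 1) - k *\<^sub>V (A 0 * S k a)"
proof (induction a rule: int_strong_induct)
  case (neg a)
  then show ?case by (cases "a = - 1") (auto simp: lin_0[OF lin_Td])
next
  case zero
  have "of_int 1 *\<^sub>V S k 1 = k *\<^sub>V (\<Sum>i\<in>{1..1}. A (i - 1) * S k (1 - int i))"
    by (rule S_rec) simp
  then show ?case by (simp add: deriv_1[OF deriv_Td])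
next
  case (pos a)
  define N where "N = nat a"
  have N: "int N = a" using pos by (simp add: N_def)
  let ?s = "\<lambda>j. A (j - 1) * S k (a + 1 - int j)"
  have "of_int a *\<^sub>V Td (S k a) = Td (of_int a *\<^sub>V S k a)"
    by (simp only: lin_scl[OF lin_Td])
  also have "\<dots> = k *\<^sub>V (\<Sum>j\<in>{1..N}. Td (A (j - 1)) * S k (a - int j) + A (j - 1) * Td (S k (a - int j)))"
    using S_rec[of a N k] by (simp add: N lin_scl[OF lin_Td] lin_sum[OF lin_Td] deriv_mult[OF deriv_Td])
  also have "(\<Sum>j\<in>{1..N}. Td (A (j - 1)) * S k (a - int j) + A (j - 1) * Td (S k (a - int j))) =
     (\<Sum>j\<in>{1..N}. of_nat j *\<^sub>V (A j * S k (a - int j))) + (\<Sum>j\<in>{1..N}. of_int (a - int j + 1) *\<^sub>V ?s j)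
     - A 0 * (k *\<^sub>V (\<Sum>j\<in>{1..N}. A (j - 1) * S k (a - int j)))"
    unfolding scl_sum_right sum_distrib_left sum.distrib[symmetric] sum_subtractf[symmetric]
  proof (rule sum.cong[OF refl])
    fix j assume j: "j \<in> {1..N}"
    have "Td (S k (a - int j)) = of_int (a - int j + 1) *\<^sub>V S k (a + 1 - int j) - k *\<^sub>V (A 0 * S k (a - int j))"
      using pos(2)[of "a - int j"] j by (simp add: algebra_simps)
    moreover have "Td (A (j - 1)) = of_nat j *\<^sub>V A j"
      using j Td_A[of "j - 1"] by simp
    ultimately show "Td (A (j - 1)) * S k (a - int j) + A (j - 1) * Td (S k (a - int j)) =
       of_nat j *\<^sub>V (A j * S k (a - int j)) + of_int (a - int j + 1) *\<^sub>V ?s j - A 0 * (k *\<^sub>V (A (j - 1) * S k (a - int j)))"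
      by (simp add: scl_mult_left scl_mult_right right_diff_distrib mult.left_commute)
  qed
  also have "k *\<^sub>V (\<Sum>j\<in>{1..N}. A (j - 1) * S k (a - int j)) = of_int a *\<^sub>V S k a"
    by (rule S_rec[symmetric]) (simp add: N)
  also have "(\<Sum>j\<in>{1..N}. of_nat j *\<^sub>V (A j * S k (a - int j))) = (\<Sum>j\<in>{1..Suc N}. of_int (int j - 1) *\<^sub>V ?s j)"
  proof -
    have E: "(\<Sum>j\<in>{1..Suc N}. f j) = f 1 + (\<Sum>j\<in>{1..N}. f (Suc j))" for f :: "nat \<Rightarrow> V"
      using sum.atLeast_Suc_atMost[of 1 "Suc N" f] sum.shift_bounds_cl_Suc_ivl[of f 1 N] by simp
    show ?thesis
      unfolding E[of "\<lambda>j. of_int (int j - 1) *\<^sub>V ?s j"] by simp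
  qed
  also have "(\<Sum>j\<in>{1..N}. of_int (a - int j + 1) *\<^sub>V ?s j) = (\<Sum>j\<in>{1..Suc N}. of_int (a - int j + 1) *\<^sub>V ?s j)"
    by (simp flip: N)
  also have "(\<Sum>j\<in>{1..Suc N}. of_int (int j - 1) *\<^sub>V ?s j) + (\<Sum>j\<in>{1..Suc N}. of_int (a - int j + 1) *\<^sub>V ?s j)
      = of_int a *\<^sub>V (\<Sum>j\<in>{1..Suc N}. ?s j)"
    unfolding sum.distrib[symmetric] scl_sum_right scl_add_left[symmetric]
    by (intro sum.cong refl) (simp add: scl_diff_left[symmetric] flip: scl_add_left)
  also have "k *\<^sub>V (of_int a *\<^sub>V (\<Sum>j\<in>{1..Suc N}. ?s j) - A 0 * (of_int a *\<^sub>V S k a))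
     = of_int a *\<^sub>V (k *\<^sub>V (\<Sum>j\<in>{1..Suc N}. ?s j) - k *\<^sub>V (A 0 * S k a))"
    by (simp add: scl_diff_right scl_mult_right mult.commute)
  also have "k *\<^sub>V (\<Sum>j\<in>{1..Suc N}. ?s j) = of_int (a + 1) *\<^sub>V S k (a + 1)"
    by (rule S_rec[symmetric]) (simp add: N)
  finally show ?case using pos by (elim scl_cancel[rotated]) simp
qed

lemma T_commutes:
  assumes "lin f" and "\<And>i x. i > 0 \<Longrightarrow> f (h (int i) x) = h (int i) (f x)"
  shows "T k a (f x) = f (T k a x)"
proof (induction a rule: int_strong_induct)
  case (neg a)
  then show ?case by (simp add: lin_0[OF assms(1)])
next
  case zero
  then show ?case by simp
next
  case (pos a)
  have "of_int a *\<^sub>V T k a (f x) = - of_int k *\<^sub>V (\<Sum>i\<in>{1..nat a}. h (int i) (T k (a - int i) (f x)))"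
    by (rule T_rec) simp
  also have "(\<Sum>i\<in>{1..nat a}. h (int i) (T k (a - int i) (f x))) = (\<Sum>i\<in>{1..nat a}. f (h (int i) (T k (a - int i) x)))"
    by (rule sum.cong) (auto simp: pos(2) assms(2))
  also have "- of_int k *\<^sub>V \<dots> = f (- of_int k *\<^sub>V (\<Sum>i\<in>{1..nat a}. h (int i) (T k (a - int i) x)))"
    by (simp only: lin_scl[OF assms(1)] lin_sum[OF assms(1)])
  also have "- of_int k *\<^sub>V (\<Sum>i\<in>{1..nat a}. h (int i) (T k (a - int i) x)) = of_int a *\<^sub>V T k a x"
    by (rule T_rec[symmetric]) simp
  finally have "of_int a *\<^sub>V T k a (f x) = of_int a *\<^sub>V f (T k a x)"
    by (simp only: lin_scl[OF assms(1)])
  then show ?case using pos by (elim scl_cancel[rotated]) simp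
qed

lemma T_h: "i \<ge> 0 \<Longrightarrow> T k a (h i x) = h i (T k a x)"
  by (rule T_commutes[OF lin_h]) (simp add: h_commute)

lemma T_ex: "T k a (ex n * x) = ex n * T k a x"
  by (rule T_commutes[OF lin_mult]) (simp add: deriv_mult[OF deriv_h] h_ex)

lemma T_T: "T k a (T l b x) = T l b (T k a x)"
  by (rule T_commutes[OF lin_T]) (simp add: T_h)

text \<open>The generating series of \<open>T k\<close> is the exponential of a derivation, hence a
  ring automorphism; it fixes the \<open>ex n\<close> and shifts \<open>A i\<close> by
  \<open>- 2 p k z ^ (- i - 1)\<close>.\<close>

lemma T_A: "T k a (A i * x) = A i * T k a x - (2 * cp * of_int k) *\<^sub>V T k (a - int i - 1) x"
proof (induction a rule: int_strong_induct)
  case (neg a)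
  then show ?case by simp
next
  case zero
  then show ?case by simp
next
  case (pos a)
  define N where "N = nat a + Suc i"
  have N: "int N \<ge> a" "int N \<ge> a - int i - 1" "Suc i \<in> {1..N}" by (auto simp: N_def)
  let ?t = "\<lambda>j. T k (a - int j) x" and ?u = "\<lambda>j. T k (a - int i - 1 - int j) x"
  have "of_int a *\<^sub>V T k a (A i * x) = - of_int k *\<^sub>V (\<Sum>j\<in>{1..N}. h (int j) (T k (a - int j) (A i * x)))"
    by (rule T_rec) (rule N)
  also have "(\<Sum>j\<in>{1..N}. h (int j) (T k (a - int j) (A i * x))) =
     (\<Sum>j\<in>{1..N}. if j = Suc i then (2 * cp * of_nat (Suc i)) *\<^sub>V T k (a - int i - 1) x else 0)
     + A i * (\<Sum>j\<in>{1..N}. h (int j) (?t j)) - (2 * cp * of_int k) *\<^sub>V (\<Sum>j\<in>{1..N}. h (int j) (?u j))"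
    unfolding scl_sum_right sum_distrib_left sum.distrib[symmetric] sum_subtractf[symmetric]
  proof (rule sum.cong[OF refl])
    fix j assume j: "j \<in> {1..N}"
    have "T k (a - int j) (A i * x) = A i * ?t j - (2 * cp * of_int k) *\<^sub>V ?u j"
      using pos(2)[of "a - int j"] j by (simp add: algebra_simps)
    moreover have "h (int j) (A i) * ?t j = (if j = Suc i then (2 * cp * of_nat (Suc i)) *\<^sub>V T k (a - int i - 1) x else 0)"
    proof (cases "j = Suc i")
      case True
      then have eq: "a - int j = a - int i - 1" by simp
      show ?thesis unfolding eq using True by (simp add: h_A scl_mult_left)
    qed (use j in \<open>auto simp: h_A\<close>)
    ultimately show "h (int j) (T k (a - int j) (A i * x)) =
       (if j = Suc i then (2 * cp * of_nat (Suc i)) *\<^sub>V T k (a - int i - 1) x else 0) + A i * h (int j) (?t j)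
       - (2 * cp * of_int k) *\<^sub>V h (int j) (?u j)"
      by (simp only: lin_diff[OF lin_h] lin_scl[OF lin_h] deriv_mult[OF deriv_h[OF of_nat_0_le_iff]])
  qed
  also have "(\<Sum>j\<in>{1..N}. if j = Suc i then (2 * cp * of_nat (Suc i)) *\<^sub>V T k (a - int i - 1) x else 0)
      = (2 * cp * of_nat (Suc i)) *\<^sub>V T k (a - int i - 1) x"
    using N(3) by (simp add: sum.delta)
  also have "- of_int k *\<^sub>V ((2 * cp * of_nat (Suc i)) *\<^sub>V T k (a - int i - 1) x + A i * (\<Sum>j\<in>{1..N}. h (int j) (?t j))
      - (2 * cp * of_int k) *\<^sub>V (\<Sum>j\<in>{1..N}. h (int j) (?u j))) =
     A i * (- of_int k *\<^sub>V (\<Sum>j\<in>{1..N}. h (int j) (?t j))) - (2 * cp * of_int k) *\<^sub>V (of_nat (Suc i) *\<^sub>V T k (a - int i - 1) x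
      + (- of_int k *\<^sub>V (\<Sum>j\<in>{1..N}. h (int j) (?u j))))"
    by (simp add: scl_add_right scl_diff_right scl_mult_right mult_ac del: of_nat_Suc)
  also have "- of_int k *\<^sub>V (\<Sum>j\<in>{1..N}. h (int j) (?t j)) = of_int a *\<^sub>V T k a x"
    by (rule T_rec[symmetric]) (rule N)
  also have "- of_int k *\<^sub>V (\<Sum>j\<in>{1..N}. h (int j) (?u j)) = of_int (a - int i - 1) *\<^sub>V T k (a - int i - 1) x"
    by (rule T_rec[symmetric]) (rule N)
  also have "of_nat (Suc i) *\<^sub>V T k (a - int i - 1) x + of_int (a - int i - 1) *\<^sub>V T k (a - int i - 1) x = of_int a *\<^sub>V T k (a - int i - 1) x"
    by (simp flip: scl_add_left)
  finally have "of_int a *\<^sub>V T k a (A i * x) = of_int a *\<^sub>V (A i * T k a x - (2 * cp * of_int k) *\<^sub>V T k (a - int i - 1) x)"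
    by (simp add: scl_diff_right scl_mult_right mult_ac)
  then show ?case using pos by (elim scl_cancel[rotated]) simp
qed

text \<open>Moving the annihilation exponential in \<open>z\<close> past the creation exponential in
  \<open>w\<close> costs the factor \<open>(1 - w / z) ^ M\<close> with \<open>M = 2 p k l\<close>;
  only this product has to be an integer, not \<open>l\<close>.\<close>

lemma T_S:
  assumes "int N > b" and M: "2 * cp * of_int k * l = of_int M"
  shows "T k a (S l b * x) = (\<Sum>i<N. bc M i *\<^sub>V (S l (b - int i) * T k (a - int i) x))"
  using assms(1)
proof (induction b arbitrary: a N rule: int_strong_induct)
  case (neg b)
  then show ?case by (simp add: lin_0[OF lin_T])
next
  case zero
  then have "(\<Sum>i<N. bc M i *\<^sub>V (S l (0 - int i) * T k (a - int i) x))
      = (\<Sum>i<1. bc M i *\<^sub>V (S l (0 - int i) * T k (a - int i) x))"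
    by (intro sum.mono_neutral_right) auto
  then show ?case by simp
next
  case (pos b)
  let ?b = "bc M"
  let ?r = "\<lambda>i. S l (b - int i) * T k (a - int i) x"
  have "of_int b *\<^sub>V T k a (S l b * x) = T k a ((of_int b *\<^sub>V S l b) * x)"
    by (simp only: lin_scl[OF lin_T] scl_mult_left)
  also have "\<dots> = l *\<^sub>V (\<Sum>j\<in>{1..N}. T k a (A (j - 1) * (S l (b - int j) * x)))"
    using pos(3) by (subst S_rec[of b N]) (simp_all add: scl_mult_left sum_distrib_right lin_scl[OF lin_T] lin_sum[OF lin_T] mult.assoc)
  also have "(\<Sum>j\<in>{1..N}. T k a (A (j - 1) * (S l (b - int j) * x))) =
      (\<Sum>j\<in>{1..N}. \<Sum>i<N. ?b i *\<^sub>V (A (j - 1) * (S l (b - int i - int j) * T k (a - int i) x)))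
      - (2 * cp * of_int k) *\<^sub>V (\<Sum>j\<in>{1..N}. \<Sum>i<N. ?b i *\<^sub>V ?r (i + j))"
    unfolding scl_sum_right sum_subtractf[symmetric]
  proof (rule sum.cong[OF refl])
    fix j assume j: "j \<in> {1..N}"
    have "T k a (A (j - 1) * (S l (b - int j) * x)) = A (j - 1) * T k a (S l (b - int j) * x)
        - (2 * cp * of_int k) *\<^sub>V T k (a - int j) (S l (b - int j) * x)"
      using j by (simp add: T_A of_nat_diff)
    also have "T k a (S l (b - int j) * x) = (\<Sum>i<N. ?b i *\<^sub>V (S l (b - int j - int i) * T k (a - int i) x))"
      using j pos by (intro pos(2)) auto
    also have "T k (a - int j) (S l (b - int j) * x) = (\<Sum>i<N. ?b i *\<^sub>V (S l (b - int j - int i) * T k (a - int j - int i) x))"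
      using j pos by (intro pos(2)) auto
    finally show "T k a (A (j - 1) * (S l (b - int j) * x)) =
       (\<Sum>i<N. ?b i *\<^sub>V (A (j - 1) * (S l (b - int i - int j) * T k (a - int i) x))
         - (2 * cp * of_int k) *\<^sub>V ?b i *\<^sub>V ?r (i + j))"
      by (simp add: sum_distrib_left scl_sum_right sum_subtractf scl_mult_right algebra_simps)
  qed
  also have "(\<Sum>j\<in>{1..N}. \<Sum>i<N. ?b i *\<^sub>V ?r (i + j)) = (\<Sum>r<N. (\<Sum>i<r. ?b i) *\<^sub>V ?r r)"
    by (rule double_sum_diag) (use pos in auto)
  also have "l *\<^sub>V ((\<Sum>j\<in>{1..N}. \<Sum>i<N. ?b i *\<^sub>V (A (j - 1) * (S l (b - int i - int j) * T k (a - int i) x)))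
      - (2 * cp * of_int k) *\<^sub>V (\<Sum>r<N. (\<Sum>i<r. ?b i) *\<^sub>V ?r r)) =
     (\<Sum>i<N. ?b i *\<^sub>V ((l *\<^sub>V (\<Sum>j\<in>{1..N}. A (j - 1) * S l (b - int i - int j))) * T k (a - int i) x))
     + (\<Sum>r<N. (- of_int M * (\<Sum>i<r. ?b i)) *\<^sub>V ?r r)"
  proof -
    have "l *\<^sub>V (\<Sum>j\<in>{1..N}. \<Sum>i<N. ?b i *\<^sub>V (A (j - 1) * (S l (b - int i - int j) * T k (a - int i) x))) =
       (\<Sum>i<N. ?b i *\<^sub>V ((l *\<^sub>V (\<Sum>j\<in>{1..N}. A (j - 1) * S l (b - int i - int j))) * T k (a - int i) x))"
      by (subst sum.swap)
        (simp add: scl_sum_right sum_distrib_right scl_mult_left mult.assoc mult.commute[of "l"])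
    moreover have "l *\<^sub>V (2 * cp * of_int k) *\<^sub>V (\<Sum>r<N. (\<Sum>i<r. ?b i) *\<^sub>V ?r r) =
        - (\<Sum>r<N. (- of_int M * (\<Sum>i<r. ?b i)) *\<^sub>V ?r r)"
      by (simp add: scl_sum_right sum_negf mult_ac flip: M)
    ultimately show ?thesis unfolding scl_diff_right by simp
  qed
  also have "(\<Sum>i<N. ?b i *\<^sub>V ((l *\<^sub>V (\<Sum>j\<in>{1..N}. A (j - 1) * S l (b - int i - int j))) * T k (a - int i) x))
      = (\<Sum>i<N. ?b i *\<^sub>V ((of_int (b - int i) *\<^sub>V S l (b - int i)) * T k (a - int i) x))"
    using pos(3) by (intro sum.cong refl) (subst S_rec, auto)
  also have "(\<Sum>r<N. (- of_int M * (\<Sum>i<r. ?b i)) *\<^sub>V ?r r) = (\<Sum>r<N. (of_nat r * ?b r) *\<^sub>V ?r r)"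
    by (simp only: bc_partial_sum)
  also have "(\<Sum>i<N. ?b i *\<^sub>V ((of_int (b - int i) *\<^sub>V S l (b - int i)) * T k (a - int i) x)) + (\<Sum>r<N. (of_nat r * ?b r) *\<^sub>V ?r r)
      = of_int b *\<^sub>V (\<Sum>i<N. ?b i *\<^sub>V ?r i)"
    unfolding scl_sum_right sum.distrib[symmetric]
  proof (intro sum.cong refl)
    fix i
    have "?b i * of_int (b - int i) + of_nat i * ?b i = of_int b * ?b i" by (simp add: algebra_simps)
    then show "?b i *\<^sub>V ((of_int (b - int i) *\<^sub>V S l (b - int i)) * T k (a - int i) x) + (of_nat i * ?b i) *\<^sub>V ?r i = of_int b *\<^sub>V ?b i *\<^sub>V ?r i"
      by (simp only: scl_mult_left scl_scl scl_add_left[symmetric])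
  qed
  finally show ?case using pos by (elim scl_cancel[rotated]) simp
qed

text \<open>Since \<open>[Td, h j] = - j h (j - 1)\<close>, commuting \<open>Td\<close> with the
  exponential amounts to \<open>d/dz\<close> plus one extra term, \<open>k h 0 / z\<close>, from the
  lowest mode.\<close>

lemma T_Td: "Td (T k a x) = T k a (Td x) + of_int k *\<^sub>V h 0 (T k (a - 1) x) - of_int (a - 1) *\<^sub>V T k (a - 1) x"
proof (induction a rule: int_strong_induct)
  case (neg a)
  then show ?case by (simp add: lin_0[OF lin_h] lin_0[OF lin_Td])
next
  case zero
  then show ?case by (simp add: lin_0[OF lin_h])
next
  case (pos a)
  define N where "N = nat a"
  have N: "int N = a" using pos by (simp add: N_def)
  let ?u = "\<lambda>j. h (int j) (T k (a - 1 - int j) x)"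
  have "of_int a *\<^sub>V Td (T k a x) = Td (of_int a *\<^sub>V T k a x)"
    by (simp only: lin_scl[OF lin_Td])
  also have "\<dots> = - of_int k *\<^sub>V (\<Sum>j\<in>{1..N}. Td (h (int j) (T k (a - int j) x)))"
    by (subst T_rec[of a N]) (simp_all add: N lin_scl[OF lin_Td] lin_sum[OF lin_Td] lin_minus[OF lin_Td])
  also have "(\<Sum>j\<in>{1..N}. Td (h (int j) (T k (a - int j) x))) =
     (\<Sum>j\<in>{1..N}. h (int j) (T k (a - int j) (Td x))) + of_int k *\<^sub>V h 0 (\<Sum>j\<in>{1..N}. ?u j)
     - (\<Sum>j\<in>{1..N}. of_int (a - 1 - int j) *\<^sub>V ?u j) - (\<Sum>j\<in>{1..N}. of_nat j *\<^sub>V h (int j - 1) (T k (a - int j) x))"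
    unfolding scl_sum_right lin_sum[OF lin_h] sum.distrib[symmetric] sum_subtractf[symmetric]
  proof (rule sum.cong[OF refl])
    fix j assume j: "j \<in> {1..N}"
    have "Td (T k (a - int j) x) = T k (a - int j) (Td x) + of_int k *\<^sub>V h 0 (T k (a - 1 - int j) x) - of_int (a - 1 - int j) *\<^sub>V T k (a - 1 - int j) x"
      using pos(2)[of "a - int j"] j by (simp add: algebra_simps)
    then show "Td (h (int j) (T k (a - int j) x)) = h (int j) (T k (a - int j) (Td x)) + of_int k *\<^sub>V h 0 (?u j)
       - of_int (a - 1 - int j) *\<^sub>V ?u j - of_nat j *\<^sub>V h (int j - 1) (T k (a - int j) x)"
      using j h_commute[of "int j" 0] by (simp add: Td_h lin_add[OF lin_h] lin_diff[OF lin_h] lin_scl[OF lin_h])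
  qed
  also have "(\<Sum>j\<in>{1..N}. of_nat j *\<^sub>V h (int j - 1) (T k (a - int j) x)) =
      (\<Sum>j\<in>{0..<N}. of_nat (Suc j) *\<^sub>V ?u j)"
    by (rule sum.reindex_bij_witness[of _ Suc "\<lambda>j. j - 1"]) (auto simp: algebra_simps of_nat_diff)
  also have "\<dots> = h 0 (T k (a - 1) x) + (\<Sum>j\<in>{1..N}. of_nat (Suc j) *\<^sub>V ?u j)"
  proof -
    have "(\<Sum>j\<in>{0..<N}. of_nat (Suc j) *\<^sub>V ?u j) = (\<Sum>j\<in>{0..N}. of_nat (Suc j) *\<^sub>V ?u j)"
      by (rule sum.mono_neutral_left) (auto simp: N not_less lin_0[OF lin_h])
    then show ?thesis by (simp add: sum.atLeast_Suc_atMost)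
  qed
  also have "- of_int k *\<^sub>V ((\<Sum>j\<in>{1..N}. h (int j) (T k (a - int j) (Td x))) + of_int k *\<^sub>V h 0 (\<Sum>j\<in>{1..N}. ?u j)
     - (\<Sum>j\<in>{1..N}. of_int (a - 1 - int j) *\<^sub>V ?u j) - (h 0 (T k (a - 1) x) + (\<Sum>j\<in>{1..N}. of_nat (Suc j) *\<^sub>V ?u j)))
     = - of_int k *\<^sub>V (\<Sum>j\<in>{1..N}. h (int j) (T k (a - int j) (Td x))) + of_int k *\<^sub>V h 0 (- of_int k *\<^sub>V (\<Sum>j\<in>{1..N}. ?u j))
      + of_int k *\<^sub>V (\<Sum>j\<in>{1..N}. of_int (a - 1 - int j) *\<^sub>V ?u j + of_nat (Suc j) *\<^sub>V ?u j) + of_int k *\<^sub>V h 0 (T k (a - 1) x)"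
    by (simp add: sum.distrib lin_scl[OF lin_h] lin_minus[OF lin_h] scl_add_right scl_diff_right mult_ac)
  also have "(\<Sum>j\<in>{1..N}. of_int (a - 1 - int j) *\<^sub>V ?u j + of_nat (Suc j) *\<^sub>V ?u j) = of_int a *\<^sub>V (\<Sum>j\<in>{1..N}. ?u j)"
    unfolding scl_sum_right scl_add_left[symmetric] by (intro sum.cong refl) simp
  also have "of_int k *\<^sub>V of_int a *\<^sub>V (\<Sum>j\<in>{1..N}. ?u j) = - of_int a *\<^sub>V (- of_int k *\<^sub>V (\<Sum>j\<in>{1..N}. ?u j))"
    by (simp add: mult.commute)
  also have "- of_int k *\<^sub>V (\<Sum>j\<in>{1..N}. ?u j) = of_int (a - 1) *\<^sub>V T k (a - 1) x"
    by (rule T_rec[symmetric]) (simp add: N)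
  also have "- of_int k *\<^sub>V (\<Sum>j\<in>{1..N}. h (int j) (T k (a - int j) (Td x))) = of_int a *\<^sub>V T k a (Td x)"
    by (rule T_rec[symmetric]) (simp add: N)
  also have "of_int a *\<^sub>V T k a (Td x) + of_int k *\<^sub>V h 0 (of_int (a - 1) *\<^sub>V T k (a - 1) x)
      + - of_int a *\<^sub>V (of_int (a - 1) *\<^sub>V T k (a - 1) x) + of_int k *\<^sub>V h 0 (T k (a - 1) x) =
     of_int a *\<^sub>V (T k a (Td x) + of_int k *\<^sub>V h 0 (T k (a - 1) x) - of_int (a - 1) *\<^sub>V T k (a - 1) x)"
    unfolding lin_scl[OF lin_h] by (simp add: scl_add_right scl_diff_right algebra_simps scl_diff_left)
  finally show ?case using pos by (elim scl_cancel[rotated]) simp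
qed

end

subsection \<open>The vertex operators\<close>

lemma fld_linext:
  assumes "\<And>b. \<exists>K. \<forall>k\<ge>K. f k b = 0"
  shows "fld (\<lambda>k. linext (f k))"
  unfolding fld_def
proof (intro conjI allI lin_linext)
  fix v
  obtain K where K: "\<And>b k. k \<ge> K b \<Longrightarrow> f k b = 0" using assms by metis
  show "\<exists>L. \<forall>k\<ge>L. linext (f k) v = 0"
  proof (intro exI allI impI)
    fix k assume k: "k \<ge> Max (insert 0 (K ` Poly_Mapping.keys v))"
    have "f k b = 0" if "b \<in> Poly_Mapping.keys v" for b
    proof (rule K)
      have "K b \<le> Max (insert 0 (K ` Poly_Mapping.keys v))" using that by (intro Max_ge) auto
      with k show "K b \<le> k" by linarith
    qed
    then show "linext (f k) v = 0" by (simp add: linext_def)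
  qed
qed

lemma hom_bv_induct:
  assumes "lin f" "lin g" "\<And>lam. int (deg lam) = d \<Longrightarrow> f (bv (lam, n)) = g (bv (lam, n))" "x \<in> hom n d"
  shows "f x = g x"
proof -
  have "f (bv b) = g (bv b)" if "b \<in> Poly_Mapping.keys x" for b
    using assms(3)[of "fst b"] assms(4) that by (auto simp: hom_def)
  then show ?thesis
    by (subst (1 2) V_expand[of x]) (simp add: lin_sum[OF assms(1)] lin_sum[OF assms(2)] lin_scl[OF assms(1)] lin_scl[OF assms(2)])
qed

lemma lin_eqI_hom:
  assumes "lin f" "lin g" "\<And>n d x. x \<in> hom n d \<Longrightarrow> f x = g x"
  shows "f x = g x"
  by (rule lin_eqI[OF assms(1,2)]) (metis assms(3) bv_hom surj_pair)

context lattice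
begin

text \<open>The mode \<open>j\<close> of the vertex operator of \<open>ex k\<close>. The cut at
  \<open>deg lam\<close> loses nothing because \<open>T k c\<close> lowers the degree by
  \<open>c\<close>; \<open>e_eq\<close> permits every larger bound.\<close>

definition e :: "int \<Rightarrow> int \<Rightarrow> V \<Rightarrow> V" where
  "e k j = linext (\<lambda>(lam, n). \<Sum>c\<in>{0..deg lam}. S (of_int k) (int c - 2 * int p * k * n - j - 1) * (ex k * T k (int c) (bv (lam, n))))"

lemma lin_e: "lin (e k j)"
  unfolding e_def by (rule lin_linext)

lemma T_deg: "x \<in> hom n d \<Longrightarrow> c > d \<Longrightarrow> T k c x = 0"
  using T_hom[of x n d k c] hom_neg by simp

lemma lin_eterm: "lin (\<lambda>x. S k a * (ex k * T k c x))"
  by (rule lin_compose[OF lin_mult lin_compose[OF lin_mult lin_T]])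

lemma e_eq:
  assumes "x \<in> hom n d" "int N > d"
  shows "e k j x = (\<Sum>c<N. S (of_int k) (int c - 2 * int p * k * n - j - 1) * (ex k * T k (int c) x))"
proof (rule hom_bv_induct[OF lin_e lin_sum_fun[OF lin_eterm] _ assms(1)])
  fix lam assume lam: "int (deg lam) = d"
  have "e k j (bv (lam, n)) = (\<Sum>c\<in>{0..deg lam}. S (of_int k) (int c - 2 * int p * k * n - j - 1) * (ex k * T k (int c) (bv (lam, n))))"
    by (simp add: e_def)
  also have "\<dots> = (\<Sum>c<N. S (of_int k) (int c - 2 * int p * k * n - j - 1) * (ex k * T k (int c) (bv (lam, n))))"
    using assms(2) lam by (intro sum.mono_neutral_left) (auto simp: T_deg[OF bv_hom])
  finally show "e k j (bv (lam, n)) = (\<Sum>c<N. S (of_int k) (int c - 2 * int p * k * n - j - 1) * (ex k * T k (int c) (bv (lam, n))))" .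
qed

lemma e_hom:
  assumes "x \<in> hom n d"
  shows "e k j x \<in> hom (n + k) (d - 2 * int p * k * n - j - 1)"
proof -
  have "S (of_int k) (int c - 2 * int p * k * n - j - 1) * (ex k * T k (int c) x) \<in> hom (n + k) (d - 2 * int p * k * n - j - 1)" for c
  proof -
    have "S (of_int k) (int c - 2 * int p * k * n - j - 1) * (ex k * T k (int c) x) \<in> hom (0 + (k + n)) ((int c - 2 * int p * k * n - j - 1) + (0 + (d - int c)))"
      by (intro hom_mult S_hom ex_hom T_hom assms)
    then show ?thesis by (simp add: algebra_simps)
  qed
  moreover have N: "int (nat d + 1) > d" by simp
  ultimately show ?thesis
    unfolding e_eq[OF assms N] by (intro hom_sum)
qed

lemma fld_e: "fld (e k)"
  unfolding e_def
proof (rule fld_linext)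
  fix b :: bas
  obtain lam n where b: "b = (lam, n)" by fastforce
  have "(\<Sum>c\<in>{0..deg lam}. S (of_int k) (int c - 2 * int p * k * n - j - 1) * (ex k * T k (int c) (bv (lam, n)))) = 0"
    if "j \<ge> int (deg lam) - 2 * int p * k * n" for j
    using that by (intro sum.neutral) auto
  then show "\<exists>K. \<forall>j\<ge>K. (case b of (lam, n) \<Rightarrow> \<Sum>c\<in>{0..deg lam}. S (of_int k) (int c - 2 * int p * k * n - j - 1) * (ex k * T k (int c) (bv (lam, n)))) = 0"
    by (intro exI[of _ "int (deg lam) - 2 * int p * k * n"]) (simp add: b)
qed

lemma fld_h: "fld h"
  unfolding fld_def
proof (intro conjI allI lin_h)
  fix v
  have "\<exists>K. \<forall>j\<ge>K. h j v = 0"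
  proof (induction v rule: V_induct)
    case (add x y)
    then obtain K1 K2 where "\<forall>j\<ge>K1. h j x = 0" "\<forall>j\<ge>K2. h j y = 0" by blast
    then show ?case by (intro exI[of _ "max K1 K2"]) (auto simp: lin_add[OF lin_h])
  next
    case (scl c x)
    then show ?case by (auto simp: lin_scl[OF lin_h])
  next
    case (mono lam n)
    show ?case
      by (intro exI[of _ "int (deg lam) + 1"] allI impI hom_neg[OF h_hom[OF bv_hom]]) simp
  qed
  then show "\<exists>K. \<forall>j\<ge>K. h j v = 0" .
qed

text \<open>The extra term has three sources: \<open>S_h\<close> for positive \<open>i\<close>, the
  change of charge for \<open>i = 0\<close>, and for negative \<open>i\<close> the shift of
  \<open>A\<close> under the annihilation exponential.\<close>

lemma h_e: "h i (e k j x) = e k j (h i x) + (2 * cp * of_int k) *\<^sub>V e k (i + j) x"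
proof (rule lin_eqI_hom[OF lin_compose[OF lin_h lin_e] lin_plus[OF lin_compose[OF lin_e lin_h] lin_scale_fun[OF lin_e]]])
  fix n d x assume x: "x \<in> hom n d"
  consider "i > 0" | "i = 0" | "i < 0" by linarith
  then show "h i (e k j x) = e k j (h i x) + (2 * cp * of_int k) *\<^sub>V e k (i + j) x"
  proof cases
    case 1
    define N where "N = nat d + 1"
    have N: "int N > d" "int N > d - i" using 1 by (auto simp: N_def)
    have idx: "int c - 2 * int p * k * n - j - 1 - i = int c - 2 * int p * k * n - (i + j) - 1" for c by simp
    have "h i (e k j x) = (\<Sum>c<N. h i (S (of_int k) (int c - 2 * int p * k * n - j - 1)) * (ex k * T k (int c) x)
         + S (of_int k) (int c - 2 * int p * k * n - j - 1) * (ex k * T k (int c) (h i x)))"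
      unfolding e_eq[OF x N(1)] lin_sum[OF lin_h] using 1
      by (simp add: deriv_mult[OF deriv_h] h_ex T_h)
    also have "\<dots> = e k j (h i x) + (2 * cp * of_int k) *\<^sub>V e k (i + j) x"
      unfolding e_eq[OF x N(1)] e_eq[OF h_hom[OF x] N(2)] scl_sum_right sum.distrib[symmetric]
      by (intro sum.cong refl) (simp only: S_h[OF 1] idx scl_mult_left add.commute)
    finally show ?thesis .
  next
    case 2
    then show ?thesis
      by (simp only: h0_hom[OF x] h0_hom[OF e_hom[OF x]] lin_scl[OF lin_e] add_0 scl_add_left[symmetric])
        (simp add: algebra_simps)
  next
    case 3
    define i' where "i' = nat (- i - 1)"
    have i: "i = - int i' - 1" using 3 by (simp add: i'_def)
    define N where "N = nat d + 1"
    define M where "M = N + Suc i'"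
    have M: "int M > d" "int M > d - i" "int N > d" using 3 by (auto simp: M_def N_def i)
    let ?s = "\<lambda>c. S (of_int k) (c - 2 * int p * k * n - j - 1)"
    have idx: "int c - int (Suc i') = int c - int i' - 1" "int c - int i' - 1 + int i' + 1 = int c" for c by simp_all
    have "e k j (h i x) = (\<Sum>c<M. ?s (int c) * (ex k * T k (int c) (A i' * x)))"
      using e_eq[OF h_hom[OF x, of i] M(2), of k j] by (simp only: i h_neg1)
    also have "\<dots> = A i' * (\<Sum>c<M. ?s (int c) * (ex k * T k (int c) x))
        - (2 * cp * of_int k) *\<^sub>V (\<Sum>c<M. ?s ((int c - int (Suc i')) + int i' + 1) * (ex k * T k (int c - int (Suc i')) x))"
      unfolding sum_distrib_left scl_sum_right sum_subtractf[symmetric]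
      by (intro sum.cong refl) (simp only: idx T_A right_diff_distrib scl_mult_right mult.left_commute[of _ "A i'"])
    also have "(\<Sum>c<M. ?s ((int c - int (Suc i')) + int i' + 1) * (ex k * T k (int c - int (Suc i')) x)) =
       (\<Sum>c<N. ?s (int c + int i' + 1) * (ex k * T k (int c) x))"
      by (rule sum_shift_int[where f = "\<lambda>c. ?s (c + int i' + 1) * (ex k * T k c x)"]) (use M(3) in \<open>auto simp: T_deg[OF x] M_def\<close>)
    also have "\<dots> = e k (i + j) x"
      unfolding e_eq[OF x M(3)] by (intro sum.cong refl) (simp add: i algebra_simps)
    finally show ?thesis
      unfolding e_eq[OF x M(1), symmetric] by (simp only: i h_neg1) simp
  qed
qed

text \<open>The \<open>A 0\<close> terms of \<open>S_Td\<close> and \<open>Td_ex\<close> cancel.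
  What remains is the derivative of the two exponentials together with \<open>2 p k n\<close>, the
  exponent of \<open>z\<close> on charge \<open>n\<close>; after shifting one sum these combine to
  the factor \<open>- j\<close>.\<close>

lemma Td_e: "Td (e k j x) = e k j (Td x) - of_int j *\<^sub>V e k (j - 1) x"
proof (rule lin_eqI_hom[OF lin_compose[OF lin_Td lin_e] lin_minus_fun[OF lin_compose[OF lin_e lin_Td] lin_scale_fun[OF lin_e]]])
  fix n d x assume x: "x \<in> hom n d"
  define N where "N = nat d + 2"
  have N: "int N > d" "int N > d + 1" "int (N - 1) > d" by (auto simp: N_def)
  let ?a = "\<lambda>c. c - 2 * int p * k * n - j - 1"
  have t: "Td (S (of_int k) (?a c) * (ex k * T k c x)) = of_int (?a c + 1) *\<^sub>V (S (of_int k) (?a c + 1) * (ex k * T k c x))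
      + S (of_int k) (?a c) * (ex k * T k c (Td x)) + of_int (2 * int p * k * n - (c - 1)) *\<^sub>V (S (of_int k) (?a c) * (ex k * T k (c - 1) x))" for c
  proof -
    have "Td (S (of_int k) (?a c) * (ex k * T k c x)) = Td (S (of_int k) (?a c)) * (ex k * T k c x)
        + S (of_int k) (?a c) * (of_int k *\<^sub>V (A 0 * ex k) * T k c x + ex k * Td (T k c x))"
      by (simp add: deriv_mult[OF deriv_Td] Td_ex)
    also have "Td (T k c x) = T k c (Td x) + of_int (2 * int p * k * n - (c - 1)) *\<^sub>V T k (c - 1) x"
      unfolding T_Td h0_hom[OF T_hom[OF x]] by (simp add: scl_diff_left algebra_simps)
    finally show ?thesis
      unfolding S_Td by (simp add: algebra_simps scl_mult_left scl_mult_right)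
  qed
  have "Td (e k j x) = (\<Sum>c<N. of_int (?a (int c) + 1) *\<^sub>V (S (of_int k) (?a (int c) + 1) * (ex k * T k (int c) x)))
      + (\<Sum>c<N. S (of_int k) (?a (int c)) * (ex k * T k (int c) (Td x)))
      + (\<Sum>c<N. of_int (2 * int p * k * n - (int c - 1)) *\<^sub>V (S (of_int k) (?a (int c)) * (ex k * T k (int c - 1) x)))"
    unfolding e_eq[OF x N(1)] lin_sum[OF lin_Td] t sum.distrib ..
  also have "(\<Sum>c<N. S (of_int k) (?a (int c)) * (ex k * T k (int c) (Td x))) = e k j (Td x)"
    by (rule e_eq[OF Td_hom[OF x] N(2), symmetric])
  also have "(\<Sum>c<N. of_int (2 * int p * k * n - (int c - 1)) *\<^sub>V (S (of_int k) (?a (int c)) * (ex k * T k (int c - 1) x))) =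
      (\<Sum>c<N. of_int (2 * int p * k * n - (int c - int 1)) *\<^sub>V (S (of_int k) (?a (int c - int 1) + 1) * (ex k * T k (int c - int 1) x)))"
    by (intro sum.cong refl) (simp add: algebra_simps)
  also have "\<dots> = (\<Sum>c<N - 1. of_int (2 * int p * k * n - int c) *\<^sub>V (S (of_int k) (?a (int c) + 1) * (ex k * T k (int c) x)))"
    by (rule sum_shift_int[where f = "\<lambda>c. of_int (2 * int p * k * n - c) *\<^sub>V (S (of_int k) (?a c + 1) * (ex k * T k c x))"])
      (use N in \<open>auto simp: T_deg[OF x] N_def\<close>)
  also have "\<dots> = (\<Sum>c<N. of_int (2 * int p * k * n - int c) *\<^sub>V (S (of_int k) (?a (int c) + 1) * (ex k * T k (int c) x)))"
    by (rule sum.mono_neutral_left) (use N in \<open>auto simp: T_deg[OF x] not_less\<close>)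
  finally have "Td (e k j x) = e k j (Td x) + (\<Sum>c<N. (of_int (?a (int c) + 1) + of_int (2 * int p * k * n - int c)) *\<^sub>V (S (of_int k) (?a (int c) + 1) * (ex k * T k (int c) x)))"
    by (simp only: scl_add_left sum.distrib add_ac)
  also have "(\<Sum>c<N. (of_int (?a (int c) + 1) + of_int (2 * int p * k * n - int c)) *\<^sub>V (S (of_int k) (?a (int c) + 1) * (ex k * T k (int c) x)))
      = - of_int j *\<^sub>V e k (j - 1) x"
    unfolding e_eq[OF x N(1)] scl_sum_right by (intro sum.cong refl) (simp add: algebra_simps)
  finally show "Td (e k j x) = e k j (Td x) - of_int j *\<^sub>V e k (j - 1) x" by simp
qed

text \<open>The product of two lattice vertex operators is \<open>(z - w) ^ (2 p k l)\<close> times this symmetric function.\<close>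
definition eX :: "int \<Rightarrow> int \<Rightarrow> int \<Rightarrow> nat \<Rightarrow> V \<Rightarrow> int \<Rightarrow> int \<Rightarrow> V" where
  "eX k l n N v m j = (\<Sum>c<N. \<Sum>d<N. S (of_int k) (int c - 2 * int p * k * n - m - 1) * (S (of_int l) (int d - 2 * int p * l * n - j - 1)
      * (ex (k + l) * T k (int c) (T l (int d) v))))"

lemma eX_sym: "eX k l n N v m j = eX l k n N v j m"
  unfolding eX_def by (subst sum.swap) (simp add: T_T[of k _ l] mult_ac add.commute)

lemma bdd_eX: "bdd (eX k l n N v)"
  unfolding bdd_def
proof (intro exI[of _ "int N - 2 * int p * l * n"] allI impI)
  fix m j assume "int N - 2 * int p * l * n \<le> j"
  then show "eX k l n N v m j = 0"
    unfolding eX_def by (intro sum.neutral ballI) auto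
qed

text \<open>\<open>T_S\<close> contributes \<open>(1 - w / z) ^ (2 p k l)\<close>, and the charge
  added by the inner operator contributes \<open>z ^ (2 p k l)\<close>; together they form the power
  of \<open>z - w\<close>.\<close>

lemma e_e:
  assumes v: "v \<in> hom n d" and N: "int N > d"
  shows "e k m (e l j v) = iexp (2 * int p * k * l) (eX k l n N v) m j"
proof -
  let ?M = "2 * int p * k * l"
  let ?b = "\<lambda>d. int d - 2 * int p * l * n - j - 1"
  define I where "I = nat (int N - 2 * int p * l * n - j)"
  define R where "R = N + I + nat (d + int I)"
  have 1: "e k m (S (of_int l) (?b d') * (ex l * T l (int d') v)) =
     (\<Sum>i<I. bc ?M i *\<^sub>V (\<Sum>c<N. S (of_int k) (int c - 2 * int p * k * n - (m + ?M - int i) - 1) * (S (of_int l) (int d' - 2 * int p * l * n - (j + int i) - 1)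
      * (ex (k + l) * T k (int c) (T l (int d') v)))))" if d': "d' < N" for d'
  proof -
    let ?u = "S (of_int l) (?b d') * (ex l * T l (int d') v)"
    have u: "?u \<in> hom (0 + (l + n)) (?b d' + (0 + (d - int d')))"
      by (intro hom_mult S_hom ex_hom T_hom v)
    have MM: "2 * cp * of_int k * of_int l = of_int ?M" by simp
    have bI: "int I > ?b d'" using d' by (simp add: I_def)
    have R: "int R > ?b d' + (0 + (d - int d'))"
    proof -
      have "int I \<ge> int N - 2 * int p * l * n - j" "int R \<ge> d + int I" by (simp_all add: I_def R_def)
      then show ?thesis using d' by linarith
    qed
    have "e k m ?u = (\<Sum>c<R. S (of_int k) (int c - 2 * int p * k * (0 + (l + n)) - m - 1) * (ex k * T k (int c) ?u))"
      by (rule e_eq[OF u R])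
    also have "\<dots> = (\<Sum>c<R. \<Sum>i<I. bc ?M i *\<^sub>V (S (of_int k) ((int c - int i) + int i - ?M - 2 * int p * k * n - m - 1) * (S (of_int l) (?b d' - int i)
       * (ex (k + l) * T k (int c - int i) (T l (int d') v)))))"
    proof (rule sum.cong[OF refl])
      fix c
      have "T k (int c) ?u = ex l * T k (int c) (S (of_int l) (?b d') * T l (int d') v)"
        by (simp add: T_ex mult.left_commute[of _ "ex l"])
      also have "\<dots> = ex l * (\<Sum>i<I. bc ?M i *\<^sub>V (S (of_int l) (?b d' - int i) * T k (int c - int i) (T l (int d') v)))"
        by (simp only: T_S[OF bI MM])
      finally show "S (of_int k) (int c - 2 * int p * k * (0 + (l + n)) - m - 1) * (ex k * T k (int c) ?u) =
         (\<Sum>i<I. bc ?M i *\<^sub>V (S (of_int k) ((int c - int i) + int i - ?M - 2 * int p * k * n - m - 1) * (S (of_int l) (?b d' - int i)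
       * (ex (k + l) * T k (int c - int i) (T l (int d') v)))))"
        by (simp add: sum_distrib_left scl_mult_right ex_mult[symmetric] algebra_simps)
    qed
    also have "\<dots> = (\<Sum>i<I. bc ?M i *\<^sub>V (\<Sum>c<R. (S (of_int k) ((int c - int i) + int i - ?M - 2 * int p * k * n - m - 1) * (S (of_int l) (?b d' - int i)
       * (ex (k + l) * T k (int c - int i) (T l (int d') v))))))"
      by (subst sum.swap) (simp add: scl_sum_right)
    also have "\<dots> = (\<Sum>i<I. bc ?M i *\<^sub>V (\<Sum>c<N. (S (of_int k) (int c + int i - ?M - 2 * int p * k * n - m - 1) * (S (of_int l) (?b d' - int i)
       * (ex (k + l) * T k (int c) (T l (int d') v))))))"
    proof (rule sum.cong[OF refl])
      fix i assume "i \<in> {..<I}"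
      have "T k c (T l (int d') v) = 0" if "c \<ge> int N" for c
        by (rule T_deg[OF T_hom[OF v]]) (use that N in simp)
      then have "(\<Sum>c<R. S (of_int k) ((int c - int i) + int i - ?M - 2 * int p * k * n - m - 1) * (S (of_int l) (?b d' - int i)
         * (ex (k + l) * T k (int c - int i) (T l (int d') v)))) =
        (\<Sum>c<N. S (of_int k) (int c + int i - ?M - 2 * int p * k * n - m - 1) * (S (of_int l) (?b d' - int i) * (ex (k + l) * T k (int c) (T l (int d') v))))"
        using \<open>i \<in> {..<I}\<close>
        by (intro sum_shift_int[where f = "\<lambda>c. S (of_int k) (c + int i - ?M - 2 * int p * k * n - m - 1) * (S (of_int l) (?b d' - int i)
         * (ex (k + l) * T k c (T l (int d') v)))"]) (auto simp: R_def)
      then show "bc ?M i *\<^sub>V (\<Sum>c<R. S (of_int k) ((int c - int i) + int i - ?M - 2 * int p * k * n - m - 1) * (S (of_int l) (?b d' - int i)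
         * (ex (k + l) * T k (int c - int i) (T l (int d') v)))) =
        bc ?M i *\<^sub>V (\<Sum>c<N. S (of_int k) (int c + int i - ?M - 2 * int p * k * n - m - 1) * (S (of_int l) (?b d' - int i) * (ex (k + l) * T k (int c) (T l (int d') v))))"
        by simp
    qed
    finally show ?thesis
      by (simp add: algebra_simps)
  qed
  have "e k m (e l j v) = (\<Sum>d'<N. e k m (S (of_int l) (?b d') * (ex l * T l (int d') v)))"
    by (simp only: e_eq[OF v N] lin_sum[OF lin_e])
  also have "\<dots> = (\<Sum>d'<N. \<Sum>i<I. bc ?M i *\<^sub>V (\<Sum>c<N. S (of_int k) (int c - 2 * int p * k * n - (m + ?M - int i) - 1) * (S (of_int l) (int d' - 2 * int p * l * n - (j + int i) - 1)
      * (ex (k + l) * T k (int c) (T l (int d') v)))))"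
    by (intro sum.cong refl 1) simp
  also have "\<dots> = (\<Sum>i<I. bc ?M i *\<^sub>V eX k l n N v (m + ?M - int i) (j + int i))"
    unfolding eX_def by (subst (2) sum.swap, subst sum.swap) (simp add: scl_sum_right)
  also have "\<dots> = iexp ?M (eX k l n N v) m j"
    unfolding iexp_def
  proof (rule fsum_eq[symmetric])
    fix i assume "I \<le> i"
    then have "eX k l n N v (m + ?M - int i) (j + int i) = 0"
      unfolding eX_def I_def by (intro sum.neutral ballI) auto
    then show "bc ?M i *\<^sub>V eX k l n N v (m + ?M - int i) (j + int i) = 0" by simp
  qed
  finally show ?thesis .
qed

text \<open>Both orders of the product are the same symmetric series times a power of
  \<open>z - w\<close>, expanded in opposite regions; the exponent is even, so no sign arises.
  Multiplication by \<open>(z - w) ^ r\<close> removes a negative exponent, after which the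
  expansions agree.\<close>

lemma loc_e_e: "loc (e k) (e l)"
proof -
  let ?M = "2 * int p * k * l"
  define r where "r = nat (- ?M)"
  have Z: "(dif ^^ s) (\<lambda>m j. iexp c (eX k l n N v) m j - sg c *\<^sub>V iexp c (eX l k n N v) j m)
     = (\<lambda>m j. iexp (c + int s) (eX k l n N v) m j - sg (c + int s) *\<^sub>V iexp (c + int s) (eX l k n N v) j m)" for s c n N v
  proof (induction s)
    case (Suc s)
    have "dif (\<lambda>m j. iexp (c + int s) (eX k l n N v) m j - sg (c + int s) *\<^sub>V iexp (c + int s) (eX l k n N v) j m)
      = (\<lambda>m j. iexp (c + int s + 1) (eX k l n N v) m j - sg (c + int s + 1) *\<^sub>V iexp (c + int s + 1) (eX l k n N v) j m)"
      unfolding dif_def iexp_Suc[OF bdd_eX] sg_Suc by (auto simp: fun_eq_iff scl_diff_right)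
    moreover have "c + int (Suc s) = c + int s + 1" by simp
    ultimately show ?case using Suc by (simp only: funpow.simps o_apply)
  qed simp
  have S0: "iexp 0 (eX k l n N v) m j - sg 0 *\<^sub>V iexp 0 (eX l k n N v) j m = 0" for n N v m j
    by (simp add: iexp_0 sg_def eX_sym[of k l])
  have sgM: "sg ?M = 1" by (simp add: sg_def)
  have "(dif ^^ r) (\<lambda>m j. e k m (e l j v) - e l j (e k m v)) m j = 0" if v: "v \<in> hom n d" for v n d m j
  proof -
    define N where "N = nat d + 1"
    have N: "int N > d" by (simp add: N_def)
    have E1: "(\<lambda>m j. e k m (e l j v) - e l j (e k m v)) = (\<lambda>m j. iexp ?M (eX k l n N v) m j - sg ?M *\<^sub>V iexp ?M (eX l k n N v) j m)"
      unfolding e_e[OF v N] sgM by (simp add: mult_ac)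
    have E2: "(dif ^^ r) (\<lambda>m j. iexp ?M (eX k l n N v) m j - sg ?M *\<^sub>V iexp ?M (eX l k n N v) j m) = (\<lambda>m j. 0)"
    proof (cases "?M \<le> 0")
      case True
      then have "?M + int r = 0" by (simp add: r_def)
      then show ?thesis unfolding Z by (simp only: S0)
    next
      case False
      then have "r = 0" by (simp add: r_def)
      have "(\<lambda>m j. iexp ?M (eX k l n N v) m j - sg ?M *\<^sub>V iexp ?M (eX l k n N v) j m) =
         (dif ^^ nat ?M) (\<lambda>m j. iexp 0 (eX k l n N v) m j - sg 0 *\<^sub>V iexp 0 (eX l k n N v) j m)"
        unfolding Z using False by simp
      also have "\<dots> = (\<lambda>m j. 0)" unfolding S0 by (rule dif_zero)
      finally have E: "(\<lambda>m j. iexp ?M (eX k l n N v) m j - sg ?M *\<^sub>V iexp ?M (eX l k n N v) j m) = (\<lambda>m j. 0)" .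
      show ?thesis unfolding \<open>r = 0\<close> funpow.simps id_apply by (rule E)
    qed
    show ?thesis unfolding E1 E2 ..
  qed
  note hom_case = this
  have "(dif ^^ r) (\<lambda>m j. e k m (e l j v) - e l j (e k m v)) m j = 0" for v m j
  proof (induction v rule: V_induct)
    case (add x y)
    have "(\<lambda>m j. e k m (e l j (x + y)) - e l j (e k m (x + y))) =
       (\<lambda>m j. (e k m (e l j x) - e l j (e k m x)) + (e k m (e l j y) - e l j (e k m y)))"
      by (simp add: lin_add[OF lin_e] fun_eq_iff)
    then show ?case by (simp only: dif_add add) simp
  next
    case (scl c x)
    have "(\<lambda>m j. e k m (e l j (c *\<^sub>V x)) - e l j (e k m (c *\<^sub>V x))) =
       (\<lambda>m j. c *\<^sub>V (e k m (e l j x) - e l j (e k m x)))"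
      by (simp add: lin_scl[OF lin_e] fun_eq_iff scl_diff_right)
    then show ?case by (simp only: dif_scl scl) simp
  next
    case (mono lam n)
    then show ?case by (rule hom_case[OF bv_hom])
  qed
  then show ?thesis unfolding loc_def by blast
qed

lemma loc_h_e: "loc h (e k)"
  unfolding loc_def
proof (intro exI[of _ 1] allI)
  fix v m j
  show "(dif ^^ 1) (\<lambda>m j. h m (e k j v) - e k j (h m v)) m j = 0"
    by (simp add: h_e dif_def algebra_simps)
qed

lemma loc_h_h: "loc h h"
  unfolding loc_def
proof (intro exI[of _ 2] allI)
  fix v m j
  show "(dif ^^ 2) (\<lambda>m j. h m (h j v) - h j (h m v)) m j = 0"
  proof -
    have "dif (\<lambda>m j. h m (h j v) - h j (h m v)) = (\<lambda>m j. if m + j + 1 = 0 then (2 * cp) *\<^sub>V v else 0)"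
    proof (intro ext)
      fix m j
      have "(2 * cp * of_int (m + 1)) *\<^sub>V v - (2 * cp * of_int m) *\<^sub>V v = (2 * cp) *\<^sub>V v"
        unfolding scl_diff_left[symmetric] by (simp add: algebra_simps)
      then show "dif (\<lambda>m j. h m (h j v) - h j (h m v)) m j = (if m + j + 1 = 0 then (2 * cp) *\<^sub>V v else 0)"
        unfolding dif_def h_comm by (auto simp: algebra_simps)
    qed
    then show ?thesis by (simp add: numeral_2_eq_2) (simp add: dif_def algebra_simps)
  qed
qed

end

lemma loc_add:
  assumes "loc X C" "loc Z C" "fld C"
  shows "loc (\<lambda>k v. X k v + Z k v) C"
proof -
  obtain N1 where N1: "\<And>v m k. (dif ^^ N1) (\<lambda>m k. X m (C k v) - C k (X m v)) m k = 0"
    using assms by (auto simp: loc_def)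
  obtain N2 where N2: "\<And>v m k. (dif ^^ N2) (\<lambda>m k. Z m (C k v) - C k (Z m v)) m k = 0"
    using assms by (auto simp: loc_def)
  have "(dif ^^ (max N1 N2)) (\<lambda>m k. (X m (C k v) + Z m (C k v)) - C k (X m v + Z m v)) m k = 0" for v m k
  proof -
    have "(\<lambda>m k. (X m (C k v) + Z m (C k v)) - C k (X m v + Z m v)) =
        (\<lambda>m k. (X m (C k v) - C k (X m v)) + (Z m (C k v) - C k (Z m v)))"
      by (simp add: lin_add[OF fld_lin[OF assms(3)]] fun_eq_iff)
    then show ?thesis
      using dif_add[of "max N1 N2" "\<lambda>m k. X m (C k v) - C k (X m v)" "\<lambda>m k. Z m (C k v) - C k (Z m v)" m k]
        dif_pow_mono[OF N1 max.cobounded1, of N2 v m k] dif_pow_mono[OF N2 max.cobounded2, of N1 v m k]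
      by simp
  qed
  then show ?thesis unfolding loc_def by blast
qed

lemma loc_scl:
  assumes "loc X C" "fld C"
  shows "loc (\<lambda>k v. c *\<^sub>V X k v) C"
proof -
  obtain N where N: "\<And>v m k. (dif ^^ N) (\<lambda>m k. X m (C k v) - C k (X m v)) m k = 0"
    using assms by (auto simp: loc_def)
  have "(dif ^^ N) (\<lambda>m k. c *\<^sub>V X m (C k v) - C k (c *\<^sub>V X m v)) m k = 0" for v m k
  proof -
    have "(\<lambda>m k. c *\<^sub>V X m (C k v) - C k (c *\<^sub>V X m v)) = (\<lambda>m k. c *\<^sub>V (X m (C k v) - C k (X m v)))"
      by (simp add: lin_scl[OF fld_lin[OF assms(2)]] scl_diff_right fun_eq_iff)
    then show ?thesis by (simp only: dif_scl N) simp
  qed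
  then show ?thesis unfolding loc_def by blast
qed

lemma fld_add: "fld X \<Longrightarrow> fld Z \<Longrightarrow> fld (\<lambda>k v. X k v + Z k v)"
  unfolding fld_def
proof (intro conjI allI)
  fix k v
  assume X: "(\<forall>k. lin (X k)) \<and> (\<forall>v. \<exists>K. \<forall>k\<ge>K. X k v = 0)" and Z: "(\<forall>k. lin (Z k)) \<and> (\<forall>v. \<exists>K. \<forall>k\<ge>K. Z k v = 0)"
  then show "lin (\<lambda>v. X k v + Z k v)" by (simp add: lin_plus)
  obtain K1 K2 where "\<forall>k\<ge>K1. X k v = 0" "\<forall>k\<ge>K2. Z k v = 0" using X Z by blast
  then show "\<exists>K. \<forall>k\<ge>K. X k v + Z k v = 0"
    by (intro exI[of _ "max K1 K2"]) auto
qed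

lemma fld_scl: "fld X \<Longrightarrow> fld (\<lambda>k v. c *\<^sub>V X k v)"
  unfolding fld_def by (auto intro: lin_scale_fun) (metis scl_zero_right)

context lattice
begin

section \<open>The state-field correspondence\<close>

function Yb :: "nat multiset \<Rightarrow> int \<Rightarrow> int \<Rightarrow> V \<Rightarrow> V" where
  "Yb lam k = (if lam = {#} then e k
     else J (- int (Max (set_mset lam) + 1)) h (Yb (lam - {#Max (set_mset lam)#}) k) 0)"
  by pat_completeness auto
termination
  by (relation "measure (\<lambda>(lam, k). size lam)") (auto simp: size_Diff1_less)

declare Yb.simps [simp del]

lemma Yb_empty: "Yb {#} k = e k"
  by (simp add: Yb.simps)

text \<open>The recursion removes the largest part, as \<open>ymode\<close> does; this rule hides
  that choice, leaving an arbitrary part to be added.\<close>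

lemma Yb_induct [case_names empty add]:
  assumes "P {#} (e k)"
    and "\<And>x lam. P lam (Yb lam k) \<Longrightarrow> P (add_mset x lam) (J (- int (x + 1)) h (Yb lam k) 0)"
  shows "P lam (Yb lam k)"
proof (induction "size lam" arbitrary: lam)
  case 0
  then show ?case using assms(1) by (simp add: Yb_empty)
next
  case (Suc s)
  let ?x = "Max (set_mset lam)"
  have "lam \<noteq> {#}" using Suc.hyps(2) by auto
  then have x: "?x \<in># lam" by (simp add: Max_in)
  have "P (lam - {#?x#}) (Yb (lam - {#?x#}) k)"
    using Suc x by (simp add: size_Diff_singleton)
  from assms(2)[OF this, of ?x] show ?case
    using x \<open>lam \<noteq> {#}\<close> by (simp add: Yb.simps[of lam])
qed

definition Y :: "V \<Rightarrow> int \<Rightarrow> V \<Rightarrow> V" where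
  "Y a j v = linext (\<lambda>b. Yb (fst b) (snd b) j v) a"

lemma lin_Y: "lin (\<lambda>a. Y a j v)"
  unfolding Y_def by (rule lin_linext)

lemma Y_add: "Y (a + b) = (\<lambda>j v. Y a j v + Y b j v)"
  and Y_scl: "Y (c *\<^sub>V a) = (\<lambda>j v. c *\<^sub>V Y a j v)"
  by (simp_all add: fun_eq_iff lin_add[OF lin_Y] lin_scl[OF lin_Y])

lemma Y_bv: "Y (bv (lam, n)) = Yb lam n"
  by (simp add: Y_def fun_eq_iff)

lemma Y_ex: "Y (ex n) = e n"
  by (simp add: ex_def Y_bv Yb_empty)

text \<open>Formulated for an arbitrary test field \<open>C\<close> so that it can be bootstrapped:
  first with \<open>C\<close> the Heisenberg field, then with \<open>e k\<close>, and with these two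
  results for \<open>C = Y b\<close>, which gives mutual locality.\<close>

lemma Yb_local:
  assumes C: "fld C" "loc h C" "\<And>l. loc (e l) C"
  shows "fld (Yb lam k) \<and> loc h (Yb lam k) \<and> loc (Yb lam k) C"
proof -
  have 1: "fld (Yb lam k) \<and> loc h (Yb lam k)"
  proof (induction rule: Yb_induct)
    case empty
    then show ?case by (simp add: fld_e loc_h_e)
  next
    case (add x lam)
    then show ?case
      using loc_sym[OF dong[OF fld_h _ fld_h _ loc_h_h loc_sym]] by (simp add: J_fld fld_h)
  qed
  have "fld (Yb lam k) \<and> loc h (Yb lam k) \<and> loc (Yb lam k) C"
  proof (induction rule: Yb_induct)
    case empty
    then show ?case by (simp add: fld_e loc_h_e C)
  next
    case (add x lam)
    then show ?case
      using loc_sym[OF dong[OF fld_h _ fld_h _ loc_h_h loc_sym]] dong[OF fld_h _ C(1) _ C(2)] by (simp add: J_fld fld_h)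
  qed
  then show ?thesis .
qed

lemma Y_local:
  assumes C: "fld C" "loc h C" "\<And>l. loc (e l) C"
  shows "fld (Y a) \<and> loc (Y a) C"
proof (induction a rule: V_induct)
  case (add x y)
  then show ?case by (simp add: Y_add fld_add loc_add C)
next
  case (scl c x)
  then show ?case by (simp add: Y_scl fld_scl loc_scl C)
next
  case (mono lam n)
  then show ?case using Yb_local[OF C] by (simp add: Y_bv)
qed

lemma fld_Y: "fld (Y a)"
  and loc_Y_h: "loc (Y a) h"
  using Y_local[OF fld_h loc_h_h loc_sym[OF loc_h_e]] by auto

lemma loc_Y_e: "loc (Y a) (e k)"
  using Y_local[OF fld_e loc_h_e loc_e_e] by auto

lemma loc_Y_Y: "loc (Y a) (Y b)"
  using Y_local[OF fld_Y loc_sym[OF loc_Y_h] loc_sym[OF loc_Y_e]] by auto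

lemma e_vac: "e k j 1 = S (of_int k) (- j - 1) * ex k"
  using e_eq[OF one_hom, of 1 k j] by simp

lemma h_vac: "j \<ge> 0 \<Longrightarrow> h j 1 = 0"
  by (simp add: deriv_1[OF deriv_h])

lemma Yb_vac: "fld (Yb lam k) \<and> (\<forall>j\<ge>0. Yb lam k j 1 = 0) \<and> Yb lam k (- 1) 1 = bv (lam, k) \<and>
    (\<forall>j v. Td (Yb lam k j v) = Yb lam k j (Td v) - of_int j *\<^sub>V Yb lam k (j - 1) v)"
proof (induction rule: Yb_induct)
  case empty
  then show ?case by (simp add: e_vac Td_e fld_e flip: ex_def)
next
  case (add x lam)
  let ?B = "Yb lam k" and ?n = "- int (x + 1)"
  have B: "fld ?B" "\<And>j. j \<ge> 0 \<Longrightarrow> ?B j 1 = 0" "?B (- 1) 1 = bv (lam, k)"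
    "\<And>j v. Td (?B j v) = ?B j (Td v) - of_int j *\<^sub>V ?B (j - 1) v"
    using add by auto
  have J0: "J ?n h ?B 0 j 1 = (if j = - 1 then h ?n (?B (- 1) 1) else 0)" if "j \<ge> - 1" for j
  proof -
    have "iexp ?n (\<lambda>m k. h m (?B k 1)) 0 j = (\<Sum>i<1. bc ?n i *\<^sub>V h (0 + ?n - int i) (?B (j + int i) 1))"
      unfolding iexp_def by (rule fsum_eq) (use that in \<open>simp add: B(2) lin_0[OF lin_h]\<close>)
    moreover have "iexp ?n (\<lambda>k m. ?B k (h m 1)) j 0 = 0"
      unfolding iexp_def fsum_def by (simp add: h_vac lin_0[OF fld_lin[OF B(1)]])
    ultimately show ?thesis
      using that unfolding J_def by (auto simp: B(2) lin_0[OF lin_h])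
  qed
  have "h ?n (bv (lam, k)) = bv (add_mset x lam, k)"
    using h_neg[of "x + 1"] by (simp add: bv_add_mset)
  then have "J ?n h ?B 0 (- 1) 1 = bv (add_mset x lam, k)"
    by (simp only: J0[OF order_refl] B(3)) simp
  moreover have "\<forall>j\<ge>0. J ?n h ?B 0 j 1 = 0"
    by (intro allI impI, subst J0) auto
  moreover have "\<forall>j v. Td (J ?n h ?B 0 j v) = J ?n h ?B 0 j (Td v) - of_int j *\<^sub>V J ?n h ?B 0 (j - 1) v"
    unfolding J_translation[OF fld_h B(1) lin_Td Td_h B(4)] by simp
  ultimately show ?case
    using J_fld[OF fld_h B(1)] by blast
qed

lemma Y_vacuum: "fld (Y a) \<and> (\<forall>j\<ge>0. Y a j 1 = 0) \<and> Y a (- 1) 1 = a \<and>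
    (\<forall>j v. Td (Y a j v) = Y a j (Td v) - of_int j *\<^sub>V Y a (j - 1) v)"
proof (induction a rule: V_induct)
  case (add x y)
  then show ?case by (simp add: Y_add fld_add lin_add[OF lin_Td] scl_add_right)
next
  case (scl c x)
  then show ?case by (simp add: Y_scl fld_scl lin_scl[OF lin_Td] scl_diff_right mult.commute)
next
  case (mono lam n)
  then show ?case using Yb_vac by (simp add: Y_bv)
qed

sublocale va: vertex_algebra Y 1 Td
  by standard (use Y_vacuum in \<open>auto simp: lin_Y loc_Y_Y lin_Td deriv_1[OF deriv_Td]\<close>)

lemma Y_A0: "Y (A 0) = h"
proof -
  have "h k v = Y (h (- 1) 1) k v" for k v
    by (rule va.Y_unique) (auto simp: fld_h loc_sym[OF loc_Y_h] h_vac Td_h)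
  moreover have "h (- 1) 1 = A 0" using h_neg[of 1 1] by simp
  ultimately show ?thesis by (simp add: fun_eq_iff)
qed

lemma Y_A_mult: "Y (A i * x) k v = J (- int i - 1) h (Y x) 0 k v"
  using va.iterate[of "A 0" "- int i - 1" x k v] by (simp add: Y_A0 h_neg1)

lemma Yb_hom:
  assumes "v \<in> hom c2 d2"
  shows "Yb lam k j v \<in> hom (k + c2) (int (deg lam) + d2 - 2 * int p * k * c2 - j - 1)"
proof -
  have "\<forall>j c2 d2 v. v \<in> hom c2 d2 \<longrightarrow> Yb lam k j v \<in> hom (k + c2) (int (deg lam) + d2 - 2 * int p * k * c2 - j - 1)"
  proof (induction rule: Yb_induct)
    case empty
    then show ?case using e_hom by (simp add: add.commute)
  next
    case (add x lam)
    show ?case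
    proof (intro allI impI J_mem hom_subspace)
      fix j c2 d2 v i assume v: "v \<in> hom c2 d2"
      have "h (0 + - int (x + 1) - int i) (Yb lam k (j + int i) v) \<in> hom (k + c2)
         (int (deg lam) + d2 - 2 * int p * k * c2 - (j + int i) - 1 - (0 + - int (x + 1) - int i))"
        using add v by (intro h_hom) auto
      then show "h (0 + - int (x + 1) - int i) (Yb lam k (j + int i) v)
           \<in> hom (k + c2) (int (deg (add_mset x lam)) + d2 - 2 * int p * k * c2 - j - 1)"
        by (simp add: algebra_simps)
      have "Yb lam k (j + - int (x + 1) - int i) (h (0 + int i) v) \<in> hom (k + c2)
         (int (deg lam) + (d2 - (0 + int i)) - 2 * int p * k * c2 - (j + - int (x + 1) - int i) - 1)"
        using add h_hom[OF v] by blast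
      then show "Yb lam k (j + - int (x + 1) - int i) (h (0 + int i) v)
           \<in> hom (k + c2) (int (deg (add_mset x lam)) + d2 - 2 * int p * k * c2 - j - 1)"
        by (simp add: algebra_simps)
    qed
  qed
  then show ?thesis using assms by blast
qed

lemma Y_hom:
  assumes "a \<in> hom c1 d1" "v \<in> hom c2 d2"
  shows "Y a j v \<in> hom (c1 + c2) (d1 + d2 - 2 * int p * c1 * c2 - j - 1)"
  unfolding Y_def linext_def
proof (intro hom_sum hom_scl)
  fix b assume "b \<in> Poly_Mapping.keys a"
  then have "snd b = c1" "int (deg (fst b)) = d1" using assms(1) by (auto simp: hom_def)
  then show "Yb (fst b) (snd b) j v \<in> hom (c1 + c2) (d1 + d2 - 2 * int p * c1 * c2 - j - 1)"
    using Yb_hom[OF assms(2)] by auto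
qed

subsection \<open>The Virasoro field\<close>

definition om :: V where
  "om = (1 / (4 * cp)) *\<^sub>V (A 0 * A 0) + ((cp - 1) / (2 * cp)) *\<^sub>V A 1"

definition L :: "int \<Rightarrow> V \<Rightarrow> V" where
  "L n = Y om (n + 1)"

lemma lin_L: "lin (L n)"
  unfolding L_def by (rule va.Y_lin2)

lemma Y_A1: "Y (A 1) j x = - of_int j *\<^sub>V h (j - 1) x"
  using va.Y_T[of "A 0" j x] by (simp add: Td_A Y_A0)

lemma bc_m1: "bc (- 1) i = 1"
proof (induction i)
  case (Suc i)
  have "of_nat (Suc i) * bc (- 1) (Suc i) = of_nat (Suc i) * 1"
    unfolding bc_absorb Suc by (simp add: algebra_simps)
  then show ?case by (simp only: mult_cancel_left of_nat_eq_0_iff) simp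
qed simp

lemma Y_A00: "Y (A 0 * A 0) j x = fsum (\<lambda>i. h (- 1 - int i) (h (j + int i) x)) + fsum (\<lambda>i. h (j - 1 - int i) (h (int i) x))"
  using Y_A_mult[of 0 "A 0" j x] by (simp add: Y_A0 J_def iexp_def bc_m1 sg_def)

lemma Y_om: "Y om j x = (1 / (4 * cp)) *\<^sub>V Y (A 0 * A 0) j x - ((cp - 1) / (2 * cp) * of_int j) *\<^sub>V h (j - 1) x"
  unfolding om_def Y_add Y_scl Y_A1 by simp

lemma A00_eq:
  assumes "\<And>i. i \<ge> int N \<Longrightarrow> h i x = 0" "int M \<ge> int N - j"
  shows "Y (A 0 * A 0) j x = (\<Sum>i<M. h (- 1 - int i) (h (j + int i) x)) + (\<Sum>i<N. h (j - 1 - int i) (h (int i) x))"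
  unfolding Y_A00 using assms
  by (subst fsum_eq[of M], simp add: lin_0[OF lin_h], subst fsum_eq[of N]) (simp_all add: lin_0[OF lin_h])

lemma A00_ex:
  assumes "j \<ge> 0"
  shows "Y (A 0 * A 0) j (ex n) = (if j = 0 then (4 * cp * of_int n) *\<^sub>V (A 0 * ex n)
    else if j = 1 then (4 * cp * cp * of_int n * of_int n) *\<^sub>V ex n else 0)"
proof -
  have "Y (A 0 * A 0) j (ex n) = (\<Sum>i<1. h (- 1 - int i) (h (j + int i) (ex n))) + (\<Sum>i<1. h (j - 1 - int i) (h (int i) (ex n)))"
    by (rule A00_eq) (use assms in \<open>auto simp: h_ex\<close>)
  also have "\<dots> = h (- 1) (h j (ex n)) + (2 * cp * of_int n) *\<^sub>V h (j - 1) (ex n)"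
    by (simp add: lin_scl[OF lin_h])
  finally show ?thesis
    using assms h_neg[of 1 "ex n"]
    by (cases "j = 0"; cases "j = 1") (auto simp: h_ex lin_scl[OF lin_h] lin_0[OF lin_h] algebra_simps simp flip: scl_add_left)
qed

lemma om_ex0: "Y om 0 (ex n) = Td (ex n)"
  using h_neg[of 1 "ex n"] by (simp add: Y_om A00_ex Td_ex)

lemma om_ex1: "Y om 1 (ex n) = (cp * of_int n * of_int n - (cp - 1) * of_int n) *\<^sub>V ex n"
proof -
  have "1 / (4 * cp) * (4 * cp * cp * of_int n * of_int n) = cp * of_int n * of_int n"
    "(cp - 1) / (2 * cp) * of_int 1 * (2 * cp * of_int n) = (cp - 1) * of_int n"
    by simp_all
  then show ?thesis
    by (simp add: Y_om A00_ex scl_diff_left)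
qed

lemma om_ex2: "j \<ge> 2 \<Longrightarrow> Y om j (ex n) = 0"
  by (simp add: Y_om A00_ex h_ex)

lemma om0_A0: "Y om 0 (A 0) = A 1"
proof -
  have hA: "h i (A 0) = (if i = 1 then (2 * cp) *\<^sub>V 1 else 0)" if "i \<ge> 0" for i
    using that by (cases "i = 0") (auto simp: h_A)
  have "Y (A 0 * A 0) 0 (A 0) = (\<Sum>i<2. h (- 1 - int i) (h (0 + int i) (A 0))) + (\<Sum>i<2. h (0 - 1 - int i) (h (int i) (A 0)))"
    by (rule A00_eq) (auto simp: hA)
  then show ?thesis
    using h_neg[of 2 1] by (simp add: Y_om hA numeral_2_eq_2 lin_scl[OF lin_h] lin_0[OF lin_h] flip: scl_add_left)
qed

text \<open>Both operators agree on \<open>ex n\<close>, and both have the same commutator with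
  \<open>h (- i - 1)\<close>, because the zeroth product of \<open>om\<close> and \<open>A 0\<close>
  is \<open>A 1\<close>, the translate of \<open>A 0\<close>.\<close>

lemma Y_om0: "Y om 0 x = Td x"
proof (rule lin_eqI[OF va.Y_lin2 lin_Td])
  fix b :: bas
  obtain lam n where b: "b = (lam, n)" by fastforce
  have "Y om 0 (bv (lam, n)) = Td (bv (lam, n))"
  proof (induction lam)
    case empty
    then show ?case by (simp add: om_ex0 flip: ex_def)
  next
    case (add i lam)
    have "Y om 0 (h (- int i - 1) (bv (lam, n))) = Y (Y om 0 (A 0)) (- int i - 1) (bv (lam, n)) + h (- int i - 1) (Y om 0 (bv (lam, n)))"
      using va.zero_mode_derivation[of om "A 0"] by (simp add: Y_A0)
    also have "\<dots> = Td (h (- int i - 1) (bv (lam, n)))"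
      unfolding om0_A0 Y_A1 add Td_h by (simp add: scl_diff_left scl_add_left)
    finally show ?case by (simp add: h_neg1 bv_add_mset)
  qed
  then show "Y om 0 (bv b) = Td (bv b)" by (simp add: b)
qed

lemma L_m1: "L (- 1) = Td"
  by (simp add: L_def Y_om0 fun_eq_iff)

text \<open>The conformal weight of \<open>ex n\<close>. As \<open>wtn 1 = 1\<close>, the residue
  \<open>Qs\<close> of the field of \<open>ex 1\<close> commutes with all \<open>L i\<close>; the
  value at \<open>- n\<close> is \<open>hn n\<close>.\<close>

definition wtn :: "int \<Rightarrow> complex" where
  "wtn n = cp * of_int n * of_int n - (cp - 1) * of_int n"

lemma L_e: "L i (e n k v) = e n k (L i v) + (of_int (i + 1) * (wtn n - 1) - of_int k) *\<^sub>V e n (i + k) v"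
proof -
  have "Y om (i + 1) (Y (ex n) k v) = Y (ex n) k (Y om (i + 1) v) + Y (Y om 0 (ex n)) (i + 1 + k) v
      + of_int (i + 1) *\<^sub>V Y (Y om 1 (ex n)) (i + 1 + k - 1) v"
    by (rule va.commutator_primary) (simp add: om_ex2)
  also have "Y (Y om 0 (ex n)) (i + 1 + k) v = - of_int (i + 1 + k) *\<^sub>V e n (i + k) v"
    unfolding om_ex0 va.Y_T Y_ex by (simp add: algebra_simps)
  also have "Y (Y om 1 (ex n)) (i + 1 + k - 1) v = wtn n *\<^sub>V e n (i + k) v"
    unfolding om_ex1 Y_scl Y_ex wtn_def by (simp add: algebra_simps)
  finally show ?thesis
    by (simp add: L_def Y_ex algebra_simps scl_diff_left scl_add_left)
qed

definition Qs :: "V \<Rightarrow> V" where "Qs = e 1 0"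

lemma lin_Qs: "lin Qs"
  by (simp add: Qs_def lin_e)

lemma L_Qs: "L i (Qs v) = Qs (L i v)"
  unfolding Qs_def L_e by (simp add: wtn_def)

lemma Qs_Y: "Qs (Y a k v) = Y (Qs a) k v + Y a k (Qs v)"
  using va.zero_mode_derivation[of "ex 1"] by (simp add: Qs_def Y_ex)

lemma Qs_hom: "x \<in> hom c d \<Longrightarrow> Qs x \<in> hom (c + 1) (d - 2 * int p * c - 1)"
  unfolding Qs_def using e_hom[of x c d 1 0] by simp

lemma L_hom: "x \<in> hom c d \<Longrightarrow> L i x \<in> hom c (d - i)"
proof -
  assume x: "x \<in> hom c d"
  have "om \<in> hom 0 2"
    unfolding om_def using hom_mult[OF A_hom A_hom, of 0 0] A_hom[of 1] by (intro hom_add hom_scl) auto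
  then have "Y om (i + 1) x \<in> hom (0 + c) (2 + d - 2 * int p * 0 * c - (i + 1) - 1)"
    by (rule Y_hom[OF _ x])
  then show ?thesis by (simp add: L_def algebra_simps)
qed

end

section \<open>Constant terms\<close>

subsection \<open>Laurent polynomials\<close>

type_synonym LP = "(nat \<Rightarrow>\<^sub>0 int) \<Rightarrow>\<^sub>0 int"

definition Z :: "nat \<Rightarrow> int \<Rightarrow> LP" where
  "Z i k = Poly_Mapping.single (Poly_Mapping.single i k) 1"

lemma Z_mult: "Z i k * Z i l = Z i (k + l)"
  by (simp add: Z_def mult_single single_add)

lemma Z_0 [simp]: "Z i 0 = 1"
  by (simp add: Z_def)

lemma Z_power: "Z i k ^ n = Z i (int n * k)"
  by (induction n) (simp_all add: Z_mult algebra_simps)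

text \<open>If \<open>g a\<close> is the coefficient of \<open>z ^ (- a)\<close> in a series, this
  is the constant term of \<open>f\<close> times that series.\<close>

definition ev :: "((nat \<Rightarrow>\<^sub>0 int) \<Rightarrow> V) \<Rightarrow> LP \<Rightarrow> V" where
  "ev g f = (\<Sum>a\<in>Poly_Mapping.keys f. of_int (Poly_Mapping.lookup f a) *\<^sub>V g a)"

lemma ev_superset:
  assumes "finite S" "Poly_Mapping.keys f \<subseteq> S"
  shows "ev g f = (\<Sum>a\<in>S. of_int (Poly_Mapping.lookup f a) *\<^sub>V g a)"
  unfolding ev_def using assms
  by (intro sum.mono_neutral_left) (auto simp: in_keys_iff)

lemma ev_add: "ev g (f + f') = ev g f + ev g f'"
proof -
  let ?S = "Poly_Mapping.keys f \<union> Poly_Mapping.keys f'"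
  have "ev g (f + f') = (\<Sum>b\<in>?S. of_int (Poly_Mapping.lookup (f + f') b) *\<^sub>V g b)"
    by (rule ev_superset) (auto dest: subsetD[OF Poly_Mapping.keys_add])
  also have "\<dots> = ev g f + ev g f'"
    by (simp add: ev_superset[of ?S f] ev_superset[of ?S f'] lookup_add scl_add_left sum.distrib)
  finally show ?thesis .
qed

lemma ev_0 [simp]: "ev g 0 = 0"
  by (simp add: ev_def)

lemma ev_sum: "ev g (sum f S) = (\<Sum>i\<in>S. ev g (f i))"
  by (induction S rule: infinite_finite_induct) (simp_all add: ev_add)

lemma LP_expand: "f = (\<Sum>a\<in>Poly_Mapping.keys f. Poly_Mapping.single a (Poly_Mapping.lookup f a))"
  by (rule poly_mapping_eqI) (simp add: lookup_sum lookup_single when_def sum.delta in_keys_iff)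

lemma ev_single: "ev g (Poly_Mapping.single a c) = of_int c *\<^sub>V g a"
  by (cases "c = 0") (simp_all add: ev_def)

lemma ev_mult_single: "ev g (f * Poly_Mapping.single b c) = of_int c *\<^sub>V ev (\<lambda>a. g (a + b)) f"
proof -
  have "f * Poly_Mapping.single b c = (\<Sum>a\<in>Poly_Mapping.keys f. Poly_Mapping.single (a + b) (Poly_Mapping.lookup f a * c))"
    by (subst LP_expand[of f]) (simp add: sum_distrib_right mult_single)
  then show ?thesis
    by (simp add: ev_sum ev_single) (simp add: ev_def scl_sum_right mult.commute)
qed

lemma ev_cong: "(\<And>a. a \<in> Poly_Mapping.keys f \<Longrightarrow> g a = g' a) \<Longrightarrow> ev g f = ev g' f"
  by (simp add: ev_def)

lemma ev_lin_sum: "ev (\<lambda>a. \<Sum>i\<in>S. of_int (c i) *\<^sub>V g i a) f = (\<Sum>i\<in>S. of_int (c i) *\<^sub>V ev (g i) f)"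
  unfolding ev_def scl_sum_right by (subst sum.swap) (simp add: mult.commute)

text \<open>The substitution of \<open>1/z\<close> for every variable \<open>z\<close>.\<close>

definition linv :: "LP \<Rightarrow> LP" where
  "linv f = (\<Sum>a\<in>Poly_Mapping.keys f. Poly_Mapping.single (- a) (Poly_Mapping.lookup f a))"

lemma lookup_linv: "Poly_Mapping.lookup (linv f) a = Poly_Mapping.lookup f (- a)"
proof -
  have "Poly_Mapping.lookup (linv f) a = (\<Sum>b\<in>Poly_Mapping.keys f. if b = - a then Poly_Mapping.lookup f b else 0)"
    unfolding linv_def lookup_sum lookup_single when_def by (rule sum.cong) (auto simp: equation_minus_iff)
  then show ?thesis by (simp add: sum.delta in_keys_iff)
qed

lemma linv_add: "linv (f + g) = linv f + linv g"
  by (rule poly_mapping_eqI) (simp add: lookup_linv lookup_add)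

lemma linv_0 [simp]: "linv 0 = 0"
  by (rule poly_mapping_eqI) (simp add: lookup_linv)

lemma linv_sum: "linv (sum f S) = (\<Sum>i\<in>S. linv (f i))"
  by (induction S rule: infinite_finite_induct) (simp_all add: linv_add)

lemma linv_single: "linv (Poly_Mapping.single a c) = Poly_Mapping.single (- a) c"
  by (cases "c = 0") (simp_all add: linv_def)

lemma linv_mult: "linv (f * g) = linv f * linv g"
proof -
  have "linv (f * g) = (\<Sum>a\<in>Poly_Mapping.keys f. \<Sum>b\<in>Poly_Mapping.keys g.
     linv (Poly_Mapping.single a (Poly_Mapping.lookup f a) * Poly_Mapping.single b (Poly_Mapping.lookup g b)))"
    by (subst LP_expand[of f], subst LP_expand[of g]) (simp only: sum_distrib_left sum_distrib_right linv_sum sum.swap[of _ "Poly_Mapping.keys g"])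
  also have "\<dots> = (\<Sum>a\<in>Poly_Mapping.keys f. \<Sum>b\<in>Poly_Mapping.keys g.
     linv (Poly_Mapping.single a (Poly_Mapping.lookup f a)) * linv (Poly_Mapping.single b (Poly_Mapping.lookup g b)))"
    by (simp add: mult_single linv_single add.commute)
  also have "\<dots> = linv f * linv g"
    by (subst (3) LP_expand[of f], subst (3) LP_expand[of g])
      (simp only: linv_sum sum_distrib_left sum_distrib_right sum.swap[of _ "Poly_Mapping.keys g"])
  finally show ?thesis .
qed

lemma linv_1 [simp]: "linv 1 = 1"
  using linv_single[of 0 1] by simp

lemma linv_diff: "linv (f - g) = linv f - linv g"
  by (rule poly_mapping_eqI) (simp add: lookup_linv lookup_minus)

lemma linv_Z: "linv (Z i k) = Z i (- k)"
  by (simp add: Z_def linv_single single_uminus)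

lemma linv_power: "linv (f ^ n) = linv f ^ n"
  by (induction n) (simp_all add: linv_mult)

lemma linv_prod: "linv (prod f S) = (\<Prod>i\<in>S. linv (f i))"
  by (induction S rule: infinite_finite_induct) (simp_all add: linv_mult)

text \<open>The constant term of \<open>g(z) g(1/z)\<close> is the sum of the squares of the integer
  coefficients of \<open>g\<close>.\<close>

lemma constant_term_positive:
  assumes "g \<noteq> (0 :: LP)"
  shows "Poly_Mapping.lookup (g * linv g) 0 > 0"
proof -
  have "g * linv g = (\<Sum>a\<in>Poly_Mapping.keys g. \<Sum>b\<in>Poly_Mapping.keys g.
      Poly_Mapping.single (a - b) (Poly_Mapping.lookup g a * Poly_Mapping.lookup g b))"
    unfolding linv_def
    by (subst (1) LP_expand[of g]) (simp only: sum_product mult_single diff_conv_add_uminus)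
  then have "Poly_Mapping.lookup (g * linv g) 0 = (\<Sum>a\<in>Poly_Mapping.keys g. \<Sum>b\<in>Poly_Mapping.keys g.
      if a - b = 0 then Poly_Mapping.lookup g a * Poly_Mapping.lookup g b else 0)"
    by (simp only: lookup_sum lookup_single when_def)
  also have "\<dots> = (\<Sum>a\<in>Poly_Mapping.keys g. \<Sum>b\<in>Poly_Mapping.keys g.
      if b = a then Poly_Mapping.lookup g a * Poly_Mapping.lookup g a else 0)"
    by (intro sum.cong refl) auto
  also have "\<dots> = (\<Sum>a\<in>Poly_Mapping.keys g. Poly_Mapping.lookup g a * Poly_Mapping.lookup g a)"
    by (simp add: sum.delta')
  also have "\<dots> > 0"
  proof (rule sum_pos)
    show "Poly_Mapping.keys g \<noteq> {}" using assms by simp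
    fix a assume "a \<in> Poly_Mapping.keys g"
    then show "0 < Poly_Mapping.lookup g a * Poly_Mapping.lookup g a"
      by (metis in_keys_iff not_real_square_gt_zero of_int_0_less_iff of_int_eq_0_iff of_int_mult mult_neg_neg mult_pos_pos linorder_neqE_linordered_idom)
  qed simp
  finally show ?thesis .
qed

definition Vdm :: "nat \<Rightarrow> nat \<Rightarrow> LP" where
  "Vdm s q = (\<Prod>r<s. \<Prod>i<r. (Z i 1 - Z r 1) ^ q)"

lemma Z_neq: "i \<noteq> r \<Longrightarrow> Z i 1 \<noteq> Z r 1"
proof
  assume "i \<noteq> r" "Z i 1 = Z r 1"
  then have "Poly_Mapping.lookup (Z i 1) (Poly_Mapping.single i 1) = Poly_Mapping.lookup (Z r 1) (Poly_Mapping.single i 1)" by simp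
  moreover have "Poly_Mapping.single i (1 :: int) \<noteq> Poly_Mapping.single r 1"
  proof
    assume "Poly_Mapping.single i (1 :: int) = Poly_Mapping.single r 1"
    then have "Poly_Mapping.lookup (Poly_Mapping.single i (1 :: int)) i = Poly_Mapping.lookup (Poly_Mapping.single r (1 :: int)) i" by simp
    then show False using \<open>i \<noteq> r\<close> by (simp add: lookup_single when_def)
  qed
  ultimately show False by (simp add: Z_def lookup_single when_def)
qed

lemma Vdm_nz: "Vdm s q \<noteq> 0"
  unfolding Vdm_def by (auto simp: prod_zero_iff Z_neq)

lemma Z_plus_nz: "1 + Z i 1 \<noteq> 0"
proof
  assume "1 + Z i 1 = 0"
  then have "Poly_Mapping.lookup (1 + Z i 1) 0 = Poly_Mapping.lookup (0 :: LP) 0" by simp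
  moreover have "Poly_Mapping.single i (1 :: int) \<noteq> 0"
    by (metis lookup_single_eq lookup_zero zero_neq_one)
  ultimately show False by (simp add: lookup_add Z_def lookup_single when_def)
qed

lemma Z_diff_square: "(Z i 1 - Z r 1) ^ (2 * q) = (- 1) ^ q * (Z i (int q) * Z r (int q)) * ((Z i 1 - Z r 1) ^ q * linv ((Z i 1 - Z r 1) ^ q))"
proof -
  have "(Z i 1 - Z r 1) ^ 2 = - 1 * (Z i 1 * Z r 1) * ((Z i 1 - Z r 1) * (Z i (- 1) - Z r (- 1)))"
  proof -
    have "Z i 1 * Z i (- 1) = 1" "Z r 1 * Z r (- 1) = 1" by (simp_all add: Z_mult)
    then show ?thesis by algebra
  qed
  then have "((Z i 1 - Z r 1) ^ 2) ^ q = (- 1 * (Z i 1 * Z r 1) * ((Z i 1 - Z r 1) * (Z i (- 1) - Z r (- 1)))) ^ q" by simp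
  then show ?thesis
    by (simp only: power_mult[symmetric] power_mult_distrib Z_power linv_power linv_diff linv_Z) simp
qed

text \<open>\<open>(x - y) ^ 2 = - x y (x - y) (1/x - 1/y)\<close>, applied to every factor. The
  sign is kept as an unspecified square root of 1, since only nonvanishing will be used.\<close>

lemma Vdm_square:
  "\<exists>c. c ^ 2 = 1 \<and> Vdm s (2 * q) = c * (\<Prod>r<s. Z r (int q * (int s - 1))) * (Vdm s q * linv (Vdm s q))"
proof (induction s)
  case 0
  show ?case by (rule exI[of _ 1]) (simp add: Vdm_def)
next
  case (Suc s)
  then obtain c where c: "c ^ 2 = 1" "Vdm s (2 * q) = c * (\<Prod>r<s. Z r (int q * (int s - 1))) * (Vdm s q * linv (Vdm s q))"
    by blast
  let ?d = "\<lambda>i. (Z i 1 - Z s 1) ^ q"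
  have step: "Vdm (Suc s) q' = Vdm s q' * (\<Prod>i<s. (Z i 1 - Z s 1) ^ q')" for q'
    by (simp add: Vdm_def)
  have "(\<Prod>i<s. (Z i 1 - Z s 1) ^ (2 * q)) = (\<Prod>i<s. (- 1) ^ q) * ((\<Prod>i<s. Z i (int q)) * (\<Prod>i<s. Z s (int q))) * (prod ?d {..<s} * linv (prod ?d {..<s}))"
    by (simp only: Z_diff_square prod.distrib linv_prod)
  moreover have "(\<Prod>i<s. Z s (int q)) = Z s (int q * int s)"
    by (simp add: Z_power mult.commute)
  moreover have "(\<Prod>r<s. Z r (int q * (int s - 1))) * (\<Prod>i<s. Z i (int q)) = (\<Prod>r<s. Z r (int q * int s))"
    unfolding prod.distrib[symmetric] Z_mult by (simp add: algebra_simps)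
  ultimately have "Vdm (Suc s) (2 * q) = (c * (- 1) ^ (q * s)) * ((\<Prod>r<s. Z r (int q * int s)) * Z s (int q * int s)) * (Vdm (Suc s) q * linv (Vdm (Suc s) q))"
    unfolding step c(2) linv_mult by (simp add: power_mult mult_ac)
  moreover have "(c * (- 1) ^ (q * s)) ^ 2 = 1"
    using c(1) by (simp add: power_mult_distrib flip: power_mult)
  ultimately show ?case by (intro exI[of _ "c * (- 1) ^ (q * s)"]) simp
qed

text \<open>The factors \<open>1 - z_r / z_i\<close> are what reordering vertex operators produces;
  the monomials come from the charges, which grow with each application. Together they clear the
  denominators.\<close>

lemma Vdm_split:
  "(\<Prod>r<s. Z r (q * (int s - 1 - int r) * 2) * (\<Prod>i<r. (1 - Z r 1 * Z i (- 1)) ^ (2 * nat q))) = Vdm s (2 * nat q)" if "q \<ge> 0"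
proof (induction s)
  case 0
  show ?case by (simp add: Vdm_def)
next
  case (Suc s)
  have step: "Vdm (Suc s) q' = Vdm s q' * (\<Prod>i<s. (Z i 1 - Z s 1) ^ q')" for q'
    by (simp add: Vdm_def)
  have f: "Z i (q * 2) * (1 - Z s 1 * Z i (- 1)) ^ (2 * nat q) = (Z i 1 - Z s 1) ^ (2 * nat q)" for i
  proof -
    have "Z i 1 * (1 - Z s 1 * Z i (- 1)) = Z i 1 - Z s 1"
    proof -
      have "Z i 1 * Z i (- 1) = 1" by (simp add: Z_mult)
      then show ?thesis by algebra
    qed
    then have "(Z i 1 - Z s 1) ^ (2 * nat q) = Z i 1 ^ (2 * nat q) * (1 - Z s 1 * Z i (- 1)) ^ (2 * nat q)"
      by (metis power_mult_distrib)
    also have "Z i 1 ^ (2 * nat q) = Z i (q * 2)" using that by (simp add: Z_power mult.commute)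
    finally show ?thesis by simp
  qed
  have "(\<Prod>r<Suc s. Z r (q * (int (Suc s) - 1 - int r) * 2) * (\<Prod>i<r. (1 - Z r 1 * Z i (- 1)) ^ (2 * nat q))) =
     (\<Prod>r<s. Z r (q * (int s - 1 - int r) * 2) * (\<Prod>i<r. (1 - Z r 1 * Z i (- 1)) ^ (2 * nat q)))
       * ((\<Prod>r<s. Z r (q * 2)) * (\<Prod>i<s. (1 - Z s 1 * Z i (- 1)) ^ (2 * nat q)))"
  proof -
    have "Z r (q * (int (Suc s) - 1 - int r) * 2) = Z r (q * (int s - 1 - int r) * 2) * Z r (q * 2)" for r
      by (simp add: Z_mult algebra_simps)
    then have E: "(\<Prod>r<s. Z r (q * (int (Suc s) - 1 - int r) * 2)) = (\<Prod>r<s. Z r (q * (int s - 1 - int r) * 2)) * (\<Prod>r<s. Z r (q * 2))"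
      by (simp only: prod.distrib)
    have "Z s (q * (int (Suc s) - 1 - int s) * 2) = 1" by simp
    then show ?thesis
      unfolding prod.lessThan_Suc prod.distrib E by (simp only: mult_ac mult_1)
  qed
  also have "\<dots> = Vdm s (2 * nat q) * (\<Prod>i<s. (Z i 1 - Z s 1) ^ (2 * nat q))"
    unfolding Suc prod.distrib[symmetric] f ..
  finally show ?case by (simp only: step)
qed

subsection \<open>Lowest components of products of vertex operators\<close>

definition chg :: "int \<Rightarrow> V set" where
  "chg c = {x. \<forall>b\<in>Poly_Mapping.keys x. snd b = c}"

lemma hom_chg: "hom c d \<subseteq> chg c"
  by (auto simp: hom_def chg_def)

lemma chg_eqI:
  assumes "lin f" "lin g" "\<And>d x. x \<in> hom c d \<Longrightarrow> f x = g x" "x \<in> chg c"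
  shows "f x = g x"
proof -
  have "f (bv b) = g (bv b)" if "b \<in> Poly_Mapping.keys x" for b
    using assms(3)[OF bv_hom[of "fst b" c]] assms(4) that by (auto simp: chg_def)
  then show ?thesis
    by (subst (1 2) V_expand[of x]) (simp add: lin_sum[OF assms(1)] lin_sum[OF assms(2)] lin_scl[OF assms(1)] lin_scl[OF assms(2)])
qed

lemma chg_subspace: "V.subspace (chg c)"
  unfolding V.subspace_def chg_def
proof (intro conjI ballI CollectI)
  fix x y :: V and b
  assume "x \<in> {x. \<forall>b\<in>Poly_Mapping.keys x. snd b = c}" "y \<in> {x. \<forall>b\<in>Poly_Mapping.keys x. snd b = c}" "b \<in> Poly_Mapping.keys (x + y)"
  then show "snd b = c"
    using Poly_Mapping.keys_add[of x y] by auto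
qed (auto simp: in_keys_iff)

lemma chg_lin:
  assumes "lin f" "\<And>d x. x \<in> hom c d \<Longrightarrow> f x \<in> chg c'" "x \<in> chg c"
  shows "f x \<in> chg c'"
proof -
  have "f (bv b) \<in> chg c'" if "b \<in> Poly_Mapping.keys x" for b
  proof -
    have "b = (fst b, c)" using assms(3) that by (auto simp: chg_def prod_eq_iff)
    then show ?thesis using assms(2)[OF bv_hom[of "fst b" c]] by simp
  qed
  then show ?thesis
    by (subst V_expand[of x]) (simp add: lin_sum[OF assms(1)] lin_scl[OF assms(1)] V.subspace_sum V.subspace_scale chg_subspace)
qed

text \<open>The augmentation \<open>A i \<mapsto> 0\<close>, \<open>ex n \<mapsto> 1\<close>.\<close>
definition ell :: "V \<Rightarrow> V" where
  "ell = linext (\<lambda>b. if fst b = {#} then 1 else 0)"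

lemma lin_ell: "lin ell"
  unfolding ell_def by (rule lin_linext)

lemma ell_A [simp]: "ell (A i * x) = 0"
proof -
  have "ell (A i * x) = (\<lambda>x. 0) x"
  proof (rule lin_eqI[OF lin_compose[OF lin_ell lin_mult] lin_zero])
    fix b :: bas
    show "ell (A i * bv b) = 0"
      by (cases b) (simp add: ell_def bv_add_mset[symmetric])
  qed
  then show ?thesis .
qed

lemma ell_ex [simp]: "ell (ex k * x) = ell x"
proof (rule lin_eqI[OF lin_compose[OF lin_ell lin_mult] lin_ell])
  fix b :: bas
  show "ell (ex k * bv b) = ell (bv b)"
    by (cases b) (simp add: ell_def ex_bv)
qed

lemma ell_1 [simp]: "ell 1 = 1"
  unfolding ell_def bv_0[symmetric] linext_bv by simp

lemma ell_hom: "x \<in> hom c d \<Longrightarrow> d \<noteq> 0 \<Longrightarrow> ell x = 0"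
  unfolding ell_def linext_def by (rule sum.neutral) (auto simp: hom_def)

lemma ell_hom0: "x \<in> hom 0 0 \<Longrightarrow> ell x = x"
proof -
  assume x: "x \<in> hom 0 0"
  have "fst b = {#} \<and> snd b = 0" if "b \<in> Poly_Mapping.keys x" for b
  proof -
    have "snd b = 0" "deg (fst b) = 0" using x that by (auto simp: hom_def)
    then show ?thesis by (simp add: deg_def)
  qed
  then have *: "(if fst b = {#} then 1 else 0) = bv b" if "b \<in> Poly_Mapping.keys x" for b
    using that by (metis bv_0 prod.collapse)
  show ?thesis
    unfolding ell_def linext_def by (subst (3) V_expand[of x]) (intro sum.cong refl, simp add: *)
qed

context lattice
begin

lemma ell_S: "ell (S k a * x) = (if a = 0 then ell x else 0)"
proof (cases "a > 0")
  case True
  have "of_int a *\<^sub>V ell (S k a * x) = ell ((of_int a *\<^sub>V S k a) * x)"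
    by (simp add: scl_mult_left lin_scl[OF lin_ell])
  also have "of_int a *\<^sub>V S k a = k *\<^sub>V (\<Sum>i\<in>{1..nat a}. A (i - 1) * S k (a - int i))"
    by (rule S_rec) simp
  also have "ell (\<dots> * x) = 0"
    by (simp add: scl_mult_left sum_distrib_right lin_scl[OF lin_ell] lin_sum[OF lin_ell] mult.assoc)
  finally show ?thesis using True by simp
next
  case False
  then show ?thesis by (cases "a = 0") (simp_all add: lin_0[OF lin_ell])
qed

text \<open>The creation factor \<open>S k a\<close> with positive \<open>a\<close> lies in the
  ideal generated by the \<open>A i\<close>, so only the summand with \<open>S k 0\<close> survives
  the augmentation.\<close>

lemma ell_e:
  assumes "x \<in> chg c"
  shows "ell (e k j x) = ell (T k (2 * int p * k * c + j + 1) x)"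
proof (rule chg_eqI[OF lin_compose[OF lin_ell lin_e] lin_compose[OF lin_ell lin_T] _ assms])
  fix d x assume x: "x \<in> hom c d"
  let ?c0 = "2 * int p * k * c + j + 1"
  define N where "N = nat (max d ?c0) + 1"
  have N: "int N > d" "int N > ?c0" unfolding N_def by linarith+
  have "ell (e k j x) = (\<Sum>i<N. ell (S (of_int k) (int i - 2 * int p * k * c - j - 1) * (ex k * T k (int i) x)))"
    unfolding e_eq[OF x N(1)] lin_sum[OF lin_ell] ..
  also have "\<dots> = (\<Sum>i<N. if int i = ?c0 then ell (T k (int i) x) else 0)"
    by (rule sum.cong) (auto simp: ell_S)
  also have "\<dots> = ell (T k ?c0 x)"
  proof (cases "?c0 \<ge> 0")
    case True
    have "(\<Sum>i<N. if int i = ?c0 then ell (T k (int i) x) else 0) = (\<Sum>i<N. if i = nat ?c0 then ell (T k ?c0 x) else 0)"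
      by (rule sum.cong) (use True in auto)
    also have "\<dots> = ell (T k ?c0 x)"
      using N(2) True by (subst sum.delta) auto
    finally show ?thesis .
  next
    case False
    then have "(\<Sum>i<N. if int i = ?c0 then ell (T k (int i) x) else 0) = 0"
      by (intro sum.neutral) auto
    then show ?thesis using False by (simp add: lin_0[OF lin_ell])
  qed
  finally show "ell (e k j x) = ell (T k ?c0 x)" .
qed

lemma bc_nat: "i > n \<Longrightarrow> bc (int n) i = 0"
  by (simp add: bc_def binomial_gbinomial[symmetric])

text \<open>The factor \<open>(1 - w / z) ^ (2 p)\<close> of \<open>T_S\<close>; for a natural
  exponent the expansion stops, which makes the later factors Laurent polynomials.\<close>

lemma T_e: "T 1 a (e 1 j x) = (\<Sum>i<2 * p + 1. bc (int (2 * p)) i *\<^sub>V e 1 (j + int i) (T 1 (a - int i) x))"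
proof (rule lin_eqI_hom[OF lin_compose[OF lin_T lin_e] lin_sum_fun[OF lin_scale_fun[OF lin_compose[OF lin_e lin_T]]]])
  fix n d x assume x: "x \<in> hom n d"
  let ?b = "\<lambda>c. int c - 2 * int p * 1 * n - j - 1"
  define N where "N = nat d + 1"
  define I where "I = nat (int N - 2 * int p * 1 * n - j) + 2 * p + 1"
  have N: "int N > d" by (simp add: N_def)
  have MM: "2 * cp * of_int 1 * of_int 1 = of_int (int (2 * p))" by simp
  have "T 1 a (e 1 j x) = (\<Sum>c<N. ex 1 * T 1 a (S (of_int 1) (?b c) * T 1 (int c) x))"
    unfolding e_eq[OF x N] lin_sum[OF lin_T] by (simp add: T_ex mult.left_commute[of _ "ex 1"])
  also have "\<dots> = (\<Sum>c<N. ex 1 * (\<Sum>i<I. bc (int (2 * p)) i *\<^sub>V (S (of_int 1) (?b c - int i) * T 1 (a - int i) (T 1 (int c) x))))"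
  proof (rule sum.cong[OF refl])
    fix c assume "c \<in> {..<N}"
    then have "int I > ?b c" by (simp add: I_def)
    from T_S[OF this MM] show "ex 1 * T 1 a (S (of_int 1) (?b c) * T 1 (int c) x) =
      ex 1 * (\<Sum>i<I. bc (int (2 * p)) i *\<^sub>V (S (of_int 1) (?b c - int i) * T 1 (a - int i) (T 1 (int c) x)))" by simp
  qed
  also have "\<dots> = (\<Sum>c<N. \<Sum>i<2 * p + 1. bc (int (2 * p)) i *\<^sub>V (S (of_int 1) (?b c - int i) * (ex 1 * T 1 (int c) (T 1 (a - int i) x))))"
  proof (rule sum.cong[OF refl])
    fix c
    have "(\<Sum>i<I. bc (int (2 * p)) i *\<^sub>V (S (of_int 1) (?b c - int i) * T 1 (a - int i) (T 1 (int c) x))) =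
      (\<Sum>i<2 * p + 1. bc (int (2 * p)) i *\<^sub>V (S (of_int 1) (?b c - int i) * T 1 (a - int i) (T 1 (int c) x)))"
      by (rule sum.mono_neutral_right) (auto simp: I_def bc_nat[of "2 * p", simplified])
    then show "ex 1 * (\<Sum>i<I. bc (int (2 * p)) i *\<^sub>V (S (of_int 1) (?b c - int i) * T 1 (a - int i) (T 1 (int c) x))) =
       (\<Sum>i<2 * p + 1. bc (int (2 * p)) i *\<^sub>V (S (of_int 1) (?b c - int i) * (ex 1 * T 1 (int c) (T 1 (a - int i) x))))"
      by (simp only: sum_distrib_left scl_mult_right T_T[of 1 "int c"] mult.left_commute[of "ex 1"])
  qed
  also have "\<dots> = (\<Sum>i<2 * p + 1. bc (int (2 * p)) i *\<^sub>V (\<Sum>c<N. S (of_int 1) (?b c - int i) * (ex 1 * T 1 (int c) (T 1 (a - int i) x))))"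
    unfolding scl_sum_right by (rule sum.swap)
  also have "\<dots> = (\<Sum>i<2 * p + 1. bc (int (2 * p)) i *\<^sub>V e 1 (j + int i) (T 1 (a - int i) x))"
  proof (intro sum.cong refl arg_cong[of _ _ "\<lambda>y. _ *\<^sub>V y"])
    fix i
    show "(\<Sum>c<N. S (of_int 1) (?b c - int i) * (ex 1 * T 1 (int c) (T 1 (a - int i) x))) = e 1 (j + int i) (T 1 (a - int i) x)"
    proof (cases "a - int i \<ge> 0")
      case True
      have "int N > d - (a - int i)" using N True by simp
      from e_eq[OF T_hom[OF x] this, of 1 "j + int i"] show ?thesis by (simp add: algebra_simps)
    qed (simp add: lin_0[OF lin_T] lin_0[OF lin_e])
  qed
  finally show "T 1 a (e 1 j x) = (\<Sum>i<2 * p + 1. bc (int (2 * p)) i *\<^sub>V e 1 (j + int i) (T 1 (a - int i) x))" .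
qed

definition TL :: "nat list \<Rightarrow> (nat \<Rightarrow>\<^sub>0 int) \<Rightarrow> V \<Rightarrow> V" where
  "TL is a x = foldr (\<lambda>i. T 1 (Poly_Mapping.lookup a i)) is x"

lemma lin_TL: "lin (TL is a)"
proof (induction "is")
  case Nil
  then show ?case by (simp add: TL_def lin_id)
next
  case (Cons i "is")
  have "TL (i # is) a = (\<lambda>x. T 1 (Poly_Mapping.lookup a i) (TL is a x))" by (simp add: TL_def fun_eq_iff)
  then show ?case using lin_compose[OF lin_T Cons] by simp
qed

lemma TL_append: "TL (is @ js) a x = TL is a (TL js a x)"
  by (simp add: TL_def)

lemma TL_T: "TL is a (T 1 c x) = T 1 c (TL is a x)"
  by (induction "is") (simp_all add: TL_def T_T[of 1 c])

lemma TL_cong: "(\<And>i. i \<in> set is \<Longrightarrow> Poly_Mapping.lookup a i = Poly_Mapping.lookup b i) \<Longrightarrow> TL is a x = TL is b x"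
  unfolding TL_def by (rule foldr_cong) auto

lemma T_chg: "x \<in> chg c \<Longrightarrow> T k a x \<in> chg c"
  by (rule chg_lin[OF lin_T]) (use T_hom hom_chg in blast)

lemma TL_chg: "x \<in> chg c \<Longrightarrow> TL is a x \<in> chg c"
  by (induction "is") (simp_all add: TL_def T_chg)

lemma e_chg: "x \<in> chg c \<Longrightarrow> e k j x \<in> chg (c + k)"
  by (rule chg_lin[OF lin_e]) (use e_hom hom_chg in blast)

text \<open>The constant term of \<open>f\<close> times the augmentation of the product of
  \<open>r\<close> annihilation exponentials in \<open>z_0, ..., z_(r-1)\<close> applied to
  \<open>x\<close>.\<close>

definition Om :: "nat \<Rightarrow> V \<Rightarrow> LP \<Rightarrow> V" where
  "Om r x f = ev (\<lambda>a. ell (TL [0..<r] a x)) f"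

lemma binomial_Z: "(1 - Z r 1 * Z q (- 1)) ^ n =
   (\<Sum>l<n + 1. Poly_Mapping.single (Poly_Mapping.single r (int l) + Poly_Mapping.single q (- int l)) ((- 1) ^ l * int (n choose l)))"
proof -
  have "(1 - Z r 1 * Z q (- 1)) ^ n = (- (Z r 1 * Z q (- 1)) + 1) ^ n" by simp
  also have "\<dots> = (\<Sum>l\<le>n. of_nat (n choose l) * (- (Z r 1 * Z q (- 1))) ^ l * 1 ^ (n - l))"
    by (rule binomial_ring)
  also have "\<dots> = (\<Sum>l<n + 1. Poly_Mapping.single (Poly_Mapping.single r (int l) + Poly_Mapping.single q (- int l)) ((- 1) ^ l * int (n choose l)))"
  proof (rule sum.cong)
    fix l
    have "(- (Z r 1 * Z q (- 1))) ^ l = (- 1) ^ l * (Z r (int l) * Z q (- int l))"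
      by (subst power_minus) (simp add: power_mult_distrib Z_power)
    also have "Z r (int l) * Z q (- int l) = Poly_Mapping.single (Poly_Mapping.single r (int l) + Poly_Mapping.single q (- int l)) 1"
      by (simp add: Z_def mult_single)
    finally show "of_nat (n choose l) * (- (Z r 1 * Z q (- 1))) ^ l * 1 ^ (n - l) =
       Poly_Mapping.single (Poly_Mapping.single r (int l) + Poly_Mapping.single q (- int l)) ((- 1) ^ l * int (n choose l))"
      by (cases "even l") (simp_all add: mult_single single_uminus flip: single_of_nat)
  qed auto
  finally show ?thesis .
qed

text \<open>A vertex operator in front of \<open>y\<close> becomes one more annihilation
  exponential, in the new variable \<open>z_r\<close>: it is moved to the left of the existing
  exponentials, each of which yields a factor, and there \<open>ell_e\<close> applies.\<close>

lemma Om_step: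
  assumes y: "y \<in> chg c" and f: "\<And>a. a \<in> Poly_Mapping.keys f \<Longrightarrow> Poly_Mapping.lookup a r = 0"
  shows "Om r (\<Sum>i<B. of_int (b i) *\<^sub>V e 1 (int i) y) f =
    Om (Suc r) y (f * (\<Sum>i<B. of_int (b i) * Z r (int i + 1 + 2 * int p * c)) * (\<Prod>i<r. (1 - Z r 1 * Z i (- 1)) ^ (2 * p)))"
proof -
  \<comment> \<open>The stage at which the exponentials with index at least \<open>q\<close> have
    already passed to the right of the vertex operator. Its mode is coded by the exponent of
    \<open>z_r\<close>, with the offset that \<open>ell_e\<close> requires.\<close>
  define H where "H q a = ell (TL [0..<q] a (e 1 (Poly_Mapping.lookup a r - 1 - 2 * int p * c) (TL [q..<r] a y)))" for q a
  let ?b = "\<Sum>i<B. of_int (b i) * Z r (int i + 1 + 2 * int p * c)"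
  have step: "ev (H (Suc q)) g = ev (H q) (g * (1 - Z r 1 * Z q (- 1)) ^ (2 * p))" if q: "q < r" for q g
  proof -
    have "H (Suc q) a = (\<Sum>l<2 * p + 1. of_int ((- 1) ^ l * int (2 * p choose l)) *\<^sub>V H q (a + (Poly_Mapping.single r (int l) + Poly_Mapping.single q (- int l))))" for a
    proof -
      let ?j = "Poly_Mapping.lookup a r - 1 - 2 * int p * c"
      let ?w = "TL [Suc q..<r] a y"
      have "H (Suc q) a = ell (TL [0..<q] a (T 1 (Poly_Mapping.lookup a q) (e 1 ?j ?w)))"
        by (simp add: H_def TL_append) (simp add: TL_def)
      also have "\<dots> = (\<Sum>l<2 * p + 1. bc (int (2 * p)) l *\<^sub>V ell (TL [0..<q] a (e 1 (?j + int l) (T 1 (Poly_Mapping.lookup a q - int l) ?w))))"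
        by (simp only: T_e lin_sum[OF lin_TL] lin_sum[OF lin_ell] lin_scl[OF lin_TL] lin_scl[OF lin_ell])
      also have "\<dots> = (\<Sum>l<2 * p + 1. of_int ((- 1) ^ l * int (2 * p choose l)) *\<^sub>V H q (a + (Poly_Mapping.single r (int l) + Poly_Mapping.single q (- int l))))"
      proof (rule sum.cong[OF refl])
        fix l
        let ?a = "a + (Poly_Mapping.single r (int l) + Poly_Mapping.single q (- int l))"
        have 1: "Poly_Mapping.lookup ?a r = Poly_Mapping.lookup a r + int l" "Poly_Mapping.lookup ?a q = Poly_Mapping.lookup a q - int l"
          using q by (simp_all add: lookup_add lookup_single when_def)
        have 2: "TL is ?a x = TL is a x" if "r \<notin> set is" "q \<notin> set is" for "is" x
          by (rule TL_cong) (use that in \<open>auto simp: lookup_add lookup_single when_def\<close>)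
        have "TL [q..<r] ?a y = T 1 (Poly_Mapping.lookup a q - int l) ?w"
          using q 2[of "[Suc q..<r]" y] by (simp add: upt_conv_Cons) (simp add: TL_def 1)
        then have "H q ?a = ell (TL [0..<q] a (e 1 (?j + int l) (T 1 (Poly_Mapping.lookup a q - int l) ?w)))"
          unfolding H_def 1 using q 2[of "[0..<q]"] by (simp add: algebra_simps)
        moreover have "bc (int (2 * p)) l = of_int ((- 1) ^ l * int (2 * p choose l))"
          by (simp add: bc_def binomial_gbinomial)
        ultimately show "bc (int (2 * p)) l *\<^sub>V ell (TL [0..<q] a (e 1 (?j + int l) (T 1 (Poly_Mapping.lookup a q - int l) ?w)))
            = of_int ((- 1) ^ l * int (2 * p choose l)) *\<^sub>V H q ?a" by simp
      qed
      finally show ?thesis .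
    qed
    then have "ev (H (Suc q)) g = (\<Sum>l<2 * p + 1. of_int ((- 1) ^ l * int (2 * p choose l)) *\<^sub>V
        ev (\<lambda>a. H q (a + (Poly_Mapping.single r (int l) + Poly_Mapping.single q (- int l)))) g)"
      by (simp only: ev_lin_sum[symmetric] cong: ev_cong)
    also have "\<dots> = ev (H q) (g * (1 - Z r 1 * Z q (- 1)) ^ (2 * p))"
      unfolding binomial_Z sum_distrib_left ev_sum ev_mult_single ..
    finally show ?thesis .
  qed
  have iter: "ev (H q) g = ev (H 0) (g * (\<Prod>i<q. (1 - Z r 1 * Z i (- 1)) ^ (2 * p)))" if "q \<le> r" for q g
    using that
  proof (induction q arbitrary: g)
    case (Suc q)
    then show ?case using step[of q g] by (simp add: mult_ac)
  qed simp
  have "Om r (\<Sum>i<B. of_int (b i) *\<^sub>V e 1 (int i) y) f = (\<Sum>i<B. of_int (b i) *\<^sub>V ev (\<lambda>a. ell (TL [0..<r] a (e 1 (int i) y))) f)"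
    unfolding Om_def lin_sum[OF lin_TL] lin_sum[OF lin_ell] lin_scl[OF lin_TL] lin_scl[OF lin_ell] by (rule ev_lin_sum)
  also have "\<dots> = ev (H r) (f * ?b)"
  proof -
    have "ev (H r) (f * ?b) = (\<Sum>i<B. ev (H r) (f * (of_int (b i) * Z r (int i + 1 + 2 * int p * c))))"
      by (simp only: sum_distrib_left ev_sum)
    also have "\<dots> = (\<Sum>i<B. of_int (b i) *\<^sub>V ev (\<lambda>a. ell (TL [0..<r] a (e 1 (int i) y))) f)"
    proof (rule sum.cong[OF refl])
      fix i
      have "of_int (b i) * Z r (int i + 1 + 2 * int p * c) = Poly_Mapping.single (Poly_Mapping.single r (int i + 1 + 2 * int p * c)) (b i)"
        unfolding Z_def by (subst single_of_int[symmetric]) (simp add: mult_single)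
      then have "ev (H r) (f * (of_int (b i) * Z r (int i + 1 + 2 * int p * c))) =
          of_int (b i) *\<^sub>V ev (\<lambda>a. H r (a + Poly_Mapping.single r (int i + 1 + 2 * int p * c))) f"
        by (simp only: ev_mult_single)
      also have "ev (\<lambda>a. H r (a + Poly_Mapping.single r (int i + 1 + 2 * int p * c))) f = ev (\<lambda>a. ell (TL [0..<r] a (e 1 (int i) y))) f"
      proof (rule ev_cong)
        fix a assume "a \<in> Poly_Mapping.keys f"
        then have "Poly_Mapping.lookup a r = 0" by (rule f)
        moreover have "TL [0..<r] (a + Poly_Mapping.single r (int i + 1 + 2 * int p * c)) x = TL [0..<r] a x" for x
          by (rule TL_cong) (auto simp: lookup_add lookup_single when_def)
        ultimately show "H r (a + Poly_Mapping.single r (int i + 1 + 2 * int p * c)) = ell (TL [0..<r] a (e 1 (int i) y))"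
          by (simp add: H_def lookup_add lookup_single when_def) (simp add: TL_def)
      qed
      finally show "ev (H r) (f * (of_int (b i) * Z r (int i + 1 + 2 * int p * c))) = of_int (b i) *\<^sub>V ev (\<lambda>a. ell (TL [0..<r] a (e 1 (int i) y))) f" .
    qed
    finally show ?thesis by simp
  qed
  also have "\<dots> = ev (H 0) (f * ?b * (\<Prod>i<r. (1 - Z r 1 * Z i (- 1)) ^ (2 * p)))"
    by (rule iter) simp
  also have "H 0 = (\<lambda>a. ell (TL [0..<Suc r] a y))"
  proof
    fix a
    have "H 0 a = ell (e 1 (Poly_Mapping.lookup a r - 1 - 2 * int p * c) (TL [0..<r] a y))"
      by (simp add: H_def) (simp add: TL_def)
    also have "\<dots> = ell (T 1 (Poly_Mapping.lookup a r) (TL [0..<r] a y))"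
      by (subst ell_e[OF TL_chg[OF y]]) simp
    also have "\<dots> = ell (TL [0..<Suc r] a y)"
      by (simp add: TL_append TL_T[symmetric]) (simp add: TL_def)
    finally show "H 0 a = ell (TL [0..<Suc r] a y)" .
  qed
  finally show ?thesis by (simp only: Om_def)
qed

end

definition fr :: "nat \<Rightarrow> LP set" where
  "fr r = {f. \<forall>a\<in>Poly_Mapping.keys f. \<forall>j\<ge>r. Poly_Mapping.lookup a j = 0}"

lemma fr_add: "f \<in> fr r \<Longrightarrow> g \<in> fr r \<Longrightarrow> f + g \<in> fr r"
  unfolding fr_def using Poly_Mapping.keys_add[of f g] by blast

lemma fr_mult: assumes "f \<in> fr r" "g \<in> fr r" shows "f * g \<in> fr r"
  unfolding fr_def
proof (intro CollectI ballI allI impI)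
  fix b j assume "b \<in> Poly_Mapping.keys (f * g)" and j: "r \<le> j"
  then obtain b1 b2 where "b = b1 + b2" "b1 \<in> Poly_Mapping.keys f" "b2 \<in> Poly_Mapping.keys g"
    using Poly_Mapping.keys_mult by blast
  then show "Poly_Mapping.lookup b j = 0"
    using assms j by (simp add: fr_def lookup_add)
qed

lemma fr_uminus: "f \<in> fr r \<Longrightarrow> - f \<in> fr r"
  by (simp add: fr_def in_keys_iff)

lemma fr_diff: "f \<in> fr r \<Longrightarrow> g \<in> fr r \<Longrightarrow> f - g \<in> fr r"
  using fr_add[OF _ fr_uminus, of f r g] by simp

lemma fr_1: "1 \<in> fr r" and fr_0: "0 \<in> fr r"
  by (simp_all add: fr_def)

lemma fr_of_int: "of_int k \<in> fr r"
  by (simp add: fr_def flip: single_of_int)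

lemma fr_power: "f \<in> fr r \<Longrightarrow> f ^ n \<in> fr r"
  by (induction n) (simp_all add: fr_1 fr_mult)

lemma fr_prod: "(\<And>i. i \<in> S \<Longrightarrow> f i \<in> fr r) \<Longrightarrow> prod f S \<in> fr r"
  by (induction S rule: infinite_finite_induct) (simp_all add: fr_1 fr_mult)

lemma fr_sum: "(\<And>i. i \<in> S \<Longrightarrow> f i \<in> fr r) \<Longrightarrow> sum f S \<in> fr r"
  by (induction S rule: infinite_finite_induct) (simp_all add: fr_0 fr_add)

lemma fr_Z: "i < r \<Longrightarrow> Z i k \<in> fr r"
  by (simp add: fr_def Z_def lookup_single when_def)

lemma fr_linv: "f \<in> fr r \<Longrightarrow> linv f \<in> fr r"
proof -
  assume f: "f \<in> fr r"
  show ?thesis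
    unfolding fr_def
  proof (intro CollectI ballI allI impI)
    fix a j assume "a \<in> Poly_Mapping.keys (linv f)" "r \<le> j"
    then have "Poly_Mapping.lookup (- a) j = 0"
      using f unfolding fr_def by (metis (mono_tags, lifting) in_keys_iff lookup_linv mem_Collect_eq)
    then show "Poly_Mapping.lookup a j = 0" by simp
  qed
qed

lemma fr_Vdm: "Vdm s q \<in> fr s"
  unfolding Vdm_def by (intro fr_prod fr_power fr_diff fr_Z) auto

lemma ev_delta:
  assumes "\<And>a. a \<in> Poly_Mapping.keys f \<Longrightarrow> g a = (if a = 0 then v else 0)"
  shows "ev g f = of_int (Poly_Mapping.lookup f 0) *\<^sub>V v"
proof -
  have "ev g f = (\<Sum>a\<in>Poly_Mapping.keys f. if a = 0 then of_int (Poly_Mapping.lookup f 0) *\<^sub>V v else 0)"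
    unfolding ev_def by (rule sum.cong) (auto simp: assms)
  then show ?thesis by (simp add: sum.delta in_keys_iff)
qed

lemma ev_uminus: "ev g (- f) = - ev g f"
  using ev_add[of g f "- f"] by (simp add: add_eq_0_iff)

lemma hom_ex:
  assumes "x \<in> hom c 0" "ell x = k *\<^sub>V 1"
  shows "x = k *\<^sub>V ex c"
proof -
  have b: "b = ({#}, c)" if "b \<in> Poly_Mapping.keys x" for b
  proof -
    have "snd b = c" "deg (fst b) = 0" using assms(1) that by (auto simp: hom_def)
    then show ?thesis by (cases b) (simp add: deg_def)
  qed
  have x: "x = Poly_Mapping.lookup x ({#}, c) *\<^sub>V ex c"
  proof (rule poly_mapping_eqI)
    fix b show "Poly_Mapping.lookup x b = Poly_Mapping.lookup (Poly_Mapping.lookup x ({#}, c) *\<^sub>V ex c) b"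
      using b[of b] by (cases "b = ({#}, c)") (auto simp: ex_def lookup_bv in_keys_iff)
  qed
  have "ell x = Poly_Mapping.lookup x ({#}, c) *\<^sub>V ell (ex c * 1)"
    by (subst x) (simp add: lin_scl[OF lin_ell])
  then have "Poly_Mapping.lookup x ({#}, c) *\<^sub>V (1 :: V) = k *\<^sub>V 1"
    using assms(2) by (simp only: ell_ex ell_1)
  then have "Poly_Mapping.lookup x ({#}, c) = k" by (simp add: V.scale_cancel_right)
  then show ?thesis using x by simp
qed

context lattice
begin

definition Eop :: "(nat \<Rightarrow> int) \<Rightarrow> nat \<Rightarrow> V \<Rightarrow> V" where
  "Eop b B y = (\<Sum>i<B. of_int (b i) *\<^sub>V e 1 (int i) y)"

lemma Eop_chg: "y \<in> chg c \<Longrightarrow> Eop b B y \<in> chg (c + 1)"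
  unfolding Eop_def by (intro V.subspace_sum V.subspace_scale chg_subspace e_chg)

lemma Eop_pow_chg: "y \<in> chg c \<Longrightarrow> (Eop b B ^^ s) y \<in> chg (c + int s)"
proof (induction s)
  case (Suc s)
  then show ?case using Eop_chg[of "(Eop b B ^^ s) y" "c + int s" b B] by (simp add: algebra_simps)
qed simp

text \<open>A Selberg-type constant term: \<open>Om_step\<close> is used \<open>s\<close> times. The
  charge of the vector rises at each step, so the monomial factors differ from one variable to the
  next; \<open>Vdm_split\<close> absorbs this asymmetry.\<close>

lemma ell_Eop_pow:
  assumes x: "x \<in> chg c"
  shows "ell ((Eop b B ^^ s) x) =
    Om s x ((\<Prod>t<s. (\<Sum>i<B. of_int (b i) * Z t (int i)) * Z t (1 + 2 * int p * c)) * Vdm s (2 * p))"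
proof -
  let ?bt = "\<lambda>t. \<Sum>i<B. of_int (b i) * Z t (int i + 1 + 2 * int p * (c + int s - 1 - int t))"
  let ?P = "\<lambda>t. \<Prod>i<t. (1 - Z t 1 * Z i (- 1)) ^ (2 * p)"
  let ?Phi = "\<lambda>r. \<Prod>t<r. ?bt t * ?P t"
  have "ell ((Eop b B ^^ s) x) = Om r ((Eop b B ^^ (s - r)) x) (?Phi r)" if "r \<le> s" for r
    using that
  proof (induction r)
    case 0
    then show ?case by (simp add: Om_def TL_def ev_def)
  next
    case (Suc r)
    let ?y = "(Eop b B ^^ (s - Suc r)) x"
    have y: "?y \<in> chg (c + int s - 1 - int r)"
      using Eop_pow_chg[OF x, where s = "s - Suc r"] Suc.prems by (simp add: of_nat_diff algebra_simps)
    have Phi: "?Phi r \<in> fr r"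
      by (intro fr_prod fr_mult fr_sum fr_of_int fr_Z fr_power fr_diff fr_1) auto
    have "(Eop b B ^^ (s - r)) x = (\<Sum>i<B. of_int (b i) *\<^sub>V e 1 (int i) ?y)"
      using Suc.prems by (simp add: Suc_diff_Suc[symmetric] Eop_def)
    then have "ell ((Eop b B ^^ s) x) = Om r (\<Sum>i<B. of_int (b i) *\<^sub>V e 1 (int i) ?y) (?Phi r)"
      using Suc by simp
    also have "\<dots> = Om (Suc r) ?y (?Phi r * ?bt r * ?P r)"
      by (rule Om_step[OF y]) (use Phi in \<open>auto simp: fr_def\<close>)
    finally show ?case by (simp add: mult.assoc)
  qed
  from this[of s] have "ell ((Eop b B ^^ s) x) = Om s x (?Phi s)" by simp
  also have "?Phi s = (\<Prod>t<s. (\<Sum>i<B. of_int (b i) * Z t (int i)) * Z t (1 + 2 * int p * c)) *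
      (\<Prod>t<s. Z t (int p * (int s - 1 - int t) * 2) * (\<Prod>i<t. (1 - Z t 1 * Z i (- 1)) ^ (2 * nat (int p))))"
    unfolding prod.distrib[symmetric]
  proof (rule prod.cong[OF refl])
    fix t
    have "?bt t = (\<Sum>i<B. of_int (b i) * Z t (int i)) * (Z t (1 + 2 * int p * c) * Z t (int p * (int s - 1 - int t) * 2))"
      unfolding sum_distrib_right Z_mult mult.assoc by (intro sum.cong refl) (simp add: algebra_simps)
    then show "?bt t * ?P t = (\<Sum>i<B. of_int (b i) * Z t (int i)) * Z t (1 + 2 * int p * c) *
      (Z t (int p * (int s - 1 - int t) * 2) * (\<Prod>i<t. (1 - Z t 1 * Z i (- 1)) ^ (2 * nat (int p))))"
      by (simp add: mult.assoc)
  qed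
  also have "(\<Prod>t<s. Z t (int p * (int s - 1 - int t) * 2) * (\<Prod>i<t. (1 - Z t 1 * Z i (- 1)) ^ (2 * nat (int p)))) = Vdm s (2 * p)"
    using Vdm_split[of "int p" s] by simp
  finally show ?thesis .
qed

lemma T_ex_delta: "T k a (ex n) = (if a = 0 then ex n else 0)"
  using T_deg[OF ex_hom[of n], where c = a and k = k] by (cases "a < 0"; cases "a = 0") auto

lemma TL_ex: "TL is a (ex n) = (if \<forall>i\<in>set is. Poly_Mapping.lookup a i = 0 then ex n else 0)"
  by (induction "is") (auto simp: TL_def T_ex_delta lin_0[OF lin_T])

lemma Om_ex:
  assumes "f \<in> fr s"
  shows "Om s (ex n) f = of_int (Poly_Mapping.lookup f 0) *\<^sub>V 1"
  unfolding Om_def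
proof (rule ev_delta)
  fix a assume "a \<in> Poly_Mapping.keys f"
  then have "(\<forall>i\<in>set [0..<s]. Poly_Mapping.lookup a i = 0) \<longleftrightarrow> a = 0"
    using assms by (auto simp: fr_def poly_mapping_eq_iff fun_eq_iff)
  then show "ell (TL [0..<s] a (ex n)) = (if a = 0 then 1 else 0)"
    using ell_ex[of n 1] by (simp add: TL_ex lin_0[OF lin_ell])
qed

lemma Z_binomial:
  "(\<Sum>i<2 * q + 1. of_int (int (2 * q choose i)) * Z t (int i)) * Z t (- int q) = (1 + Z t 1) ^ q * linv ((1 + Z t 1) ^ q)"
proof -
  have "(\<Sum>i<2 * q + 1. of_int (int (2 * q choose i)) * Z t (int i)) = (Z t 1 + 1) ^ (2 * q)"
    unfolding binomial_ring by (intro sum.cong) (auto simp: Z_power)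
  also have "\<dots> = (1 + Z t 1) ^ q * (1 + Z t 1) ^ q"
    by (simp add: add.commute power_add mult_2)
  finally have "(\<Sum>i<2 * q + 1. of_int (int (2 * q choose i)) * Z t (int i)) * Z t (- int q) =
      (1 + Z t 1) ^ q * ((1 + Z t 1) ^ q * Z t (- int q))" by (simp add: mult.assoc)
  also have "(1 + Z t 1) ^ q * Z t (- int q) = ((1 + Z t 1) * Z t (- 1)) ^ q"
    by (simp add: power_mult_distrib Z_power)
  also have "(1 + Z t 1) * Z t (- 1) = linv (1 + Z t 1)"
    by (simp add: linv_add linv_Z distrib_right Z_mult add.commute)
  finally show ?thesis by (simp add: linv_power)
qed

lemma sign_cases:
  fixes c :: LP assumes "c ^ 2 = 1" shows "c = 1 \<or> c = - 1"
  using assms by (simp add: power2_eq_1_iff)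

text \<open>The weights \<open>b\<close> are the coefficients of \<open>(1 + z) ^ (2 p - 2)\<close>.
  On charge \<open>- n\<close> with \<open>2 n\<close> variables the monomials of
  \<open>ell_Eop_pow\<close> and \<open>Vdm_square\<close> multiply to \<open>z ^ (1 - p)\<close>,
  exactly what makes each \<open>(1 + z) ^ (2 p - 2)\<close> symmetric under inversion.\<close>

lemma kappa_constant_term:
  "\<exists>k. k \<noteq> 0 \<and> ell ((Eop (\<lambda>i. int (2 * (p - 1) choose i)) (2 * (p - 1) + 1) ^^ (2 * n)) (ex (- int n))) = k *\<^sub>V 1"
proof -
  let ?s = "2 * n" and ?q = "p - 1"
  obtain c where c: "c ^ 2 = 1" "Vdm ?s (2 * p) = c * (\<Prod>r<?s. Z r (int p * (int ?s - 1))) * (Vdm ?s p * linv (Vdm ?s p))"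
    using Vdm_square by blast
  define G where "G = (\<Prod>t<?s. (1 + Z t 1) ^ ?q) * Vdm ?s p"
  have G: "G \<noteq> 0" unfolding G_def using Vdm_nz Z_plus_nz by simp
  have frG: "G * linv G \<in> fr ?s"
    unfolding G_def linv_mult linv_prod by (intro fr_mult fr_prod fr_linv fr_power fr_add fr_1 fr_Z fr_Vdm) auto
  have exp: "1 + 2 * int p * (- int n) + int p * (int ?s - 1) = - int ?q"
    using p2 by (simp add: algebra_simps of_nat_diff)
  have "(\<Prod>t<?s. (\<Sum>i<2 * ?q + 1. of_int (int (2 * ?q choose i)) * Z t (int i)) * Z t (1 + 2 * int p * (- int n))) * Vdm ?s (2 * p)
     = c * ((\<Prod>t<?s. (\<Sum>i<2 * ?q + 1. of_int (int (2 * ?q choose i)) * Z t (int i)) * (Z t (1 + 2 * int p * (- int n)) * Z t (int p * (int ?s - 1))))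
        * (Vdm ?s p * linv (Vdm ?s p)))"
    unfolding c(2) prod.distrib by (simp only: mult_ac)
  also have "\<dots> = c * (G * linv G)"
    unfolding Z_mult exp Z_binomial G_def linv_mult linv_prod prod.distrib by (simp only: mult_ac)
  finally have E: "ell ((Eop (\<lambda>i. int (2 * ?q choose i)) (2 * ?q + 1) ^^ ?s) (ex (- int n))) = Om ?s (ex (- int n)) (c * (G * linv G))"
    using ell_Eop_pow[where x = "ex (- int n)" and c = "- int n" and b = "\<lambda>i. int (2 * ?q choose i)" and B = "2 * ?q + 1" and s = ?s] ex_hom hom_chg by (simp only:) blast
  have "Om ?s (ex (- int n)) (c * (G * linv G)) = Om ?s (ex (- int n)) (G * linv G) \<or>
     Om ?s (ex (- int n)) (c * (G * linv G)) = - Om ?s (ex (- int n)) (G * linv G)"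
    using sign_cases[OF c(1)] by (auto simp: Om_def ev_uminus)
  then have "ell ((Eop (\<lambda>i. int (2 * ?q choose i)) (2 * ?q + 1) ^^ ?s) (ex (- int n))) = of_int (Poly_Mapping.lookup (G * linv G) 0) *\<^sub>V 1
     \<or> ell ((Eop (\<lambda>i. int (2 * ?q choose i)) (2 * ?q + 1) ^^ ?s) (ex (- int n))) = (- of_int (Poly_Mapping.lookup (G * linv G) 0)) *\<^sub>V 1"
    unfolding E Om_ex[OF frG] by simp
  moreover have "of_int (Poly_Mapping.lookup (G * linv G) 0) \<noteq> (0 :: complex)"
    using constant_term_positive[OF G] by simp
  ultimately show ?thesis by (metis neg_equal_0_iff_equal)
qed

subsection \<open>Nonvanishing of the two structure constants\<close>

lemma Qs_pow_hom:
  assumes "x \<in> hom c d"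
  shows "(Qs ^^ s) x \<in> hom (c + int s) (d - int s * (2 * int p * c + int p * (int s - 1) + 1))"
proof (induction s)
  case (Suc s)
  have "(Qs ^^ Suc s) x \<in> hom (c + int s + 1) (d - int s * (2 * int p * c + int p * (int s - 1) + 1) - 2 * int p * (c + int s) - 1)"
    using Qs_hom[OF Suc] by simp
  moreover have "d - int s * (2 * int p * c + int p * (int s - 1) + 1) - 2 * int p * (c + int s) - 1 =
     d - int (Suc s) * (2 * int p * c + int p * (int (Suc s) - 1) + 1)"
    by (simp add: algebra_simps)
  ultimately show ?case by (simp only: of_nat_Suc add.assoc add.commute[of 1])
qed (simp add: assms)

text \<open>With parameter \<open>1 / (2 p)\<close> each annihilation exponential only contributes a
  linear factor \<open>1 - w / z_i\<close>, where \<open>w\<close> marks the creation index.\<close>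

lemma TL_S:
  "TL is a (S (1 / (2 * cp)) r * ex n) =
    (\<Prod>i\<leftarrow>is. if Poly_Mapping.lookup a i < 0 then 0 else bc 1 (nat (Poly_Mapping.lookup a i))) *\<^sub>V
      (S (1 / (2 * cp)) (r - (\<Sum>i\<leftarrow>is. Poly_Mapping.lookup a i)) * ex n)"
proof (induction "is")
  case Nil
  then show ?case by (simp add: TL_def)
next
  case (Cons i "is")
  let ?a = "Poly_Mapping.lookup a i"
  have T1: "T 1 c (S (1 / (2 * cp)) r * ex n) = (if c < 0 then 0 else bc 1 (nat c)) *\<^sub>V (S (1 / (2 * cp)) (r - c) * ex n)" for c r
  proof -
    define N where "N = nat (max r c) + 1"
    have N: "int N > r" "c < int N" unfolding N_def by linarith+
    have "T 1 c (S (1 / (2 * cp)) r * ex n) = (\<Sum>i<N. bc 1 i *\<^sub>V (S (1 / (2 * cp)) (r - int i) * T 1 (c - int i) (ex n)))"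
      by (rule T_S[OF N(1)]) simp
    also have "\<dots> = (\<Sum>i<N. if int i = c then bc 1 i *\<^sub>V (S (1 / (2 * cp)) (r - c) * ex n) else 0)"
      by (rule sum.cong) (auto simp: T_ex_delta)
    also have "\<dots> = (if c < 0 then 0 else bc 1 (nat c)) *\<^sub>V (S (1 / (2 * cp)) (r - c) * ex n)"
    proof (cases "c < 0")
      case True
      then show ?thesis by (auto intro!: sum.neutral)
    next
      case False
      then have "(\<Sum>i<N. if int i = c then bc 1 i *\<^sub>V (S (1 / (2 * cp)) (r - c) * ex n) else 0)
         = (\<Sum>i<N. if i = nat c then bc 1 i *\<^sub>V (S (1 / (2 * cp)) (r - c) * ex n) else 0)"
        by (intro sum.cong) auto
      then show ?thesis using False N(2) by (simp add: sum.delta) 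
    qed
    finally show ?thesis .
  qed
  have "TL (i # is) a (S (1 / (2 * cp)) r * ex n) = T 1 ?a (TL is a (S (1 / (2 * cp)) r * ex n))"
    by (simp add: TL_def)
  also have "\<dots> = (\<Prod>i\<leftarrow>is. if Poly_Mapping.lookup a i < 0 then 0 else bc 1 (nat (Poly_Mapping.lookup a i))) *\<^sub>V
      T 1 ?a (S (1 / (2 * cp)) (r - (\<Sum>i\<leftarrow>is. Poly_Mapping.lookup a i)) * ex n)"
    unfolding Cons by (rule lin_scl[OF lin_T])
  finally show ?case unfolding T1 by (simp add: algebra_simps)
qed

lemma bc1: "bc 1 j = (if j = 0 then 1 else if j = 1 then - 1 else 0)"
proof -
  have "bc 1 (Suc (Suc i)) = 0" for i
    using bc_nat[of 1 "Suc (Suc i)"] by simp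
  then show ?thesis by (cases j; cases "j - 1") (auto simp: bc_def)
qed

lemma weight_one:
  assumes "(\<Sum>i\<leftarrow>is. a i) = int (length is)" "(\<Prod>i\<leftarrow>is. if a i < (0 :: int) then 0 else bc 1 (nat (a i))) \<noteq> 0"
  shows "\<forall>i\<in>set is. a i = 1"
proof -
  have le: "a i \<le> 1" if "i \<in> set is" for i
  proof (rule ccontr)
    assume "\<not> a i \<le> 1"
    then have "(if a i < 0 then 0 else bc 1 (nat (a i))) = 0" by (auto simp: bc1)
    then have "0 \<in> set (map (\<lambda>i. if a i < 0 then 0 else bc 1 (nat (a i))) is)" using that by force
    then show False using assms(2) by (metis prod_list_zero_iff)
  qed
  show ?thesis
    using assms(1) le
  proof (induction "is")
    case (Cons i "is")
    have "(\<Sum>i\<leftarrow>is. a i) \<le> int (length is)"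
      using Cons.prems(2) by (induction "is") (simp_all, smt (verit))
    moreover have "a i \<le> 1" using Cons.prems(2) by simp
    moreover have "a i + (\<Sum>i\<leftarrow>is. a i) = 1 + int (length is)" using Cons.prems(1) by simp
    ultimately have "a i = 1" "(\<Sum>i\<leftarrow>is. a i) = int (length is)" by linarith+
    moreover from this(2) have "\<forall>i\<in>set is. a i = 1"
      by (rule Cons.IH) (rule Cons.prems(2), simp)
    ultimately show ?case by simp
  qed simp
qed

text \<open>With \<open>2 n + 1\<close> variables on charge \<open>- n\<close> the remaining
  monomial is the product of all variables. The coefficient of \<open>w ^ (2 n + 1)\<close> in the
  product of the \<open>1 - w / z_i\<close> is, up to sign, its inverse, so the constant term of the
  symmetrized Vandermonde factor is left.\<close>

lemma ex_in_image: "\<exists>x \<in> hom (- int n) (int (2 * n + 1)). (Qs ^^ (2 * n + 1)) x = ex (int n + 1)"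
proof -
  let ?s = "2 * n + 1" and ?k = "1 / (2 * cp)"
  \<comment> \<open>The degree \<open>2 n + 1\<close> is exactly what \<open>2 n + 1\<close>
    applications of \<open>Qs\<close> consume, so the image has degree 0 and is a multiple of
    \<open>ex (n + 1)\<close>.\<close>
  define x where "x = S ?k (int ?s) * ex (- int n)"
  have x: "x \<in> hom (- int n) (int ?s)"
    using hom_mult[OF S_hom ex_hom, of ?k "int ?s" "- int n"] by (simp add: x_def)
  obtain c where c: "c ^ 2 = 1" "Vdm ?s (2 * p) = c * (\<Prod>r<?s. Z r (int p * (int ?s - 1))) * (Vdm ?s p * linv (Vdm ?s p))"
    using Vdm_square by blast
  let ?g = "Vdm ?s p * linv (Vdm ?s p)"
  define ones where "ones = (\<Sum>i<?s. Poly_Mapping.single i (1 :: int))"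
  have E1: "Eop (\<lambda>_. 1) 1 = Qs" by (simp add: Eop_def Qs_def fun_eq_iff)
  have exp: "1 + 2 * int p * (- int n) + int p * (int ?s - 1) = 1" by (simp add: algebra_simps)
  have pz: "(\<Prod>r<m. Z r 1) = Poly_Mapping.single (\<Sum>i<m. Poly_Mapping.single i (1 :: int)) 1" for m
    by (induction m) (simp_all add: Z_def mult_single)
  have "(\<Prod>t<?s. (\<Sum>i<1. of_int 1 * Z t (int i)) * Z t (1 + 2 * int p * (- int n))) * Vdm ?s (2 * p)
     = c * ((\<Prod>t<?s. Z t (1 + 2 * int p * (- int n)) * Z t (int p * (int ?s - 1))) * ?g)"
    unfolding c(2) prod.distrib by (simp add: mult_ac)
  also have "\<dots> = c * (?g * Poly_Mapping.single ones 1)"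
    unfolding Z_mult exp pz ones_def by (simp only: mult_ac)
  finally have E: "ell ((Qs ^^ ?s) x) = Om ?s x (c * (?g * Poly_Mapping.single ones 1))"
    using ell_Eop_pow[where x = x and c = "- int n" and b = "\<lambda>_. 1" and B = 1 and s = ?s] x hom_chg unfolding E1 by (simp only:) blast
  have frg: "?g \<in> fr ?s" by (intro fr_mult fr_linv fr_Vdm)
  have "Om ?s x (?g * Poly_Mapping.single ones 1) = ev (\<lambda>a. ell (TL [0..<?s] (a + ones) x)) ?g"
    unfolding Om_def ev_mult_single by simp
  also have "\<dots> = of_int (Poly_Mapping.lookup ?g 0) *\<^sub>V ((- 1) ^ ?s *\<^sub>V 1)"
  proof (rule ev_delta)
    fix a assume a: "a \<in> Poly_Mapping.keys ?g"
    have ones: "Poly_Mapping.lookup ones i = (if i < ?s then 1 else 0)" for i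
      unfolding ones_def lookup_sum lookup_single when_def by (simp add: sum.delta)
    let ?w = "\<Prod>i\<leftarrow>[0..<?s]. if Poly_Mapping.lookup (a + ones) i < 0 then 0 else bc 1 (nat (Poly_Mapping.lookup (a + ones) i))"
    let ?t = "\<Sum>i\<leftarrow>[0..<?s]. Poly_Mapping.lookup (a + ones) i"
    have "ell (TL [0..<?s] (a + ones) x) = ?w *\<^sub>V (if int ?s - ?t = 0 then 1 else 0)"
      unfolding x_def TL_S lin_scl[OF lin_ell] ell_S using ell_ex[of "- int n" 1] by simp
    moreover have "a = 0" if "int ?s = ?t" "?w \<noteq> 0"
    proof -
      have "\<forall>i\<in>set [0..<?s]. Poly_Mapping.lookup (a + ones) i = 1"
        by (rule weight_one) (use that in auto)
      then have "Poly_Mapping.lookup (a + ones) i = 1" if "i < ?s" for i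
        using that by (simp del: upt_Suc)
      then have "Poly_Mapping.lookup a i = 0" if "i < ?s" for i
        using that ones by (simp add: lookup_add)
      moreover have "Poly_Mapping.lookup a i = 0" if "i \<ge> ?s" for i
        using frg a that by (simp add: fr_def)
      ultimately show ?thesis by (metis linorder_not_less lookup_zero poly_mapping_eqI)
    qed
    moreover have "?w = (- 1) ^ ?s \<and> int ?s = ?t" if "a = 0"
    proof -
      have 1: "map (\<lambda>i. if Poly_Mapping.lookup (a + ones) i < 0 then 0 else bc 1 (nat (Poly_Mapping.lookup (a + ones) i))) [0..<?s] = map (\<lambda>i. - 1) [0..<?s]"
        by (rule map_cong) (auto simp: that ones bc1)
      have 2: "map (Poly_Mapping.lookup (a + ones)) [0..<?s] = map (\<lambda>i. 1) [0..<?s]"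
        by (rule map_cong) (auto simp: that ones)
      show ?thesis unfolding 1 2 by (simp add: map_replicate_const sum_list_replicate prod_list_replicate del: upt_Suc)
    qed
    ultimately show "ell (TL [0..<?s] (a + ones) x) = (if a = 0 then (- 1) ^ ?s *\<^sub>V 1 else 0)"
      by (cases "a = 0") (simp_all, metis)
  qed
  finally have O: "Om ?s x (?g * Poly_Mapping.single ones 1) = (of_int (Poly_Mapping.lookup ?g 0) * (- 1) ^ ?s) *\<^sub>V 1" by simp
  have "\<exists>k. k \<noteq> 0 \<and> ell ((Qs ^^ ?s) x) = k *\<^sub>V 1"
  proof -
    have nz: "of_int (Poly_Mapping.lookup ?g 0) * (- 1) ^ ?s \<noteq> (0 :: complex)"
      using constant_term_positive[OF Vdm_nz, of ?s p] by simp
    from sign_cases[OF c(1)] show ?thesis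
    proof
      assume "c = 1"
      then have "ell ((Qs ^^ ?s) x) = (of_int (Poly_Mapping.lookup ?g 0) * (- 1) ^ ?s) *\<^sub>V 1"
        unfolding E by (simp only: mult_1 O)
      then show ?thesis using nz by blast
    next
      assume "c = - 1"
      then have "ell ((Qs ^^ ?s) x) = (- (of_int (Poly_Mapping.lookup ?g 0) * (- 1) ^ ?s)) *\<^sub>V 1"
        unfolding E using O by (simp add: Om_def ev_uminus)
      then show ?thesis using nz by (metis neg_equal_0_iff_equal)
    qed
  qed
  then obtain k where k: "k \<noteq> 0" "ell ((Qs ^^ ?s) x) = k *\<^sub>V 1" by blast
  have "int ?s * (2 * int p * (- int n) + int p * (int ?s - 1) + 1) = int ?s" by (simp add: algebra_simps)
  then have "(Qs ^^ ?s) x \<in> hom (int n + 1) 0"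
    using Qs_pow_hom[OF x, of ?s] by (simp only:) (simp add: algebra_simps)
  then have "(Qs ^^ ?s) x = k *\<^sub>V ex (int n + 1)" by (rule hom_ex) (rule k)
  then have "(Qs ^^ ?s) ((1 / k) *\<^sub>V x) = ex (int n + 1)"
    using k by (simp only: lin_scl[OF lin_funpow[OF lin_Qs]]) simp
  then show ?thesis using hom_scl[OF x] by blast
qed

text \<open>The raising operator \<open>L_1\<close> for the conformal vector without background charge.\<close>
definition M1 :: "V \<Rightarrow> V" where
  "M1 x = (1 / (4 * cp)) *\<^sub>V Y (A 0 * A 0) 2 x"

lemma lin_M1: "lin M1"
  unfolding M1_def[abs_def] by (rule lin_scale_fun[OF va.Y_lin2])

lemma A00_hom: "A 0 * A 0 \<in> hom 0 2"
  using hom_mult[OF A_hom[of 0] A_hom[of 0]] by simp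

lemma M1_hom: "x \<in> hom c d \<Longrightarrow> M1 x \<in> hom c (d - 1)"
  unfolding M1_def using Y_hom[OF A00_hom, of x c d 2] by (simp add: hom_scl)

lemma h_A0: "i \<ge> 0 \<Longrightarrow> h i (A 0) = (if i = 1 then (2 * cp) *\<^sub>V 1 else 0)"
  by (cases "i = 0") (auto simp: h_A)

lemma A00_A0:
  assumes "j \<ge> 0"
  shows "Y (A 0 * A 0) j (A 0) = (if j = 0 then (4 * cp) *\<^sub>V A 1 else if j = 1 then (4 * cp) *\<^sub>V A 0 else 0)"
proof -
  have "Y (A 0 * A 0) j (A 0) = (\<Sum>i<2. h (- 1 - int i) (h (j + int i) (A 0))) + (\<Sum>i<2. h (j - 1 - int i) (h (int i) (A 0)))"
    by (rule A00_eq) (use assms in \<open>auto simp: h_A0\<close>)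
  also have "\<dots> = h (- 1) (h j (A 0)) + h (- 2) (h (j + 1) (A 0)) + (2 * cp) *\<^sub>V h (j - 2) 1"
    using assms by (simp add: numeral_2_eq_2 h_A0 lin_scl[OF lin_h] lin_0[OF lin_h])
  finally have E: "Y (A 0 * A 0) j (A 0) = h (- 1) (h j (A 0)) + h (- 2) (h (j + 1) (A 0)) + (2 * cp) *\<^sub>V h (j - 2) 1" .
  consider "j = 0" | "j = 1" | "j \<ge> 2" using assms by linarith
  then show ?thesis
  proof cases
    case 1
    then show ?thesis unfolding E using h_neg[of 2 1] by (simp add: h_A0 lin_scl[OF lin_h] lin_0[OF lin_h] flip: scl_add_left)
  next
    case 2
    then show ?thesis unfolding E using h_neg[of 1 1] by (simp add: h_A0 lin_scl[OF lin_h] lin_0[OF lin_h] flip: scl_add_left)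
  next
    case 3
    then show ?thesis unfolding E by (simp add: h_A0 h_vac lin_0[OF lin_h])
  qed
qed

lemma M1_h: "M1 (h k x) = h k (M1 x) - of_int k *\<^sub>V h (k + 1) x"
proof -
  have "Y (A 0 * A 0) 2 (Y (A 0) k x) = Y (A 0) k (Y (A 0 * A 0) 2 x) + Y (Y (A 0 * A 0) 0 (A 0)) (2 + k) x
     + of_int 2 *\<^sub>V Y (Y (A 0 * A 0) 1 (A 0)) (2 + k - 1) x"
    by (rule va.commutator_primary) (simp add: A00_A0)
  also have "Y (Y (A 0 * A 0) 0 (A 0)) (2 + k) x = (4 * cp) *\<^sub>V (- of_int (2 + k) *\<^sub>V h (k + 1) x)"
    unfolding A00_A0[OF order_refl] by (simp only: simp_thms if_True Y_scl Y_A1) (simp add: algebra_simps)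
  also have "Y (Y (A 0 * A 0) 1 (A 0)) (2 + k - 1) x = (4 * cp) *\<^sub>V h (k + 1) x"
    by (simp add: A00_A0 Y_scl Y_A0 algebra_simps)
  finally have "Y (A 0 * A 0) 2 (h k x) = h k (Y (A 0 * A 0) 2 x) - (4 * cp * of_int k) *\<^sub>V h (k + 1) x"
    by (simp add: Y_A0 algebra_simps scl_add_left scl_diff_left)
  then show ?thesis
    by (simp add: M1_def scl_diff_right lin_scl[OF lin_h])
qed

lemma M1_e: "M1 (e 1 j x) = e 1 j (M1 x) + (2 * cp - 2 - of_int j) *\<^sub>V e 1 (j + 1) x"
proof -
  have "Y (A 0 * A 0) 2 (Y (ex 1) j x) = Y (ex 1) j (Y (A 0 * A 0) 2 x) + Y (Y (A 0 * A 0) 0 (ex 1)) (2 + j) x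
     + of_int 2 *\<^sub>V Y (Y (A 0 * A 0) 1 (ex 1)) (2 + j - 1) x"
    by (rule va.commutator_primary) (simp add: A00_ex)
  also have "Y (A 0 * A 0) 0 (ex 1) = (4 * cp) *\<^sub>V Td (ex 1)"
    by (simp add: A00_ex Td_ex)
  also have "Y ((4 * cp) *\<^sub>V Td (ex 1)) (2 + j) x = (4 * cp) *\<^sub>V (- of_int (2 + j) *\<^sub>V e 1 (j + 1) x)"
    unfolding Y_scl va.Y_T Y_ex by (simp add: algebra_simps)
  also have "Y (Y (A 0 * A 0) 1 (ex 1)) (2 + j - 1) x = (4 * cp * cp) *\<^sub>V e 1 (j + 1) x"
    by (simp add: A00_ex Y_scl Y_ex algebra_simps)
  finally have "Y (A 0 * A 0) 2 (e 1 j x) = e 1 j (Y (A 0 * A 0) 2 x) + (4 * cp * (2 * cp - 2 - of_int j)) *\<^sub>V e 1 (j + 1) x"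
    by (simp add: Y_ex algebra_simps scl_add_left scl_diff_left)
  then show ?thesis
    by (simp add: M1_def scl_add_right lin_scl[OF lin_e])
qed

lemma ell_h_neg: "j < 0 \<Longrightarrow> ell (h j x) = 0"
  by (simp add: h_def)

text \<open>All terms of the quadratic operator with a creation mode on the left die; what is left
  is \<open>h 1 h 0\<close> and \<open>h 0 h 1\<close>, and \<open>h 0\<close> is
  \<open>2 p c\<close>.\<close>

lemma ell_M1:
  assumes "x \<in> hom c d"
  shows "ell (M1 x) = of_int c *\<^sub>V ell (h 1 x)"
proof -
  define N where "N = nat d + 2"
  have z: "h i x = 0" if "i \<ge> int N" for i
  proof (rule hom_neg[OF h_hom[OF assms]])
    show "d - i < 0" using that unfolding N_def by linarith
  qed
  have "Y (A 0 * A 0) 2 x = (\<Sum>i<N. h (- 1 - int i) (h (2 + int i) x)) + (\<Sum>i<N. h (2 - 1 - int i) (h (int i) x))"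
    by (rule A00_eq[OF z], assumption) linarith
  then have "ell (Y (A 0 * A 0) 2 x) = (\<Sum>i<N. ell (h (2 - 1 - int i) (h (int i) x)))"
    by (simp add: lin_add[OF lin_ell] lin_sum[OF lin_ell] ell_h_neg)
  also have "\<dots> = (\<Sum>i<2. ell (h (2 - 1 - int i) (h (int i) x)))"
    by (rule sum.mono_neutral_right) (auto simp: N_def ell_h_neg)
  also have "\<dots> = (4 * cp * of_int c) *\<^sub>V ell (h 1 x)"
    by (simp add: numeral_2_eq_2 h0_hom[OF assms] h0_hom[OF h_hom[OF assms]] lin_scl[OF lin_h] lin_scl[OF lin_ell] flip: scl_add_left)
  finally show ?thesis by (simp add: M1_def lin_scl[OF lin_ell])
qed

lemma T_M1:
  assumes "int N \<ge> a"
  shows "T k a (M1 x) = M1 (T k a x) - of_int k *\<^sub>V (\<Sum>i\<in>{1..N}. h (int i + 1) (T k (a - int i) x))"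
  using assms
proof (induction a arbitrary: N rule: int_strong_induct)
  case (neg a)
  then show ?case by (simp add: lin_0[OF lin_M1] lin_0[OF lin_h])
next
  case zero
  have "(\<Sum>i\<in>{1..N}. h (int i + 1) (T k (0 - int i) x)) = 0"
    by (rule sum.neutral) (auto simp: lin_0[OF lin_h])
  then show ?case by simp
next
  case (pos a)
  let ?t = "\<lambda>i. T k (a - int i) x"
  let ?u = "\<lambda>i. h (int i + 1) (?t i)"
  have "of_int a *\<^sub>V T k a (M1 x) = - of_int k *\<^sub>V (\<Sum>i\<in>{1..N}. h (int i) (T k (a - int i) (M1 x)))"
    by (rule T_rec) (rule pos)
  also have "(\<Sum>i\<in>{1..N}. h (int i) (T k (a - int i) (M1 x))) = (\<Sum>i\<in>{1..N}. M1 (h (int i) (?t i))) + (\<Sum>i\<in>{1..N}. of_nat i *\<^sub>V ?u i)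
     - of_int k *\<^sub>V (\<Sum>i\<in>{1..N}. \<Sum>j\<in>{1..N}. h (int i) (h (int j + 1) (T k (a - int j - int i) x)))"
    unfolding scl_sum_right sum.distrib[symmetric] sum_subtractf[symmetric]
  proof (rule sum.cong[OF refl])
    fix i assume i: "i \<in> {1..N}"
    have "T k (a - int i) (M1 x) = M1 (?t i) - of_int k *\<^sub>V (\<Sum>j\<in>{1..N}. h (int j + 1) (T k (a - int i - int j) x))"
      using i pos by (intro pos(2)) auto
    then have "h (int i) (T k (a - int i) (M1 x)) = h (int i) (M1 (?t i)) - of_int k *\<^sub>V (\<Sum>j\<in>{1..N}. h (int i) (h (int j + 1) (T k (a - int i - int j) x)))"
      by (simp only: lin_diff[OF lin_h] lin_scl[OF lin_h] lin_sum[OF lin_h])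
    moreover have "a - int i - int j = a - int j - int i" for j by simp
    ultimately show "h (int i) (T k (a - int i) (M1 x)) = M1 (h (int i) (?t i)) + of_nat i *\<^sub>V ?u i
        - (\<Sum>j\<in>{1..N}. of_int k *\<^sub>V h (int i) (h (int j + 1) (T k (a - int j - int i) x)))"
      by (simp only: M1_h scl_sum_right) simp
  qed
  also have "(\<Sum>i\<in>{1..N}. \<Sum>j\<in>{1..N}. h (int i) (h (int j + 1) (T k (a - int j - int i) x))) =
      (\<Sum>j\<in>{1..N}. h (int j + 1) (\<Sum>i\<in>{1..N}. h (int i) (T k (a - int j - int i) x)))"
    unfolding lin_sum[OF lin_h] by (subst sum.swap) (simp add: h_commute)
  also have "- of_int k *\<^sub>V ((\<Sum>i\<in>{1..N}. M1 (h (int i) (?t i))) + (\<Sum>i\<in>{1..N}. of_nat i *\<^sub>V ?u i)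
     - of_int k *\<^sub>V (\<Sum>j\<in>{1..N}. h (int j + 1) (\<Sum>i\<in>{1..N}. h (int i) (T k (a - int j - int i) x)))) =
     M1 (- of_int k *\<^sub>V (\<Sum>i\<in>{1..N}. h (int i) (?t i))) - of_int k *\<^sub>V ((\<Sum>i\<in>{1..N}. of_nat i *\<^sub>V ?u i)
     + (\<Sum>j\<in>{1..N}. h (int j + 1) (- of_int k *\<^sub>V (\<Sum>i\<in>{1..N}. h (int i) (T k (a - int j - int i) x)))))"
    by (simp only: lin_scl[OF lin_M1] lin_sum[OF lin_M1, symmetric] lin_scl[OF lin_h])
      (simp add: scl_add_right scl_diff_right sum_negf flip: scl_sum_right)
  also have "- of_int k *\<^sub>V (\<Sum>i\<in>{1..N}. h (int i) (?t i)) = of_int a *\<^sub>V T k a x"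
    by (rule T_rec[symmetric]) (rule pos)
  also have "(\<Sum>j\<in>{1..N}. h (int j + 1) (- of_int k *\<^sub>V (\<Sum>i\<in>{1..N}. h (int i) (T k (a - int j - int i) x)))) = (\<Sum>j\<in>{1..N}. of_int (a - int j) *\<^sub>V ?u j)"
  proof (rule sum.cong[OF refl])
    fix j assume "j \<in> {1..N}"
    then have "- of_int k *\<^sub>V (\<Sum>i\<in>{1..N}. h (int i) (T k (a - int j - int i) x)) = of_int (a - int j) *\<^sub>V ?t j"
      using pos by (intro T_rec[symmetric]) auto
    then show "h (int j + 1) (- of_int k *\<^sub>V (\<Sum>i\<in>{1..N}. h (int i) (T k (a - int j - int i) x))) = of_int (a - int j) *\<^sub>V ?u j"
      by (simp only: lin_scl[OF lin_h])
  qed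
  also have "(\<Sum>i\<in>{1..N}. of_nat i *\<^sub>V ?u i) + (\<Sum>j\<in>{1..N}. of_int (a - int j) *\<^sub>V ?u j) = of_int a *\<^sub>V (\<Sum>i\<in>{1..N}. ?u i)"
    unfolding sum.distrib[symmetric] scl_sum_right scl_add_left[symmetric] by (intro sum.cong refl) simp
  also have "M1 (of_int a *\<^sub>V T k a x) - of_int k *\<^sub>V of_int a *\<^sub>V (\<Sum>i\<in>{1..N}. ?u i) = of_int a *\<^sub>V (M1 (T k a x) - of_int k *\<^sub>V (\<Sum>i\<in>{1..N}. ?u i))"
    by (simp add: lin_scl[OF lin_M1] scl_diff_right mult.commute)
  finally show ?case using pos by (elim scl_cancel[rotated]) simp
qed

text \<open>For the exponential with parameter \<open>- c\<close> the term \<open>c h 1\<close> of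
  \<open>ell_M1\<close> is precisely the first summand missing from the commutator in
  \<open>T_M1\<close>; together they form the recursion for \<open>T\<close> at index
  \<open>a + 1\<close>.\<close>

lemma ell_T_M1:
  assumes x: "x \<in> hom c d" and a: "a \<ge> 0"
  shows "ell (T (- c) a (M1 x)) = of_int (a + 1) *\<^sub>V ell (T (- c) (a + 1) x)"
proof -
  define N where "N = nat a"
  have N: "int N = a" using a by (simp add: N_def)
  let ?f = "\<lambda>i. ell (h (int i) (T (- c) (a + 1 - int i) x))"
  have "ell (T (- c) a (M1 x)) = of_int c *\<^sub>V ell (h 1 (T (- c) a x)) + of_int c *\<^sub>V (\<Sum>i\<in>{1..N}. ell (h (int i + 1) (T (- c) (a - int i) x)))"
    using T_M1[of a N "- c" x] ell_M1[OF T_hom[OF x]] N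
    by (simp add: lin_add[OF lin_ell] lin_scl[OF lin_ell] lin_sum[OF lin_ell])
  also have "\<dots> = of_int c *\<^sub>V (\<Sum>i\<in>{1..Suc N}. ?f i)"
  proof -
    have "(\<Sum>i\<in>{1..Suc N}. ?f i) = ?f 1 + (\<Sum>i\<in>{1..N}. ?f (Suc i))"
      using sum.atLeast_Suc_atMost[of 1 "Suc N" ?f] sum.shift_bounds_cl_Suc_ivl[of ?f 1 N] by simp
    then show ?thesis by (simp add: scl_add_right add.commute)
  qed
  also have "\<dots> = ell (- of_int (- c) *\<^sub>V (\<Sum>i\<in>{1..Suc N}. h (int i) (T (- c) (a + 1 - int i) x)))"
    by (simp only: lin_scl[OF lin_ell] lin_sum[OF lin_ell]) simp
  also have "- of_int (- c) *\<^sub>V (\<Sum>i\<in>{1..Suc N}. h (int i) (T (- c) (a + 1 - int i) x)) = of_int (a + 1) *\<^sub>V T (- c) (a + 1) x"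
    by (rule T_rec[symmetric]) (simp add: N)
  finally show ?thesis by (simp only: lin_scl[OF lin_ell])
qed

lemma M1_pow_hom: "x \<in> hom c d \<Longrightarrow> (M1 ^^ m) x \<in> hom c (d - int m)"
proof (induction m)
  case (Suc m)
  then show ?case using M1_hom[of "(M1 ^^ m) x" c "d - int m"] by (simp add: algebra_simps)
qed simp

definition D1 :: "nat \<Rightarrow> V \<Rightarrow> V" where
  "D1 m x = (1 / fact m) *\<^sub>V (M1 ^^ m) x"

lemma D1_hom: "x \<in> hom c d \<Longrightarrow> D1 m x \<in> hom c (d - int m)"
  unfolding D1_def by (intro hom_scl M1_pow_hom)

lemma D1_0 [simp]: "D1 0 x = x"
  by (simp add: D1_def)

lemma M1_D1: "M1 (D1 m x) = of_nat (Suc m) *\<^sub>V D1 (Suc m) x"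
  by (simp add: D1_def lin_scl[OF lin_M1] del: of_nat_Suc)

text \<open>On charge \<open>c\<close>, applying the vertex operator of charge \<open>- c\<close>
  and taking the lowest component is the same as applying the exponential of \<open>M1\<close> and
  taking the lowest component.\<close>

lemma ell_T_D1:
  assumes x: "x \<in> hom c d"
  shows "ell (T (- c) (int m) x) = ell (D1 m x)"
proof -
  have "ell (T (- c) (int m) ((M1 ^^ r) x)) = ((fact (m + r)) / fact m) *\<^sub>V ell (T (- c) (int (m + r)) x)" for m r
  proof (induction r arbitrary: m)
    case (Suc r)
    have "ell (T (- c) (int m) ((M1 ^^ Suc r) x)) = of_int (int m + 1) *\<^sub>V ell (T (- c) (int m + 1) ((M1 ^^ r) x))"
      using ell_T_M1[OF M1_pow_hom[OF x], of "int m" r] by simp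
    also have "ell (T (- c) (int m + 1) ((M1 ^^ r) x)) = ((fact (Suc m + r)) / fact (Suc m)) *\<^sub>V ell (T (- c) (int (Suc m + r)) x)"
      using Suc[of "Suc m"] by (simp add: add.commute)
    finally have "ell (T (- c) (int m) ((M1 ^^ Suc r) x)) = (of_int (int m + 1) * (fact (m + Suc r) / fact (Suc m))) *\<^sub>V ell (T (- c) (int (m + Suc r)) x)"
      by simp
    moreover have "of_int (int m + 1) * (fact (m + Suc r) / fact (Suc m)) = (fact (m + Suc r) / fact m :: complex)"
    proof -
      have "a * (x / (a * f)) = x / f" if "a \<noteq> 0" for a x f :: complex using that by simp
      from this[of "of_nat (Suc m)" "fact (m + Suc r)" "fact m"] show ?thesis
        unfolding fact_Suc[of m] by (simp del: of_nat_Suc fact_Suc add_Suc_right add: of_nat_Suc[symmetric] add.commute[of _ 1])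
    qed
    ultimately show ?case by simp
  qed simp
  from this[of 0 m] show ?thesis
    by (simp add: D1_def lin_scl[OF lin_ell])
qed

lemma binomial_absorb: "(2 * cp - 2 - of_nat i) * of_nat (2 * (p - 1) choose i) = of_nat (Suc i) * (of_nat (2 * (p - 1) choose Suc i) :: complex)"
proof -
  have "2 * cp - 2 = of_nat (2 * (p - 1))" using p2 by (simp add: of_nat_diff)
  then show ?thesis
    using gbinomial_mult_1[of "of_nat (2 * (p - 1)) :: complex" i]
    by (simp add: binomial_gbinomial algebra_simps)
qed

text \<open>The field of \<open>ex 1\<close> has weight \<open>p\<close> for the conformal vector
  defining \<open>M1\<close>; conjugating its residue by the exponential of \<open>M1\<close>
  inserts \<open>(1 + z) ^ (2 p - 2)\<close> into the residue.\<close>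

lemma D1_e: "D1 m (e 1 0 x) = (\<Sum>i\<le>m. of_nat (2 * (p - 1) choose i) *\<^sub>V e 1 (int i) (D1 (m - i) x))"
proof (induction m)
  case (Suc m)
  let ?b = "\<lambda>i. of_nat (2 * (p - 1) choose i) :: complex"
  have "of_nat (Suc m) *\<^sub>V D1 (Suc m) (e 1 0 x) = (\<Sum>i\<le>m. ?b i *\<^sub>V M1 (e 1 (int i) (D1 (m - i) x)))"
    unfolding M1_D1[symmetric] Suc by (simp only: lin_sum[OF lin_M1] lin_scl[OF lin_M1])
  also have "\<dots> = (\<Sum>i\<le>m. (?b i * of_nat (Suc m - i)) *\<^sub>V e 1 (int i) (D1 (Suc m - i) x)) +
      (\<Sum>i\<le>m. (of_nat (Suc i) * ?b (Suc i)) *\<^sub>V e 1 (int (Suc i)) (D1 (Suc m - Suc i) x))"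
    unfolding sum.distrib[symmetric]
  proof (rule sum.cong[OF refl])
    fix i assume i: "i \<in> {..m}"
    then have "M1 (D1 (m - i) x) = of_nat (Suc m - i) *\<^sub>V D1 (Suc m - i) x"
      using M1_D1[of "m - i" x] by (simp add: Suc_diff_le)
    then have "?b i *\<^sub>V M1 (e 1 (int i) (D1 (m - i) x)) = (?b i * of_nat (Suc m - i)) *\<^sub>V e 1 (int i) (D1 (Suc m - i) x)
       + ((2 * cp - 2 - of_nat i) * ?b i) *\<^sub>V e 1 (int i + 1) (D1 (m - i) x)"
      by (simp only: M1_e lin_scl[OF lin_e] scl_add_right scl_scl of_int_of_nat_eq mult.commute[of "2 * cp - 2 - of_nat i"])
    then show "?b i *\<^sub>V M1 (e 1 (int i) (D1 (m - i) x)) = (?b i * of_nat (Suc m - i)) *\<^sub>V e 1 (int i) (D1 (Suc m - i) x)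
       + (of_nat (Suc i) * ?b (Suc i)) *\<^sub>V e 1 (int (Suc i)) (D1 (Suc m - Suc i) x)"
      unfolding binomial_absorb by (simp add: add.commute)
  qed
  also have "(\<Sum>i\<le>m. (?b i * of_nat (Suc m - i)) *\<^sub>V e 1 (int i) (D1 (Suc m - i) x)) = (\<Sum>i\<le>Suc m. (?b i * of_nat (Suc m - i)) *\<^sub>V e 1 (int i) (D1 (Suc m - i) x))"
    by simp
  also have "(\<Sum>i\<le>m. (of_nat (Suc i) * ?b (Suc i)) *\<^sub>V e 1 (int (Suc i)) (D1 (Suc m - Suc i) x)) =
     (\<Sum>i\<le>Suc m. (of_nat i * ?b i) *\<^sub>V e 1 (int i) (D1 (Suc m - i) x))"
    unfolding sum.atMost_Suc_shift by simp
  also have "(\<Sum>i\<le>Suc m. (?b i * of_nat (Suc m - i)) *\<^sub>V e 1 (int i) (D1 (Suc m - i) x)) + (\<Sum>i\<le>Suc m. (of_nat i * ?b i) *\<^sub>V e 1 (int i) (D1 (Suc m - i) x))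
     = of_nat (Suc m) *\<^sub>V (\<Sum>i\<le>Suc m. ?b i *\<^sub>V e 1 (int i) (D1 (Suc m - i) x))"
    unfolding sum.distrib[symmetric] scl_sum_right
  proof (rule sum.cong[OF refl])
    fix i assume "i \<in> {..Suc m}"
    then have "?b i * of_nat (Suc m - i) + of_nat i * ?b i = of_nat (Suc m) * ?b i"
      by (simp add: of_nat_diff algebra_simps)
    then show "(?b i * of_nat (Suc m - i)) *\<^sub>V e 1 (int i) (D1 (Suc m - i) x) + (of_nat i * ?b i) *\<^sub>V e 1 (int i) (D1 (Suc m - i) x)
       = of_nat (Suc m) *\<^sub>V ?b i *\<^sub>V e 1 (int i) (D1 (Suc m - i) x)"
      by (simp only: scl_add_left[symmetric] scl_scl)
  qed
  finally show ?case by (elim scl_cancel[rotated]) (simp del: of_nat_Suc)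
qed simp

text \<open>The exponential of \<open>M1\<close> intertwines \<open>Qs\<close> with
  \<open>Eop\<close>. It is written as a finite sum, since \<open>M1\<close> lowers the degree; the
  bounds \<open>N\<close> and \<open>M\<close> only ensure that nothing is cut off.\<close>

lemma expM1:
  assumes "x \<in> hom c d" "int N > d" "int M > d - 2 * int p * c - 1" "M \<ge> N + 2 * p"
  shows "(\<Sum>m<M. D1 m (Qs x)) = Eop (\<lambda>i. int (2 * (p - 1) choose i)) (2 * (p - 1) + 1) (\<Sum>m<N. D1 m x)"
proof -
  let ?b = "\<lambda>i. of_nat (2 * (p - 1) choose i) :: complex"
  have z: "D1 m x = 0" if "m \<ge> N" for m
    by (rule hom_neg[OF D1_hom[OF assms(1)]]) (use that assms(2) in simp)
  have "(\<Sum>m<M. D1 m (Qs x)) = (\<Sum>m<M. \<Sum>i<M. if i \<le> m then ?b i *\<^sub>V e 1 (int i) (D1 (m - i) x) else 0)"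
  proof (rule sum.cong[OF refl])
    fix m assume "m \<in> {..<M}"
    then show "D1 m (Qs x) = (\<Sum>i<M. if i \<le> m then ?b i *\<^sub>V e 1 (int i) (D1 (m - i) x) else 0)"
      unfolding Qs_def D1_e by (intro sum.mono_neutral_cong_left) auto
  qed
  also have "\<dots> = (\<Sum>i<M. \<Sum>m<M. if i \<le> m then ?b i *\<^sub>V e 1 (int i) (D1 (m - i) x) else 0)"
    by (rule sum.swap)
  also have "\<dots> = (\<Sum>i<2 * (p - 1) + 1. \<Sum>m<M. if i \<le> m then ?b i *\<^sub>V e 1 (int i) (D1 (m - i) x) else 0)"
  proof (rule sum.mono_neutral_right)
    show "{..<2 * (p - 1) + 1} \<subseteq> {..<M}" using assms(4) p2 by auto
  qed (auto intro!: sum.neutral simp: binomial_eq_0)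
  also have "\<dots> = (\<Sum>i<2 * (p - 1) + 1. ?b i *\<^sub>V e 1 (int i) (\<Sum>m<N. D1 m x))"
  proof (rule sum.cong[OF refl])
    fix i assume i: "i \<in> {..<2 * (p - 1) + 1}"
    have "(\<Sum>m<M. if i \<le> m then ?b i *\<^sub>V e 1 (int i) (D1 (m - i) x) else 0) = (\<Sum>m\<in>{i..<i + N}. ?b i *\<^sub>V e 1 (int i) (D1 (m - i) x))"
      using i assms(4) by (intro sum.mono_neutral_cong_right) (auto simp: z lin_0[OF lin_e] not_less)
    also have "\<dots> = (\<Sum>m<N. ?b i *\<^sub>V e 1 (int i) (D1 m x))"
      by (rule sum.reindex_bij_witness[of _ "\<lambda>c. c + i" "\<lambda>c. c - i"]) auto
    finally show "(\<Sum>m<M. if i \<le> m then ?b i *\<^sub>V e 1 (int i) (D1 (m - i) x) else 0) = ?b i *\<^sub>V e 1 (int i) (\<Sum>m<N. D1 m x)"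
      by (simp add: lin_sum[OF lin_e] scl_sum_right)
  qed
  finally show ?thesis by (simp add: Eop_def)
qed

text \<open>The conformal weight of \<open>F n\<close> and of the whole string it generates.\<close>

definition hn :: "nat \<Rightarrow> int" where
  "hn n = int n * (int p * int n + int p - 1)"

definition F :: "nat \<Rightarrow> V" where
  "F n = ex (- int n)"

lemma F_hom: "F n \<in> hom (- int n) 0"
  unfolding F_def by (rule ex_hom)

lemma exp_M1_F: "\<exists>N. (\<forall>M\<ge>N. (\<Sum>m<M. D1 m ((Qs ^^ s) (F n))) = (Eop (\<lambda>i. int (2 * (p - 1) choose i)) (2 * (p - 1) + 1) ^^ s) (F n))"
proof (induction s)
  case 0
  have "(\<Sum>m<M. D1 m (F n)) = F n" if "M \<ge> 1" for M
  proof -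
    have "(\<Sum>m<M. D1 m (F n)) = (\<Sum>m<1. D1 m (F n))"
      using that hom_neg[OF D1_hom[OF F_hom]] by (intro sum.mono_neutral_right) auto
    then show ?thesis by simp
  qed
  then show ?case by (intro exI[of _ 1]) simp
next
  case (Suc s)
  let ?E = "Eop (\<lambda>i. int (2 * (p - 1) choose i)) (2 * (p - 1) + 1)"
  obtain N0 where N0: "\<And>M. M \<ge> N0 \<Longrightarrow> (\<Sum>m<M. D1 m ((Qs ^^ s) (F n))) = (?E ^^ s) (F n)"
    using Suc by blast
  obtain c d where cd: "(Qs ^^ s) (F n) \<in> hom c d" using Qs_pow_hom[OF F_hom] by blast
  define N where "N = max N0 (nat d + 1)"
  have N: "int N > d" "N \<ge> N0" by (auto simp: N_def)
  show ?case
  proof (intro exI allI impI)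
    fix M assume M: "M \<ge> N + 2 * p + nat (d - 2 * int p * c)"
    then have "int M > d - 2 * int p * c - 1" by linarith
    from expM1[OF cd N(1) this] M N0[OF N(2)]
    show "(\<Sum>m<M. D1 m ((Qs ^^ Suc s) (F n))) = (?E ^^ Suc s) (F n)" by simp
  qed
qed

text \<open>The mode \<open>2 hn n - 1\<close> brings the result down to degree 0, where it equals
  its augmentation. \<open>ell_e\<close> and \<open>ell_T_D1\<close> turn that into the lowest
  component after the exponential of \<open>M1\<close>, and \<open>exp_M1_F\<close> carries this
  exponential through the powers of \<open>Qs\<close>.\<close>

lemma kappa: "\<exists>k. k \<noteq> 0 \<and> e (- int n) (2 * hn n - 1) ((Qs ^^ (2 * n)) (F n)) = k *\<^sub>V 1"
proof -
  let ?x = "(Qs ^^ (2 * n)) (F n)" and ?d = "2 * (p - 1) * n"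
  have d: "int ?d = 2 * (int p - 1) * int n" using p2 by (simp add: of_nat_diff)
  have "0 - int (2 * n) * (2 * int p * (- int n) + int p * (int (2 * n) - 1) + 1) = int ?d"
    unfolding d by (simp add: algebra_simps)
  then have x: "?x \<in> hom (int n) (int ?d)"
  proof -
    assume E: "0 - int (2 * n) * (2 * int p * (- int n) + int p * (int (2 * n) - 1) + 1) = int ?d"
    have c: "- int n + int (2 * n) = int n" by simp
    show ?thesis using Qs_pow_hom[OF F_hom, of "2 * n" n] unfolding E c .
  qed
  have deg: "int ?d - 2 * int p * (- int n) * int n - (2 * hn n - 1) - 1 = 0"
    unfolding d by (simp add: hn_def algebra_simps)
  have "e (- int n) (2 * hn n - 1) ?x \<in> hom 0 0"
    using e_hom[OF x, of "- int n" "2 * hn n - 1"] unfolding deg by simp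
  then have "e (- int n) (2 * hn n - 1) ?x = ell (e (- int n) (2 * hn n - 1) ?x)"
    by (simp add: ell_hom0)
  also have "\<dots> = ell (T (- int n) (2 * int p * (- int n) * int n + (2 * hn n - 1) + 1) ?x)"
    by (rule ell_e) (use x hom_chg in blast)
  also have "2 * int p * (- int n) * int n + (2 * hn n - 1) + 1 = int ?d"
    using deg by linarith
  also have "ell (T (- int n) (int ?d) ?x) = ell (D1 ?d ?x)"
    by (rule ell_T_D1[OF x])
  also have "\<dots> = ell ((Eop (\<lambda>i. int (2 * (p - 1) choose i)) (2 * (p - 1) + 1) ^^ (2 * n)) (F n))"
  proof -
    obtain N where N: "\<And>M. M \<ge> N \<Longrightarrow> (\<Sum>m<M. D1 m ?x) = (Eop (\<lambda>i. int (2 * (p - 1) choose i)) (2 * (p - 1) + 1) ^^ (2 * n)) (F n)"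
      using exp_M1_F[of "2 * n" n] by blast
    have "ell (\<Sum>m<N + ?d + 1. D1 m ?x) = (\<Sum>m<N + ?d + 1. if m = ?d then ell (D1 ?d ?x) else 0)"
      unfolding lin_sum[OF lin_ell] 
    proof (intro sum.cong refl)
      fix r
      show "ell (D1 r ?x) = (if r = ?d then ell (D1 ?d ?x) else 0)"
      proof (cases "r = ?d")
        case True
        then show ?thesis by (simp only: if_True simp_thms)
      next
        case False
        then have "int ?d - int r \<noteq> 0" by (metis of_nat_eq_iff right_minus_eq)
        from ell_hom[OF D1_hom[OF x] this] False show ?thesis by (simp only: if_False simp_thms)
      qed
    qed
    also have "\<dots> = ell (D1 ?d ?x)" by (simp only: sum.delta finite_lessThan lessThan_iff) simp
    finally show ?thesis using N[of "N + ?d + 1"] by (simp only: le_add1 add.assoc)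
  qed
  finally show ?thesis
    using kappa_constant_term[of n] unfolding F_def by metis
qed

end

section \<open>Kernels of powers of the screening operator\<close>

subsection \<open>Graded projections and linear algebra\<close>

definition pr :: "(int \<Rightarrow> int \<Rightarrow> bool) \<Rightarrow> V \<Rightarrow> V" where
  "pr P = linext (\<lambda>(lam, n). if P n (int (deg lam)) then bv (lam, n) else 0)"

lemma lin_pr: "lin (pr P)"
  unfolding pr_def by (rule lin_linext)

lemma pr_hom: "x \<in> hom c d \<Longrightarrow> pr P x = (if P c d then x else 0)"
proof -
  assume x: "x \<in> hom c d"
  show ?thesis
  proof (cases "P c d")
    case True
    have "pr P x = (\<lambda>x. x) x"
      by (rule hom_bv_induct[OF lin_pr lin_id _ x]) (simp add: pr_def True)
    then show ?thesis using True by simp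
  next
    case False
    have "pr P x = (\<lambda>x. 0) x"
      by (rule hom_bv_induct[OF lin_pr lin_zero _ x]) (simp add: pr_def False)
    then show ?thesis using False by simp
  qed
qed

lemma pr_in_hom: "pr (\<lambda>c' d'. c' = c \<and> d' = d) x \<in> hom c d"
  unfolding pr_def linext_def
  by (intro hom_sum hom_scl) (auto split: prod.splits intro: bv_hom)

lemma pr_commute:
  assumes "lin f" "\<And>c d x. x \<in> hom c d \<Longrightarrow> f x \<in> hom (g c) (k c d)" "\<And>c d. P' (g c) (k c d) \<longleftrightarrow> P c d"
  shows "pr P' (f x) = f (pr P x)"
proof (rule lin_eqI_hom[OF lin_compose[OF lin_pr assms(1)] lin_compose[OF assms(1) lin_pr]])
  fix c d x assume x: "x \<in> hom c d"
  show "pr P' (f x) = f (pr P x)"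
    using pr_hom[OF assms(2)[OF x], of P'] pr_hom[OF x, of P] assms(3)[of c d] lin_0[OF assms(1)] by auto
qed

definition homog :: "V set" where
  "homog = (\<Union>c d. hom c d)"

lemma homogI: "x \<in> hom c d \<Longrightarrow> x \<in> homog"
  by (auto simp: homog_def)

lemma pr_span:
  assumes "S \<subseteq> homog" "x \<in> V.span S"
  shows "pr P x \<in> V.span (S \<inter> {y. \<exists>c d. P c d \<and> y \<in> hom c d})"
proof (rule lin_span[OF lin_pr assms(2)])
  fix y assume "y \<in> S"
  moreover then obtain c d where "y \<in> hom c d" using assms(1) by (auto simp: homog_def)
  ultimately show "pr P y \<in> V.span (S \<inter> {y. \<exists>c d. P c d \<and> y \<in> hom c d})"
    unfolding pr_hom[OF \<open>y \<in> hom c d\<close>] by (auto intro: V.span_base V.span_zero)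
qed

lemma independent_bv: "V.independent (bv ` S)"
  unfolding V.dependent_explicit
proof (intro notI, elim exE conjE)
  fix t u assume t: "finite t" "t \<subseteq> bv ` S" "(\<Sum>v\<in>t. u v *\<^sub>V v) = 0" "\<exists>v\<in>t. u v \<noteq> 0"
  then obtain v b where v: "v \<in> t" "u v \<noteq> 0" "v = bv b" by auto
  have "Poly_Mapping.lookup (\<Sum>w\<in>t. u w *\<^sub>V w) b = (\<Sum>w\<in>t. u w * Poly_Mapping.lookup w b)"
    by (simp add: lookup_sum)
  also have "\<dots> = (\<Sum>w\<in>t. if w = v then u v else 0)"
  proof (rule sum.cong[OF refl])
    fix w assume "w \<in> t"
    then obtain b' where "w = bv b'" using t(2) by auto
    then show "u w * Poly_Mapping.lookup w b = (if w = v then u v else 0)"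
      using v(3) by (auto simp: lookup_bv) (metis keys_bv singleton_inject)
  qed
  also have "\<dots> = u v" using t(1) v(1) by simp
  finally show False using t(3) v(2) by simp
qed

lemma inj_bv: "inj bv"
  by (rule injI) (metis keys_bv singleton_inject)

lemma injective_on_span:
  assumes f: "lin f" and N: "finite N" and B: "V.independent B" "B \<subseteq> V.span (f ` N)" "card N \<le> card B" "finite B"
    and x: "x \<in> V.span N" "f x = 0"
  shows "x = 0"
proof -
  have "card B \<le> card (f ` N)" using V.independent_span_bound[OF _ B(1,2)] N by simp
  with B(3) card_image_le[OF N, of f] have "card (f ` N) = card N" "card B = card N" by auto
  then have inj: "inj_on f N" using N by (simp add: eq_card_imp_inj_on)
  have ind: "V.independent (f ` N)"
  proof
    assume "V.dependent (f ` N)"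
    then obtain y where y: "y \<in> f ` N" "y \<in> V.span (f ` N - {y})" by (auto simp: V.dependent_def)
    have "V.span (f ` N) \<subseteq> V.span (f ` N - {y})"
    proof (rule V.span_minimal[OF _ V.subspace_span], rule subsetI)
      fix z assume "z \<in> f ` N"
      then show "z \<in> V.span (f ` N - {y})" using y(2) by (cases "z = y") (auto intro: V.span_base)
    qed
    with B(2) have "B \<subseteq> V.span (f ` N - {y})" by blast
    from V.independent_span_bound[OF _ B(1) this] N have "card B \<le> card (f ` N - {y})" by simp
    also have "\<dots> < card (f ` N)" using y(1) N by (intro psubset_card_mono) auto
    finally show False using \<open>card (f ` N) = card N\<close> \<open>card B = card N\<close> by simp
  qed
  obtain c where c: "x = (\<Sum>n\<in>N. c n *\<^sub>V n)" using x(1) V.span_finite[OF N] by auto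
  have "(\<Sum>w\<in>f ` N. c (the_inv_into N f w) *\<^sub>V w) = (\<Sum>n\<in>N. c n *\<^sub>V f n)"
    by (subst sum.reindex[OF inj]) (simp add: the_inv_into_f_f[OF inj])
  also have "\<dots> = 0" using x(2) unfolding c by (simp add: lin_sum[OF f] lin_scl[OF f])
  finally have "\<forall>w\<in>f ` N. c (the_inv_into N f w) = 0"
    using V.independentD[OF ind, of "f ` N" "\<lambda>w. c (the_inv_into N f w)"] N by auto
  then have "c n = 0" if "n \<in> N" for n using that the_inv_into_f_f[OF inj that] by auto
  then show "x = 0" unfolding c by simp
qed

text \<open>Gaussian elimination of one index keeps the remaining rows strictly diagonally dominant;
  the rows only have to be known modulo the subspace.\<close>

lemma diag_dominant_mem:
  fixes a :: "'i \<Rightarrow> 'i \<Rightarrow> complex"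
  assumes "finite B" "V.subspace U"
    and "\<And>i. i \<in> B \<Longrightarrow> (\<Sum>j\<in>B - {i}. norm (a i j)) < norm (a i i)"
    and "\<And>i. i \<in> B \<Longrightarrow> (\<Sum>j\<in>B. a i j *\<^sub>V u j) \<in> U"
    and "i \<in> B"
  shows "u i \<in> U"
  using assms(1,3-5)
proof (induction B arbitrary: a i rule: finite_induct)
  case (insert b B)
  have b: "insert b B - {b} = B" using insert by auto
  have nz: "(\<Sum>j\<in>B. norm (a b j)) < norm (a b b)" using insert.prems(1)[of b] unfolding b by simp
  then have ab: "a b b \<noteq> 0" using sum_nonneg[of B "\<lambda>j. norm (a b j)"] by fastforce
  have row_b: "a b b *\<^sub>V u b + (\<Sum>j\<in>B. a b j *\<^sub>V u j) \<in> U" using insert.prems(2)[of b] insert.hyps by simp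
  define a' where "a' i j = a i j - a i b * a b j / a b b" for i j
  have B: "u i \<in> U" if "i \<in> B" for i
  proof (rule insert.IH[of a', OF _ _ that])
    fix i assume i: "i \<in> B"
    have r: "(\<Sum>j\<in>B - {i}. norm (a i j)) + norm (a i b) < norm (a i i)"
    proof -
      have "insert b B - {i} = insert b (B - {i})" using insert.hyps i by auto
      then show ?thesis using insert.prems(1)[of i] insert.hyps i by (simp add: add.commute)
    qed
    have rb: "(\<Sum>j\<in>B - {i}. norm (a b j)) + norm (a b i) < norm (a b b)"
      using nz sum.remove[OF insert.hyps(1) i, of "\<lambda>j. norm (a b j)"] by (simp add: add.commute)
    have "(\<Sum>j\<in>B - {i}. norm (a' i j)) \<le> (\<Sum>j\<in>B - {i}. norm (a i j) + norm (a i b) * norm (a b j) / norm (a b b))"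
      unfolding a'_def by (intro sum_mono) (metis norm_triangle_ineq4 norm_mult norm_divide)
    also have "\<dots> = (\<Sum>j\<in>B - {i}. norm (a i j)) + norm (a i b) / norm (a b b) * (\<Sum>j\<in>B - {i}. norm (a b j))"
      by (simp add: sum.distrib sum_distrib_left)
    also have "\<dots> \<le> (\<Sum>j\<in>B - {i}. norm (a i j)) + norm (a i b) / norm (a b b) * (norm (a b b) - norm (a b i))"
      using rb by (intro add_left_mono mult_left_mono) auto
    also have "\<dots> = (\<Sum>j\<in>B - {i}. norm (a i j)) + norm (a i b) - norm (a i b) * norm (a b i) / norm (a b b)"
      using ab by (simp add: field_simps)
    also have "\<dots> < norm (a i i) - norm (a i b * a b i / a b b)"
      using r by (simp add: norm_mult norm_divide)
    also have "\<dots> \<le> norm (a' i i)" unfolding a'_def by (rule norm_triangle_ineq2)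
    finally show "(\<Sum>j\<in>B - {i}. norm (a' i j)) < norm (a' i i)" .
    have "(\<Sum>j\<in>B. a' i j *\<^sub>V u j) = (\<Sum>j\<in>insert b B. a i j *\<^sub>V u j) - (a i b / a b b) *\<^sub>V (a b b *\<^sub>V u b + (\<Sum>j\<in>B. a b j *\<^sub>V u j))"
      using insert.hyps ab by (simp add: a'_def scl_diff_left sum_subtractf scl_add_right scl_sum_right algebra_simps)
    then show "(\<Sum>j\<in>B. a' i j *\<^sub>V u j) \<in> U"
      using V.subspace_diff[OF assms(2) insert.prems(2)[of i] V.subspace_scale[OF assms(2) row_b]] i by auto
  qed
  have "(\<Sum>j\<in>B. a b j *\<^sub>V u j) \<in> U" by (intro V.subspace_sum V.subspace_scale assms(2) B)
  from V.subspace_scale[OF assms(2) V.subspace_diff[OF assms(2) row_b this], of "1 / a b b"]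
  have "u b \<in> U" using ab by simp
  then show ?case using B insert.prems(3) by auto
qed simp

context lattice
begin

subsection \<open>Virasoro submodules\<close>

inductive_set vir :: "V set \<Rightarrow> V set" for B where
  gen: "x \<in> B \<Longrightarrow> x \<in> vir B"
| zero: "0 \<in> vir B"
| add: "x \<in> vir B \<Longrightarrow> y \<in> vir B \<Longrightarrow> x + y \<in> vir B"
| scl: "x \<in> vir B \<Longrightarrow> c *\<^sub>V x \<in> vir B"
| L: "x \<in> vir B \<Longrightarrow> L k x \<in> vir B"

lemma vir_subspace: "V.subspace (vir B)"
  unfolding V.subspace_def by (auto intro: vir.intros)

lemma vir_least:
  assumes "V.subspace U" "B \<subseteq> U" "\<And>k x. x \<in> U \<Longrightarrow> L k x \<in> U"
  shows "vir B \<subseteq> U"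
proof
  fix x assume "x \<in> vir B"
  then show "x \<in> U"
    by induction (use assms in \<open>auto intro: V.subspace_0 V.subspace_add V.subspace_scale\<close>)
qed

lemma vir_lin:
  assumes "lin f" "\<And>k x. f (L k x) = L k (f x)" "x \<in> vir B" "f ` B \<subseteq> vir C"
  shows "f x \<in> vir C"
  using assms(3)
proof induction
  case (gen x)
  then show ?case using assms(4) by auto
next
  case zero
  then show ?case by (simp add: lin_0[OF assms(1)] vir.zero)
qed (simp_all add: lin_add[OF assms(1)] lin_scl[OF assms(1)] assms(2) vir.add vir.scl vir.L)

text \<open>Only the lowering operators are applied. This is the form suited to
  \<open>C2\<close>-arguments, because all \<open>L k\<close> with \<open>k < 0\<close> are modes of
  \<open>om\<close> of index at most 0 and the positive modes need not be tracked.\<close>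

inductive_set low :: "V \<Rightarrow> V set" for v where
  gen: "v \<in> low v"
| zero: "0 \<in> low v"
| add: "x \<in> low v \<Longrightarrow> y \<in> low v \<Longrightarrow> x + y \<in> low v"
| scl: "x \<in> low v \<Longrightarrow> c *\<^sub>V x \<in> low v"
| L: "x \<in> low v \<Longrightarrow> k < 0 \<Longrightarrow> L k x \<in> low v"

lemma low_subspace: "V.subspace (low v)"
  unfolding V.subspace_def by (auto intro: low.intros)

lemma two_scl: "2 * x = 2 *\<^sub>V (x :: V)"
  using scl_of_nat[of 2 x] by simp

lemma om_hom: "om \<in> hom 0 2"
  unfolding om_def using A_hom[of 1] by (intro hom_add hom_scl A00_hom) simp

lemma h_om:
  assumes "i \<ge> 0"
  shows "h i om = (if i = 1 then A 0 else if i = 2 then (2 * (cp - 1)) *\<^sub>V 1 else 0)"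
proof -
  have "h i om = (1 / (4 * cp)) *\<^sub>V (h i (A 0) * A 0 + A 0 * h i (A 0)) + ((cp - 1) / (2 * cp)) *\<^sub>V h i (A 1)"
    unfolding om_def lin_add[OF lin_h] lin_scl[OF lin_h] deriv_mult[OF deriv_h[OF assms]] ..
  moreover have "h i (A 1) = (if i = 2 then (4 * cp) *\<^sub>V 1 else 0)"
    using assms by (cases "i = 0") (auto simp: h_A)
  ultimately show ?thesis
    using assms by (auto simp: h_A0 scl_mult_left scl_mult_right two_scl simp flip: scl_add_left)
qed

lemma A00_om:
  assumes "j \<ge> 1"
  shows "Y (A 0 * A 0) j om = h (- 1) (h j om) + h (- 2) (h (j + 1) om) + h (j - 2) (h 1 om) + h (j - 3) (h 2 om)"
proof -
  have "Y (A 0 * A 0) j om = (\<Sum>i<3. h (- 1 - int i) (h (j + int i) om)) + (\<Sum>i<3. h (j - 1 - int i) (h (int i) om))"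
    by (rule A00_eq) (use assms in \<open>auto simp: h_om\<close>)
  also have "h (j + 2) om = 0" "h 0 om = 0" using assms by (simp_all add: h_om)
  then have "(\<Sum>i<3. h (- 1 - int i) (h (j + int i) om)) + (\<Sum>i<3. h (j - 1 - int i) (h (int i) om)) =
    h (- 1) (h j om) + h (- 2) (h (j + 1) om) + h (j - 2) (h 1 om) + h (j - 3) (h 2 om)"
    by (simp add: numeral_3_eq_3 lin_0[OF lin_h])
  finally show ?thesis .
qed

lemma om1_om: "Y om 1 om = 2 *\<^sub>V om"
proof -
  have E: "Y (A 0 * A 0) 1 om = 2 *\<^sub>V (A 0 * A 0) + (2 * (2 * (cp - 1))) *\<^sub>V A 1"
    using h_neg[of 1 "A 0"] h_neg[of 2 1]
    by (simp add: A00_om h_om lin_scl[OF lin_h] flip: scl_add_left) (simp add: two_scl)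
  have "Y om 1 om = (1 / (4 * cp)) *\<^sub>V (2 *\<^sub>V (A 0 * A 0) + (2 * (2 * (cp - 1))) *\<^sub>V A 1)"
    using h_om[of 0] by (simp only: Y_om E) simp
  also have "\<dots> = 2 *\<^sub>V om"
    unfolding om_def scl_add_right scl_scl
    by (intro arg_cong2[where f = "(+)"] arg_cong2[where f = scl] refl) (simp_all add: field_simps)
  finally show ?thesis .
qed

lemma om2_om: "Y om 2 om = 0"
proof -
  have E: "Y (A 0 * A 0) 2 om = (4 * (cp - 1)) *\<^sub>V A 0"
    using h_neg[of 1 1] by (simp add: A00_om h_om lin_scl[OF lin_h] lin_0[OF lin_h] flip: scl_add_left)
  have "h (2 - 1) om = A 0" using h_om[of 1] by simp
  then have "Y om 2 om = (1 / (4 * cp) * (4 * (cp - 1)) - (cp - 1) / (2 * cp) * of_int 2) *\<^sub>V A 0"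
    by (simp only: Y_om E scl_scl scl_diff_left)
  also have "1 / (4 * cp) * (4 * (cp - 1)) - (cp - 1) / (2 * cp) * of_int 2 = 0" by (simp add: field_simps)
  finally show ?thesis by simp
qed

lemma hom00: "x \<in> hom 0 0 \<Longrightarrow> \<exists>k. x = k *\<^sub>V 1"
proof -
  assume x: "x \<in> hom 0 0"
  have "lam = {#}" if "deg lam = 0" for lam using that by (cases lam) auto
  then have "Poly_Mapping.keys x \<subseteq> {({#}, 0)}" using x by (fastforce simp: hom_def)
  then have "x = (\<Sum>b\<in>{({#}, 0)}. Poly_Mapping.lookup x b *\<^sub>V bv b)"
    by (subst V_expand) (rule sum.mono_neutral_left, auto simp: in_keys_iff)
  then show ?thesis by auto
qed

text \<open>A qualitative Virasoro relation. The third product of \<open>om\<close> with itself has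
  charge and degree 0, hence is some multiple of the vacuum; the value of the central charge stays
  unspecified.\<close>

lemma L_L: "L m (L n x) - L n (L m x) \<in> V.span {L (m + n) x, x}"
proof -
  have "Y (Y om (int i) om) (m + n + 2 - int i) x \<in> V.span {L (m + n) x, x}" for i
  proof -
    consider "i = 0" | "i = 1" | "i = 2" | "i = 3" | "i \<ge> 4" by linarith
    then show ?thesis
    proof cases
      case 1
      then have "Y (Y om (int i) om) (m + n + 2 - int i) x = - of_int (m + n + 2) *\<^sub>V L (m + n) x"
        unfolding L_def by (simp only: of_nat_0 Y_om0 va.Y_T) (simp add: algebra_simps)
      then show ?thesis by (simp only:) (intro V.span_scale V.span_base insertI1)
    next
      case 2
      then show ?thesis
        by (auto simp: om1_om Y_scl L_def algebra_simps intro!: V.span_base V.span_scale)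
    next
      case 3
      then show ?thesis by (simp add: om2_om lin_0[OF lin_Y] V.span_zero)
    next
      case 4
      have "Y om 3 om \<in> hom 0 0" using Y_hom[OF om_hom om_hom, of 3] by simp
      then obtain k where "Y om 3 om = k *\<^sub>V 1" using hom00 by blast
      then show ?thesis using 4
        by (auto simp: Y_scl va.Y_vac_left intro!: V.span_base V.span_scale V.span_zero)
    next
      case 5
      have "Y om (int i) om = 0"
        by (rule hom_neg[OF Y_hom[OF om_hom om_hom]]) (use 5 in simp)
      then show ?thesis by (simp add: lin_0[OF lin_Y] V.span_zero)
    qed
  qed
  then have "V.span (range (\<lambda>i. Y (Y om (int i) om) (m + 1 + (n + 1) - int i) x)) \<subseteq> V.span {L (m + n) x, x}"
    by (intro V.span_minimal V.subspace_span) (auto simp: algebra_simps)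
  then show ?thesis
    using va.commutator_span[of om "m + 1" om "n + 1" x] by (auto simp: L_def)
qed

lemma vir_low:
  assumes "\<And>k. k > 0 \<Longrightarrow> L k v = 0" "L 0 v = c *\<^sub>V v"
  shows "vir {v} \<subseteq> low v"
proof (rule vir_least[OF low_subspace])
  fix k x assume "x \<in> low v"
  then show "L k x \<in> low v"
  proof (induction arbitrary: k)
    case gen
    consider "k < 0" | "k = 0" | "k > 0" by linarith
    then show ?case by cases (auto simp: assms intro: low.intros)
  next
    case (L x j)
    have "V.span {L (k + j) x, x} \<subseteq> low v"
      by (rule V.span_minimal[OF _ low_subspace]) (use L in auto)
    with L_L[of k j x] have "L k (L j x) - L j (L k x) \<in> low v" by blast
    from low.add[OF this low.L[OF L.IH[of k] L.hyps(2)]] show ?case by simp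
  qed (auto simp: lin_0[OF lin_L] lin_add[OF lin_L] lin_scl[OF lin_L] intro: low.intros)
qed (auto intro: low.gen)

lemma sum_lessThan_plus:
  fixes f :: "nat \<Rightarrow> V"
  shows "(\<Sum>i<k + N. f i) = (\<Sum>i<k. f i) + (\<Sum>r<N. f (k + r))"
  by (induction N) (simp_all add: add.assoc)

text \<open>The normally ordered square split into pairs of creation modes and mixed pairs; each
  mixed pair arises in both halves of \<open>A00_eq\<close>, which turns \<open>1 / (4 p)\<close>
  into \<open>1 / (2 p)\<close>.\<close>

lemma L_neg:
  assumes "\<forall>i\<ge>int N. h i x = 0"
  shows "L (- int k - 1) x = (1 / (4 * cp)) *\<^sub>V (\<Sum>i<k. A i * (A (k - 1 - i) * x))
     + (1 / (2 * cp)) *\<^sub>V (\<Sum>r<N. A (k + r) * h (int r) x) + ((cp - 1) / (2 * cp) * of_nat k) *\<^sub>V (A k * x)"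
proof -
  have "Y (A 0 * A 0) (- int k) x = (\<Sum>i<k + N. h (- 1 - int i) (h (- int k + int i) x)) + (\<Sum>i<N. h (- int k - 1 - int i) (h (int i) x))"
    by (rule A00_eq) (use assms in auto)
  also have "(\<Sum>i<k + N. h (- 1 - int i) (h (- int k + int i) x)) = (\<Sum>i<k. A i * (A (k - 1 - i) * x)) + (\<Sum>r<N. A (k + r) * h (int r) x)"
    unfolding sum_lessThan_plus
  proof (intro arg_cong2[where f = "(+)"] sum.cong refl)
    fix i assume "i \<in> {..<k}"
    then have "- int k + int i = - int (k - 1 - i) - 1" by auto
    then show "h (- 1 - int i) (h (- int k + int i) x) = A i * (A (k - 1 - i) * x)"
      using h_neg1[of i] h_neg1[of "k - 1 - i" x] by (simp only: diff_conv_add_uminus add.commute)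
  next
    fix r
    have "- 1 - int (k + r) = - int (k + r) - 1" by simp
    moreover have "- int k + int (k + r) = int r" by simp
    ultimately show "h (- 1 - int (k + r)) (h (- int k + int (k + r)) x) = A (k + r) * h (int r) x"
      by (simp only: h_neg1)
  qed
  also have "(\<Sum>i<N. h (- int k - 1 - int i) (h (int i) x)) = (\<Sum>r<N. A (k + r) * h (int r) x)"
  proof (intro sum.cong refl)
    fix r
    have "- int k - 1 - int r = - int (k + r) - 1" by simp
    then show "h (- int k - 1 - int r) (h (int r) x) = A (k + r) * h (int r) x" by (simp only: h_neg1)
  qed
  finally have E: "Y (A 0 * A 0) (- int k) x = (\<Sum>i<k. A i * (A (k - 1 - i) * x)) + 2 *\<^sub>V (\<Sum>r<N. A (k + r) * h (int r) x)"
    by (simp add: scl_add_left[of 1 1, simplified])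
  have "- int k - 1 + 1 = - int k" by simp
  then show ?thesis
    unfolding L_def Y_om by (simp only: E h_neg1) (simp add: scl_add_right)
qed

lemma h_bv:
  assumes "j > 0"
  shows "h j (bv (lam, n)) = (2 * cp * of_int j * of_nat (count lam (nat j - 1))) *\<^sub>V bv (lam - {#nat j - 1#}, n)"
proof -
  define k where "k = nat j - 1"
  have j: "j = int k + 1" using assms by (simp add: k_def)
  have "h j (bv (lam, n)) = (\<Sum>x\<in>#lam. (if x = k then (2 * cp * of_int j) *\<^sub>V bv (lam - {#k#}, n) else 0))"
    using assms unfolding h_def by (auto simp: der_bv j scl_mult_left intro!: arg_cong[where f = sum_mset] image_mset_cong)
  also have "(\<Sum>x\<in>#mu. (if x = k then y else 0)) = of_nat (count mu k) *\<^sub>V y" for mu and y :: V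
    by (induction mu) (auto simp: scl_add_left)
  finally show ?thesis by (simp add: k_def mult.commute)
qed

end

subsection \<open>Counting monomials\<close>

lemma finite_deg: "finite {lam. deg lam = d}"
proof (induction d rule: less_induct)
  case (less d)
  have "{lam. deg lam = d} \<subseteq> insert {#} (\<Union>i<d. add_mset i ` {lam. deg lam = d - Suc i})"
  proof
    fix lam assume "lam \<in> {lam. deg lam = d}"
    then show "lam \<in> insert {#} (\<Union>i<d. add_mset i ` {lam. deg lam = d - Suc i})"
    proof (cases lam)
      case (add x mu)
      with \<open>lam \<in> _\<close> have "x < d" "deg mu = d - Suc x" by auto
      then show ?thesis using add by blast
    qed simp
  qed
  moreover have "finite (insert {#} (\<Union>i<d. add_mset i ` {lam. deg lam = d - Suc i}))"
    using less by auto
  ultimately show ?case by (rule finite_subset)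
qed

text \<open>\<open>good mu\<close> indexes the leading monomial of the product of the \<open>L (- i - 2)\<close>, \<open>i \<in> mu\<close>, applied to
  the vacuum, for the order by length and then by the exponent of \<open>A 0\<close>.\<close>
definition good :: "nat multiset \<Rightarrow> nat multiset" where
  "good mu = mu + replicate_mset (size mu) 0"

lemma deg_replicate: "deg (replicate_mset n 0) = n"
  by (induction n) auto

lemma deg_good: "deg (good mu) = deg mu + size mu"
  by (simp add: good_def deg_plus deg_replicate)

lemma inj_good: "inj good"
proof (rule injI)
  fix mu nu assume e: "good mu = good nu"
  have "size (good mu) = 2 * size mu" for mu by (simp add: good_def)
  with e have "size mu = size nu" by (metis mult_left_cancel zero_neq_numeral)
  with e show "mu = nu" by (simp add: good_def)
qed

lemma deg_image_Suc: "deg (image_mset Suc mu) = deg mu + size mu"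
  by (induction mu) auto

text \<open>The multisets \<open>mu\<close> with \<open>deg mu + size mu = d + 1\<close> index the
  good monomials of degree \<open>d + 1\<close> through \<open>good\<close>, and the monomials
  without a part 0 through raising all parts. So the others are equinumerous with the monomials
  containing a part 0, hence with all monomials of degree \<open>d\<close>.\<close>

lemma card_not_good: "card ({lam. deg lam = Suc d} - range good) = card {lam. deg lam = d}"
proof -
  let ?M = "{mu. deg mu + size mu = Suc d}"
  have 1: "{lam. deg lam = Suc d} \<inter> range good = good ` ?M" by (auto simp: deg_good)
  have 2: "{lam. deg lam = Suc d} = image_mset Suc ` ?M \<union> add_mset 0 ` {lam. deg lam = d}"
  proof (intro equalityI subsetI)
    fix lam assume l: "lam \<in> {lam. deg lam = Suc d}"
    show "lam \<in> image_mset Suc ` ?M \<union> add_mset 0 ` {lam. deg lam = d}"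
    proof (cases "0 \<in># lam")
      case True
      then obtain mu where "lam = add_mset 0 mu" by (meson mset_add)
      then show ?thesis using l by auto
    next
      case False
      then have "image_mset Suc (image_mset (\<lambda>x. x - 1) lam) = lam"
        unfolding multiset.map_comp by (intro multiset.map_ident_strong) (metis Suc_pred' comp_apply not_gr_zero One_nat_def)
      moreover have "deg (image_mset (\<lambda>x. x - 1) lam) + size (image_mset (\<lambda>x. x - 1) lam) = Suc d"
        using l calculation deg_image_Suc[of "image_mset (\<lambda>x. x - 1) lam"] by simp
      ultimately show ?thesis by (metis (mono_tags, lifting) UnI1 imageI mem_Collect_eq)
    qed
  qed (auto simp: deg_image_Suc)
  have fM: "finite ?M"
    by (rule finite_subset[of _ "\<Union>i\<le>Suc d. {lam. deg lam = i}"]) (auto simp: finite_deg)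
  have "card {lam. deg lam = Suc d} = card ?M + card {lam. deg lam = d}"
    unfolding 2
  proof (subst card_Un_disjoint)
    show "image_mset Suc ` ?M \<inter> add_mset 0 ` {lam. deg lam = d} = {}"
    proof -
      have "image_mset Suc mu \<noteq> add_mset 0 nu" for mu nu
      proof
        assume "image_mset Suc mu = add_mset 0 nu"
        then have "0 \<in># image_mset Suc mu" by simp
        then show False by auto
      qed
      then show ?thesis by blast
    qed
    have "inj_on (image_mset Suc) ?M"
      by (rule inj_on_subset[OF multiset.inj_map[OF inj_Suc]]) simp
    then show "card (image_mset Suc ` ?M) + card (add_mset 0 ` {lam. deg lam = d}) = card ?M + card {lam. deg lam = d}"
      by (simp add: card_image inj_on_def)
  qed (use fM finite_deg in auto)
  moreover have "card ({lam. deg lam = Suc d} \<inter> range good) = card ?M"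
    unfolding 1 by (rule card_image) (metis inj_good inj_on_subset subset_UNIV)
  moreover have "card ({lam. deg lam = Suc d} - range good) = card {lam. deg lam = Suc d} - card ({lam. deg lam = Suc d} \<inter> range good)"
    by (rule card_Diff_subset_Int) (use finite_deg in auto)
  ultimately show ?thesis by simp
qed

lemma hom_expand:
  assumes "x \<in> hom c (int d)"
  shows "x = (\<Sum>lam | deg lam = d. Poly_Mapping.lookup x (lam, c) *\<^sub>V bv (lam, c))"
proof -
  have inj: "inj_on (\<lambda>lam. (lam, c)) {lam. deg lam = d}" by (rule inj_onI) simp
  have k: "Poly_Mapping.keys x \<subseteq> (\<lambda>lam. (lam, c)) ` {lam. deg lam = d}"
    using assms unfolding hom_def by force
  have "x = (\<Sum>b\<in>Poly_Mapping.keys x. Poly_Mapping.lookup x b *\<^sub>V bv b)" by (rule V_expand)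
  also have "\<dots> = (\<Sum>b\<in>(\<lambda>lam. (lam, c)) ` {lam. deg lam = d}. Poly_Mapping.lookup x b *\<^sub>V bv b)"
    by (rule sum.mono_neutral_left) (use k finite_deg in \<open>auto simp: in_keys_iff\<close>)
  also have "\<dots> = (\<Sum>lam | deg lam = d. Poly_Mapping.lookup x (lam, c) *\<^sub>V bv (lam, c))"
    by (subst sum.reindex[OF inj]) simp
  finally show ?thesis .
qed

context lattice
begin

lemma h_ex_mult: "r > 0 \<Longrightarrow> h r (ex c * y) = ex c * h r y"
  by (simp add: deriv_mult[OF deriv_h] h_ex)

text \<open>On charge \<open>c\<close> the operator \<open>L (- k - 1)\<close> is multiplication by \<open>c A k\<close> plus terms independent
  of \<open>c\<close>, so for large \<open>c\<close> the transition matrix is diagonally dominant.\<close>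
lemma low_level: "\<exists>c0 \<ge> 1. \<forall>c\<ge>c0. \<forall>lam. deg lam \<le> d \<longrightarrow> bv (lam, c) \<in> vir {ex c}"
proof (induction d)
  case 0
  have "bv (lam, c) \<in> vir {ex c}" if "deg lam \<le> 0" for lam c
  proof -
    have "lam = {#}" using that by (cases lam) auto
    then show ?thesis by (auto simp: ex_def intro: vir.gen)
  qed
  then show ?case by auto
next
  case (Suc d)
  then obtain c1 where c1: "c1 \<ge> 1" "\<And>c lam. c \<ge> c1 \<Longrightarrow> deg lam \<le> d \<Longrightarrow> bv (lam, c) \<in> vir {ex c}" by blast
  let ?B = "{lam. deg lam = Suc d}"
  define k where "k lam = (SOME x. x \<in># lam)" for lam :: "nat multiset"
  define mu where "mu lam = lam - {#k lam#}" for lam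
  have lam: "lam = add_mset (k lam) (mu lam)" if "lam \<in> ?B" for lam
  proof -
    have "lam \<noteq> {#}" using that by auto
    then have "k lam \<in># lam" unfolding k_def by (meson multiset_nonemptyE someI)
    then show ?thesis by (simp add: mu_def)
  qed
  define R where "R lam = (1 / (4 * cp)) *\<^sub>V (\<Sum>i<k lam. A i * (A (k lam - 1 - i) * bv (mu lam, 0)))
     + (1 / (2 * cp)) *\<^sub>V (\<Sum>r\<in>{1..<Suc (Suc d)}. A (k lam + r) * h (int r) (bv (mu lam, 0)))" for lam
  define g where "g c lam = of_int c + (cp - 1) / (2 * cp) * of_nat (k lam)" for c lam
  have hz: "\<forall>i\<ge>int (Suc (Suc d)). h i (bv (mu lam, c)) = 0" if "lam \<in> ?B" for lam c
  proof (intro allI impI)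
    fix i assume i: "i \<ge> int (Suc (Suc d))"
    show "h i (bv (mu lam, c)) = 0"
    proof (rule hom_neg[OF h_hom[OF bv_hom]])
      have "Suc (k lam + deg (mu lam)) = Suc d" using lam[OF that] that deg_add_mset[of "k lam" "mu lam"] by auto
      then show "int (deg (mu lam)) - i < 0" using i by linarith
    qed
  qed
  have row: "L (- int (k lam) - 1) (bv (mu lam, c)) = g c lam *\<^sub>V bv (lam, c) + ex c * R lam" if l: "lam \<in> ?B" for lam c
  proof -
    have b: "bv (mu lam, c) = ex c * bv (mu lam, 0)" by (simp add: ex_bv)
    have "(\<Sum>r<Suc (Suc d). A (k lam + r) * h (int r) (bv (mu lam, c))) = A (k lam) * h 0 (bv (mu lam, c)) +
      (\<Sum>r\<in>{1..<Suc (Suc d)}. A (k lam + r) * h (int r) (bv (mu lam, c)))"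
      unfolding lessThan_atLeast0 sum.atLeast_Suc_lessThan[OF zero_less_Suc] by (simp del: sum.op_ivl_Suc)
    also have "(\<Sum>r\<in>{1..<Suc (Suc d)}. A (k lam + r) * h (int r) (bv (mu lam, c))) =
      ex c * (\<Sum>r\<in>{1..<Suc (Suc d)}. A (k lam + r) * h (int r) (bv (mu lam, 0)))"
      unfolding b sum_distrib_left by (rule sum.cong) (auto simp: h_ex_mult mult.left_commute)
    also have "A (k lam) * h 0 (bv (mu lam, c)) = (2 * cp * of_int c) *\<^sub>V bv (lam, c)"
      by (simp add: h0_hom[OF bv_hom] scl_mult_right bv_add_mset[symmetric] lam[OF l, symmetric])
    finally have 2: "(\<Sum>r<Suc (Suc d). A (k lam + r) * h (int r) (bv (mu lam, c))) = (2 * cp * of_int c) *\<^sub>V bv (lam, c) +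
      ex c * (\<Sum>r\<in>{1..<Suc (Suc d)}. A (k lam + r) * h (int r) (bv (mu lam, 0)))" .
    have 1: "(\<Sum>i<k lam. A i * (A (k lam - 1 - i) * bv (mu lam, c))) = ex c * (\<Sum>i<k lam. A i * (A (k lam - 1 - i) * bv (mu lam, 0)))"
      by (simp add: b sum_distrib_left mult.left_commute)
    have 3: "A (k lam) * bv (mu lam, c) = bv (lam, c)" using lam[OF l] by (simp flip: bv_add_mset)
    show ?thesis
      unfolding L_neg[OF hz[OF l]] 1 2 3 R_def g_def
      by (simp add: scl_add_right scl_add_left distrib_left scl_mult_right del: sum.op_ivl_Suc)
  qed
  have Rhom: "R lam \<in> hom 0 (int (Suc d))" if l: "lam \<in> ?B" for lam
  proof -
    have "L (- int (k lam) - 1) (bv (mu lam, 0)) \<in> hom 0 (int (Suc d))"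
      using L_hom[OF bv_hom[of "mu lam" 0], of "- int (k lam) - 1"] l deg_add_mset[of "k lam" "mu lam"] lam[OF l] by (simp add: algebra_simps)
    moreover have "bv (lam, 0) \<in> hom 0 (int (Suc d))" using bv_hom[of lam 0] l by simp
    ultimately have "L (- int (k lam) - 1) (bv (mu lam, 0)) - g 0 lam *\<^sub>V bv (lam, 0) \<in> hom 0 (int (Suc d))"
      by (intro V.subspace_diff[OF hom_subspace] hom_scl)
    then show ?thesis using row[OF l, of 0] by simp
  qed
  define r where "r lam nu = Poly_Mapping.lookup (R lam) (nu, 0)" for lam nu
  \<comment> \<open>Bounds the sum of norms in every row of the part independent of
    \<open>c\<close>; the diagonal entry \<open>g c lam\<close> has norm at least \<open>c\<close>,
    so any \<open>c > K\<close> gives dominance.\<close>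
  define K where "K = (\<Sum>lam\<in>?B. \<Sum>nu\<in>?B. norm (r lam nu))"
  show ?case
  proof (intro exI[of _ "max c1 (\<lceil>K\<rceil> + 1)"] conjI allI impI)
    fix c lam assume c: "c \<ge> max c1 (\<lceil>K\<rceil> + 1)" and l: "deg lam \<le> Suc d"
    show "bv (lam, c) \<in> vir {ex c}"
    proof (cases "deg lam \<le> d")
      case True
      then show ?thesis using c1(2) c by auto
    next
      case False
      show ?thesis
      proof (rule diag_dominant_mem[where B = ?B and a = "\<lambda>lam nu. (if lam = nu then g c lam else 0) + r lam nu" and u = "\<lambda>lam. bv (lam, c)"])
        show "lam \<in> ?B" using l False by simp
      next
        fix lam assume lB: "lam \<in> ?B"
        have "(\<Sum>j\<in>?B - {lam}. norm ((if lam = j then g c lam else 0) + r lam j)) + norm (r lam lam) = (\<Sum>j\<in>?B. norm (r lam j))"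
        proof -
          have "(\<Sum>j\<in>?B - {lam}. norm ((if lam = j then g c lam else 0) + r lam j)) = (\<Sum>j\<in>?B - {lam}. norm (r lam j))"
            by (rule sum.cong) auto
          then show ?thesis using sum.remove[OF finite_deg lB, of "\<lambda>j. norm (r lam j)"] by linarith
        qed
        also have "\<dots> \<le> K" unfolding K_def
          by (rule member_le_sum[OF lB, of "\<lambda>lam. \<Sum>nu\<in>?B. norm (r lam nu)"]) (auto intro: sum_nonneg finite_deg)
        also have "K < of_int c" using c by linarith
        also have "of_int c \<le> norm (g c lam)"
        proof -
          have "g c lam = complex_of_real (of_int c + (real p - 1) / (2 * real p) * real (k lam))"
            by (simp add: g_def)
          moreover have "(real p - 1) / (2 * real p) * real (k lam) \<ge> 0" using p2 by simp
          moreover have "c \<ge> 0" using c c1(1) by linarith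
          ultimately show ?thesis by (simp only: norm_of_real)
        qed
        also have "norm (g c lam) \<le> norm ((if lam = lam then g c lam else 0) + r lam lam) + norm (r lam lam)"
          by (simp add: norm_diff_triangle_ineq) (metis add_diff_cancel_right' norm_triangle_ineq4)
        finally show "(\<Sum>j\<in>?B - {lam}. norm ((if lam = j then g c lam else 0) + r lam j)) < norm ((if lam = lam then g c lam else 0) + r lam lam)"
          by simp
        have "deg (mu lam) \<le> d" using lB lam[OF lB] deg_add_mset[of "k lam" "mu lam"] by auto
        then have "L (- int (k lam) - 1) (bv (mu lam, c)) \<in> vir {ex c}" using c1(2) c by (intro vir.L) auto
        moreover have "ex c * R lam = (\<Sum>nu\<in>?B. r lam nu *\<^sub>V bv (nu, c))"
          by (subst hom_expand[OF Rhom[OF lB]]) (simp add: sum_distrib_left scl_mult_right ex_bv r_def)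
        moreover have "(\<Sum>nu\<in>?B. (if lam = nu then g c lam else 0) *\<^sub>V bv (nu, c)) = g c lam *\<^sub>V bv (lam, c)"
          using finite_deg[of "Suc d"] lB by (simp add: if_distrib[of "\<lambda>t. t *\<^sub>V _"] cong: if_cong)
        ultimately show "(\<Sum>nu\<in>?B. ((if lam = nu then g c lam else 0) + r lam nu) *\<^sub>V bv (nu, c)) \<in> vir {ex c}"
          by (simp add: row[OF lB] scl_add_left sum.distrib)
      qed (use finite_deg vir_subspace in auto)
    qed
  qed (use c1 in auto)
qed

section \<open>Surjectivity of the screening operator from charge 0 to charge 1\<close>

lemma Qs_pow_F: "(Qs ^^ (2 * n + 1)) (F n) = 0"
proof (rule hom_neg[OF Qs_pow_hom[OF F_hom]])
  have "2 * int p * (- int n) + int p * (int (2 * n + 1) - 1) + 1 = 1" by (simp add: algebra_simps)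
  then show "0 - int (2 * n + 1) * (2 * int p * (- int n) + int p * (int (2 * n + 1) - 1) + 1) < 0" by (simp only:) simp
qed

lemma Qs_pow_L: "L k ((Qs ^^ s) x) = (Qs ^^ s) (L k x)"
  by (induction s) (simp_all add: L_Qs)

lemma lin_Qs_pow: "lin (Qs ^^ s)"
  by (rule lin_funpow[OF lin_Qs])

lemma range_subspace: "lin f \<Longrightarrow> V.subspace (range f)"
  unfolding V.subspace_def
  by (auto simp: image_iff) (metis lin_0, metis lin_add, metis lin_scl)

text \<open>Integration by parts: \<open>Qs\<close> is a derivation of all modes, so each
  \<open>Qs\<close> moves to the other factor with a sign, modulo the image of
  \<open>Qs\<close>.\<close>

lemma Y_Qs_pow_mod: "Y a i ((Qs ^^ r) x) - (- 1) ^ r *\<^sub>V Y ((Qs ^^ r) a) i x \<in> range Qs"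
proof (induction r arbitrary: x)
  case 0
  then show ?case using lin_0[OF lin_Qs] by (auto intro: range_eqI[of _ _ 0])
next
  case (Suc r)
  have "Y a i ((Qs ^^ Suc r) x) - (- 1) ^ r *\<^sub>V Y ((Qs ^^ r) a) i (Qs x) \<in> range Qs"
    using Suc[of "Qs x"] by (simp add: funpow_swap1)
  moreover have "(- 1) ^ r *\<^sub>V Qs (Y ((Qs ^^ r) a) i x) \<in> range Qs"
    by (intro V.subspace_scale range_subspace lin_Qs) auto
  ultimately have "Y a i ((Qs ^^ Suc r) x) - (- 1) ^ r *\<^sub>V Y ((Qs ^^ r) a) i (Qs x) + (- 1) ^ r *\<^sub>V Qs (Y ((Qs ^^ r) a) i x) \<in> range Qs"
    by (intro V.subspace_add range_subspace lin_Qs)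
  then show ?case by (simp add: Qs_Y scl_add_right)
qed

lemma e_ex_top: "e (- n) (2 * int p * n * n - 1) (ex n) = 1"
  using e_eq[OF ex_hom[of n], of 1 "- n" "2 * int p * n * n - 1"] by (simp add: ex_mult)

lemma J_eq_first:
  assumes "\<And>i. X (m + int i) v = 0" "\<And>k. lin (X' k)"
  shows "J n X X' m k v = iexp n (\<lambda>m k. X m (X' k v)) m k"
  unfolding J_def iexp_def by (simp add: assms(1) lin_0[OF assms(2)] fsum_eq[of 0])

text \<open>For large \<open>n\<close>, the vectors \<open>e\<^sup>n\<^sub>i y\<close> occurring in the expansion of \<open>y\<close> through
  \<open>e\<^sup>-\<^sup>n\<close> and \<open>e\<^sup>n\<close> have low level, hence lie in the image of \<open>Q\<^sup>2\<^sup>n\<^sup>+\<^sup>1\<close>; moving that power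
  of \<open>Q\<close> across onto \<open>e\<^sup>-\<^sup>n\<close>, which it kills, leaves an element of the image of \<open>Q\<close>.\<close>
lemma Qs_surj:
  assumes y: "y \<in> hom 1 (int d)"
  shows "\<exists>z\<in>hom 0 (int d + 1). Qs z = y"
proof -
  obtain c0 where c0: "\<And>c lam. c \<ge> c0 \<Longrightarrow> deg lam \<le> 2 * d \<Longrightarrow> bv (lam, c) \<in> vir {ex c}"
    using low_level[of "2 * d"] by blast
  define n where "n = nat c0"
  define m where "m = int d + 2 * int p * int n"
  let ?N = "2 * int p * int n * int n - 1"
  have "J ?N (Y (F n)) (Y (ex (int n))) m (- 1 - m) y = Y (Y (F n) ?N (ex (int n))) (m + (- 1 - m)) y"
  proof (rule va.J_top)
    fix i
    show "Y (F n) (?N + 1 + int i) (ex (int n)) = 0"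
      by (rule hom_neg[OF Y_hom[OF F_hom ex_hom]]) simp
  qed
  also have "Y (F n) ?N (ex (int n)) = 1"
    using e_ex_top[of "int n"] by (simp add: F_def Y_ex)
  finally have 1: "J ?N (Y (F n)) (Y (ex (int n))) m (- 1 - m) y = y"
    by (simp add: va.Y_vac_left)
  have "J ?N (Y (F n)) (Y (ex (int n))) m (- 1 - m) y = iexp ?N (\<lambda>m k. Y (F n) m (Y (ex (int n)) k y)) m (- 1 - m)"
  proof (rule J_eq_first[OF _ va.Y_lin2])
    fix i
    show "Y (F n) (m + int i) y = 0"
      by (rule hom_neg[OF Y_hom[OF F_hom y]]) (simp add: m_def)
  qed
  also have "\<dots> \<in> range Qs"
  proof (rule iexp_mem[OF range_subspace[OF lin_Qs]])
    fix i
    let ?z = "Y (ex (int n)) (- 1 - m + int i) y"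
    \<comment> \<open>The level \<open>2 d - i\<close> does not depend on \<open>n\<close>; only for
      this reason can \<open>n\<close> be chosen after the bound \<open>c0\<close> obtained for
      level \<open>2 d\<close>.\<close>
    have z: "?z \<in> hom (int n + 1) (2 * int d - int i)"
      using Y_hom[OF ex_hom y, of "int n" "- 1 - m + int i"] by (simp add: m_def algebra_simps)
    have "?z \<in> vir {ex (int n + 1)}"
    proof -
      have "bv b \<in> vir {ex (int n + 1)}" if "b \<in> Poly_Mapping.keys ?z" for b
        using that z c0[of "int n + 1" "fst b"] unfolding hom_def n_def by (cases b) auto
      then show ?thesis
        by (subst V_expand) (intro V.subspace_sum V.subspace_scale vir_subspace)
    qed
    moreover have "vir {ex (int n + 1)} \<subseteq> range (Qs ^^ (2 * n + 1))"
    proof (rule vir_least[OF range_subspace[OF lin_Qs_pow]])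
      show "{ex (int n + 1)} \<subseteq> range (Qs ^^ (2 * n + 1))" using ex_in_image[of n] by (metis empty_subsetI insert_subset rangeI)
      show "L k x \<in> range (Qs ^^ (2 * n + 1))" if "x \<in> range (Qs ^^ (2 * n + 1))" for k x
      proof -
        from that obtain y where "x = (Qs ^^ (2 * n + 1)) y" by (rule imageE)
        then show ?thesis using rangeI[of "Qs ^^ (2 * n + 1)" "L k y"] by (simp only: Qs_pow_L)
      qed
    qed
    ultimately obtain x where x: "?z = (Qs ^^ (2 * n + 1)) x" by blast
    show "Y (F n) (m + ?N - int i) ?z \<in> range Qs"
      using Y_Qs_pow_mod[of "F n" "m + ?N - int i" "2 * n + 1" x] unfolding x Qs_pow_F lin_0[OF lin_Y] by simp
  qed
  finally obtain z where z: "Qs z = y" using 1 by auto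
  let ?P = "\<lambda>(c::int) (e::int) c' e'. c' = c \<and> e' = e"
  have "Qs (pr (?P 0 (int d + 1)) z) = pr (?P 1 (int d)) (Qs z)"
    by (rule pr_commute[OF lin_Qs, symmetric, where g = "\<lambda>c. c + 1" and k = "\<lambda>c d. d - 2 * int p * c - 1"])
       (auto intro: Qs_hom)
  also have "\<dots> = y" using pr_hom[OF y] z by simp
  finally show ?thesis using pr_in_hom by blast
qed

section \<open>Leading monomials of the Virasoro module of the vacuum\<close>

definition Lw :: "nat \<Rightarrow> nat \<Rightarrow> nat \<Rightarrow> V set" where
  "Lw d s z = V.span ((\<lambda>nu. bv (nu, 0)) ` {nu. deg nu = d \<and> (size nu < s \<or> size nu = s \<and> count nu 0 < z)})"

lemma Lw_bv: "deg nu = d \<Longrightarrow> size nu < s \<or> size nu = s \<and> count nu 0 < z \<Longrightarrow> bv (nu, 0) \<in> Lw d s z"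
  unfolding Lw_def by (intro V.span_base) auto

lemma Lw_subspace: "V.subspace (Lw d s z)"
  unfolding Lw_def by (rule V.subspace_span)

lemma Lw_mono: "s < s' \<or> s = s' \<and> z \<le> z' \<Longrightarrow> Lw d s z \<subseteq> Lw d s' z'"
  unfolding Lw_def by (intro V.span_mono) auto

definition lead :: "nat \<Rightarrow> complex" where
  "lead x = (1 / (4 * cp)) * of_nat (card {i. i < Suc x \<and> (i = 0 \<or> i = x)})"

lemma lead_nz: "lead x \<noteq> 0"
proof -
  have "finite {i. i < Suc x \<and> (i = 0 \<or> i = x)}" "0 \<in> {i. i < Suc x \<and> (i = 0 \<or> i = x)}" by auto
  then have "card {i. i < Suc x \<and> (i = 0 \<or> i = x)} \<noteq> 0" by (metis card_eq_0_iff empty_iff)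
  then show ?thesis by (simp add: lead_def)
qed

text \<open>Among the products \<open>A i * A (x - i)\<close> of equal length, the pairs with
  \<open>i = 0\<close> or \<open>i = x\<close> contain the most factors \<open>A 0\<close>; they
  coincide when \<open>x = 0\<close>, whence the cardinality in \<open>lead\<close>. The mixed and
  linear terms give shorter monomials.\<close>

lemma L_bv_lead:
  defines "t x \<equiv> if x = 0 then 2 else 1 :: nat"
  shows "L (- int (Suc x) - 1) (bv (lam, 0)) - lead x *\<^sub>V bv (add_mset 0 (add_mset x lam), 0)
     \<in> Lw (deg lam + x + 2) (size lam + 2) (count lam 0 + t x)"
proof -
  let ?W = "Lw (deg lam + x + 2) (size lam + 2) (count lam 0 + t x)"
  let ?b = "bv (add_mset 0 (add_mset x lam), 0)"
  define N where "N = Suc (deg lam)"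
  have hz: "\<forall>i\<ge>int N. h i (bv (lam, 0)) = 0"
    by (auto simp: N_def intro!: hom_neg[OF h_hom[OF bv_hom]])
  have 1: "(\<Sum>i<Suc x. A i * (A (x - i) * bv (lam, 0)) - (if i = 0 \<or> i = x then 1 else 0) *\<^sub>V ?b) \<in> ?W"
  proof (rule V.subspace_sum[OF Lw_subspace])
    fix i assume i: "i \<in> {..<Suc x}"
    have e: "A i * (A (x - i) * bv (lam, 0)) = bv (add_mset i (add_mset (x - i) lam), 0)"
      by (simp add: bv_add_mset)
    show "A i * (A (x - i) * bv (lam, 0)) - (if i = 0 \<or> i = x then 1 else 0) *\<^sub>V ?b \<in> ?W"
    proof (cases "i = 0 \<or> i = x")
      case True
      then have "add_mset i (add_mset (x - i) lam) = add_mset 0 (add_mset x lam)" by (auto simp: add_mset_commute)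
      then have "A i * (A (x - i) * bv (lam, 0)) = ?b" by (simp only: e)
      then show ?thesis using True by (simp only: if_True scl_one diff_self V.subspace_0[OF Lw_subspace])
    next
      case False
      then have "bv (add_mset i (add_mset (x - i) lam), 0) \<in> ?W"
        using i by (intro Lw_bv) (auto simp: t_def)
      then show ?thesis using False by (simp add: e)
    qed
  qed
  have 2: "A (Suc x + r) * h (int r) (bv (lam, 0)) \<in> ?W" for r
  proof (cases "r = 0")
    case True
    then show ?thesis using V.subspace_0[OF Lw_subspace] by (simp add: h0_hom[OF bv_hom])
  next
    case False
    then obtain q where r: "r = Suc q" by (cases r) auto
    show ?thesis
    proof (cases "q \<in># lam")
      case True
      then obtain mu where mu: "lam = add_mset q mu" by (meson mset_add)
      have "A (Suc x + r) * bv (mu, 0) \<in> ?W" unfolding bv_add_mset[symmetric]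
        by (rule Lw_bv) (simp_all add: mu r)
      moreover have "\<exists>k. h (int r) (bv (lam, 0)) = k *\<^sub>V bv (mu, 0)"
        using h_bv[of "int (Suc q)" lam 0] unfolding r mu by (auto simp del: of_nat_Suc)
      ultimately show ?thesis by (auto simp only: scl_mult_right intro: V.subspace_scale[OF Lw_subspace])
    next
      case False
      then have "count lam q = 0" by (simp add: not_in_iff)
      then have "h (int r) (bv (lam, 0)) = 0" using h_bv[of "int (Suc q)" lam 0] unfolding r by (simp del: of_nat_Suc)
      then show ?thesis using V.subspace_0[OF Lw_subspace] by simp
    qed
  qed
  have 3: "A (Suc x) * bv (lam, 0) \<in> ?W" unfolding bv_add_mset[symmetric] by (rule Lw_bv) simp_all
  have 4: "(\<Sum>i<Suc x. (if i = 0 \<or> i = x then 1 else 0) *\<^sub>V ?b) = (4 * cp * lead x) *\<^sub>V ?b"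
  proof -
    have "(\<Sum>i<Suc x. (if i = 0 \<or> i = x then 1 else 0 :: complex)) = of_nat (card {i. i < Suc x \<and> (i = 0 \<or> i = x)})"
      by (simp add: sum.If_cases Int_def del: sum.lessThan_Suc)
    then show ?thesis unfolding scl_sum_left[symmetric] by (simp add: lead_def)
  qed
  have "L (- int (Suc x) - 1) (bv (lam, 0)) - lead x *\<^sub>V ?b = (1 / (4 * cp)) *\<^sub>V (\<Sum>i<Suc x. A i * (A (x - i) * bv (lam, 0)) - (if i = 0 \<or> i = x then 1 else 0) *\<^sub>V ?b)
    + (1 / (2 * cp)) *\<^sub>V (\<Sum>r<N. A (Suc x + r) * h (int r) (bv (lam, 0))) + ((cp - 1) / (2 * cp) * of_nat (Suc x)) *\<^sub>V (A (Suc x) * bv (lam, 0))"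
    unfolding L_neg[OF hz] sum_subtractf 4 by (simp add: scl_diff_right del: sum.lessThan_Suc of_nat_Suc)
  also have "\<dots> \<in> ?W"
    by (intro V.subspace_add V.subspace_scale Lw_subspace V.subspace_sum 1 2 3)
  finally show ?thesis .
qed

lemma L_Lw:
  assumes "y \<in> Lw d s z"
  shows "L (- int (Suc x) - 1) y \<in> Lw (d + x + 2) (s + 2) (z + (if x = 0 then 2 else 1))"
  unfolding Lw_def
proof (rule lin_span[OF lin_L assms[unfolded Lw_def]], fold Lw_def)
  fix y assume "y \<in> (\<lambda>nu. bv (nu, 0)) ` {nu. deg nu = d \<and> (size nu < s \<or> size nu = s \<and> count nu 0 < z)}"
  then obtain nu where nu: "y = bv (nu, 0)" "deg nu = d" "size nu < s \<or> size nu = s \<and> count nu 0 < z" by auto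
  let ?W = "Lw (d + x + 2) (s + 2) (z + (if x = 0 then 2 else 1))"
  have "L (- int (Suc x) - 1) y - lead x *\<^sub>V bv (add_mset 0 (add_mset x nu), 0) \<in> ?W"
    using L_bv_lead[of x nu] Lw_mono[of "size nu + 2" "s + 2" "count nu 0 + (if x = 0 then 2 else 1)" "z + (if x = 0 then 2 else 1)" "d + x + 2"] nu by auto
  moreover have "bv (add_mset 0 (add_mset x nu), 0) \<in> ?W" using nu by (intro Lw_bv) auto
  ultimately show "L (- int (Suc x) - 1) y \<in> ?W"
    using V.subspace_add[OF Lw_subspace _ V.subspace_scale[OF Lw_subspace]] by (metis diff_add_cancel)
qed

lemma good_lead: "\<exists>c w. c \<noteq> 0 \<and> w \<in> vir {1} \<and> w - c *\<^sub>V bv (good mu, 0) \<in> Lw (deg (good mu)) (size (good mu)) (count (good mu) 0)"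
proof (induction mu)
  case empty
  show ?case by (intro exI[of _ 1]) (auto simp: good_def intro: vir.gen V.subspace_0[OF Lw_subspace])
next
  case (add x mu)
  then obtain c w where cw: "c \<noteq> 0" "w \<in> vir {1}" "w - c *\<^sub>V bv (good mu, 0) \<in> Lw (deg (good mu)) (size (good mu)) (count (good mu) 0)"
    by blast
  have g: "good (add_mset x mu) = add_mset 0 (add_mset x (good mu))" by (simp add: good_def add_mset_commute)
  have gs: "deg (good (add_mset x mu)) = deg (good mu) + x + 2" "size (good (add_mset x mu)) = size (good mu) + 2"
    "count (good (add_mset x mu)) 0 = count (good mu) 0 + (if x = 0 then 2 else 1)"
    unfolding g by auto
  let ?L = "L (- int (Suc x) - 1)"
  have "?L w - (c * lead x) *\<^sub>V bv (good (add_mset x mu), 0) = ?L (w - c *\<^sub>V bv (good mu, 0)) +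
     c *\<^sub>V (?L (bv (good mu, 0)) - lead x *\<^sub>V bv (good (add_mset x mu), 0))"
    by (simp add: lin_diff[OF lin_L] lin_scl[OF lin_L] scl_diff_right)
  also have "\<dots> \<in> Lw (deg (good (add_mset x mu))) (size (good (add_mset x mu))) (count (good (add_mset x mu)) 0)"
    unfolding gs using L_Lw[OF cw(3), of x] L_bv_lead[of x "good mu"] unfolding g
    by (intro V.subspace_add V.subspace_scale Lw_subspace)
  finally show ?case using cw lead_nz[of x] vir.L[OF cw(2)] by (metis mult_eq_0_iff)
qed

text \<open>A good monomial is replaced by a Virasoro descendant of the vacuum with that leading
  monomial, leaving smaller monomials. The measure codes the lexicographic order by length and
  number of parts 0, as that number is at most the length and hence at most
  \<open>d\<close>.\<close>

lemma bv_decompose: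
  assumes "deg lam = d"
  shows "bv (lam, 0) \<in> V.span (vir {1} \<union> (\<lambda>nu. bv (nu, 0)) ` ({nu. deg nu = d} - range good))" (is "_ \<in> V.span ?S")
  using assms
proof (induction "size lam * Suc d + count lam 0" arbitrary: lam rule: less_induct)
  case less
  show ?case
  proof (cases "lam \<in> range good")
    case False
    then show ?thesis using less.prems by (intro V.span_base) auto
  next
    case True
    then obtain mu where mu: "lam = good mu" by auto
    obtain c w where cw: "c \<noteq> 0" "w \<in> vir {1}" "w - c *\<^sub>V bv (lam, 0) \<in> Lw d (size lam) (count lam 0)"
      using good_lead[of mu] less.prems unfolding mu by auto
    have "Lw d (size lam) (count lam 0) \<subseteq> V.span ?S"
      unfolding Lw_def
    proof (rule V.span_minimal[OF _ V.subspace_span], rule subsetI)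
      fix z assume "z \<in> (\<lambda>nu. bv (nu, 0)) ` {nu. deg nu = d \<and> (size nu < size lam \<or> size nu = size lam \<and> count nu 0 < count lam 0)}"
      then obtain nu where z: "z = bv (nu, 0)" and nu: "deg nu = d" "size nu < size lam \<or> size nu = size lam \<and> count nu 0 < count lam 0"
        by blast
      have "count nu 0 \<le> size nu" by (rule count_le_size)
      moreover have "size nu \<le> deg nu" by (simp add: deg_def)
      ultimately have cn: "count nu 0 < Suc d" using nu by linarith
      have "size nu * Suc d + count nu 0 < size lam * Suc d + count lam 0"
      proof (cases "size nu < size lam")
        case True
        then have "Suc (size nu) * Suc d \<le> size lam * Suc d" by (intro mult_right_mono) auto
        then show ?thesis using cn by simp
      next
        case False
        then show ?thesis using nu by simp
      qed
      from less.hyps[OF this nu(1)] show "z \<in> V.span ?S" unfolding z .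
    qed
    with cw(3) have 1: "w - c *\<^sub>V bv (lam, 0) \<in> V.span ?S" by blast
    have 2: "w \<in> V.span ?S" using cw(2) by (intro V.span_base) auto
    from V.span_scale[OF V.span_diff[OF 2 1], of "1 / c"] show ?thesis using cw(1) by simp
  qed
qed

lemma Qs_1: "Qs 1 = 0"
  using Qs_pow_F[of 0] by (simp add: F_def)

text \<open>Modulo \<open>vir {1}\<close>, which \<open>Qs\<close> kills, every vector lies in the
  span of the non-good monomials. Their images span charge 1 in degree \<open>d - 1\<close>, and by
  \<open>card_not_good\<close> there are no more of them than the dimension there, so
  \<open>Qs\<close> is injective on their span.\<close>

lemma ker_Qs_charge0:
  assumes v: "v \<in> hom 0 (int d)" "Qs v = 0"
  shows "v \<in> vir {1}"
proof -
  let ?N = "(\<lambda>nu. bv (nu, 0)) ` ({nu. deg nu = d} - range good)"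
  have N: "finite ?N" "?N \<subseteq> hom 0 (int d)" using finite_deg bv_hom by auto
  have ker: "Qs u = 0" if "u \<in> vir {1}" for u
  proof -
    have "vir {1} \<subseteq> {u. Qs u = 0}"
      by (rule vir_least) (auto simp: V.subspace_def Qs_1 lin_0[OF lin_Qs] lin_add[OF lin_Qs] lin_scl[OF lin_Qs] lin_0[OF lin_L] simp flip: L_Qs)
    then show ?thesis using that by auto
  qed
  have dec: "\<exists>u n. u \<in> vir {1} \<and> n \<in> V.span ?N \<and> x = u + n" if "x \<in> hom 0 (int d)" for x
  proof -
    have "x \<in> V.span (vir {1} \<union> ?N)"
      by (subst hom_expand[OF that]) (intro V.span_sum V.span_scale bv_decompose, simp)
    then show ?thesis unfolding V.span_Un V.span_eq_iff[THEN iffD2, OF vir_subspace] by auto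
  qed
  obtain u n where un: "u \<in> vir {1}" "n \<in> V.span ?N" "v = u + n" using dec[OF v(1)] by blast
  have Qn: "Qs n = 0" using v(2) ker[OF un(1)] un(3) by (simp add: lin_add[OF lin_Qs])
  have "n = 0"
  proof (cases d)
    case 0
    have "?N = {}"
    proof -
      have "nu = good {#}" if "deg nu = 0" for nu using that by (cases nu) (auto simp: good_def)
      then show ?thesis using 0 by blast
    qed
    then show ?thesis using un(2) by (simp only: V.span_empty singleton_iff)
  next
    case (Suc e)
    let ?B = "(\<lambda>nu. bv (nu, 1)) ` {nu. deg nu = e}"
    show ?thesis
    proof (rule injective_on_span[OF lin_Qs N(1) _ _ _ _ un(2) Qn])
      show "V.independent ?B" using independent_bv[of "(\<lambda>nu. (nu, 1)) ` {nu. deg nu = e}"] by (simp add: image_image)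
      show "finite ?B" using finite_deg by simp
      have "card ?B = card {nu. deg nu = e}" by (rule card_image) (auto simp: inj_on_def dest: injD[OF inj_bv])
      moreover have "card ?N \<le> card ({nu. deg nu = d} - range good)" by (rule card_image_le) (use finite_deg in auto)
      ultimately show "card ?N \<le> card ?B" using card_not_good[of e] Suc by simp
      show "?B \<subseteq> V.span (Qs ` ?N)"
      proof clarify
        fix nu assume e: "e = deg nu"
        obtain z where z: "z \<in> hom 0 (int d)" "Qs z = bv (nu, 1)"
          using Qs_surj[of "bv (nu, 1)" e] bv_hom[of nu 1] Suc e by (auto simp: add.commute)
        obtain u' n' where "u' \<in> vir {1}" "n' \<in> V.span ?N" "z = u' + n'" using dec[OF z(1)] by blast
        then have "bv (nu, 1) = Qs n'" using z(2) ker by (simp add: lin_add[OF lin_Qs])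
        then show "bv (nu, 1) \<in> V.span (Qs ` ?N)"
          using lin_span[OF lin_Qs \<open>n' \<in> V.span ?N\<close>, of "Qs ` ?N"] V.span_base by auto
      qed
    qed
  qed
  then show ?thesis using un by simp
qed

end

subsection \<open>Products of two strings\<close>

text \<open>An \<open>s\<close>-th finite difference of a polynomial of degree below
  \<open>s\<close>. The shift \<open>c\<close> is carried along because absorbing a factor
  \<open>i\<close> into the binomial coefficient moves the summation index by one.\<close>

lemma alternating_sum_shifted_factors:
  fixes us :: "complex list"
  assumes "length us < s"
  shows "(\<Sum>i\<le>s. (- 1) ^ i * of_nat (s choose i) * prod_list (map (\<lambda>u. u - (c + of_nat i)) us)) = 0"
  using assms
proof (induction us arbitrary: s c)
  case Nil
  then show ?case using choose_alternating_sum[of s, where ?'a = complex] by simp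
next
  case (Cons u us)
  then obtain r where s: "s = Suc r" "length us < r" by (cases s) auto
  let ?P = "\<lambda>c i. prod_list (map (\<lambda>u. u - (c + of_nat i)) us) :: complex"
  have "(\<Sum>i\<le>s. (- 1) ^ i * of_nat (s choose i) * prod_list (map (\<lambda>u. u - (c + of_nat i)) (u # us))) =
    (u - c) * (\<Sum>i\<le>s. (- 1) ^ i * of_nat (s choose i) * ?P c i) - (\<Sum>i\<le>Suc r. (- 1) ^ i * (of_nat i * of_nat (Suc r choose i)) * ?P c i)"
    unfolding s(1) sum_distrib_left sum_subtractf[symmetric] by (intro sum.cong refl) (simp add: algebra_simps)
  also have "(\<Sum>i\<le>s. (- 1) ^ i * of_nat (s choose i) * ?P c i) = 0"
    by (rule Cons.IH) (use Cons.prems in simp)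
  also have "(\<Sum>i\<le>Suc r. (- 1) ^ i * (of_nat i * of_nat (Suc r choose i)) * ?P c i) =
    (\<Sum>i\<le>r. (- 1) ^ Suc i * (of_nat (Suc i) * of_nat (Suc r choose Suc i)) * ?P c (Suc i))"
    unfolding sum.atMost_Suc_shift by simp
  also have "\<dots> = - of_nat (Suc r) * (\<Sum>i\<le>r. (- 1) ^ i * of_nat (r choose i) * ?P (c + 1) i)"
    unfolding sum_distrib_left
  proof (rule sum.cong[OF refl])
    fix i
    have 1: "of_nat (Suc i) * of_nat (Suc r choose Suc i) = of_nat (Suc r) * (of_nat (r choose i) :: complex)"
      unfolding of_nat_mult[symmetric] Suc_times_binomial ..
    have 2: "?P c (Suc i) = ?P (c + 1) i" by (simp add: add_ac)
    show "(- 1) ^ Suc i * (of_nat (Suc i) * of_nat (Suc r choose Suc i)) * ?P c (Suc i) =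
        - of_nat (Suc r) * ((- 1) ^ i * of_nat (r choose i) * ?P (c + 1) i)"
      unfolding 1 2 power_Suc by (simp only: mult_minus_left mult_minus_right mult_1_left mult_ac)
  qed
  also have "(\<Sum>i\<le>r. (- 1) ^ i * of_nat (r choose i) * ?P (c + 1) i) = 0"
    by (rule Cons.IH[OF s(2)])
  finally show ?case by simp
qed

lemma alternating_sum_linear_factors:
  fixes us :: "complex list"
  assumes "length us < s"
  shows "(\<Sum>i\<le>s. (- 1) ^ i * of_nat (s choose i) * prod_list (map (\<lambda>u. u - of_nat i) us)) = 0"
  using alternating_sum_shifted_factors[OF assms, of 0] by simp

lemma prod_list_reflect:
  assumes "i \<le> s"
  shows "prod_list (map (\<lambda>u. of_nat u - of_nat (s - i)) ws) =
    (- 1) ^ length ws * prod_list (map (\<lambda>u. u - of_nat i) (map (\<lambda>w. of_nat s - of_nat w) ws) :: complex list)"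
proof (induction ws)
  case (Cons w ws)
  have "(of_nat w - of_nat (s - i) :: complex) = - (of_nat s - of_nat w - of_nat i)" using assms by (simp add: of_nat_diff)
  then show ?case by (simp only: list.map prod_list.Cons length_Cons power_Suc Cons mult_minus_left mult_minus_right mult_1_left mult_ac)
qed simp

lemma fact_prod_list:
  assumes "i \<le> m" "m \<le> n"
  shows "(fact (n - i) :: complex) = fact (m - i) * prod_list (map (\<lambda>u. of_nat u - of_nat i) [Suc m..<Suc n])"
  using assms(2)
proof (induction n rule: dec_induct)
  case (step n)
  then have "Suc n - i = Suc (n - i)" using assms(1) by simp
  then have "(fact (Suc n - i) :: complex) = of_nat (Suc n - i) * fact (n - i)" by (simp del: of_nat_Suc)
  also have "of_nat (Suc n - i) = (of_nat (Suc n) - of_nat i :: complex)" using assms(1) step by (intro of_nat_diff) simp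
  finally show ?case using step by simp
qed simp

text \<open>Models \<open>g i j\<close> as a fixed mode of \<open>Q ^ i u\<close> applied to
  \<open>Q ^ j v\<close>, where the strings of \<open>u\<close> and \<open>v\<close> stop at
  \<open>a\<close> and \<open>b\<close>. In the application both ends are even, \<open>2 a\<close>
  and \<open>2 b\<close>.\<close>

locale two_strings =
  fixes Q :: "V \<Rightarrow> V" and g :: "nat \<Rightarrow> nat \<Rightarrow> V" and a b :: nat
  assumes lin_Q: "lin Q"
    and Q_g: "Q (g i j) = g (Suc i) j + g i (Suc j)"
    and g_left: "i > a \<Longrightarrow> g i j = 0"
    and g_right: "j > b \<Longrightarrow> g i j = 0"
begin

lemma Q_pow_g: "(Q ^^ r) (g i j) = (\<Sum>t\<le>r. of_nat (r choose t) *\<^sub>V g (i + t) (j + (r - t)))"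
proof (induction r arbitrary: i j)
  case (Suc r)
  have "(Q ^^ Suc r) (g i j) = (\<Sum>t\<le>r. of_nat (r choose t) *\<^sub>V g (Suc i + t) (j + (r - t))) + (\<Sum>t\<le>r. of_nat (r choose t) *\<^sub>V g (i + t) (Suc j + (r - t)))"
    unfolding funpow_Suc_right o_def Q_g lin_add[OF lin_funpow[OF lin_Q]] Suc ..
  also have "(\<Sum>t\<le>r. of_nat (r choose t) *\<^sub>V g (i + t) (Suc j + (r - t))) = (\<Sum>t\<le>Suc r. of_nat (r choose t) *\<^sub>V g (i + t) (j + (Suc r - t)))"
    by (simp add: Suc_diff_le)
  also have "\<dots> = g i (j + Suc r) + (\<Sum>t\<le>r. of_nat (r choose Suc t) *\<^sub>V g (i + Suc t) (j + (r - t)))"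
    unfolding sum.atMost_Suc_shift by simp
  also have "(\<Sum>t\<le>r. of_nat (r choose t) *\<^sub>V g (Suc i + t) (j + (r - t))) + (g i (j + Suc r) + (\<Sum>t\<le>r. of_nat (r choose Suc t) *\<^sub>V g (i + Suc t) (j + (r - t)))) =
     (\<Sum>t\<le>Suc r. of_nat (Suc r choose t) *\<^sub>V g (i + t) (j + (Suc r - t)))"
    unfolding sum.atMost_Suc_shift by (simp add: scl_add_left sum.distrib)
  finally show ?case .
qed simp

text \<open>The highest weight vector of weight \<open>a + b - 2 s\<close> when \<open>g\<close> is the tensor product of two
  \<open>sl\<^sub>2\<close>-strings.\<close>
definition y :: "nat \<Rightarrow> V" where
  "y s = (\<Sum>i\<le>s. ((- 1) ^ i * of_nat (s choose i) * (fact (a - i) * fact (b - (s - i)))) *\<^sub>V g i (s - i))"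

text \<open>The coefficient of \<open>g I (s + r - I)\<close> in \<open>Q ^ r (y s)\<close>. With
  \<open>J = s + r - I\<close>, clearing factorials leaves a polynomial in \<open>i\<close> of
  degree \<open>(a - I) + (b - J) = s - 1\<close>, which the alternating sum of order
  \<open>s\<close> annihilates; binomials out of range match zeros of that polynomial.\<close>

lemma y_coeff:
  assumes s: "s \<le> a" "s \<le> b" and r: "r = a + b - 2 * s + 1" and I: "I \<le> a" "s + r - I \<le> b" "I \<le> s + r"
  shows "(\<Sum>i\<le>s. ((- 1) ^ i * of_nat (s choose i) * (fact (a - i) * fact (b - (s - i)))) * (if i \<le> I then of_nat (r choose (I - i)) else 0)) = (0 :: complex)"
proof -
  define J where "J = s + r - I"
  have J: "J \<le> b" "I + J = s + r" using I by (auto simp: J_def)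
  let ?p = "\<lambda>i. prod_list (map (\<lambda>u. of_nat u - of_nat i) [Suc I..<Suc a]) :: complex"
  let ?q = "\<lambda>i. prod_list (map (\<lambda>u. of_nat u - of_nat i) [Suc J..<Suc b]) :: complex"
  let ?us = "map of_nat [Suc I..<Suc a] @ map (\<lambda>w. of_nat s - of_nat w) [Suc J..<Suc b] :: complex list"
  have E: "fact (a - i) * fact (b - (s - i)) * (if i \<le> I then of_nat (r choose (I - i)) else 0) = fact r * (?p i * ?q (s - i))" if i: "i \<le> s" for i
  proof -
    consider "i > I" | "s - i > J" | "i \<le> I" "s - i \<le> J" by linarith
    then show ?thesis
    proof cases
      case 1
      then have "0 \<in> set (map (\<lambda>u. of_nat u - of_nat i) [Suc I..<Suc a] :: complex list)" unfolding set_map set_upt using i s by (intro image_eqI[of _ _ i]) auto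
      then have "?p i = 0" by (simp only: prod_list_zero_iff)
      then show ?thesis using 1 by simp
    next
      case 2
      then have "0 \<in> set (map (\<lambda>u. of_nat u - of_nat (s - i)) [Suc J..<Suc b] :: complex list)" unfolding set_map set_upt using i s by (intro image_eqI[of _ _ "s - i"]) auto
      then have "?q (s - i) = 0" by (simp only: prod_list_zero_iff)
      moreover have "r choose (I - i) = 0" using 2 J i by (intro binomial_eq_0) linarith
      ultimately show ?thesis by simp
    next
      case 3
      have "I - i \<le> r" "r - (I - i) = J - (s - i)" using J i 3 by linarith+
      then have "(of_nat (r choose (I - i)) :: complex) = fact r / (fact (I - i) * fact (J - (s - i)))"
        using binomial_fact[of "I - i" r, where ?'a = complex] by simp
      then show ?thesis using 3 unfolding fact_prod_list[OF 3(1) I(1)] fact_prod_list[OF 3(2) J(1)] by simp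
    qed
  qed
  have q: "?q (s - i) = (- 1) ^ (b - J) * prod_list (map (\<lambda>u. u - of_nat i) (map (\<lambda>w. of_nat s - of_nat w) [Suc J..<Suc b]))" if i: "i \<le> s" for i
    using prod_list_reflect[OF i, of "[Suc J..<Suc b]"] by (simp del: upt_Suc)
  have "(\<Sum>i\<le>s. ((- 1) ^ i * of_nat (s choose i) * (fact (a - i) * fact (b - (s - i)))) * (if i \<le> I then of_nat (r choose (I - i)) else 0)) =
     (\<Sum>i\<le>s. (fact r * (- 1) ^ (b - J)) * ((- 1) ^ i * of_nat (s choose i) * prod_list (map (\<lambda>u. u - of_nat i) ?us)))"
  proof (rule sum.cong[OF refl])
    fix i assume "i \<in> {..s}"
    then have i: "i \<le> s" by simp
    have 1: "prod_list (map (\<lambda>u. u - of_nat i) ?us) = ?p i * prod_list (map (\<lambda>u. u - of_nat i) (map (\<lambda>w. of_nat s - of_nat w) [Suc J..<Suc b]))"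
      by (simp add: o_def del: upt_Suc)
    show "((- 1) ^ i * of_nat (s choose i) * (fact (a - i) * fact (b - (s - i)))) * (if i \<le> I then of_nat (r choose (I - i)) else 0) =
      (fact r * (- 1) ^ (b - J)) * ((- 1) ^ i * of_nat (s choose i) * prod_list (map (\<lambda>u. u - of_nat i) ?us))"
      unfolding 1 mult.assoc[of "(- 1) ^ i * of_nat (s choose i)"] E[OF i] q[OF i] by (simp only: mult.assoc mult.left_commute)
  qed
  also have "\<dots> = (fact r * (- 1) ^ (b - J)) * (\<Sum>i\<le>s. (- 1) ^ i * of_nat (s choose i) * prod_list (map (\<lambda>u. u - of_nat i) ?us))"
    by (rule sum_distrib_left[symmetric])
  also have "(\<Sum>i\<le>s. (- 1) ^ i * of_nat (s choose i) * prod_list (map (\<lambda>u. u - of_nat i) ?us)) = 0"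
    by (rule alternating_sum_linear_factors) (use J r s I in \<open>simp del: upt_Suc\<close>)
  finally show ?thesis by simp
qed

lemma Q_pow_y:
  assumes "s \<le> a" "s \<le> b"
  shows "(Q ^^ (a + b - 2 * s + 1)) (y s) = 0"
proof -
  define r where "r = a + b - 2 * s + 1"
  let ?c = "\<lambda>i. (- 1) ^ i * of_nat (s choose i) * (fact (a - i) * fact (b - (s - i))) :: complex"
  let ?d = "\<lambda>i I. (if i \<le> I then of_nat (r choose (I - i)) else 0) :: complex"
  have "(Q ^^ r) (g i (s - i)) = (\<Sum>I\<le>s + r. ?d i I *\<^sub>V g I (s + r - I))" if "i \<le> s" for i
  proof -
    have "(\<Sum>I\<le>s + r. ?d i I *\<^sub>V g I (s + r - I)) = (\<Sum>I\<in>{i..i + r}. ?d i I *\<^sub>V g I (s + r - I))"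
      using that by (intro sum.mono_neutral_right) (auto simp: binomial_eq_0)
    also have "\<dots> = (\<Sum>t\<le>r. of_nat (r choose t) *\<^sub>V g (i + t) (s - i + (r - t)))"
      using that by (intro sum.reindex_bij_witness[of _ "\<lambda>t. i + t" "\<lambda>I. I - i"]) auto
    finally show ?thesis unfolding Q_pow_g ..
  qed
  then have "(Q ^^ r) (y s) = (\<Sum>i\<le>s. \<Sum>I\<le>s + r. (?c i * ?d i I) *\<^sub>V g I (s + r - I))"
    unfolding y_def lin_sum[OF lin_funpow[OF lin_Q]] lin_scl[OF lin_funpow[OF lin_Q]] by (simp add: scl_sum_right)
  also have "\<dots> = (\<Sum>I\<le>s + r. (\<Sum>i\<le>s. ?c i * ?d i I) *\<^sub>V g I (s + r - I))"
    unfolding scl_sum_left by (rule sum.swap)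
  also have "\<dots> = 0"
  proof (rule sum.neutral, rule ballI)
    fix I assume "I \<in> {..s + r}"
    then have I: "I \<le> s + r" by simp
    show "(\<Sum>i\<le>s. ?c i * ?d i I) *\<^sub>V g I (s + r - I) = 0"
    proof (cases "I \<le> a \<and> s + r - I \<le> b")
      case True
      then show ?thesis using y_coeff[OF assms r_def _ _ I] by (simp only: scl_zero_left)
    next
      case False
      then have "g I (s + r - I) = 0" using g_left g_right by (meson not_le)
      then show ?thesis by simp
    qed
  qed
  finally show ?thesis by (simp only: r_def)
qed

text \<open>The projection of \<open>g i j\<close> to the top component: with strings \<open>x\<^sup>a\<close>, \<open>x\<^sup>b\<close> in polynomials
  and \<open>Q = y \<partial>\<^sub>x\<close>, it is multiplication of polynomials.\<close>
definition gam :: "nat \<Rightarrow> nat \<Rightarrow> complex" where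
  "gam i j = (if i \<le> a \<and> j \<le> b then fact a * fact b * fact (a + b - (i + j)) / (fact (a - i) * fact (b - j) * fact (a + b)) else 0)"

lemma gam_rec:
  assumes "i + j < a + b"
  shows "gam i j = gam (Suc i) j + gam i (Suc j)"
proof (cases "i \<le> a \<and> j \<le> b")
  case True
  define u v where "u = a - i" and "v = b - j"
  have uv: "a = i + u" "b = j + v" "u + v > 0" using True assms by (auto simp: u_def v_def)
  have fS: "(fact (a + b - (i + j)) :: complex) = of_nat (u + v) * fact (a + b - Suc (i + j))"
    using uv fact_Suc[of "a + b - Suc (i + j)", where ?'a = complex] by (simp add: Suc_diff_Suc del: fact_Suc of_nat_Suc)
  have cancel: "x * z / (f * v' * w) = x * (c * z) / (c * f * v' * w)" "x * z / (f * v' * w) = x * (c * z) / (f * (c * v') * w)"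
    if "c \<noteq> 0" for x z f v' w c :: complex
    using that by simp_all
  have 1: "gam (Suc i) j = fact a * fact b * (of_nat u * fact (a + b - Suc (i + j))) / (fact u * fact v * fact (a + b))"
  proof (cases u)
    case 0
    then show ?thesis using True unfolding gam_def u_def by simp
  next
    case (Suc u')
    then have "a - Suc i = u'" "Suc i \<le> a" using True unfolding u_def by auto
    then have "gam (Suc i) j = fact a * fact b * fact (a + b - Suc (i + j)) / (fact u' * fact v * fact (a + b))"
      using True by (simp add: gam_def v_def)
    also have "\<dots> = fact a * fact b * (of_nat u * fact (a + b - Suc (i + j))) / (fact u * fact v * fact (a + b))"
      unfolding Suc fact_Suc by (rule cancel(1)) (rule of_nat_neq_0)
    finally show ?thesis .
  qed
  have 2: "gam i (Suc j) = fact a * fact b * (of_nat v * fact (a + b - Suc (i + j))) / (fact u * fact v * fact (a + b))"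
  proof (cases v)
    case 0
    then show ?thesis using True unfolding gam_def v_def by simp
  next
    case (Suc v')
    then have "b - Suc j = v'" "Suc j \<le> b" using True unfolding v_def by auto
    then have "gam i (Suc j) = fact a * fact b * fact (a + b - Suc (i + j)) / (fact u * fact v' * fact (a + b))"
      using True by (simp add: gam_def u_def)
    also have "\<dots> = fact a * fact b * (of_nat v * fact (a + b - Suc (i + j))) / (fact u * fact v * fact (a + b))"
      unfolding Suc fact_Suc by (rule cancel(2)) (rule of_nat_neq_0)
    finally show ?thesis .
  qed
  have 3: "gam i j = fact a * fact b * (of_nat (u + v) * fact (a + b - Suc (i + j))) / (fact u * fact v * fact (a + b))"
    using True by (simp only: gam_def if_True fS u_def v_def simp_thms)
  show ?thesis unfolding 1 2 3 add_divide_distrib[symmetric] of_nat_add by (simp only: distrib_left distrib_right)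
next
  case False
  then show ?thesis by (auto simp: gam_def)
qed

text \<open>\<open>del i j\<close> is the error at total height \<open>Suc s\<close>. Applying
  \<open>Q\<close> to the statement at height \<open>s\<close> ties neighbouring errors together up
  to sign, and the membership of \<open>y (Suc s)\<close> in \<open>R\<close> fixes the one value
  still free.\<close>

lemma g_mod:
  assumes R: "V.subspace R" "\<And>x. x \<in> R \<Longrightarrow> Q x \<in> R"
    and y: "\<And>s. 1 \<le> s \<Longrightarrow> s \<le> a \<Longrightarrow> s \<le> b \<Longrightarrow> y s \<in> R"
  shows "g i j - gam i j *\<^sub>V (Q ^^ (i + j)) (g 0 0) \<in> R"
proof (induction "i + j" arbitrary: i j)
  case 0
  then show ?case using V.subspace_0[OF R(1)] by (simp add: gam_def)
next
  case (Suc s)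
  define x where "x = (Q ^^ Suc s) (g 0 0)"
  define del where "del i j = g i j - gam i j *\<^sub>V x" for i j
  show ?case
  proof (cases "Suc s \<le> a + b")
    case False
    then have "i > a \<or> j > b" using Suc(2) by linarith
    then show ?thesis using g_left g_right V.subspace_0[OF R(1)] by (auto simp: gam_def)
  next
    case True
    have step: "del (Suc i) j + del i (Suc j) \<in> R" if "i + j = s" for i j
    proof -
      have "Q (g i j - gam i j *\<^sub>V (Q ^^ (i + j)) (g 0 0)) \<in> R" by (rule R(2), rule Suc(1)) (use that in simp)
      moreover have "Q (g i j - gam i j *\<^sub>V (Q ^^ (i + j)) (g 0 0)) = del (Suc i) j + del i (Suc j)"
        using gam_rec[of i j] that True
        by (simp add: lin_diff[OF lin_Q] lin_add[OF lin_Q] lin_scl[OF lin_Q] Q_g del_def x_def scl_add_left)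
      ultimately show ?thesis by simp
    qed
    have alt: "del i (Suc s - i) - (- 1) ^ i *\<^sub>V del 0 (Suc s) \<in> R" if "i \<le> Suc s" for i
      using that
    proof (induction i)
      case 0
      then show ?case using V.subspace_0[OF R(1)] by simp
    next
      case (Suc i)
      then have "del (Suc i) (s - i) + del i (Suc s - i) \<in> R" using step[of i "s - i"] by (simp add: Suc_diff_le)
      from V.subspace_diff[OF R(1) this Suc.IH] Suc.prems show ?case by simp
    qed
    have "del 0 (Suc s) \<in> R"
    proof -
      consider "Suc s > b" | "Suc s > a" | "Suc s \<le> a" "Suc s \<le> b" by linarith
      then show ?thesis
      proof cases
        case 1
        then show ?thesis using g_right V.subspace_0[OF R(1)] by (simp add: del_def gam_def)
      next
        case 2
        then have "del (Suc s) 0 = 0" using g_left by (simp add: del_def gam_def)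
        then have "(- 1) ^ Suc s *\<^sub>V del 0 (Suc s) \<in> R"
          using alt[of "Suc s"] V.subspace_neg[OF R(1), of "- ((- 1) ^ Suc s *\<^sub>V del 0 (Suc s))"] by simp
        then have "(- 1) ^ Suc s *\<^sub>V ((- 1) ^ Suc s *\<^sub>V del 0 (Suc s)) \<in> R" by (rule V.subspace_scale[OF R(1)])
        then show ?thesis by (simp only: scl_scl power_mult_distrib[symmetric]) simp
      next
        case 3
        let ?k = "\<lambda>i. (Suc s choose i) * (fact (a - i) * fact (b - (Suc s - i))) :: nat"
        let ?c = "\<lambda>i. (- 1) ^ i * of_nat (Suc s choose i) * (fact (a - i) * fact (b - (Suc s - i))) :: complex"
        \<comment> \<open>In range the factorials of \<open>gam\<close> cancel those in
          \<open>y\<close>, leaving a constant times the alternating sum of binomial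
          coefficients.\<close>
        have gz: "(\<Sum>i\<le>Suc s. ?c i * gam i (Suc s - i)) = 0"
        proof -
          have "?c i * gam i (Suc s - i) = (fact a * fact b * fact (a + b - Suc s) / fact (a + b)) * ((- 1) ^ i * of_nat (Suc s choose i))" if "i \<le> Suc s" for i
            using that 3 by (simp add: gam_def field_simps)
          then have "(\<Sum>i\<le>Suc s. ?c i * gam i (Suc s - i)) = (\<Sum>i\<le>Suc s. (fact a * fact b * fact (a + b - Suc s) / fact (a + b)) * ((- 1) ^ i * of_nat (Suc s choose i)))"
            by (intro sum.cong) auto
          also have "\<dots> = 0" unfolding sum_distrib_left[symmetric] using choose_alternating_sum[of "Suc s", where ?'a = complex] by (simp del: sum.atMost_Suc binomial_Suc_Suc)
          finally show ?thesis .
        qed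
        have "y (Suc s) = (\<Sum>i\<le>Suc s. ?c i *\<^sub>V del i (Suc s - i)) + (\<Sum>i\<le>Suc s. ?c i * gam i (Suc s - i)) *\<^sub>V x"
          unfolding y_def del_def scl_sum_left sum.distrib[symmetric] by (simp add: scl_diff_right del: sum.atMost_Suc binomial_Suc_Suc)
        then have "(\<Sum>i\<le>Suc s. ?c i *\<^sub>V del i (Suc s - i)) \<in> R" using y[of "Suc s"] 3 gz by (simp del: sum.atMost_Suc)
        moreover have "(\<Sum>i\<le>Suc s. ?c i *\<^sub>V (del i (Suc s - i) - (- 1) ^ i *\<^sub>V del 0 (Suc s))) \<in> R"
          by (intro V.subspace_sum V.subspace_scale R(1) alt) simp
        ultimately have "(\<Sum>i\<le>Suc s. ?c i *\<^sub>V del i (Suc s - i)) - (\<Sum>i\<le>Suc s. ?c i *\<^sub>V (del i (Suc s - i) - (- 1) ^ i *\<^sub>V del 0 (Suc s))) \<in> R"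
          by (rule V.subspace_diff[OF R(1)])
        \<comment> \<open>The sign of \<open>?c i\<close> and the sign from \<open>alt\<close>
          cancel, so \<open>del 0 (Suc s)\<close> appears with a sum of positive integers, which can
          be divided out.\<close>
        also have "(\<Sum>i\<le>Suc s. ?c i *\<^sub>V del i (Suc s - i)) - (\<Sum>i\<le>Suc s. ?c i *\<^sub>V (del i (Suc s - i) - (- 1) ^ i *\<^sub>V del 0 (Suc s))) = of_nat (\<Sum>i\<le>Suc s. ?k i) *\<^sub>V del 0 (Suc s)"
          unfolding of_nat_sum scl_sum_left sum_subtractf[symmetric]
        proof (rule sum.cong[OF refl])
          fix i
          have "?c i * (- 1) ^ i = of_nat (?k i)" by (simp del: binomial_Suc_Suc flip: power_mult_distrib)
          then show "?c i *\<^sub>V del i (Suc s - i) - ?c i *\<^sub>V (del i (Suc s - i) - (- 1) ^ i *\<^sub>V del 0 (Suc s)) = of_nat (?k i) *\<^sub>V del 0 (Suc s)"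
            by (simp only: scl_diff_right scl_scl) simp
        qed
        finally have "(1 / of_nat (\<Sum>i\<le>Suc s. ?k i)) *\<^sub>V of_nat (\<Sum>i\<le>Suc s. ?k i) *\<^sub>V del 0 (Suc s) \<in> R"
          by (rule V.subspace_scale[OF R(1)])
        moreover have "(\<Sum>i\<le>Suc s. ?k i) \<noteq> 0"
        proof -
          have "?k 0 \<le> (\<Sum>i\<le>Suc s. ?k i)" by (rule member_le_sum) auto
          moreover have "?k 0 > 0" by simp
          ultimately show ?thesis by linarith
        qed
        then have "of_nat (\<Sum>i\<le>Suc s. ?k i) \<noteq> (0 :: complex)" unfolding of_nat_eq_0_iff .
        then have "(1 / of_nat (\<Sum>i\<le>Suc s. ?k i)) * of_nat (\<Sum>i\<le>Suc s. ?k i) = (1 :: complex)"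
          by (rule nonzero_eq_divide_eq[THEN iffD1]) (rule refl)
        ultimately show ?thesis by (simp only: scl_scl scl_one)
      qed
    qed
    then have "(- 1) ^ i *\<^sub>V del 0 (Suc s) \<in> R" by (rule V.subspace_scale[OF R(1)])
    moreover have j: "Suc s - i = j" "i \<le> Suc s" using Suc(2) by auto
    have "del i j - (- 1) ^ i *\<^sub>V del 0 (Suc s) \<in> R" using alt[OF j(2)] unfolding j(1) .
    ultimately have "(- 1) ^ i *\<^sub>V del 0 (Suc s) + (del i j - (- 1) ^ i *\<^sub>V del 0 (Suc s)) \<in> R"
      by (rule V.subspace_add[OF R(1)])
    then have "del i j \<in> R" by simp
    then show ?thesis unfolding del_def x_def Suc(2) .
  qed
qed

end

context lattice
begin

section \<open>Kernels of powers of the screening operator on charge \<open>- n\<close>\<close>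

lemma F_mode_vir:
  assumes "u \<in> vir {1}"
  shows "Y (F n) j u \<in> vir {F n}"
  using assms
proof (induction arbitrary: j)
  case (gen x)
  \<comment> \<open>On the vacuum the negative modes of \<open>F n\<close> are its iterated
    translates up to factorials, that is, powers of \<open>L (- 1)\<close> applied to
    \<open>F n\<close>.\<close>
  have neg: "Y (F n) (- 1 - int r) 1 \<in> vir {F n}" for r
  proof (induction r)
    case 0
    then show ?case using va.Y_create[of "F n"] by (simp add: vir.gen)
  next
    case (Suc r)
    have "Td (Y (F n) (- 1 - int r) 1) = of_nat (Suc r) *\<^sub>V Y (F n) (- 1 - int (Suc r)) 1"
      unfolding va.T_Y va.T_vac lin_0[OF va.Y_lin2] by (simp add: algebra_simps scl_add_left)
    then have "Y (F n) (- 1 - int (Suc r)) 1 = (1 / of_nat (Suc r)) *\<^sub>V L (- 1) (Y (F n) (- 1 - int r) 1)"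
      unfolding L_m1 by (simp del: of_nat_Suc)
    then show ?case using vir.scl[OF vir.L[OF Suc]] by simp
  qed
  show ?case
  proof (cases "j \<ge> 0")
    case True
    then show ?thesis using gen va.Y_vac vir.zero by simp
  next
    case False
    then show ?thesis using gen neg[of "nat (- 1 - j)"] by simp
  qed
next
  case (L x k)
  have "Y (F n) j (L k x) = L k (Y (F n) j x) - (of_int (k + 1) * (wtn (- int n) - 1) - of_int j) *\<^sub>V Y (F n) (k + j) x"
    using L_e[of k "- int n" j x] by (simp add: F_def Y_ex)
  then show ?case using V.subspace_diff[OF vir_subspace vir.L[OF L.IH] vir.scl[OF L.IH]] by simp
qed (simp_all add: lin_0[OF va.Y_lin2] lin_add[OF va.Y_lin2] lin_scl[OF va.Y_lin2] vir.zero vir.add vir.scl)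

lemma modes_vanish: "\<exists>K. \<forall>l\<le>M. \<forall>k\<ge>K. Y (f l) k (v l) = 0" for M :: nat
proof (induction M)
  case 0
  then show ?case using fld_Y[of "f 0"] by (auto simp: fld_def)
next
  case (Suc M)
  then obtain K where K: "\<forall>l\<le>M. \<forall>k\<ge>K. Y (f l) k (v l) = 0" by blast
  obtain K' where K': "\<forall>k\<ge>K'. Y (f (Suc M)) k (v (Suc M)) = 0"
    using fld_Y[of "f (Suc M)"] unfolding fld_def by blast
  show ?case
    by (rule exI[of _ "max K K'"]) (use K K' in \<open>auto simp: le_Suc_eq\<close>)
qed

lemma telescope_alternating:
  fixes u :: "nat \<Rightarrow> V"
  shows "(\<Sum>l\<le>M. (- 1) ^ l *\<^sub>V (u l + u (Suc l))) = u 0 + (- 1) ^ M *\<^sub>V u (Suc M)"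
  by (induction M) (simp_all add: scl_add_right)

lemma string_hom:
  assumes "v \<in> hom (- int b) d"
  shows "Y ((Qs ^^ i) (F a)) k ((Qs ^^ j) v) \<in> hom (int (i + j) - int (a + b))
    (d - int p * int (i + j) ^ 2 + 2 * int p * int (a + b) * int (i + j) + (int p - 1) * int (i + j) - 2 * int p * int a * int b - k - 1)"
proof -
  have c: "- int a + int i + (- int b + int j) = int (i + j) - int (a + b)" by simp
  have d: "0 - int i * (2 * int p * (- int a) + int p * (int i - 1) + 1) + (d - int j * (2 * int p * (- int b) + int p * (int j - 1) + 1))
      - 2 * int p * (- int a + int i) * (- int b + int j) - k - 1 =
    d - int p * int (i + j) ^ 2 + 2 * int p * int (a + b) * int (i + j) + (int p - 1) * int (i + j) - 2 * int p * int a * int b - k - 1"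
    by (simp add: algebra_simps power2_eq_square)
  show ?thesis
    using Y_hom[OF Qs_pow_hom[OF F_hom, of i a] Qs_pow_hom[OF assms, of j], of k] unfolding c d .
qed

lemma ker_Qs_charge0': "v \<in> hom 0 d \<Longrightarrow> Qs v = 0 \<Longrightarrow> v \<in> vir {1}"
  using ker_Qs_charge0[of v "nat d"] hom_neg[of v 0 d] vir.zero by (cases "d < 0") auto

text \<open>Up to the constant \<open>kap\<close>, \<open>v\<close> is a sum of modes of \<open>F n\<close> applied to the vectors \<open>X k\<close>; the
  correction terms with \<open>l > 0\<close> do not change the sum, but put \<open>X k\<close> into the kernel of \<open>Q\<close>.\<close>
lemma ker_Qs_pow:
  assumes v: "v \<in> hom (- int n) d" and Qv: "(Qs ^^ (2 * n + 1)) v = 0"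
  shows "v \<in> vir {F n}"
proof -
  obtain kap where kap: "kap \<noteq> 0" "Y (F n) (2 * hn n - 1) ((Qs ^^ (2 * n)) (F n)) = kap *\<^sub>V 1"
    using kappa[of n] by (auto simp: F_def Y_ex)
  obtain m where m: "\<And>l k. l \<le> 2 * n \<Longrightarrow> k \<ge> m \<Longrightarrow> Y (F n) k ((Qs ^^ l) v) = 0"
    using modes_vanish[of "2 * n" "\<lambda>l. F n" "\<lambda>l. (Qs ^^ l) v"] by blast
  obtain K where K: "\<And>l k. l \<le> 2 * n \<Longrightarrow> k \<ge> K \<Longrightarrow> Y ((Qs ^^ (2 * n - l)) (F n)) k ((Qs ^^ l) v) = 0"
    using modes_vanish[of "2 * n" "\<lambda>l. (Qs ^^ (2 * n - l)) (F n)" "\<lambda>l. (Qs ^^ l) v"] by blast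
  define M where "M = nat (K + 1 + m)"
  let ?N = "2 * hn n - 1"
  let ?y = "\<lambda>l k. Y ((Qs ^^ (2 * n - l)) (F n)) k ((Qs ^^ l) v)"
  define X where "X k = (\<Sum>l\<le>2 * n. (- 1) ^ l *\<^sub>V ?y l k)" for k
  have deg: "int ((2 * n - l) + l) = 2 * int n" "int (2 * n - l) = 2 * int n - int l" if "l \<le> 2 * n" for l
    using that by auto
  have I: "J ?N (Y (F n)) (Y ((Qs ^^ (2 * n - l)) (F n))) m (- 1 - m) ((Qs ^^ l) v) =
      (\<Sum>i<M. bc ?N i *\<^sub>V Y (F n) (m + ?N - int i) (?y l (- 1 - m + int i)))" if l: "l \<le> 2 * n" for l
  proof -
    have "J ?N (Y (F n)) (Y ((Qs ^^ (2 * n - l)) (F n))) m (- 1 - m) ((Qs ^^ l) v) =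
      iexp ?N (\<lambda>m k. Y (F n) m (?y l k)) m (- 1 - m)"
      by (rule J_eq_first[OF _ va.Y_lin2]) (simp add: m[OF l])
    also have "\<dots> = (\<Sum>i<M. bc ?N i *\<^sub>V Y (F n) (m + ?N - int i) (?y l (- 1 - m + int i)))"
      unfolding iexp_def
    proof (rule fsum_eq)
      fix i assume "i \<ge> M"
      then have "- 1 - m + int i \<ge> K" unfolding M_def by linarith
      then show "bc ?N i *\<^sub>V Y (F n) (m + ?N - int i) (?y l (- 1 - m + int i)) = 0"
        by (simp only: K[OF l] lin_0[OF va.Y_lin2] scl_zero_right)
    qed
    finally show ?thesis .
  qed
  \<comment> \<open>The degree is \<open>- (p l ^ 2 + (p - 1) l + i)\<close>. Thus every summand of
    \<open>X\<close> with \<open>l > 0\<close> contributes 0, and for \<open>l = 0\<close> only the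
    product giving \<open>kap\<close> survives.\<close>
  have D: "Y (F n) (2 * hn n - 1 + int i) ((Qs ^^ (2 * n - l)) (F n)) = 0" if l: "l \<le> 2 * n" and i: "l > 0 \<or> i > 0" for l i
  proof (rule hom_neg[OF Y_hom[OF F_hom Qs_pow_hom[OF F_hom]]])
    have "0 + (0 - int (2 * n - l) * (2 * int p * (- int n) + int p * (int (2 * n - l) - 1) + 1)) - 2 * int p * (- int n) * (- int n + int (2 * n - l)) - (2 * hn n - 1 + int i) - 1
      = - (int p * int l * int l + (int p - 1) * int l + int i)"
      unfolding deg(2)[OF l] hn_def by (simp add: algebra_simps)
    moreover have "int p * int l * int l + (int p - 1) * int l + int i > 0"
      using i p2 by (cases "l = 0") (auto intro!: add_pos_nonneg)
    ultimately show "0 + (0 - int (2 * n - l) * (2 * int p * (- int n) + int p * (int (2 * n - l) - 1) + 1)) - 2 * int p * (- int n) * (- int n + int (2 * n - l)) - (2 * hn n - 1 + int i) - 1 < 0"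
      by linarith
  qed
  have J0: "J ?N (Y (F n)) (Y ((Qs ^^ (2 * n - 0)) (F n))) m (- 1 - m) ((Qs ^^ 0) v) = kap *\<^sub>V v"
  proof -
    have "J ?N (Y (F n)) (Y ((Qs ^^ (2 * n - 0)) (F n))) m (- 1 - m) ((Qs ^^ 0) v) = Y (Y (F n) ?N ((Qs ^^ (2 * n - 0)) (F n))) (m + (- 1 - m)) ((Qs ^^ 0) v)"
    proof (rule va.J_top)
      fix i
      have "?N + 1 + int i = 2 * hn n - 1 + int (Suc i)" by simp
      then show "Y (F n) (?N + 1 + int i) ((Qs ^^ (2 * n - 0)) (F n)) = 0" using D[of 0 "Suc i"] by (simp only:) simp
    qed
    then show ?thesis by (simp add: kap(2) Y_scl va.Y_vac_left)
  qed
  have Jl: "J ?N (Y (F n)) (Y ((Qs ^^ (2 * n - l)) (F n))) m (- 1 - m) ((Qs ^^ l) v) = 0" if "l \<le> 2 * n" "l > 0" for l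
    by (rule va.J_eq_0) (use D that in simp)
  have "kap *\<^sub>V v = (\<Sum>l\<le>2 * n. (- 1) ^ l *\<^sub>V J ?N (Y (F n)) (Y ((Qs ^^ (2 * n - l)) (F n))) m (- 1 - m) ((Qs ^^ l) v))"
  proof -
    have "(\<Sum>l\<le>2 * n. (- 1) ^ l *\<^sub>V J ?N (Y (F n)) (Y ((Qs ^^ (2 * n - l)) (F n))) m (- 1 - m) ((Qs ^^ l) v)) = (\<Sum>l\<in>{0}. (- 1) ^ l *\<^sub>V J ?N (Y (F n)) (Y ((Qs ^^ (2 * n - l)) (F n))) m (- 1 - m) ((Qs ^^ l) v))"
      by (rule sum.mono_neutral_right) (auto simp: Jl)
    also have "\<dots> = kap *\<^sub>V v" using J0 by simp
    finally show ?thesis ..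
  qed
  also have "\<dots> = (\<Sum>l\<le>2 * n. (- 1) ^ l *\<^sub>V (\<Sum>i<M. bc ?N i *\<^sub>V Y (F n) (m + ?N - int i) (?y l (- 1 - m + int i))))"
    by (intro sum.cong refl) (simp only: I atMost_iff)
  also have "\<dots> = (\<Sum>i<M. bc ?N i *\<^sub>V Y (F n) (m + ?N - int i) (X (- 1 - m + int i)))"
    unfolding X_def lin_sum[OF va.Y_lin2] lin_scl[OF va.Y_lin2] scl_sum_right
    by (subst sum.swap) (simp add: mult.commute)
  also have "\<dots> \<in> vir {F n}"
  proof (intro V.subspace_sum V.subspace_scale vir_subspace F_mode_vir)
    fix i
    let ?k = "- 1 - m + int i"
    show "X ?k \<in> vir {1}"
    proof (rule ker_Qs_charge0')
      show "X ?k \<in> hom 0 (d - int p * (2 * int n) ^ 2 + 2 * int p * int (n + n) * (2 * int n) + (int p - 1) * (2 * int n) - 2 * int p * int n * int n - ?k - 1)"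
        unfolding X_def
      proof (intro hom_sum hom_scl)
        fix l assume "l \<in> {..2 * n}"
        then have l: "l \<le> 2 * n" by simp
        show "?y l ?k \<in> hom 0 (d - int p * (2 * int n) ^ 2 + 2 * int p * int (n + n) * (2 * int n) + (int p - 1) * (2 * int n) - 2 * int p * int n * int n - ?k - 1)"
          using string_hom[OF v, of "2 * n - l" n ?k l] unfolding deg(1)[OF l] by simp
      qed
      let ?u = "\<lambda>l. Y ((Qs ^^ (2 * n + 1 - l)) (F n)) ?k ((Qs ^^ l) v)"
      \<comment> \<open>The derivation property makes the alternating sum telescope; the two ends
        contain \<open>Q ^ (2 n + 1)\<close> applied to \<open>F n\<close> and to \<open>v\<close>,
        both 0.\<close>
      have "Qs (X ?k) = (\<Sum>l\<le>2 * n. (- 1) ^ l *\<^sub>V (?u l + ?u (Suc l)))"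
        unfolding X_def lin_sum[OF lin_Qs] lin_scl[OF lin_Qs]
      proof (intro sum.cong refl arg_cong[where f = "\<lambda>x. _ *\<^sub>V x"])
        fix l assume "l \<in> {..2 * n}"
        then have "2 * n + 1 - l = Suc (2 * n - l)" "2 * n + 1 - Suc l = 2 * n - l" by auto
        then show "Qs (?y l ?k) = ?u l + ?u (Suc l)" by (simp only: Qs_Y funpow.simps o_apply)
      qed
      also have "\<dots> = ?u 0 + (- 1) ^ (2 * n) *\<^sub>V ?u (Suc (2 * n))" by (rule telescope_alternating)
      also have "\<dots> = 0"
      proof -
        have "?u 0 = 0" using Qs_pow_F[of n] by (simp only: diff_zero lin_0[OF lin_Y])
        moreover have "?u (Suc (2 * n)) = 0" using Qv by (simp only: Suc_eq_plus1 lin_0[OF va.Y_lin2])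
        ultimately show ?thesis by (simp only: scl_zero_right add_0)
      qed
      finally show "Qs (X ?k) = 0" .
    qed
  qed
  finally have "(1 / kap) *\<^sub>V kap *\<^sub>V v \<in> vir {F n}" by (rule vir.scl)
  then show ?thesis using kap(1) by simp
qed

section \<open>The triplet algebra\<close>

text \<open>The members of the strictly lower strings; the Virasoro module they generate absorbs the
  lower components of a product of two strings.\<close>

definition gens :: "nat \<Rightarrow> V set" where
  "gens n = {(Qs ^^ i) (F n') | i n'. n' < n \<and> i \<le> 2 * n'}"

lemma Qs_pow_F_zero:
  assumes "i > 2 * n"
  shows "(Qs ^^ i) (F n) = 0"
proof -
  obtain j where "i = j + (2 * n + 1)" using assms by (metis Suc_eq_plus1 Suc_leI le_add_diff_inverse2)
  then show ?thesis using Qs_pow_F[of n] lin_0[OF lin_Qs_pow] by (simp only: funpow_add o_apply)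
qed

lemma Qs_vir_gens: "x \<in> vir (gens n) \<Longrightarrow> Qs x \<in> vir (gens n)"
proof (rule vir_lin[OF lin_Qs, of x "gens n"])
  show "Qs ` gens n \<subseteq> vir (gens n)"
  proof
    fix z assume "z \<in> Qs ` gens n"
    then obtain i n' where z: "z = (Qs ^^ Suc i) (F n')" "n' < n" "i \<le> 2 * n'" by (auto simp: gens_def)
    show "z \<in> vir (gens n)"
    proof (cases "Suc i \<le> 2 * n'")
      case True
      then show ?thesis using z by (intro vir.gen) (auto simp: gens_def simp del: funpow.simps)
    next
      case False
      then show ?thesis using z(1) Qs_pow_F_zero[of n' "Suc i"] by (simp only: not_le vir.zero)
    qed
  qed
qed (simp_all add: L_Qs)

text \<open>The vector \<open>y s\<close> has charge \<open>s - (a + b)\<close> and is killed by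
  exactly the power of \<open>Qs\<close> for which \<open>ker_Qs_pow\<close> places it in the module
  of \<open>F (a + b - s)\<close>. For \<open>s = 0\<close> this is the first claim; the cases
  \<open>s >= 1\<close> feed \<open>g_mod\<close> for the second.\<close>

lemma F_F_vir: "Y (F a) k (F b) \<in> vir {F (a + b)}"
  and string_product: "\<exists>c. (i \<le> 2 * a \<longrightarrow> j \<le> 2 * b \<longrightarrow> c \<noteq> 0) \<and>
    Y ((Qs ^^ i) (F a)) k ((Qs ^^ j) (F b)) - c *\<^sub>V (Qs ^^ (i + j)) (Y (F a) k (F b)) \<in> vir (gens (a + b))"
proof -
  let ?g = "\<lambda>i j. Y ((Qs ^^ i) (F a)) k ((Qs ^^ j) (F b))"
  interpret two_strings Qs ?g "2 * a" "2 * b"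
    by unfold_locales (simp_all add: lin_Qs Qs_Y Qs_pow_F_zero lin_0[OF lin_Y] lin_0[OF va.Y_lin2])
  have y: "y s \<in> vir {F (a + b - s)}" if "s \<le> 2 * a" "s \<le> 2 * b" for s
  proof -
    have s: "s \<le> a + b" using that by linarith
    have "y s \<in> hom (- int (a + b - s)) (0 - int p * int s ^ 2 + 2 * int p * int (a + b) * int s + (int p - 1) * int s - 2 * int p * int a * int b - k - 1)"
      unfolding y_def
    proof (intro hom_sum hom_scl)
      fix i assume "i \<in> {..s}"
      then have 1: "i + (s - i) = s" by simp
      have 2: "int s - int (a + b) = - int (a + b - s)" using s by simp
      show "?g i (s - i) \<in> hom (- int (a + b - s)) (0 - int p * int s ^ 2 + 2 * int p * int (a + b) * int s + (int p - 1) * int s - 2 * int p * int a * int b - k - 1)"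
        using string_hom[OF F_hom[of b], of i a k "s - i"] unfolding 1 2 .
    qed
    moreover have "(Qs ^^ (2 * (a + b - s) + 1)) (y s) = 0"
    proof -
      have "2 * (a + b - s) + 1 = 2 * a + 2 * b - 2 * s + 1" using s by simp
      then show ?thesis using Q_pow_y[OF that] by (simp only:)
    qed
    ultimately show ?thesis by (rule ker_Qs_pow)
  qed
  have "y 0 = (fact (2 * a) * fact (2 * b)) *\<^sub>V Y (F a) k (F b)" by (simp add: y_def)
  then have "Y (F a) k (F b) = (1 / (fact (2 * a) * fact (2 * b))) *\<^sub>V y 0" by simp
  then show "Y (F a) k (F b) \<in> vir {F (a + b)}" using vir.scl[OF y[of 0]] by simp
  have "?g i j - gam i j *\<^sub>V (Qs ^^ (i + j)) (?g 0 0) \<in> vir (gens (a + b))"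
  proof (rule g_mod[OF vir_subspace])
    fix s assume s: "1 \<le> s" "s \<le> 2 * a" "s \<le> 2 * b"
    have "{F (a + b - s)} \<subseteq> gens (a + b)"
    proof -
      have "F (a + b - s) = (Qs ^^ 0) (F (a + b - s))" by simp
      moreover have "a + b - s < a + b" using s by linarith
      ultimately show ?thesis unfolding gens_def by blast
    qed
    then have "vir {F (a + b - s)} \<subseteq> vir (gens (a + b))"
      by (intro vir_least vir_subspace vir.L) (auto intro: vir.gen)
    then show "y s \<in> vir (gens (a + b))" using y[OF s(2,3)] by blast
  qed (rule Qs_vir_gens)
  moreover have "gam i j \<noteq> 0" if "i \<le> 2 * a" "j \<le> 2 * b" using that by (simp add: gam_def)
  ultimately show "\<exists>c. (i \<le> 2 * a \<longrightarrow> j \<le> 2 * b \<longrightarrow> c \<noteq> 0) \<and>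
    Y ((Qs ^^ i) (F a)) k ((Qs ^^ j) (F b)) - c *\<^sub>V (Qs ^^ (i + j)) (Y (F a) k (F b)) \<in> vir (gens (a + b))"
    by auto
qed

definition W :: "V set" where
  "W = vir {(Qs ^^ i) (F n) | i n. i \<le> 2 * n}"

lemma vir_mono: "B \<subseteq> C \<Longrightarrow> vir B \<subseteq> vir C"
  by (intro vir_least vir_subspace vir.L) (auto intro: vir.gen)

lemma gens_W: "vir (gens n) \<subseteq> W"
  unfolding W_def by (rule vir_mono) (auto simp: gens_def)

lemma F_W: "i \<le> 2 * n \<Longrightarrow> (Qs ^^ i) (F n) \<in> W"
  unfolding W_def by (intro vir.gen) auto

lemma W_subspace: "V.subspace W"
  unfolding W_def by (rule vir_subspace)

lemma W_L: "x \<in> W \<Longrightarrow> L k x \<in> W"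
  unfolding W_def by (rule vir.L)

lemma Qs_pow_W: "x \<in> W \<Longrightarrow> (Qs ^^ i) x \<in> W"
proof (induction i)
  case (Suc i)
  have "Qs z \<in> W" if "z \<in> W" for z
    using that unfolding W_def
  proof (rule vir_lin[OF lin_Qs, rotated])
    show "Qs ` {(Qs ^^ i) (F n) |i n. i \<le> 2 * n} \<subseteq> vir {(Qs ^^ i) (F n) |i n. i \<le> 2 * n}"
    proof clarify
      fix i n :: nat assume "i \<le> 2 * n"
      then have "(Qs ^^ Suc i) (F n) \<in> W"
        using F_W[of "Suc i" n] Qs_pow_F_zero[of n "Suc i"] V.subspace_0[OF W_subspace] by (cases "Suc i \<le> 2 * n") (auto simp del: funpow.simps)
      then show "Qs ((Qs ^^ i) (F n)) \<in> vir {(Qs ^^ i) (F n) |i n. i \<le> 2 * n}" by (simp add: W_def)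
    qed
  qed (simp_all add: L_Qs)
  then show ?case using Suc by simp
qed simp

lemma primary:
  "k > 0 \<Longrightarrow> L k ((Qs ^^ i) (F n)) = 0"
  "L 0 ((Qs ^^ i) (F n)) = wtn (- int n) *\<^sub>V (Qs ^^ i) (F n)"
  unfolding Qs_pow_L F_def by (simp_all add: L_def om_ex2 om_ex1 lin_0[OF lin_Qs_pow] lin_scl[OF lin_Qs_pow] wtn_def)

lemma L_primary_mode:
  fixes i n defines "u \<equiv> (Qs ^^ i) (F n)"
  shows "Y u k (L m w) = L m (Y u k w) - (of_int (m + 1) * (wtn (- int n) - 1) - of_int k) *\<^sub>V Y u (m + k) w"
proof -
  have "Y om (m + 1) (Y u k w) = Y u k (Y om (m + 1) w) + Y (Y om 0 u) (m + 1 + k) w + of_int (m + 1) *\<^sub>V Y (Y om 1 u) (m + 1 + k - 1) w"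
  proof (rule va.commutator_primary)
    fix r
    show "Y om (2 + int r) u = 0" using primary(1)[of "1 + int r" i n] by (simp add: u_def L_def)
  qed
  also have "Y om 0 u = Td u" by (rule Y_om0)
  also have "Y om 1 u = wtn (- int n) *\<^sub>V u" using primary(2)[of i n] by (simp add: u_def L_def)
  finally show ?thesis
    unfolding va.Y_T Y_scl L_def by (simp add: algebra_simps scl_add_left scl_diff_left)
qed

text \<open>For two generators this is \<open>string_product\<close>. The generators are primary, so
  Virasoro operators on the right move out by \<open>L_primary_mode\<close>, and those on the left
  by the iterate formula.\<close>

lemma W_closed:
  assumes "x \<in> W" "w \<in> W"
  shows "Y x k w \<in> W"
proof -
  have 1: "Y ((Qs ^^ i) (F a)) k ((Qs ^^ j) (F b)) \<in> W" for i a j b k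
  proof -
    obtain c where c: "Y ((Qs ^^ i) (F a)) k ((Qs ^^ j) (F b)) - c *\<^sub>V (Qs ^^ (i + j)) (Y (F a) k (F b)) \<in> vir (gens (a + b))"
      using string_product[of i a j b k] by blast
    have "{F (a + b)} \<subseteq> W" using F_W[of 0 "a + b"] by simp
    then have "vir {F (a + b)} \<subseteq> W" by (intro vir_least W_subspace W_L)
    then have "(Qs ^^ (i + j)) (Y (F a) k (F b)) \<in> W" using F_F_vir Qs_pow_W by blast
    from V.subspace_add[OF W_subspace subsetD[OF gens_W c] V.subspace_scale[OF W_subspace this, of c]] show ?thesis by simp
  qed
  have 2: "Y ((Qs ^^ i) (F a)) k w \<in> W" if "w \<in> W" for i a w k
    using that unfolding W_def
  proof (induction arbitrary: k)
    case (gen x)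
    then show ?case using 1[of i a] by (auto simp: W_def)
  next
    case (L x m)
    show ?case unfolding L_primary_mode
      by (intro V.subspace_diff vir_subspace vir.L vir.scl L.IH)
  qed (simp_all add: lin_0[OF va.Y_lin2] lin_add[OF va.Y_lin2] lin_scl[OF va.Y_lin2] vir.zero vir.add vir.scl)
  have "\<forall>k. \<forall>w\<in>W. Y x k w \<in> W"
    using assms(1)[unfolded W_def]
  proof induction
    case (gen x)
    then show ?case using 2 by auto
  next
    case (L x m)
    show ?case
    proof (intro allI ballI)
      fix k w assume w: "w \<in> W"
      have om: "Y om r z \<in> W" if "z \<in> W" for r z using W_L[OF that, of "r - 1"] by (simp add: L_def)
      show "Y (L m x) k w \<in> W"
        unfolding L_def va.iterate by (rule J_mem[OF W_subspace]) (use L.IH w om in blast)+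
    qed
  qed (auto simp: Y_add Y_scl lin_0[OF lin_Y] intro: V.subspace_0[OF W_subspace] V.subspace_add[OF W_subspace] V.subspace_scale[OF W_subspace])
  then show ?thesis using assms(2) by blast
qed

end

lemma hom_unique: "x \<in> hom c d \<Longrightarrow> x \<in> hom c' d' \<Longrightarrow> x \<noteq> 0 \<Longrightarrow> c = c' \<and> d = d'"
proof -
  assume x: "x \<in> hom c d" "x \<in> hom c' d'" "x \<noteq> 0"
  then obtain b where b: "b \<in> Poly_Mapping.keys x" by (metis keys_eq_empty equals0I)
  have "snd b = c \<and> int (deg (fst b)) = d" using x(1) b unfolding hom_def by blast
  moreover have "snd b = c' \<and> int (deg (fst b)) = d'" using x(2) b unfolding hom_def by blast
  ultimately show ?thesis by simp
qed

lemma fsum_split: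
  assumes "\<And>i. i \<ge> N \<Longrightarrow> f i = 0"
  shows "fsum f = f 0 + fsum (\<lambda>i. f (Suc i))"
  using fsum_eq[of "Suc N" f] fsum_eq[of N "\<lambda>i. f (Suc i)"] assms by (simp add: sum.lessThan_Suc_shift del: sum.lessThan_Suc)

context lattice
begin

subsection \<open>Fixed points and their \<open>C\<^sub>2\<close>-spaces\<close>

text \<open>Homogeneous fixed vectors. Divisibility by 0 means being 0, so the value
  \<open>m = 0\<close> describes the charge 0 part of \<open>W\<close>; this instance is used in
  \<open>omega_nilpotent\<close>.\<close>

definition Ug :: "nat \<Rightarrow> V set" where
  "Ug m = {x \<in> W. \<exists>c d. x \<in> hom c d \<and> int m dvd c}"

definition U :: "nat \<Rightarrow> V set" where
  "U m = V.span (Ug m)"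

definition C2g :: "nat \<Rightarrow> V set" where
  "C2g m = {Y a (- 2) b | a b. a \<in> Ug m \<and> b \<in> Ug m}"

definition C2s :: "nat \<Rightarrow> V set" where
  "C2s m = V.span (C2g m)"

lemma U_subspace: "V.subspace (U m)" and C2s_subspace: "V.subspace (C2s m)"
  unfolding U_def C2s_def by (rule V.subspace_span)+

lemma Ug_U: "x \<in> Ug m \<Longrightarrow> x \<in> U m"
  unfolding U_def by (rule V.span_base)

lemma U_W: "U m \<subseteq> W"
  unfolding U_def by (rule V.span_minimal[OF _ W_subspace]) (auto simp: Ug_def)

lemma Y_Ug: "a \<in> Ug m \<Longrightarrow> b \<in> Ug m \<Longrightarrow> Y a k b \<in> Ug m"
  unfolding Ug_def using W_closed Y_hom by (blast intro: dvd_add)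

lemma Y_U:
  assumes "a \<in> U m" "b \<in> U m"
  shows "Y a k b \<in> U m"
proof -
  have "Y a' k b \<in> U m" if "a' \<in> Ug m" for a'
    unfolding U_def by (rule lin_span[OF va.Y_lin2 assms(2)[unfolded U_def]]) (use that Y_Ug in \<open>blast intro: V.span_base\<close>)
  then show ?thesis
    unfolding U_def by (intro lin_span[OF lin_Y assms(1)[unfolded U_def]]) (simp add: U_def)
qed

lemma C2_gen:
  assumes "a \<in> U m" "b \<in> U m"
  shows "Y a (- 2) b \<in> C2s m"
proof -
  have "Y a' (- 2) b \<in> C2s m" if "a' \<in> Ug m" for a'
    unfolding C2s_def by (rule lin_span[OF va.Y_lin2 assms(2)[unfolded U_def]]) (use that in \<open>auto simp: C2g_def intro: V.span_base\<close>)
  then show ?thesis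
    unfolding C2s_def by (intro lin_span[OF lin_Y assms(1)[unfolded U_def]]) (simp add: C2s_def)
qed

lemma F_0: "F 0 = 1"
  by (simp add: F_def)

lemma string_charge: "\<exists>d. (Qs ^^ i) (F n) \<in> hom (int i - int n) d"
  using Qs_pow_hom[OF F_hom, of i n] by (auto simp: algebra_simps)

lemma string_Ug: "i \<le> 2 * n \<Longrightarrow> int m dvd int i - int n \<Longrightarrow> (Qs ^^ i) (F n) \<in> Ug m"
  unfolding Ug_def using F_W string_charge by blast

lemma one_U: "1 \<in> U m"
  using string_Ug[of 0 0 m] by (auto simp: F_0 intro: Ug_U)

lemma L2_om: "L (- 2) = Y om (- 1)"
  by (simp add: L_def)

lemma om_U: "om \<in> U m"
proof -
  have "om \<in> W" using W_L[of 1 "- 2"] one_U U_W va.Y_create[of om] by (auto simp: L2_om)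
  then show ?thesis using om_hom by (intro Ug_U) (auto simp: Ug_def)
qed

lemma Td_eq: "Td x = Y x (- 2) 1"
  using va.T_Y[of x "- 1" 1] by (simp add: va.T_vac lin_0[OF va.Y_lin2] va.Y_create)

text \<open>\<open>Y (Td a) k = - k Y a (k - 1)\<close>, and \<open>Td\<close> preserves the
  algebra, so all modes below \<open>- 2\<close> reduce to the mode \<open>- 2\<close>.\<close>

lemma C2_neg:
  assumes "a \<in> U m" "b \<in> U m" "k \<le> - 2"
  shows "Y a k b \<in> C2s m"
proof -
  have "Y a (- int r - 2) b \<in> C2s m" for r
    using assms(1)
  proof (induction r arbitrary: a)
    case 0
    then show ?case using C2_gen[OF _ assms(2)] by simp
  next
    case (Suc r)
    have "Td a \<in> U m" unfolding Td_eq by (rule Y_U[OF Suc.prems one_U])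
    from Suc.IH[OF this] have "of_nat (r + 2) *\<^sub>V Y a (- int (Suc r) - 2) b \<in> C2s m"
      unfolding va.Y_T by (simp add: algebra_simps)
    from V.subspace_scale[OF C2s_subspace this, of "1 / of_nat (r + 2)"] show ?case
      by (simp del: of_nat_add of_nat_Suc add_2_eq_Suc')
  qed
  from this[of "nat (- 2 - k)"] show ?thesis using assms(3) by simp
qed

text \<open>The commutator of the modes \<open>- 1\<close> and \<open>- 2\<close> consists of modes
  of index at most \<open>- 3\<close>.\<close>

lemma C2_mult_left:
  assumes "a \<in> U m" "x \<in> C2s m"
  shows "Y a (- 1) x \<in> C2s m"
  unfolding C2s_def
proof (rule lin_span[OF va.Y_lin2 assms(2)[unfolded C2s_def]], fold C2s_def)
  fix y assume "y \<in> C2g m"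
  then obtain b c where y: "y = Y b (- 2) c" "b \<in> U m" "c \<in> U m" by (auto simp: C2g_def intro: Ug_U)
  have "V.span (range (\<lambda>i. Y (Y a (int i) b) (- 1 + - 2 - int i) c)) \<subseteq> C2s m"
    by (rule V.span_minimal[OF _ C2s_subspace]) (auto intro!: C2_neg Y_U assms(1) y)
  with va.commutator_span[of a "- 1" b "- 2" c]
  have "Y a (- 1) y - Y b (- 2) (Y a (- 1) c) \<in> C2s m" unfolding y(1) by blast
  from V.subspace_add[OF C2s_subspace this C2_gen[OF y(2) Y_U[OF assms(1) y(3), of "- 1"]]] show "Y a (- 1) y \<in> C2s m" by simp
qed

lemma C2_mult_right:
  assumes "x \<in> C2s m" "g \<in> U m"
  shows "Y x (- 1) g \<in> C2s m"
  unfolding C2s_def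
proof (rule lin_span[OF lin_Y assms(1)[unfolded C2s_def]], fold C2s_def)
  fix y assume "y \<in> C2g m"
  then obtain b c where y: "y = Y b (- 2) c" "b \<in> U m" "c \<in> U m" by (auto simp: C2g_def intro: Ug_U)
  show "Y y (- 1) g \<in> C2s m"
    unfolding y(1) va.iterate by (rule J_mem[OF C2s_subspace]) (auto intro!: C2_neg Y_U y assms(2))
qed

text \<open>In the iterate formula every term but the leading one has an outer mode of index at most
  \<open>- 2\<close>.\<close>

lemma C2_assoc:
  assumes "u \<in> U m" "v \<in> U m" "w \<in> U m"
  shows "Y (Y u (- 1) v) (- 1) w - Y u (- 1) (Y v (- 1) w) \<in> C2s m"
proof -
  obtain K where K: "\<And>k. k \<ge> K \<Longrightarrow> Y v k w = 0" using fld_Y[of v] unfolding fld_def by blast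
  let ?f = "\<lambda>i. bc (- 1) i *\<^sub>V Y u (0 + - 1 - int i) (Y v (- 1 + int i) w)"
  have "?f i = 0" if "i \<ge> nat (K + 1)" for i
  proof -
    have "- 1 + int i \<ge> K" using that by linarith
    then show ?thesis by (simp only: K lin_0[OF va.Y_lin2] scl_zero_right)
  qed
  from fsum_split[of _ ?f, OF this] have "iexp (- 1) (\<lambda>m k. Y u m (Y v k w)) 0 (- 1) = Y u (- 1) (Y v (- 1) w) + fsum (\<lambda>i. ?f (Suc i))"
    unfolding iexp_def by simp
  then have "Y (Y u (- 1) v) (- 1) w - Y u (- 1) (Y v (- 1) w) = fsum (\<lambda>i. ?f (Suc i)) - sg (- 1) *\<^sub>V iexp (- 1) (\<lambda>k m. Y v k (Y u m w)) (- 1) 0"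
    unfolding va.iterate J_def by simp
  also have "\<dots> \<in> C2s m"
  proof (intro V.subspace_diff V.subspace_scale C2s_subspace)
    show "fsum (\<lambda>i. ?f (Suc i)) \<in> C2s m"
      by (rule fsum_mem[OF C2s_subspace], rule V.subspace_scale[OF C2s_subspace], rule C2_neg) (auto intro!: Y_U assms)
    show "iexp (- 1) (\<lambda>k m. Y v k (Y u m w)) (- 1) 0 \<in> C2s m"
      by (rule iexp_mem[OF C2s_subspace], rule C2_neg) (auto intro!: Y_U assms)
  qed
  finally show ?thesis .
qed

lemma L2_pow_U: "g \<in> U m \<Longrightarrow> (L (- 2) ^^ b) g \<in> U m"
  by (induction b) (auto simp: L2_om intro: Y_U om_U)

lemma L2_pow_C2: "x \<in> C2s m \<Longrightarrow> (L (- 2) ^^ b) x \<in> C2s m"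
  by (induction b) (auto simp: L2_om intro: C2_mult_left om_U)

lemma L2_pow_mult:
  assumes "g \<in> U m"
  shows "Y ((L (- 2) ^^ b) 1) (- 1) g - (L (- 2) ^^ b) g \<in> C2s m"
proof (induction b)
  case 0
  then show ?case using V.subspace_0[OF C2s_subspace] by (simp add: va.Y_vac_left)
next
  case (Suc b)
  have "Y om (- 1) (Y ((L (- 2) ^^ b) 1) (- 1) g - (L (- 2) ^^ b) g) \<in> C2s m"
    by (rule C2_mult_left[OF om_U Suc])
  moreover have "Y (Y om (- 1) ((L (- 2) ^^ b) 1)) (- 1) g - Y om (- 1) (Y ((L (- 2) ^^ b) 1) (- 1) g) \<in> C2s m"
    by (rule C2_assoc[OF om_U L2_pow_U[OF one_U] assms])
  ultimately have "Y om (- 1) (Y ((L (- 2) ^^ b) 1) (- 1) g - (L (- 2) ^^ b) g) + (Y (Y om (- 1) ((L (- 2) ^^ b) 1)) (- 1) g - Y om (- 1) (Y ((L (- 2) ^^ b) 1) (- 1) g)) \<in> C2s m"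
    by (rule V.subspace_add[OF C2s_subspace])
  then show ?case by (simp add: L2_om lin_diff[OF va.Y_lin2])
qed

text \<open>Modulo \<open>C2s m\<close> the operator \<open>L (- 2) ^ N\<close> is multiplication by
  \<open>L (- 2) ^ N 1\<close>, and \<open>C2s m\<close> is stable under multiplication from either
  side.\<close>

lemma L2_pow_nilpotent:
  assumes "(L (- 2) ^^ N) 1 \<in> C2s m" "g \<in> U m" "b \<ge> N"
  shows "(L (- 2) ^^ b) g \<in> C2s m"
proof -
  have "(L (- 2) ^^ N) g \<in> C2s m"
    using V.subspace_diff[OF C2s_subspace C2_mult_right[OF assms(1,2)] L2_pow_mult[OF assms(2), of N]] by simp
  moreover have "(L (- 2) ^^ b) g = (L (- 2) ^^ (b - N)) ((L (- 2) ^^ N) g)"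
    using assms(3) by (simp flip: funpow_add[unfolded o_def, THEN fun_cong])
  ultimately show ?thesis using L2_pow_C2 by simp
qed

definition G :: "nat \<Rightarrow> V set" where
  "G m = {1, Qs (F 1), F m, (Qs ^^ (2 * m)) (F m)}"

definition Dg :: "nat \<Rightarrow> V set" where
  "Dg m = C2g m \<union> {(L (- 2) ^^ b) g | b g. g \<in> G m}"

lemma G_Ug: "G m \<subseteq> Ug m"
  using string_Ug[of 0 0 m] string_Ug[of 1 1 m] string_Ug[of 0 m m] string_Ug[of "2 * m" m m]
  by (auto simp: G_def F_0)

lemma C2g_Ug: "C2g m \<subseteq> Ug m"
  by (auto simp: C2g_def intro: Y_Ug)

lemma C2s_D: "C2s m \<subseteq> V.span (Dg m)"
  unfolding C2s_def Dg_def by (rule V.span_mono) auto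

lemma D_U: "V.span (Dg m) \<subseteq> U m"
  by (rule V.span_minimal[OF _ U_subspace])
    (auto simp: Dg_def dest: subsetD[OF G_Ug] subsetD[OF C2g_Ug] intro: Ug_U L2_pow_U)

text \<open>On \<open>U m\<close>, \<open>L (- 1)\<close> is the mode \<open>- 2\<close> against the
  vacuum and \<open>L k\<close> for \<open>k <= - 3\<close> is a mode of \<open>om\<close> of index
  at most \<open>- 2\<close>; both land in \<open>C2s m\<close>. Only \<open>L (- 2)\<close> is not
  absorbed, and it raises the exponent in \<open>Dg\<close>.\<close>

lemma low_D:
  assumes "v \<in> V.span (Dg m)"
  shows "low v \<subseteq> V.span (Dg m)"
proof
  fix x assume "x \<in> low v"
  then show "x \<in> V.span (Dg m)"
  proof induction
    case (L x k)
    then have x: "x \<in> U m" using D_U by blast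
    consider "k = - 1" | "k = - 2" | "k \<le> - 3" using L.hyps by linarith
    then show ?case
    proof cases
      case 1
      have "L k x = Y x (- 2) 1" unfolding 1 L_m1 Td_eq ..
      then show ?thesis using C2_gen[OF x one_U] C2s_D by auto
    next
      case 2
      have "L (- 2) x \<in> V.span (Dg m)"
      proof (rule lin_span[OF lin_L L.IH])
        fix y assume "y \<in> Dg m"
        then consider "y \<in> C2g m" | b g where "y = (L (- 2) ^^ b) g" "g \<in> G m" by (auto simp: Dg_def)
        then show "L (- 2) y \<in> V.span (Dg m)"
        proof cases
          case 1
          then have "y \<in> C2s m" by (simp add: C2s_def V.span_base)
          then show ?thesis using L2_pow_C2[of y m 1] C2s_D by auto
        next
          case 2
          then have "L (- 2) y = (L (- 2) ^^ Suc b) g" by simp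
          then show ?thesis using 2 by (intro V.span_base) (auto simp: Dg_def simp del: funpow.simps)
        qed
      qed
      then show ?thesis using 2 by simp
    next
      case 3
      have "L k x \<in> C2s m" unfolding L_def by (rule C2_neg[OF om_U x]) (use 3 in simp)
      then show ?thesis using C2s_D by blast
    qed
  qed (use assms in \<open>auto intro: V.span_zero V.span_add V.span_scale\<close>)
qed

lemma vir_D: "(Qs ^^ i) (F n) \<in> V.span (Dg m) \<Longrightarrow> vir {(Qs ^^ i) (F n)} \<subseteq> V.span (Dg m)"
  using vir_low[OF primary, of i n] low_D by blast

lemma vir_Union:
  assumes "V.subspace D" "\<And>v. v \<in> C \<Longrightarrow> vir {v} \<subseteq> D"
  shows "vir C \<subseteq> D"
proof -
  have "vir C \<subseteq> V.span (\<Union>v\<in>C. vir {v})"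
  proof (rule vir_least[OF V.subspace_span])
    show "C \<subseteq> V.span (\<Union>v\<in>C. vir {v})" by (auto intro!: V.span_base vir.gen)
    show "L k x \<in> V.span (\<Union>v\<in>C. vir {v})" if "x \<in> V.span (\<Union>v\<in>C. vir {v})" for k x
      by (rule lin_span[OF lin_L that]) (auto intro!: V.span_base vir.L)
  qed
  also have "\<dots> \<subseteq> D" by (rule V.span_minimal) (use assms in auto)
  finally show ?thesis .
qed

text \<open>The remainders of \<open>string_product\<close> may contain vectors of charges not
  divisible by \<open>m\<close>. Projecting them away commutes with the Virasoro action, so only the
  admissible strings have to be known.\<close>

lemma pr_vir:
  assumes "x \<in> vir {(Qs ^^ i) (F n) | i n. R i n}" "\<And>i n. R i n \<Longrightarrow> int m dvd int i - int n \<Longrightarrow> (Qs ^^ i) (F n) \<in> V.span (Dg m)"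
  shows "pr (\<lambda>c d. int m dvd c) x \<in> V.span (Dg m)"
proof -
  let ?P = "pr (\<lambda>c d. int m dvd c)"
  let ?C = "{(Qs ^^ i) (F n) | i n. R i n \<and> int m dvd int i - int n}"
  have "?P x \<in> vir ?C"
  proof (rule vir_lin[OF lin_pr _ assms(1)])
    fix k x
    show "?P (L k x) = L k (?P x)"
      by (rule pr_commute[OF lin_L, where g = "\<lambda>c. c" and k = "\<lambda>c d. d - k"]) (auto intro: L_hom)
  next
    show "?P ` {(Qs ^^ i) (F n) | i n. R i n} \<subseteq> vir ?C"
    proof clarify
      fix i n assume R: "R i n"
      obtain d where d: "(Qs ^^ i) (F n) \<in> hom (int i - int n) d" using string_charge by blast
      show "?P ((Qs ^^ i) (F n)) \<in> vir ?C"
        unfolding pr_hom[OF d] using R by (auto intro: vir.zero vir.gen)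
    qed
  qed
  moreover have "vir ?C \<subseteq> V.span (Dg m)"
  proof (rule vir_Union[OF V.subspace_span])
    fix v assume "v \<in> ?C"
    then obtain i n where v: "v = (Qs ^^ i) (F n)" "R i n" "int m dvd int i - int n" by blast
    show "vir {v} \<subseteq> V.span (Dg m)" unfolding v(1) by (rule vir_D, rule assms(2)) (rule v)+
  qed
  ultimately show ?thesis by blast
qed

lemma F_F_top: "Y (F a) (- (2 * int p * int a * int b) - 1) (F b) = F (a + b)"
  using e_eq[OF ex_hom[of "- int b"], of 1 "- int a" "- (2 * int p * int a * int b) - 1"]
  by (simp add: F_def Y_ex ex_mult)

text \<open>Of all terms of the Leibniz expansion only the one at the end of both strings survives,
  so this product of string ends needs no correction from lower strings.\<close>

lemma top_string:
  "of_nat ((2 * a + 2 * b) choose (2 * a)) *\<^sub>V Y ((Qs ^^ (2 * a)) (F a)) k ((Qs ^^ (2 * b)) (F b)) = (Qs ^^ (2 * a + 2 * b)) (Y (F a) k (F b))"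
proof -
  let ?g = "\<lambda>i j. Y ((Qs ^^ i) (F a)) k ((Qs ^^ j) (F b))"
  interpret two_strings Qs ?g "2 * a" "2 * b"
    by unfold_locales (simp_all add: lin_Qs Qs_Y Qs_pow_F_zero lin_0[OF lin_Y] lin_0[OF va.Y_lin2])
  let ?r = "2 * a + 2 * b"
  have "(Qs ^^ ?r) (?g 0 0) = (\<Sum>t\<le>?r. of_nat (?r choose t) *\<^sub>V ?g (0 + t) (0 + (?r - t)))" by (rule Q_pow_g)
  also have "\<dots> = (\<Sum>t\<in>{2 * a}. of_nat (?r choose t) *\<^sub>V ?g (0 + t) (0 + (?r - t)))"
  proof (rule sum.mono_neutral_right)
    show "\<forall>t\<in>{..?r} - {2 * a}. of_nat (?r choose t) *\<^sub>V ?g (0 + t) (0 + (?r - t)) = 0"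
    proof
      fix t assume t: "t \<in> {..?r} - {2 * a}"
      then have "t > 2 * a \<or> ?r - t > 2 * b" by auto
      then have "?g t (?r - t) = 0" using g_left g_right by blast
      then show "of_nat (?r choose t) *\<^sub>V ?g (0 + t) (0 + (?r - t)) = 0" by (simp only: add_0 scl_zero_right)
    qed
  qed auto
  finally show ?thesis by simp
qed

text \<open>Ends of strings with \<open>n > m\<close> factor through the ends for \<open>m\<close>
  and \<open>n - m\<close>, whose charges are again divisible by \<open>m\<close>. Interior members
  factor through \<open>Qs (F 1)\<close>, which has charge 0 and is therefore fixed for every
  \<open>m\<close>, at the price of lower strings covered by induction.\<close>

lemma string_D:
  assumes "i \<le> 2 * n" "int m dvd int i - int n"
  shows "(Qs ^^ i) (F n) \<in> V.span (Dg m)"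
  using assms
proof (induction n arbitrary: i rule: less_induct)
  case (less n)
  have G: "g \<in> V.span (Dg m)" if "g \<in> G m" for g
  proof -
    have "g = (L (- 2) ^^ 0) g" by simp
    then show ?thesis using that unfolding Dg_def by (intro V.span_base) blast
  qed
  have ends: "n = 0 \<or> n = m \<or> (m \<ge> 1 \<and> n > m)" if "m dvd n"
    using that by (metis One_nat_def Suc_leI dvd_0_left_iff dvd_imp_le gr0I le_neq_implies_less)
  \<comment> \<open>The mode at which \<open>F a\<close> and \<open>F b\<close> multiply to
    \<open>F (a + b)\<close> is at most \<open>- 2\<close> once both indices are positive, so these
    products lie in \<open>C2s m\<close>.\<close>
  have neg: "- (2 * int p * int a * int b) - 1 \<le> - 2" if "a \<ge> 1" "b \<ge> 1" for a b
  proof -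
    have "1 \<le> int p * int a * int b" using that p2 by (simp add: Suc_leI flip: of_nat_mult)
    then show ?thesis by linarith
  qed
  consider "i = 0" | "i = 2 * n" | "n = 1" "i = 1" | "n \<ge> 2" "1 \<le> i" "i \<le> 2 * n - 1"
    using less.prems(1) by linarith
  then show ?case
  proof cases
    case 1
    then have dvd: "m dvd n" using less.prems(2) by simp
    from ends[OF dvd] show ?thesis
    proof (elim disjE)
      assume "n = 0"
      then show ?thesis using G[of 1] 1 by (simp add: G_def F_0)
    next
      assume "n = m"
      then show ?thesis using G[of "F m"] 1 by (simp add: G_def)
    next
      assume n: "m \<ge> 1 \<and> n > m"
      have "int m dvd int 0 - int (n - m)" using dvd n by (simp add: dvd_diff_nat)
      then have "(Qs ^^ 0) (F (n - m)) \<in> U m" by (intro Ug_U string_Ug) auto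
      moreover have "F m \<in> U m" using G_Ug Ug_U by (auto simp: G_def)
      ultimately have "Y (F m) (- (2 * int p * int m * int (n - m)) - 1) (F (n - m)) \<in> C2s m"
        using n by (intro C2_neg neg) auto
      then have "F (m + (n - m)) \<in> C2s m" by (simp only: F_F_top)
      moreover have "m + (n - m) = n" using n by simp
      ultimately show ?thesis using C2s_D 1 by auto
    qed
  next
    case 2
    then have dvd: "m dvd n" using less.prems(2) by simp
    from ends[OF dvd] show ?thesis
    proof (elim disjE)
      assume "n = 0"
      then show ?thesis using G[of 1] 2 by (simp add: G_def F_0)
    next
      assume "n = m"
      then show ?thesis using G[of "(Qs ^^ (2 * m)) (F m)"] 2 by (simp add: G_def)
    next
      assume n: "m \<ge> 1 \<and> n > m"
      let ?k = "- (2 * int p * int m * int (n - m)) - 1"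
      have "int m dvd int (2 * (n - m)) - int (n - m)" using dvd n by (simp add: dvd_diff_nat)
      then have "(Qs ^^ (2 * (n - m))) (F (n - m)) \<in> U m" by (intro Ug_U string_Ug) auto
      moreover have "(Qs ^^ (2 * m)) (F m) \<in> U m" using G_Ug Ug_U by (auto simp: G_def)
      ultimately have "Y ((Qs ^^ (2 * m)) (F m)) ?k ((Qs ^^ (2 * (n - m))) (F (n - m))) \<in> C2s m"
        using n by (intro C2_neg neg) auto
      from V.subspace_scale[OF C2s_subspace this, of "of_nat ((2 * m + 2 * (n - m)) choose (2 * m))"]
      have "(Qs ^^ (2 * m + 2 * (n - m))) (F n) \<in> C2s m"
        unfolding top_string F_F_top using n by simp
      moreover have "2 * m + 2 * (n - m) = i" using n 2 by linarith
      ultimately show ?thesis using C2s_D by auto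
    qed
  next
    case 3
    then show ?thesis using G[of "Qs (F 1)"] by (simp add: G_def)
  next
    case 4
    let ?k = "- (2 * int p * int 1 * int (n - 1)) - 1"
    obtain c where c: "c \<noteq> 0"
      "Y ((Qs ^^ 1) (F 1)) ?k ((Qs ^^ (i - 1)) (F (n - 1))) - c *\<^sub>V (Qs ^^ (1 + (i - 1))) (Y (F 1) ?k (F (n - 1))) \<in> vir (gens (1 + (n - 1)))"
      using string_product[of 1 1 "i - 1" "n - 1" ?k] 4 by auto
    have "1 + (n - 1) = n" "1 + (i - 1) = i" using 4 by auto
    note c = c[unfolded F_F_top this]
    let ?y = "Y ((Qs ^^ 1) (F 1)) ?k ((Qs ^^ (i - 1)) (F (n - 1)))"
    have ch: "int (i - 1) - int (n - 1) = int i - int n" using 4 by simp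
    have u1: "(Qs ^^ 1) (F 1) \<in> Ug m" by (rule string_Ug) auto
    have u2: "(Qs ^^ (i - 1)) (F (n - 1)) \<in> Ug m" by (rule string_Ug) (use 4 less.prems(2) ch in auto)
    have y: "?y \<in> C2s m" by (intro C2_neg neg Ug_U u1 u2) (use 4 in auto)
    have prx: "pr (\<lambda>c d. int m dvd c) x = x" if "x \<in> Ug m" for x
      using that pr_hom by (auto simp: Ug_def)
    \<comment> \<open>Both vectors on the left have charge divisible by \<open>m\<close>, so the
      projection fixes them and acts only on the description of the remainder.\<close>
    have "pr (\<lambda>c d. int m dvd c) (?y - c *\<^sub>V (Qs ^^ i) (F n)) \<in> V.span (Dg m)"
      using c(2) unfolding gens_def by (rule pr_vir) (use less.IH in auto)
    also have "pr (\<lambda>c d. int m dvd c) (?y - c *\<^sub>V (Qs ^^ i) (F n)) = ?y - c *\<^sub>V (Qs ^^ i) (F n)"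
      unfolding lin_diff[OF lin_pr] lin_scl[OF lin_pr] prx[OF Y_Ug[OF u1 u2]] prx[OF string_Ug[OF less.prems]] ..
    finally have 5: "?y - c *\<^sub>V (Qs ^^ i) (F n) \<in> V.span (Dg m)" .
    from V.span_scale[OF V.span_diff[OF subsetD[OF C2s_D y] 5], of "1 / c"] show ?thesis using c(1) by simp
  qed
qed

lemma U_D: "U m \<subseteq> V.span (Dg m)"
  unfolding U_def
proof (rule V.span_minimal[OF _ V.subspace_span], rule subsetI)
  fix x assume x: "x \<in> Ug m"
  then have "pr (\<lambda>c d. int m dvd c) x = x" using pr_hom by (auto simp: Ug_def)
  moreover have "pr (\<lambda>c d. int m dvd c) x \<in> V.span (Dg m)"
    using x unfolding Ug_def W_def by (intro pr_vir[OF _ string_D]) auto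
  ultimately show "x \<in> V.span (Dg m)" by simp
qed

subsection \<open>Nilpotency of the conformal vector\<close>

definition tau :: "nat \<Rightarrow> V \<Rightarrow> complex" where
  "tau d x = Poly_Mapping.lookup x (replicate_mset d 0, 0)"

lemma tau_add: "tau d (x + y) = tau d x + tau d y"
  and tau_scl: "tau d (c *\<^sub>V x) = c * tau d x"
  and tau_0: "tau d 0 = 0"
  and tau_sum: "tau d (sum f I) = (\<Sum>i\<in>I. tau d (f i))"
  by (simp_all add: tau_def lookup_add lookup_minus lookup_sum)

lemma tau_A: "tau d (A i * x) = (if i = 0 \<and> d > 0 then tau (d - 1) x else 0)"
proof (induction x rule: V_induct)
  case (add x y)
  then show ?case by (simp add: distrib_left tau_add)
next
  case (scl c x)
  then show ?case by (simp add: scl_mult_right tau_scl)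
next
  case (mono lam n)
  show ?case
  proof (cases d)
    case 0
    then show ?thesis by (simp add: tau_def lookup_bv flip: bv_add_mset)
  next
    case (Suc e)
    have "add_mset i lam = add_mset 0 (replicate_mset e 0) \<longleftrightarrow> i = 0 \<and> lam = replicate_mset e 0"
    proof
      assume eq: "add_mset i lam = add_mset 0 (replicate_mset e 0)"
      then have "i \<in># replicate_mset (Suc e) 0" by (metis replicate_mset_Suc union_single_eq_member)
      then have "i = 0" by (auto split: if_splits)
      then show "i = 0 \<and> lam = replicate_mset e 0" using eq by simp
    qed simp
    then show ?thesis using Suc by (simp add: tau_def lookup_bv flip: bv_add_mset)
  qed
qed

definition K0 :: "V set" where
  "K0 = {x. \<forall>d. tau d x = 0}"

lemma K0_subspace: "V.subspace K0"
  by (auto simp: V.subspace_def K0_def tau_add tau_scl tau_0)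

text \<open>A pure power of \<alpha>(-1) can only come from creating with \<open>A 0\<close> on top
  of the unchanged mode \<open>k\<close>, which is excluded by induction; the other half of the
  expansion only lowers the mode.\<close>

lemma bv_mode_K0: "k \<le> - 2 \<Longrightarrow> Y (bv (lam, 0)) k v \<in> K0"
proof (induction lam arbitrary: k v)
  case empty
  then show ?case by (simp add: va.Y_vac_left K0_def tau_0)
next
  case (add i lam)
  show ?case
    unfolding bv_add_mset Y_A_mult
  proof (rule J_mem[OF K0_subspace])
    fix r
    have "0 + (- int i - 1) - int r = - int (i + r) - 1" by simp
    moreover have "A (i + r) * Y (bv (lam, 0)) (k + int r) v \<in> K0"
      using add(1)[of k v] add(2) by (cases "i + r = 0") (auto simp: K0_def tau_A)
    ultimately show "h (0 + (- int i - 1) - int r) (Y (bv (lam, 0)) (k + int r) v) \<in> K0" by (simp only: h_neg1)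
    show "Y (bv (lam, 0)) (k + (- int i - 1) - int r) (h (0 + int r) v) \<in> K0"
      by (rule add(1)) (use add(2) in simp)
  qed
qed

lemma C2s0_K0: "C2s 0 \<subseteq> K0"
  unfolding C2s_def
proof (rule V.span_minimal[OF _ K0_subspace], rule subsetI)
  fix x assume "x \<in> C2g 0"
  then obtain a b d where x: "x = Y a (- 2) b" "a \<in> hom 0 d" by (auto simp: C2g_def Ug_def)
  have "x = (\<Sum>c\<in>Poly_Mapping.keys a. Poly_Mapping.lookup a c *\<^sub>V Y (bv c) (- 2) b)"
    unfolding x(1) by (subst V_expand[of a]) (simp only: lin_sum[OF lin_Y] lin_scl[OF lin_Y])
  also have "\<dots> \<in> K0"
  proof (intro V.subspace_sum V.subspace_scale K0_subspace)
    fix c assume "c \<in> Poly_Mapping.keys a"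
    then have "c = (fst c, 0)" using x(2) by (auto simp: hom_def prod_eq_iff)
    then show "Y (bv c) (- 2) b \<in> K0" using bv_mode_K0[of "- 2" "fst c" b] by simp
  qed
  finally show "x \<in> K0" .
qed

text \<open>Only the part \<open>k A 0 z\<close> of the exponent contributes to pure powers of
  \<open>A 0\<close>.\<close>

lemma tau_S: "tau (d + a) (S k (int a) * y) = k ^ a / fact a * tau d y"
proof (induction a)
  case (Suc a)
  have "of_nat (Suc a) * tau (d + Suc a) (S k (int (Suc a)) * y) = tau (d + Suc a) ((of_int (int (Suc a)) *\<^sub>V S k (int (Suc a))) * y)"
    by (simp add: scl_mult_left tau_scl)
  also have "of_int (int (Suc a)) *\<^sub>V S k (int (Suc a)) = k *\<^sub>V (\<Sum>i\<in>{1..Suc a}. A (i - 1) * S k (int (Suc a) - int i))"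
    by (rule S_rec) simp
  also have "tau (d + Suc a) (k *\<^sub>V (\<Sum>i\<in>{1..Suc a}. A (i - 1) * S k (int (Suc a) - int i)) * y) =
     k * (\<Sum>i\<in>{1..Suc a}. if i = 1 then tau (d + a) (S k (int a) * y) else 0)"
    unfolding scl_mult_left tau_scl sum_distrib_right tau_sum mult.assoc tau_A
    by (intro arg_cong[where f = "\<lambda>x. k * x"] sum.cong) auto
  also have "\<dots> = k * (k ^ a / fact a * tau d y)" using Suc by simp
  finally have "of_nat (Suc a) * tau (d + Suc a) (S k (int (Suc a)) * y) = k * (k ^ a / fact a * tau d y)" .
  then have "tau (d + Suc a) (S k (int (Suc a)) * y) = k * (k ^ a / fact a * tau d y) / of_nat (Suc a)"
    by (metis nonzero_mult_div_cancel_left of_nat_neq_0)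
  also have "\<dots> = k ^ Suc a / fact (Suc a) * tau d y" by (simp add: mult_ac)
  finally show ?case .
qed simp

lemma fact_falling: "r \<le> n \<Longrightarrow> (fact n :: complex) = fact (n - r) * (\<Prod>i<r. of_nat n - of_nat i)"
proof (induction r)
  case (Suc r)
  then have "n - r = Suc (n - Suc r)" by simp
  then have "(fact (n - r) :: complex) = (of_nat n - of_nat r) * fact (n - Suc r)"
    using Suc.prems fact_Suc[of "n - Suc r", where ?'a = complex] by (simp add: of_nat_diff del: fact_Suc)
  then show ?case using Suc by simp
qed simp

text \<open>The product is a polynomial of degree \<open>r\<close> in \<open>i\<close>, and the sum
  is a finite difference of order \<open>s > r\<close>.\<close>

lemma falling_alternating_sum:
  assumes "r < s" "B > 0"
  shows "(\<Sum>i\<le>s. (- 1) ^ i * of_nat (s choose i) * (\<Prod>t<r. of_nat (B * i) - of_nat t)) = (0 :: complex)"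
proof -
  have P: "(\<Prod>t<r. of_nat (B * i) - of_nat t) = (- of_nat B :: complex) ^ r * prod_list (map (\<lambda>u. u - of_nat i) (map (\<lambda>t. of_nat t / of_nat B) [0..<r]))" for i :: nat
  proof -
    have "of_nat (B * i) - of_nat t = - of_nat B * (of_nat t / of_nat B - of_nat i :: complex)" for t :: nat
      using assms(2) by (simp add: right_diff_distrib)
    then have "(\<Prod>t<r. of_nat (B * i) - of_nat t) = (- of_nat B :: complex) ^ r * (\<Prod>t<r. of_nat t / of_nat B - of_nat i)"
      by (simp only: prod.distrib prod_constant card_lessThan)
    also have "(\<Prod>t<r. of_nat t / of_nat B - of_nat i) = prod_list (map (\<lambda>u. u - of_nat i) (map (\<lambda>t. of_nat t / of_nat B) [0..<r]) :: complex list)"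
      by (induction r) (simp_all add: mult.commute)
    finally show ?thesis .
  qed
  have "(\<Sum>i\<le>s. (- 1) ^ i * of_nat (s choose i) * (\<Prod>t<r. of_nat (B * i) - of_nat t)) =
     (- of_nat B :: complex) ^ r * (\<Sum>i\<le>s. (- 1) ^ i * of_nat (s choose i) * prod_list (map (\<lambda>u. u - of_nat i) (map (\<lambda>t. of_nat t / of_nat B) [0..<r])))"
    unfolding P sum_distrib_left by (intro sum.cong refl) (simp only: mult_ac)
  also have "\<dots> = (0 :: complex)"
    by (subst alternating_sum_linear_factors) (use assms in auto)
  finally show ?thesis .
qed

text \<open>Up to a nonzero factor, the coefficient is a polynomial in the degree \<open>D\<close> whose value at
  \<open>D = 0\<close> is nonzero by \<open>kappa\<close>.\<close>
lemma nilpotent_witness: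
  assumes "m \<ge> 1"
  shows "\<exists>N j. j \<le> - 2 \<and> Y (F m) j ((Qs ^^ (2 * m)) (F m)) \<in> hom 0 (int (2 * N)) \<and> tau (2 * N) (Y (F m) j ((Qs ^^ (2 * m)) (F m))) \<noteq> 0"
proof -
  let ?E = "(Qs ^^ (2 * m)) (F m)"
  define d0 where "d0 = 2 * (p - 1) * m"
  have d0: "int d0 = 2 * (int p - 1) * int m" using p2 by (simp add: d0_def of_nat_diff)
  have E: "?E \<in> hom (int m) (int d0)"
  proof -
    have c: "- int m + int (2 * m) = int m" by simp
    have d: "0 - int (2 * m) * (2 * int p * (- int m) + int p * (int (2 * m) - 1) + 1) = int d0"
      unfolding d0 by (simp add: algebra_simps)
    show ?thesis using Qs_pow_hom[OF F_hom, of "2 * m" m] unfolding c d .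
  qed
  \<comment> \<open>The mode that sends \<open>?E\<close> to degree \<open>D\<close>; larger degrees
    mean more negative modes.\<close>
  define jj where "jj D = int d0 + 2 * int p * int m * int m - 1 - D" for D
  define t where "t c = tau (d0 - c) (ex (- int m) * T (- int m) (int c) ?E)" for c
  have eE: "Y (F m) (jj D) ?E = (\<Sum>c<Suc d0. S (- of_nat m) (int c - int d0 + D) * (ex (- int m) * T (- int m) (int c) ?E))" for D
  proof -
    have idx: "int c - 2 * int p * (- int m) * int m - jj D - 1 = int c - int d0 + D" for c by (simp add: jj_def)
    have FY: "Y (F m) = e (- int m)" by (simp add: F_def Y_ex)
    have "int (Suc d0) > int d0" by simp
    from e_eq[OF E this, of "- int m" "jj D"] show ?thesis unfolding idx FY of_int_minus of_int_of_nat_eq .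
  qed
  have hom: "Y (F m) (jj D) ?E \<in> hom 0 D" for D
    using Y_hom[OF F_hom E, of m "jj D"] by (simp add: jj_def algebra_simps)
  \<comment> \<open>In degree 0 only the summand \<open>c = d0\<close> is left, and the mode is the
    one in \<open>kappa\<close>.\<close>
  have top: "t d0 \<noteq> 0"
  proof -
    obtain k where k: "k \<noteq> 0" "Y (F m) (2 * hn m - 1) ?E = k *\<^sub>V 1" using kappa[of m] by (auto simp: F_def Y_ex)
    have "jj 0 = 2 * hn m - 1" unfolding jj_def hn_def d0 by (simp add: algebra_simps)
    with k(2) eE[of 0] have "k *\<^sub>V 1 = (\<Sum>c<Suc d0. S (- of_nat m) (int c - int d0 + 0) * (ex (- int m) * T (- int m) (int c) ?E))" by (simp only:)
    also have "\<dots> = ex (- int m) * T (- int m) (int d0) ?E" by simp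
    finally have "t d0 = tau 0 (k *\<^sub>V 1)" by (simp add: t_def)
    also have "\<dots> = k" using lookup_bv[of "({#}, 0)" "({#}, 0)"] unfolding bv_0 by (simp add: tau_scl) (simp add: tau_def)
    finally show ?thesis using k(1) by simp
  qed
  define f where "f D = (\<Sum>c<Suc d0. ((- of_nat m) ^ c * t c) * (\<Prod>r<d0 - c. of_nat D - of_nat r))" for D :: nat
  have tauD: "tau D (Y (F m) (jj (int D)) ?E) = (- of_nat m) ^ (D - d0) / fact D * f D" if D: "D \<ge> d0" for D
  proof -
    have "tau D (Y (F m) (jj (int D)) ?E) = (\<Sum>c<Suc d0. tau D (S (- of_nat m) (int c - int d0 + int D) * (ex (- int m) * T (- int m) (int c) ?E)))"
      unfolding eE tau_sum ..
    also have "\<dots> = (\<Sum>c<Suc d0. (- of_nat m) ^ (D - d0) / fact D * (((- of_nat m) ^ c * t c) * (\<Prod>r<d0 - c. of_nat D - of_nat r)))"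
    proof (rule sum.cong[OF refl])
      fix c assume "c \<in> {..<Suc d0}"
      then have c: "c \<le> d0" by simp
      define a where "a = D - d0 + c"
      have a: "int c - int d0 + int D = int a" "D = (d0 - c) + a" "a = D - (d0 - c)" using c D by (auto simp: a_def)
      have fa: "(fact D :: complex) = fact a * (\<Prod>r<d0 - c. of_nat D - of_nat r)"
        unfolding a(3) by (rule fact_falling) (use c D in simp)
      have "fact D \<noteq> (0 :: complex)" by simp
      then have nz: "(\<Prod>r<d0 - c. of_nat D - of_nat r) \<noteq> (0 :: complex)" unfolding fa by auto
      have "tau D (S (- of_nat m) (int c - int d0 + int D) * (ex (- int m) * T (- int m) (int c) ?E)) = (- of_nat m) ^ a / fact a * t c"
        unfolding a(1) t_def using tau_S[of "d0 - c" a "- of_nat m" "ex (- int m) * T (- int m) (int c) ?E"] a(2) by simp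
      also have "\<dots> = (- of_nat m) ^ (D - d0) / fact D * (((- of_nat m) ^ c * t c) * (\<Prod>r<d0 - c. of_nat D - of_nat r))"
        unfolding fa using nz by (simp add: a_def power_add)
      finally show "tau D (S (- of_nat m) (int c - int d0 + int D) * (ex (- int m) * T (- int m) (int c) ?E)) =
        (- of_nat m) ^ (D - d0) / fact D * (((- of_nat m) ^ c * t c) * (\<Prod>r<d0 - c. of_nat D - of_nat r))" .
    qed
    finally show ?thesis unfolding f_def sum_distrib_left .
  qed
  have f0: "f 0 \<noteq> 0"
  proof -
    have z: "(\<Prod>r<d0 - c. of_nat 0 - of_nat r) = (0 :: complex)" if "c < d0" for c
      using that by (intro prod_zero) (auto intro!: bexI[of _ 0])
    have "(\<Sum>c<d0. ((- of_nat m) ^ c * t c) * (\<Prod>r<d0 - c. of_nat 0 - of_nat r)) = 0"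
      by (intro sum.neutral ballI) (simp only: lessThan_iff z mult_zero_right)
    then have "f 0 = (- of_nat m) ^ d0 * t d0" by (simp only: f_def sum.lessThan_Suc) simp
    then show ?thesis using top assms by simp
  qed
  \<comment> \<open>Makes every degree \<open>2 B i\<close> with \<open>i >= 1\<close> even, at
    least \<open>d0\<close>, and large enough for its mode to be at most \<open>- 2\<close>.\<close>
  define B where "B = d0 + 2 * p * m * m + 1"
  have "\<exists>i. i \<ge> 1 \<and> f (2 * B * i) \<noteq> 0"
  \<comment> \<open>\<open>f\<close> is a polynomial of degree at most \<open>d0\<close>, so its
    difference of order \<open>d0 + 1\<close> along multiples of \<open>2 B\<close> vanishes; zeros
    at all \<open>i >= 1\<close> would force \<open>f 0 = 0\<close>.\<close>
  proof (rule ccontr)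
    assume a: "\<not> (\<exists>i. i \<ge> 1 \<and> f (2 * B * i) \<noteq> 0)"
    have "(\<Sum>i\<le>Suc d0. (- 1) ^ i * of_nat (Suc d0 choose i) * f (2 * B * i)) =
       (\<Sum>c<Suc d0. ((- of_nat m) ^ c * t c) * (\<Sum>i\<le>Suc d0. (- 1) ^ i * of_nat (Suc d0 choose i) * (\<Prod>r<d0 - c. of_nat (2 * B * i) - of_nat r)))"
      unfolding f_def sum_distrib_left by (subst sum.swap) (simp only: mult_ac)
    also have "\<dots> = 0"
      by (intro sum.neutral ballI) (subst falling_alternating_sum, auto simp: B_def)
    finally have "(\<Sum>i\<le>Suc d0. (- 1) ^ i * of_nat (Suc d0 choose i) * f (2 * B * i)) = 0" .
    moreover have "(\<Sum>i\<le>Suc d0. (- 1) ^ i * of_nat (Suc d0 choose i) * f (2 * B * i)) = (\<Sum>i\<in>{0}. (- 1) ^ i * of_nat (Suc d0 choose i) * f (2 * B * i))"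
      using a by (intro sum.mono_neutral_right) auto
    ultimately show False using f0 by simp
  qed
  then obtain i where i: "i \<ge> 1" "f (2 * B * i) \<noteq> 0" by blast
  have "B \<le> 2 * B * i" using i(1) by (cases i) auto
  then have D: "2 * B * i \<ge> d0" "2 * B * i \<ge> d0 + 2 * p * m * m + 1" by (auto simp: B_def)
  have j: "jj (int (2 * B * i)) \<le> - 2"
  proof -
    have "int (d0 + 2 * p * m * m + 1) \<le> int (2 * B * i)" using D(2) by (simp only: of_nat_le_iff)
    then show ?thesis unfolding jj_def by simp
  qed
  have "tau (2 * (B * i)) (Y (F m) (jj (int (2 * (B * i)))) ?E) \<noteq> 0"
    using tauD[OF D(1)] i(2) assms by (simp add: mult.assoc)
  then show ?thesis using j hom[of "int (2 * (B * i))"] by (intro exI[of _ "B * i"] exI[of _ "jj (int (2 * (B * i)))"]) (simp add: mult.assoc)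
qed

lemma L2_pow_hom: "x \<in> hom c d \<Longrightarrow> (L (- 2) ^^ b) x \<in> hom c (d + 2 * int b)"
proof (induction b)
  case (Suc b)
  then show ?case using L_hom[of "(L (- 2) ^^ b) x" c "d + 2 * int b" "- 2"] by (simp add: algebra_simps)
qed simp

lemma omega_nilpotent:
  assumes "m \<ge> 1"
  shows "\<exists>N. (L (- 2) ^^ N) 1 \<in> C2s m"
proof -
  obtain N j where Nj: "j \<le> - 2" "Y (F m) j ((Qs ^^ (2 * m)) (F m)) \<in> hom 0 (int (2 * N))"
    "tau (2 * N) (Y (F m) j ((Qs ^^ (2 * m)) (F m))) \<noteq> 0"
    using nilpotent_witness[OF assms] by blast
  define X where "X = Y (F m) j ((Qs ^^ (2 * m)) (F m))"
  note Nj = Nj[folded X_def]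
  have FE: "F m \<in> Ug m" "(Qs ^^ (2 * m)) (F m) \<in> Ug m" using G_Ug by (auto simp: G_def)
  have XC: "X \<in> C2s m" unfolding X_def by (intro C2_neg Ug_U FE Nj(1))
  have "X \<in> W" unfolding X_def using FE by (intro W_closed) (auto simp: Ug_def)
  \<comment> \<open>Here \<open>X\<close> is viewed a second time, as an element of the charge 0
    algebra, where it is not yet known to lie in the \<open>C2\<close>-space.\<close>
  then have "X \<in> U 0" using Nj(2) by (intro Ug_U) (auto simp: Ug_def)
  then have XD: "X \<in> V.span (Dg 0)" using U_D by blast
  let ?P = "\<lambda>c d. c = (0::int) \<and> d = int (2 * N)"
  let ?w = "(L (- 2) ^^ N) 1"
  have Dh: "Dg 0 \<subseteq> homog"
  proof
    fix x assume "x \<in> Dg 0"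
    then consider "x \<in> C2g 0" | b g where "x = (L (- 2) ^^ b) g" "g \<in> G 0" by (auto simp: Dg_def)
    then show "x \<in> homog"
    proof cases
      case 1
      then show ?thesis using C2g_Ug[of 0] by (auto simp: Ug_def intro: homogI)
    next
      case 2
      then obtain c d where "g \<in> hom c d" using G_Ug[of 0] by (auto simp: Ug_def)
      then show ?thesis using 2 L2_pow_hom homogI by blast
    qed
  qed
  have "pr ?P X = X" using pr_hom[OF Nj(2), of ?P] by simp
  then have "X \<in> V.span (Dg 0 \<inter> {y. \<exists>c d. ?P c d \<and> y \<in> hom c d})" using pr_span[OF Dh XD, of ?P] by simp
  also have "\<dots> \<subseteq> V.span (insert ?w (C2g 0))"
  proof (rule V.span_minimal[OF _ V.subspace_span], rule subsetI)
    fix y assume y: "y \<in> Dg 0 \<inter> {y. \<exists>c d. ?P c d \<and> y \<in> hom c d}"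
    show "y \<in> V.span (insert ?w (C2g 0))"
    proof (cases "y = 0 \<or> y \<in> C2g 0")
      case True
      then show ?thesis by (auto intro: V.span_zero V.span_base)
    next
      case False
      then obtain b g where bg: "y = (L (- 2) ^^ b) g" "g \<in> G 0" using y by (auto simp: Dg_def)
      have yh: "y \<in> hom 0 (int (2 * N))" using y by auto
      have "g = 1 \<or> g = Qs (F 1)" using bg(2) by (auto simp: G_def F_0)
      then show ?thesis
      proof
        assume g: "g = 1"
        have "y \<in> hom 0 (2 * int b)" using L2_pow_hom[OF one_hom, of b] bg(1) g by simp
        from hom_unique[OF this yh] False have "b = N" by auto
        then show ?thesis using bg g by (intro V.span_base) simp
      next
        \<comment> \<open>Parity: the degree of \<open>Qs (F 1)\<close> is \<open>2 p - 1\<close>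
          and each \<open>L (- 2)\<close> adds 2, so the even degree \<open>2 N\<close> is never
          reached.\<close>
        assume g: "g = Qs (F 1)"
        have "Qs (F 1) \<in> hom 0 (2 * int p - 1)" using Qs_hom[OF F_hom[of 1]] by simp
        then have "y \<in> hom 0 (2 * int p - 1 + 2 * int b)" using L2_pow_hom bg(1) g by blast
        from hom_unique[OF this yh] False have "2 * int p - 1 + 2 * int b = 2 * int N" by simp
        then have False by presburger
        then show ?thesis ..
      qed
    qed
  qed
  finally have "X \<in> V.span (insert ?w (C2g 0))" .
  then obtain k where k: "X - k *\<^sub>V ?w \<in> C2s 0" unfolding C2s_def using V.span_breakdown_eq by blast
  have "k \<noteq> 0"
  proof
    assume "k = 0"
    then have "X \<in> K0" using k C2s0_K0 by auto
    then show False using Nj(3) by (simp add: K0_def)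
  qed
  have "C2s 0 \<subseteq> C2s m"
  proof -
    have "Ug 0 \<subseteq> Ug m" by (auto simp: Ug_def)
    then show ?thesis unfolding C2s_def C2g_def by (intro V.span_mono) blast
  qed
  with k have "X - k *\<^sub>V ?w \<in> C2s m" by blast
  from V.subspace_scale[OF C2s_subspace V.subspace_diff[OF C2s_subspace XC this], of "1 / k"]
  have "?w \<in> C2s m" using \<open>k \<noteq> 0\<close> by simp
  then show ?thesis by blast
qed

lemma C2_cofinite_abstract:
  assumes "m \<ge> 1"
  shows "\<exists>S. finite S \<and> S \<subseteq> U m \<and> U m \<subseteq> V.span (S \<union> C2g m)"
proof -
  obtain N where N: "(L (- 2) ^^ N) 1 \<in> C2s m" using omega_nilpotent[OF assms] by blast
  let ?S = "(\<lambda>(b, g). (L (- 2) ^^ b) g) ` ({..<N} \<times> G m)"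
  have C: "C2s m \<subseteq> V.span (?S \<union> C2g m)" unfolding C2s_def by (rule V.span_mono) auto
  have "U m \<subseteq> V.span (Dg m)" by (rule U_D)
  also have "\<dots> \<subseteq> V.span (?S \<union> C2g m)"
  proof (rule V.span_minimal[OF _ V.subspace_span], rule subsetI)
    fix x assume "x \<in> Dg m"
    then consider "x \<in> C2g m" | b g where "x = (L (- 2) ^^ b) g" "g \<in> G m" by (auto simp: Dg_def)
    then show "x \<in> V.span (?S \<union> C2g m)"
    proof cases
      case 1
      then show ?thesis by (auto intro: V.span_base)
    next
      case 2
      show ?thesis
      proof (cases "b < N")
        case True
        then have "x \<in> ?S" unfolding 2(1) using 2(2) by (intro image_eqI[of _ _ "(b, g)"]) auto
        then show ?thesis by (intro V.span_base) (rule UnI1)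
      next
        case False
        have "g \<in> U m" using 2(2) G_Ug Ug_U by blast
        from L2_pow_nilpotent[OF N this, of b] False have "x \<in> C2s m" unfolding 2(1) by simp
        then show ?thesis using C by blast
      qed
    qed
  qed
  finally have "U m \<subseteq> V.span (?S \<union> C2g m)" .
  moreover have "?S \<subseteq> U m" by (auto dest: subsetD[OF G_Ug] intro: L2_pow_U Ug_U)
  moreover have "finite ?S" by (simp add: G_def)
  ultimately show ?thesis by blast
qed

end

section \<open>Transfer to coefficient functions\<close>

abbreviation lk :: "V \<Rightarrow> vec" where "lk \<equiv> Poly_Mapping.lookup"

lemma supp_lk: "supp (lk x) = Poly_Mapping.keys x"
  by (auto simp: supp_def in_keys_iff)

lemma vadd_lk: "vadd (lk x) (lk y) = lk (x + y)"
  and vsub_lk: "vsub (lk x) (lk y) = lk (x - y)"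
  and smult_lk: "smult c (lk x) = lk (c *\<^sub>V x)"
  and vzero_lk: "vzero = lk 0"
  and bvec_lk: "bvec b = lk (bv b)"
  by (auto simp: fun_eq_iff vadd_def vsub_def smult_def vzero_def bvec_def lookup_add lookup_minus lookup_bv)

lemma extend_lk:
  assumes "\<And>b. f b = lk (f' b)"
  shows "extend f (lk x) = lk (linext f' x)"
  by (simp add: fun_eq_iff extend_def linext_def supp_lk lookup_sum assms)

lemma degmax_ge: "b \<in> Poly_Mapping.keys x \<Longrightarrow> deg (fst b) \<le> degmax (lk x)"
  unfolding degmax_def supp_lk by (rule Max_ge) (auto simp: image_iff)

lemma wtmax_ge: "b \<in> Poly_Mapping.keys x \<Longrightarrow> wt p b \<le> wtmax p (lk x)"
  unfolding wtmax_def supp_lk by (rule Max_ge) (auto simp: image_iff)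

lemma lin_keys_zero:
  assumes "lin f" "\<And>b. b \<in> Poly_Mapping.keys x \<Longrightarrow> f (bv b) = 0"
  shows "f x = 0"
  by (subst V_expand) (simp add: lin_sum[OF assms(1)] lin_scl[OF assms(1)] assms(2))

context lattice
begin

lemma hmode_lk: "hmode p j (lk x) = lk (h j x)"
proof -
  have "hmode_b p j b = lk (h j (bv b))" for b
  proof -
    obtain lam n where b: "b = (lam, n)" by fastforce
    consider "j < 0" | "j = 0" | "j > 0" by linarith
    then show ?thesis
    proof cases
      case 1
      then have "h j (bv (lam, n)) = bv (add_mset (nat (- j) - 1) lam, n)"
        by (simp add: h_def bv_add_mset)
      then show ?thesis using 1 by (simp add: hmode_b_def b bvec_lk)
    next
      case 2
      then show ?thesis by (simp add: hmode_b_def b bvec_lk smult_lk h0_hom[OF bv_hom])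
    next
      case 3
      then show ?thesis by (simp add: hmode_b_def b bvec_lk smult_lk h_bv)
    qed
  qed
  then have "hmode p j (lk x) = lk (linext (\<lambda>b. h j (bv b)) x)"
    unfolding hmode_def by (rule extend_lk)
  also have "linext (\<lambda>b. h j (bv b)) x = h j x"
    by (rule lin_eqI[OF lin_linext lin_h]) simp
  finally show ?thesis .
qed

lemma Sop_lk: "Sop p k m (lk x) = lk (S (of_int k) (int m) * x)"
proof (induction m rule: less_induct)
  case (less m)
  show ?case
  proof (cases "m = 0")
    case True
    then show ?thesis by simp
  next
    case False
    have "of_int (int m) *\<^sub>V S (of_int k) (int m) = of_int k *\<^sub>V (\<Sum>i\<in>{1..m}. A (i - 1) * S (of_int k) (int m - int i))"
      by (rule S_rec) simp
    then have "(1 / of_nat m) *\<^sub>V of_int (int m) *\<^sub>V S (of_int k) (int m) = (1 / of_nat m) *\<^sub>V of_int k *\<^sub>V (\<Sum>i\<in>{1..m}. A (i - 1) * S (of_int k) (int m - int i))" by simp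
    then have "S (of_int k) (int m) = (1 / of_nat m) *\<^sub>V (\<Sum>i\<in>{1..m}. of_int k *\<^sub>V (A (i - 1) * S (of_int k) (int m - int i)))"
      using False by (simp add: scl_sum_right)
    then have "S (of_int k) (int m) * x = (1 / of_nat m) *\<^sub>V (\<Sum>i\<in>{1..m}. of_int k *\<^sub>V (A (i - 1) * (S (of_int k) (int m - int i) * x)))"
      by (simp add: scl_mult_left sum_distrib_right mult.assoc)
    moreover have "hmode p (- int i) (Sop p k (m - i) (lk x)) = lk (A (i - 1) * (S (of_int k) (int m - int i) * x))" if "i \<in> {1..m}" for i
      using less[of "m - i"] that h_neg[of i] by (simp add: hmode_lk of_nat_diff del: Sop.simps)
    ultimately show ?thesis using False
      by (subst Sop.simps) (simp add: fun_eq_iff lookup_sum del: Sop.simps)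
  qed
qed

lemma Top_lk: "Top p k m (lk x) = lk (T k (int m) x)"
proof (induction m rule: less_induct)
  case (less m)
  show ?case
  proof (cases "m = 0")
    case True
    then show ?thesis by simp
  next
    case False
    have "of_int (int m) *\<^sub>V T k (int m) x = - of_int k *\<^sub>V (\<Sum>i\<in>{1..m}. h (int i) (T k (int m - int i) x))"
      by (rule T_rec) simp
    then have "(1 / of_nat m) *\<^sub>V of_int (int m) *\<^sub>V T k (int m) x = (1 / of_nat m) *\<^sub>V (- of_int k) *\<^sub>V (\<Sum>i\<in>{1..m}. h (int i) (T k (int m - int i) x))" by (simp only:)
    then have "T k (int m) x = (- 1 / of_nat m) *\<^sub>V (\<Sum>i\<in>{1..m}. of_int k *\<^sub>V h (int i) (T k (int m - int i) x))"
      using False by (simp add: scl_sum_right)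
    moreover have "hmode p (int i) (Top p k (m - i) (lk x)) = lk (h (int i) (T k (int m - int i) x))" if "i \<in> {1..m}" for i
      using less[of "m - i"] that by (simp add: hmode_lk of_nat_diff del: Top.simps)
    ultimately show ?thesis using False
      by (subst Top.simps) (simp add: fun_eq_iff lookup_sum del: Top.simps)
  qed
qed

lemma latmode_lk: "latmode p k j (lk x) = lk (e k j x)"
  unfolding latmode_def e_def
proof (rule extend_lk)
  fix b :: bas
  obtain lam n where b: "b = (lam, n)" by fastforce
  have "bvec (lam, n + k) = lk (ex k * bv (lam, n))" by (simp add: bvec_lk ex_bv)
  then have "Sop p k a (Top p k c (bvec (lam, n + k))) = lk (S (of_int k) (int a) * (ex k * T k (int c) (bv (lam, n))))" for a c
    by (simp only: Top_lk Sop_lk T_ex)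
  then have "(if a \<ge> 0 then Sop p k (nat a) (Top p k c (bvec (lam, n + k))) b' else 0) = lk (S (of_int k) a * (ex k * T k (int c) (bv (lam, n)))) b'" for a c b'
    by (simp del: Sop.simps Top.simps)
  then show "latmode_b p k j b = lk (case b of (lam, n) \<Rightarrow> \<Sum>c\<in>{0..deg lam}. S (of_int k) (int c - 2 * int p * k * n - j - 1) * (ex k * T k (int c) (bv (lam, n))))"
    by (simp only: latmode_b_def b prod.case Let_def) (simp add: fun_eq_iff lookup_sum)
qed

lemma lin_Yb: "lin (Yb mu k j)"
  using va.Y_lin2[of "bv (mu, k)" j] by (simp add: Y_bv)

text \<open>Since \<open>p (k + c) ^ 2 >= 0\<close>, the cross term \<open>- 2 p k c\<close> in the
  degree is at most \<open>p k ^ 2 + p c ^ 2\<close>; this is what makes the weights in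
  \<open>ymode\<close> a valid truncation.\<close>

lemma Yb_vanish:
  assumes "j' \<ge> wt p (mu, k) + wtmax p (lk x)"
  shows "Yb mu k j' x = 0"
proof (rule lin_keys_zero[OF lin_Yb])
  fix b assume b: "b \<in> Poly_Mapping.keys x"
  obtain nu c where nu: "b = (nu, c)" by fastforce
  have "0 \<le> int p * (k + c)^2" by simp
  moreover have "int p * (k + c)^2 = int p * k^2 + 2 * int p * k * c + int p * c^2" by (simp add: power2_eq_square algebra_simps)
  moreover have "int (deg nu) + int p * c^2 \<le> wtmax p (lk x)" using wtmax_ge[OF b, of p] by (simp add: nu wt_def)
  moreover have "int (deg mu) + int p * k^2 + wtmax p (lk x) \<le> j'" using assms by (simp add: wt_def)
  ultimately have "int (deg mu) + int (deg nu) - 2 * int p * k * c - j' - 1 < 0" by linarith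
  then show "Yb mu k j' (bv b) = 0" unfolding nu by (rule hom_neg[OF Yb_hom[OF bv_hom]])
qed

lemma h_vanish: "i > int (degmax (lk x)) \<Longrightarrow> h i x = 0"
proof (rule lin_keys_zero[OF lin_h])
  fix b assume i: "i > int (degmax (lk x))" and b: "b \<in> Poly_Mapping.keys x"
  obtain nu c where nu: "b = (nu, c)" by fastforce
  have "int (deg nu) - i < 0" using degmax_ge[OF b] i by (simp add: nu)
  then show "h i (bv b) = 0" unfolding nu by (rule hom_neg[OF h_hom[OF bv_hom]])
qed

text \<open>Beyond the cut-off of \<open>ymode\<close> the terms of the first kind vanish by the
  weight bound and those of the second kind by the degree bound, so its finite sum is the full
  iterate formula.\<close>

lemma ymode_lk: "ymode p lam k j (lk x) = lk (Yb lam k j x)"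
proof (induction "size lam" arbitrary: lam j x)
  case 0
  then show ?case by (subst ymode.simps) (simp add: latmode_lk Yb_empty)
next
  case (Suc s)
  define y mu n where "y = Max (set_mset lam)" and "mu = lam - {#y#}" and "n = y + 1"
  have ne: "lam \<noteq> {#}" using Suc(2) by auto
  then have "y \<in># lam" by (simp add: y_def)
  then have s: "s = size mu" using Suc(2) by (simp add: mu_def size_Diff_singleton)
  define N where "N = nat (wt p (mu, k) + wtmax p (lk x) + \<bar>j\<bar>) + degmax (lk x) + 1"
  let ?f = "\<lambda>i. h (- int n - int i) (Yb mu k (j + int i) x)" and ?g = "\<lambda>i. Yb mu k (- int n + j - int i) (h (int i) x)"
  have f0: "?f i = 0" if "i \<ge> Suc N" for i
  proof -
    have "Yb mu k (j + int i) x = 0" by (rule Yb_vanish) (use that in \<open>simp add: N_def\<close>)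
    then show ?thesis by (simp add: lin_0[OF lin_h])
  qed
  have g0: "?g i = 0" if "i \<ge> Suc N" for i
  proof -
    have "h (int i) x = 0" by (rule h_vanish) (use that in \<open>simp add: N_def\<close>)
    then show ?thesis by (simp add: lin_0[OF lin_Yb])
  qed
  have sgn: "sg (- int n) = (- 1) ^ n" by (simp add: sg_def)
  have "Yb lam k j x = J (- int n) h (Yb mu k) 0 j x"
    using ne by (subst Yb.simps) (simp add: y_def mu_def n_def)
  also have "\<dots> = fsum (\<lambda>i. bc (- int n) i *\<^sub>V ?f i) - (- 1) ^ n *\<^sub>V fsum (\<lambda>i. bc (- int n) i *\<^sub>V ?g i)"
    unfolding J_def iexp_def sgn by (simp add: algebra_simps)
  also have "\<dots> = (\<Sum>i<Suc N. bc (- int n) i *\<^sub>V ?f i) - (- 1) ^ n *\<^sub>V (\<Sum>i<Suc N. bc (- int n) i *\<^sub>V ?g i)"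
    using f0 g0 by (simp only: fsum_eq[of "Suc N" "\<lambda>i. bc (- int n) i *\<^sub>V ?f i"] fsum_eq[of "Suc N" "\<lambda>i. bc (- int n) i *\<^sub>V ?g i"] scl_zero_right)
  also have "\<dots> = (\<Sum>i<Suc N. bc (- int n) i *\<^sub>V (?f i - (- 1) ^ n *\<^sub>V ?g i))"
    unfolding scl_sum_right sum_subtractf[symmetric] by (simp only: scl_diff_right scl_scl mult.commute)
  finally have Y: "Yb lam k j x = (\<Sum>i<Suc N. bc (- int n) i *\<^sub>V (?f i - (- 1) ^ n *\<^sub>V ?g i))" .
  have "ymode p lam k j (lk x) = (\<lambda>b. \<Sum>i\<in>{0..N}.
          ((- 1) ^ i * ((- of_nat n :: complex) gchoose i)) *
          (hmode p (- int n - int i) (ymode p mu k (j + int i) (lk x)) b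
           - (- 1) ^ n * ymode p mu k (- int n + j - int i) (hmode p (int i) (lk x)) b))"
    using ne by (subst ymode.simps) (simp only: Let_def if_False y_def mu_def n_def N_def)
  also have "\<dots> = (\<lambda>b. \<Sum>i\<in>{0..N}. lk (bc (- int n) i *\<^sub>V (?f i - (- 1) ^ n *\<^sub>V ?g i)) b)"
    by (simp only: hmode_lk Suc(1)[OF s]) (simp add: bc_def lookup_minus)
  also have "\<dots> = lk (Yb lam k j x)"
    unfolding Y by (simp add: fun_eq_iff lookup_sum atLeast0AtMost lessThan_Suc_atMost del: sum.lessThan_Suc)
  finally show ?case .
qed

lemma mode_lk: "mode p (lk a) j (lk x) = lk (Y a j x)"
  by (simp add: fun_eq_iff mode_def supp_lk Y_def linext_def lookup_sum ymode_lk del: ymode.simps)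

lemma omega_lk: "omega p = lk om"
proof -
  have "A 0 * A 0 = bv ({#0, 0#}, 0)" "A 1 = bv ({#1#}, 0)" by (simp_all add: A_def bv_mult add_mset_commute)
  then show ?thesis
    by (auto simp: fun_eq_iff omega_def om_def lookup_add lookup_bv)
qed

lemma Lvir_lk: "Lvir p n (lk x) = lk (L n x)"
  by (simp add: Lvir_def omega_lk mode_lk L_def)

lemma Q_lk: "Q p (lk x) = lk (Qs x)"
  by (simp add: Q_def bvec_lk mode_lk Qs_def Y_ex flip: ex_def)

lemma Q_pow_lk: "(Q p ^^ i) (lk x) = lk ((Qs ^^ i) x)"
  by (induction i) (simp_all add: Q_lk)

lemma Wp_lk: "Wp p = lk ` W"
proof (intro equalityI subsetI)
  fix v assume "v \<in> Wp p"
  then show "v \<in> lk ` W"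
  proof induction
    case (gen i n)
    then show ?case using F_W[OF gen] by (simp add: bvec_lk Q_pow_lk F_def flip: ex_def)
  next
    case zero
    then show ?case using V.subspace_0[OF W_subspace] by (simp only: vzero_lk imageI)
  next
    case (add v w)
    then show ?case using V.subspace_add[OF W_subspace] by (auto simp: vadd_lk)
  next
    case (scal v c)
    then obtain x where "v = lk x" "x \<in> W" by blast
    then show ?case using V.subspace_scale[OF W_subspace] by (simp only: smult_lk imageI)
  next
    case (vir v n)
    then show ?case using W_L by (auto simp: Lvir_lk)
  qed
next
  fix v assume "v \<in> lk ` W"
  then obtain x where x: "v = lk x" "x \<in> W" by auto
  have "lk x \<in> Wp p"
    using x(2) unfolding W_def
  proof induction
    case (gen x)
    then obtain i n where "x = (Qs ^^ i) (F n)" "i \<le> 2 * n" by auto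
    then show ?case using Wp.gen[of i n p] by (simp add: bvec_lk Q_pow_lk F_def flip: ex_def)
  next
    case zero
    then show ?case using Wp.zero[of p] by (simp only: vzero_lk)
  next
    case (add x y)
    then show ?case using Wp.add[of "lk x" p "lk y"] by (simp add: vadd_lk)
  next
    case (scl x c)
    then show ?case using Wp.scal[of "lk x" p c] by (simp only: smult_lk)
  next
    case (L x k)
    then show ?case using Wp.vir[of "lk x" p k] by (simp add: Lvir_lk)
  qed
  then show "v \<in> Wp p" using x(1) by simp
qed

text \<open>The generators are homogeneous and each \<open>L k\<close> preserves homogeneity; this
  allows elements of \<open>W\<close> to be projected to prescribed charges inside
  \<open>W\<close>.\<close>

lemma W_homog: "W \<subseteq> V.span (W \<inter> homog)"
proof -
  have "vir {(Qs ^^ i) (F n) | i n. i \<le> 2 * n} \<subseteq> V.span (W \<inter> homog)"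
  proof (rule vir_least[OF V.subspace_span])
    show "{(Qs ^^ i) (F n) | i n. i \<le> 2 * n} \<subseteq> V.span (W \<inter> homog)"
      using F_W string_charge homogI by (blast intro: V.span_base)
    show "L k x \<in> V.span (W \<inter> homog)" if "x \<in> V.span (W \<inter> homog)" for k x
    proof (rule lin_span[OF lin_L that])
      fix y assume "y \<in> W \<inter> homog"
      then obtain c d where "y \<in> W" "y \<in> hom c d" by (auto simp: homog_def)
      then have "L k y \<in> W \<inter> homog" using W_L homogI[OF L_hom] by blast
      then show "L k y \<in> V.span (W \<inter> homog)" by (rule V.span_base)
    qed
  qed
  then show ?thesis by (simp add: W_def)
qed

text \<open>Being supported on charges divisible by \<open>m\<close> is a condition on coefficients,
  while \<open>U m\<close> is a span of homogeneous vectors; projecting a homogeneous decomposition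
  connects the two.\<close>

lemma WAm_lk: "WAm p m = lk ` U m"
proof (intro equalityI subsetI)
  fix v assume "v \<in> WAm p m"
  then obtain x where x: "v = lk x" "x \<in> W" "\<And>b. b \<in> Poly_Mapping.keys x \<Longrightarrow> int m dvd snd b"
    by (auto simp: WAm_def Wp_lk VL_fixed_def in_keys_iff)
  let ?P = "\<lambda>c d. int m dvd c"
  have "pr ?P x = x"
  proof -
    have "pr ?P x = (\<Sum>b\<in>Poly_Mapping.keys x. Poly_Mapping.lookup x b *\<^sub>V bv b)"
      unfolding pr_def linext_def using x(3) by (intro sum.cong) (auto split: prod.splits)
    then show ?thesis using V_expand[of x] by simp
  qed
  moreover have "pr ?P x \<in> V.span ((W \<inter> homog) \<inter> {y. \<exists>c d. ?P c d \<and> y \<in> hom c d})"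
    by (rule pr_span) (use x(2) W_homog in auto)
  moreover have "(W \<inter> homog) \<inter> {y. \<exists>c d. ?P c d \<and> y \<in> hom c d} \<subseteq> Ug m" by (auto simp: Ug_def)
  ultimately have "x \<in> U m" unfolding U_def using V.span_mono by (metis (no_types, lifting) subsetD)
  then show "v \<in> lk ` U m" using x(1) by simp
next
  fix v assume "v \<in> lk ` U m"
  then obtain x where x: "v = lk x" "x \<in> U m" by auto
  have "x \<in> {x. \<forall>b\<in>Poly_Mapping.keys x. int m dvd snd b}"
  proof (rule subsetD[OF V.span_minimal x(2)[unfolded U_def]])
    show "Ug m \<subseteq> {x. \<forall>b\<in>Poly_Mapping.keys x. int m dvd snd b}" by (auto simp: Ug_def hom_def)
    show "V.subspace {x. \<forall>b\<in>Poly_Mapping.keys x. int m dvd snd b}"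
      unfolding V.subspace_def
    proof (intro conjI ballI allI CollectI)
      fix x y :: V and b
      assume "x \<in> {x. \<forall>b\<in>Poly_Mapping.keys x. int m dvd snd b}" "y \<in> {x. \<forall>b\<in>Poly_Mapping.keys x. int m dvd snd b}"
        "b \<in> Poly_Mapping.keys (x + y)"
      then show "int m dvd snd b" using Poly_Mapping.keys_add[of x y] by auto
    next
      fix c and x :: V and b
      assume "x \<in> {x. \<forall>b\<in>Poly_Mapping.keys x. int m dvd snd b}" "b \<in> Poly_Mapping.keys (c *\<^sub>V x)"
      then show "int m dvd snd b" by (auto simp: in_keys_iff)
    qed simp
  qed
  then have "\<forall>b. lk x b \<noteq> 0 \<longrightarrow> int m dvd snd b" by (simp add: in_keys_iff)
  moreover have "lk x \<in> lk ` W" using x(2) U_W by blast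
  moreover have "finite (supp (lk x))" by (simp add: supp_lk)
  ultimately show "v \<in> WAm p m" unfolding x(1) WAm_def Wp_lk VL_fixed_def VL_def by blast
qed

lemma C2s_lk: "x \<in> C2s m \<Longrightarrow> lk x \<in> C2 p (WAm p m)"
proof -
  assume x: "x \<in> C2s m"
  have "x \<in> {x. lk x \<in> C2 p (WAm p m)}"
  proof (rule subsetD[OF V.span_minimal x[unfolded C2s_def]])
    show "C2g m \<subseteq> {x. lk x \<in> C2 p (WAm p m)}"
    proof
      fix x assume "x \<in> C2g m"
      then obtain a b where x: "x = Y a (- 2) b" "a \<in> U m" "b \<in> U m" by (auto simp: C2g_def intro: Ug_U)
      then have "mode p (lk a) (- 2) (lk b) \<in> C2 p (WAm p m)" by (intro C2.gen) (auto simp: WAm_lk)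
      then show "x \<in> {x. lk x \<in> C2 p (WAm p m)}" using x(1) by (simp add: mode_lk)
    qed
    show "V.subspace {x. lk x \<in> C2 p (WAm p m)}"
      unfolding V.subspace_def
      using C2.zero[of p "WAm p m"] C2.add[of _ p "WAm p m"] C2.scal[of _ p "WAm p m"]
      by (auto simp: vzero_lk simp flip: vadd_lk smult_lk)
  qed
  then show ?thesis by simp
qed

lemma C2_cofinite_WAm:
  assumes "m \<ge> 1"
  shows "C2_cofinite p (WAm p m)"
proof -
  obtain B where B: "finite B" "B \<subseteq> U m" "U m \<subseteq> V.span (B \<union> C2g m)" using C2_cofinite_abstract[OF assms] by blast
  have inj: "inj_on lk B" by (rule inj_onI) (simp add: lookup_inject)
  show ?thesis
    unfolding C2_cofinite_def
  proof (intro exI[of _ "lk ` B"] conjI ballI)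
    show "finite (lk ` B)" using B(1) by simp
    show "lk ` B \<subseteq> WAm p m" using B(2) by (auto simp: WAm_lk)
    fix u assume "u \<in> WAm p m"
    then obtain x where x: "u = lk x" "x \<in> U m" by (auto simp: WAm_lk)
    then obtain s y where sy: "s \<in> V.span B" "y \<in> C2s m" "x = s + y" using B(3) by (auto simp: V.span_Un C2s_def)
    obtain c where c: "s = (\<Sum>b\<in>B. c b *\<^sub>V b)" using sy(1) V.span_finite[OF B(1)] by auto
    \<comment> \<open>The coefficients are carried over to functions along
      \<open>Abs_poly_mapping\<close>, the inverse of \<open>lk\<close>.\<close>
    have "(\<lambda>b. \<Sum>v\<in>lk ` B. c (Abs_poly_mapping v) * v b) = lk s"
      unfolding c by (simp add: fun_eq_iff sum.reindex[OF inj] lookup_sum Poly_Mapping.lookup_inverse)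
    then have "vsub u (\<lambda>b. \<Sum>v\<in>lk ` B. c (Abs_poly_mapping v) * v b) = lk y"
      using x(1) sy(3) by (simp add: vsub_lk)
    then show "\<exists>c. vsub u (\<lambda>b. \<Sum>s\<in>lk ` B. c s * s b) \<in> C2 p (WAm p m)"
      using C2s_lk[OF sy(2)] by (intro exI[of _ "\<lambda>v. c (Abs_poly_mapping v)"]) simp
  qed
qed

end

theorem mainTheorem7:
  fixes p m :: nat
  assumes "p \<ge> 2" and "m \<ge> 1"
  shows "C2_cofinite p (WAm p m)"
proof -
  interpret lattice p by unfold_locales (rule assms(1))
  show ?thesis by (rule C2_cofinite_WAm[OF assms(2)])
qed

end
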